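(* There is an absolute constant $C_2>0$, and for every constant $C_0>0$ there exist constants $C_1,C_3>0$ depending only on $C_0$, such that the following holds. Consider the logistic regression model with Gaussian design described in the context, and suppose $|\theta^*|\leq C_0$ and $d^{3/2}\leq C_0n$. If $$s\geq12,\qquad C_1s\sqrt{d/n}\leq1,\qquad C_1\bar\delta_{01}^*(C_1s)\leq\sqrt{nd},$$ then $$\mathrm{TV}(\pi_v,\gamma^* )\leq C_3\left(\frac{\bar\delta_{01}^*(C_1s)}{\sqrt n}+\frac{sd}{\sqrt n}+e^{d[M_0^*-(s/12)^2]}\right)$$ with probability at least $1-8e^{-C_2\sqrt n}-e^{-ds^2/10}$ with respect to the joint feature and label distribution.
   Context: Model: $\psi(\omega)=\log(1+e^\omega)$, $\omega\in\mathbb R$; $\theta^*\in\mathbb R^d$ is the ground truth; $X_1,\dots,X_n$ are i.i.d. $\mathcal N(0,I_d)$ and, conditionally on the $X_i$, the labels $Y_i\in\{0,1\}$ are independent with $Y_i\mid X_i\sim\mathrm{Bernoulli}(\psi'(X_i^\top\theta^* ))$. The parameter space is $\Theta=\mathbb R^d$. Normalized negative log likelihood: $\ell(\theta)=\frac1n\sum_{i=1}^n[\psi(X_i^\top\theta)-Y_iX_i^\top\theta]$. The MLE is $\hat\theta=\arg\min_{\theta\in\mathbb R^d}\ell(\theta)$ when it exists and is unique. $F^*=\frac1n\sum_{i=1}^n\psi''(X_i^\top\theta^* )X_iX_i^\top$. The prior is a probability density $\pi_0$ strictly positive on $\mathbb R^d$; the posterior is $\pi_v(\theta)\propto e^{-n\ell(\theta)}\pi_0(\theta)$;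 and $\gamma^*=\mathcal N(\hat\theta,(nF^* )^{-1})$ (the assertion that a bound on $\mathrm{TV}(\pi_v,\gamma^* )$ holds on an event includes that $\hat\theta$ exists and is unique and $F^*$ is positive definite on that event). $\bar\delta_{01}^*(t)=\sup_{|\theta-\theta^*|\le t\sqrt{d/n}}|\nabla\log\pi_0(\theta)|$ with $|\cdot|$ the Euclidean norm, set to $\infty$ if $\pi_0$ is not $C^1$ on that ball; $M_0^*=d^{-1}\log\sup_{\theta\in\mathbb R^d}\pi_0(\theta)/\pi_0(\theta^* )$. $\mathrm{TV}(P,Q)=\sup_B|P(B)-Q(B)|$. *)

theory Defs
  imports "HOL-Probability.Probability" "Jordan_Normal_Form.Gauss_Jordan_Elimination"
    "Jordan_Normal_Form.Determinant"
begin

text \<open>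
  The constants of the theorem must not depend on the dimension, so the dimension has to be a term
  and not a type.  Points of \<open>\<real>\<^sup>d\<close> are the functions \<open>nat \<Rightarrow> real\<close> that are extensional on
  \<open>{..<d}\<close>; on this set the product topology of \<open>nat \<Rightarrow> real\<close> is the Euclidean one.
\<close>

abbreviation Rspace :: "nat \<Rightarrow> (nat \<Rightarrow> real) set" where
  "Rspace d \<equiv> PiE {..<d} (\<lambda>_. UNIV)"

abbreviation lebesgue_R :: "nat \<Rightarrow> (nat \<Rightarrow> real) measure" where
  "lebesgue_R d \<equiv> PiM {..<d} (\<lambda>_. lborel)"

definition dot :: "nat \<Rightarrow> (nat \<Rightarrow> real) \<Rightarrow> (nat \<Rightarrow> real) \<Rightarrow> real" where
  "dot d x y = (\<Sum>i<d. x i * y i)"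

abbreviation enorm :: "nat \<Rightarrow> (nat \<Rightarrow> real) \<Rightarrow> real" where
  "enorm d x \<equiv> L2_set x {..<d}"

definition ecball :: "nat \<Rightarrow> (nat \<Rightarrow> real) \<Rightarrow> real \<Rightarrow> (nat \<Rightarrow> real) set" where
  "ecball d x r = {y \<in> Rspace d. enorm d (\<lambda>i. y i - x i) \<le> r}"

definition grad :: "nat \<Rightarrow> ((nat \<Rightarrow> real) \<Rightarrow> real) \<Rightarrow> (nat \<Rightarrow> real) \<Rightarrow> nat \<Rightarrow> real" where
  "grad d f x = (\<lambda>i\<in>{..<d}. deriv (\<lambda>t. f (x(i := t))) (x i))"

text \<open>
  Continuous differentiability of a function on \<open>\<real>\<^sup>d\<close> on a set that need not be open: at each
  point of the set the function is Frechet differentiable as a function on \<open>\<real>\<^sup>d\<close>, and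
  its gradient is continuous on the set.
\<close>

definition C1_on :: "nat \<Rightarrow> ((nat \<Rightarrow> real) \<Rightarrow> real) \<Rightarrow> (nat \<Rightarrow> real) set \<Rightarrow> bool" where
  "C1_on d f S \<longleftrightarrow>
     (\<forall>x\<in>S. ((\<lambda>y. (f y - f x - dot d (grad d f x) (\<lambda>i. y i - x i)) / enorm d (\<lambda>i. y i - x i))
                \<longlongrightarrow> 0) (at x within Rspace d)) \<and>
     (\<forall>i<d. continuous_on S (\<lambda>x. grad d f x i))"

definition pos_def_mat :: "nat \<Rightarrow> real mat \<Rightarrow> bool" where
  "pos_def_mat d A \<longleftrightarrow> A \<in> carrier_mat d d \<and> transpose_mat A = A \<and>
     (\<forall>v\<in>carrier_vec d. v \<noteq> 0\<^sub>v d \<longrightarrow> Matrix.scalar_prod v (A *\<^sub>v v) > 0)"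

abbreviation inv_mat :: "real mat \<Rightarrow> real mat" where
  "inv_mat A \<equiv> the (mat_inverse A)"

text \<open>The nondegenerate Gaussian law with mean \<open>\<mu>\<close> and (positive definite) covariance \<open>V\<close>.\<close>

definition gaussian :: "nat \<Rightarrow> (nat \<Rightarrow> real) \<Rightarrow> real mat \<Rightarrow> (nat \<Rightarrow> real) measure" where
  "gaussian d \<mu> V = density (lebesgue_R d) (\<lambda>x.
     let z = Matrix.vec d (\<lambda>i. x i - \<mu> i) in
     ennreal (exp (- Matrix.scalar_prod z (inv_mat V *\<^sub>v z) / 2) /
              sqrt ((2 * pi) ^ d * Determinant.det V)))"

definition tv_dist :: "'a measure \<Rightarrow> 'a measure \<Rightarrow> real" where
  "tv_dist P Q = (SUP B\<in>sets P. \<bar>measure P B - measure Q B\<bar>)"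

definition psi :: "real \<Rightarrow> real" where
  "psi w = ln (1 + exp w)"

text \<open>
  Joint law of the features \<open>X\<^sub>i\<close> and labels \<open>Y\<^sub>i\<close>, \<open>i < n\<close>: the \<open>X\<^sub>i\<close> are i.i.d. standard
  Gaussian, and the conditional probability mass function of the labels given the features is the
  product of the Bernoulli mass functions with success probabilities \<open>\<psi>'(X\<^sub>i \<cdot> \<theta>*)\<close>.
  The label values 0 and 1 are \<open>False\<close> and \<open>True\<close>.
\<close>

definition logistic_law ::
  "nat \<Rightarrow> nat \<Rightarrow> (nat \<Rightarrow> real) \<Rightarrow> ((nat \<Rightarrow> nat \<Rightarrow> real) \<times> (nat \<Rightarrow> bool)) measure" where
  "logistic_law d n \<theta>s = density
     (PiM {..<n} (\<lambda>_. gaussian d (\<lambda>i\<in>{..<d}. 0) (1\<^sub>m d)) \<Otimes>\<^sub>M PiM {..<n} (\<lambda>_. count_space UNIV))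
     (\<lambda>(X, Y). \<Prod>i<n. ennreal (pmf (bernoulli_pmf (deriv psi (dot d (X i) \<theta>s))) (Y i)))"

definition neg_loglik ::
  "nat \<Rightarrow> nat \<Rightarrow> (nat \<Rightarrow> nat \<Rightarrow> real) \<Rightarrow> (nat \<Rightarrow> bool) \<Rightarrow> (nat \<Rightarrow> real) \<Rightarrow> real" where
  "neg_loglik d n X Y \<theta> =
     (1 / real n) * (\<Sum>i<n. psi (dot d (X i) \<theta>) - of_bool (Y i) * dot d (X i) \<theta>)"

definition mle_exists_unique ::
  "nat \<Rightarrow> nat \<Rightarrow> (nat \<Rightarrow> nat \<Rightarrow> real) \<Rightarrow> (nat \<Rightarrow> bool) \<Rightarrow> bool" where
  "mle_exists_unique d n X Y \<longleftrightarrow>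
     (\<exists>!\<theta>. is_arg_min (neg_loglik d n X Y) (\<lambda>\<theta>. \<theta> \<in> Rspace d) \<theta>)"

definition mle ::
  "nat \<Rightarrow> nat \<Rightarrow> (nat \<Rightarrow> nat \<Rightarrow> real) \<Rightarrow> (nat \<Rightarrow> bool) \<Rightarrow> nat \<Rightarrow> real" where
  "mle d n X Y = arg_min_on (neg_loglik d n X Y) (Rspace d)"

definition fisher ::
  "nat \<Rightarrow> nat \<Rightarrow> (nat \<Rightarrow> nat \<Rightarrow> real) \<Rightarrow> (nat \<Rightarrow> real) \<Rightarrow> real mat" where
  "fisher d n X \<theta>s = Matrix.mat d d (\<lambda>(j, k).
     (1 / real n) * (\<Sum>i<n. deriv (deriv psi) (dot d (X i) \<theta>s) * X i j * X i k))"

definition positive_prior :: "nat \<Rightarrow> ((nat \<Rightarrow> real) \<Rightarrow> real) \<Rightarrow> bool" where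
  "positive_prior d \<pi>0 \<longleftrightarrow> \<pi>0 \<in> borel_measurable (lebesgue_R d) \<and>
     (\<forall>\<theta>\<in>Rspace d. \<pi>0 \<theta> > 0) \<and> (\<integral>\<^sup>+\<theta>. ennreal (\<pi>0 \<theta>) \<partial>lebesgue_R d) = 1"

definition posterior ::
  "nat \<Rightarrow> nat \<Rightarrow> ((nat \<Rightarrow> real) \<Rightarrow> real) \<Rightarrow> (nat \<Rightarrow> nat \<Rightarrow> real) \<Rightarrow> (nat \<Rightarrow> bool)
    \<Rightarrow> (nat \<Rightarrow> real) measure" where
  "posterior d n \<pi>0 X Y =
     (let w = (\<lambda>\<theta>. exp (- real n * neg_loglik d n X Y \<theta>) * \<pi>0 \<theta>)
      in density (lebesgue_R d) (\<lambda>\<theta>. ennreal (w \<theta> / (LINT \<theta>'|lebesgue_R d. w \<theta>'))))"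

definition gamma_star ::
  "nat \<Rightarrow> nat \<Rightarrow> (nat \<Rightarrow> real) \<Rightarrow> (nat \<Rightarrow> nat \<Rightarrow> real) \<Rightarrow> (nat \<Rightarrow> bool)
    \<Rightarrow> (nat \<Rightarrow> real) measure" where
  "gamma_star d n \<theta>s X Y =
     gaussian d (mle d n X Y) (inv_mat (real n \<cdot>\<^sub>m fisher d n X \<theta>s))"

definition delta01_star ::
  "nat \<Rightarrow> nat \<Rightarrow> (nat \<Rightarrow> real) \<Rightarrow> ((nat \<Rightarrow> real) \<Rightarrow> real) \<Rightarrow> real \<Rightarrow> ereal" where
  "delta01_star d n \<theta>s \<pi>0 t =
     (let B = ecball d \<theta>s (t * sqrt (real d / real n))
      in if C1_on d \<pi>0 B
         then (SUP \<theta>\<in>B. ereal (enorm d (grad d (\<lambda>\<theta>'. ln (\<pi>0 \<theta>')) \<theta>)))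
         else \<infinity>)"

definition exp_ereal :: "ereal \<Rightarrow> ereal" where
  "exp_ereal x = (case x of ereal r \<Rightarrow> ereal (exp r) | PInfty \<Rightarrow> \<infinity> | MInfty \<Rightarrow> 0)"

definition ln_ereal :: "ereal \<Rightarrow> ereal" where
  "ln_ereal x = (if x \<le> 0 then - \<infinity> else if x = \<infinity> then \<infinity> else ereal (ln (real_of_ereal x)))"

text \<open>Extended real: the prior density need not be bounded, in which case the value is \<open>\<infinity>\<close>.\<close>

definition M0_star :: "nat \<Rightarrow> (nat \<Rightarrow> real) \<Rightarrow> ((nat \<Rightarrow> real) \<Rightarrow> real) \<Rightarrow> ereal" where
  "M0_star d \<theta>s \<pi>0 =
     ereal (1 / real d) * ln_ereal ((SUP \<theta>\<in>Rspace d. ereal (\<pi>0 \<theta>)) / ereal (\<pi>0 \<theta>s))"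

end

theory Submission
  imports Defs "HOL-Real_Asymp.Real_Asymp"
begin

text \<open>
  The Gaussian \<open>L\<^sup>1\<close> Poincare inequality (with the interpolation argument of Maurey and Pisier) bounds
  the total variation distance of the posterior \<open>\<mu>\<close> and \<open>\<gamma>*\<close> by \<open>1 / \<surd>(n \<kappa>)\<close> times the \<open>\<mu>\<close>-average of
  \<open>|\<nabla> log (d\<mu>/d\<gamma>*)|\<close>, where \<open>\<kappa>\<close> is a lower bound for \<open>F*\<close>.  A smooth cutoff confines the argument to a
  ball of radius \<open>\<rho> = O(s \<surd>(d/n))\<close> around \<open>\<theta>*\<close>; its gradient and the missing mass are controlled by the
  posterior mass outside a smaller ball, which is small since the log likelihood grows quadratically
  near the MLE and then, by convexity, linearly.  In the ball the gradient of the likelihood differs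
  from its linearization by at most \<open>n \<rho> |\<theta> - MLE|\<close> times the empirical third moment of the
  features, and \<open>|\<theta> - MLE|\<close> averages to \<open>O(\<surd>(d/n))\<close>, whence \<open>s d / \<surd>n\<close>.

  When \<open>d > \<surd>n\<close> the bound is trivial, so the third moment is only needed for \<open>d \<le> \<surd>n\<close>.  There a union
  bound over a lattice suffices; for the second moments it suffices because \<open>d powr (3/2) \<le> C0 n\<close>.  The score
  is bounded without any covering, by averaging its exponential moments over a Gaussian direction,
  which is what keeps the probability \<open>exp (- d s\<^sup>2 / 10)\<close> free of logarithms of \<open>d\<close>.
\<close>

section \<open>Lebesgue measure and Gaussian integrals on \<open>Rspace d\<close>\<close>

text \<open>The inequality is used in L1 form because of how gradients behave: if G is the density
  of the cut-off posterior with respect to gamma*, then |grad G| d gamma* is |grad log G| times the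
  cut-off posterior, so only posterior averages occur and no bound on G itself enters. The rate s d
  / sqrt n, rather than s^2 d / sqrt n, comes from two scales: the Hessian error is controlled at
  the confinement radius, of order s sqrt (d/n), but it multiplies a mean distance of order sqrt
  (d/n), without s. The prior is tamed by C1 delta <= sqrt (n d): its logarithm varies by a small
  multiple of d over a distance sqrt (d/n), so comparing tail masses with the normalizing integral
  costs factors exp (O(d)) or exp (s d), which the tail exponent of order d s^2 absorbs. The lattice
  has (O(sqrt d))^d points, so the entropy d log d has to be beaten by n for the second moments and
  by n^(2/3) for the truncated third moments. Four feature events fail with probability exp (- sqrt
  n) each, which leaves C2 = 1.\<close>

definition lincomb :: "nat \<Rightarrow> real \<Rightarrow> (nat \<Rightarrow> real) \<Rightarrow> real \<Rightarrow> (nat \<Rightarrow> real) \<Rightarrow> nat \<Rightarrow> real" where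
  "lincomb d a x b y = (\<lambda>i\<in>{..<d}. a * x i + b * y i)"

lemma lincomb_apply [simp]: "i < d \<Longrightarrow> lincomb d a x b y i = a * x i + b * y i"
  by (simp add: lincomb_def)

lemma lincomb_in [simp, intro]: "lincomb d a x b y \<in> Rspace d"
  by (auto simp: lincomb_def)

lemma Rspace_eqI: "x \<in> Rspace d \<Longrightarrow> y \<in> Rspace d \<Longrightarrow> (\<And>i. i < d \<Longrightarrow> x i = y i) \<Longrightarrow> x = y"
  by (rule PiE_ext) auto

lemma space_lebesgue_R [simp]: "space (lebesgue_R d) = Rspace d"
  by (simp add: space_PiM)

lemma measurable_coord [measurable]: "i < d \<Longrightarrow> (\<lambda>x. x i) \<in> borel_measurable (lebesgue_R d)"
  by (metis lessThan_iff measurable_component_singleton measurable_lborel1)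

lemma measurable_dot [measurable]:
  assumes "\<And>i. i < d \<Longrightarrow> (\<lambda>x. f x i) \<in> borel_measurable M"
    "\<And>i. i < d \<Longrightarrow> (\<lambda>x. g x i) \<in> borel_measurable M"
  shows "(\<lambda>x. dot d (f x) (g x)) \<in> borel_measurable M"
  unfolding dot_def by (intro borel_measurable_sum borel_measurable_times assms) auto

lemma measurable_enorm [measurable]:
  assumes "\<And>i. i < d \<Longrightarrow> (\<lambda>x. f x i) \<in> borel_measurable M"
  shows "(\<lambda>x. enorm d (f x)) \<in> borel_measurable M"
  unfolding L2_set_def
  by (intro borel_measurable_sqrt measurable_compose[OF _ borel_measurable_sqrt]
      borel_measurable_sum borel_measurable_power assms) auto

lemma measurable_restrict_lebesgue_R:
  assumes [measurable]: "\<And>i. i < d \<Longrightarrow> (\<lambda>x. f x i) \<in> borel_measurable M"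
  shows "(\<lambda>x. \<lambda>i\<in>{..<d}. f x i) \<in> M \<rightarrow>\<^sub>M lebesgue_R d"
  by (rule measurable_restrict) auto

lemma measurable_lincomb [measurable]:
  assumes [measurable]: "\<And>i. i < d \<Longrightarrow> (\<lambda>x. f x i) \<in> borel_measurable M"
    "\<And>i. i < d \<Longrightarrow> (\<lambda>x. g x i) \<in> borel_measurable M"
    "a \<in> borel_measurable M" "b \<in> borel_measurable M"
  shows "(\<lambda>x. lincomb d (a x) (f x) (b x) (g x)) \<in> M \<rightarrow>\<^sub>M lebesgue_R d"
  unfolding lincomb_def by (rule measurable_restrict_lebesgue_R) measurable

interpretation lborel_prod: product_sigma_finite "\<lambda>_::nat. lborel :: real measure"
  by standard

lemma sigma_finite_lebesgue_R: "sigma_finite_measure (lebesgue_R d)"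
  using lborel_prod.sigma_finite by simp

interpretation leb: sigma_finite_measure "lebesgue_R d" for d
  by (rule sigma_finite_lebesgue_R)

interpretation leb2: pair_sigma_finite "lebesgue_R d" "lebesgue_R d" for d ..

text \<open>A measure on a finite product is determined by boxes, and a box is translated coordinate
  by coordinate, so the invariance of \<open>lborel\<close> suffices.\<close>

lemma distr_translate_lebesgue_R:
  "distr (lebesgue_R d) (lebesgue_R d) (\<lambda>x. \<lambda>i\<in>{..<d}. x i + v i) = lebesgue_R d"
proof (rule lborel_prod.PiM_eqI)
  fix A :: "nat \<Rightarrow> real set"
  assume A: "\<And>i. i \<in> {..<d} \<Longrightarrow> A i \<in> sets lborel"
  have m[measurable]: "(\<lambda>x. \<lambda>i\<in>{..<d}. x i + v i) \<in> lebesgue_R d \<rightarrow>\<^sub>M lebesgue_R d"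
    by (rule measurable_restrict_lebesgue_R) measurable
  let ?B = "\<lambda>i. (\<lambda>t. t + v i) -` A i"
  have B: "?B i \<in> sets lborel" if "i \<in> {..<d}" for i
    using measurable_sets[of "\<lambda>t. t + v i" borel borel "A i"] A[OF that] by simp
  have eq: "(\<lambda>x. \<lambda>i\<in>{..<d}. x i + v i) -` (Pi\<^sub>E {..<d} A) \<inter> Rspace d = Pi\<^sub>E {..<d} ?B"
    by (auto simp: PiE_def Pi_def extensional_def)
  have eB: "emeasure lborel (?B i) = emeasure lborel (A i)" if "i \<in> {..<d}" for i
  proof -
    have "emeasure lborel (A i) = emeasure (distr lborel borel ((+) (v i))) (A i)"
      by (simp add: lborel_distr_plus)
    also have "\<dots> = emeasure lborel (?B i)"
      using A[OF that] by (subst emeasure_distr) (auto simp: vimage_def add.commute)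
    finally show ?thesis by simp
  qed
  have "emeasure (distr (lebesgue_R d) (lebesgue_R d) (\<lambda>x. \<lambda>i\<in>{..<d}. x i + v i)) (Pi\<^sub>E {..<d} A)
      = emeasure (lebesgue_R d) (Pi\<^sub>E {..<d} ?B)"
    using A by (subst emeasure_distr) (auto simp: eq sets_PiM_I_finite simp del: restrict_apply)
  also have "\<dots> = (\<Prod>i\<in>{..<d}. emeasure lborel (?B i))"
    using B by (intro lborel_prod.emeasure_PiM) auto
  also have "\<dots> = (\<Prod>i\<in>{..<d}. emeasure lborel (A i))"
    using eB by (intro prod.cong) auto
  finally show "emeasure (distr (lebesgue_R d) (lebesgue_R d) (\<lambda>x. \<lambda>i\<in>{..<d}. x i + v i)) (Pi\<^sub>E {..<d} A)
      = (\<Prod>i\<in>{..<d}. emeasure lborel (A i))" .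
qed auto

lemma nn_integral_translate:
  assumes [measurable]: "f \<in> borel_measurable (lebesgue_R d)"
  shows "(\<integral>\<^sup>+x. f (\<lambda>i\<in>{..<d}. x i + v i) \<partial>lebesgue_R d) = (\<integral>\<^sup>+x. f x \<partial>lebesgue_R d)"
proof -
  have [measurable]: "(\<lambda>x. \<lambda>i\<in>{..<d}. x i + v i) \<in> lebesgue_R d \<rightarrow>\<^sub>M lebesgue_R d"
    by (rule measurable_restrict_lebesgue_R) measurable
  show ?thesis
    by (subst (2) distr_translate_lebesgue_R[of d v, symmetric], subst nn_integral_distr) auto
qed

text \<open>A rotation of the plane spanned by two copies of the space is a product of three shears.\<close>

lemma nn_integral_shear1:
  assumes F [measurable]: "F \<in> borel_measurable (lebesgue_R d \<Otimes>\<^sub>M lebesgue_R d)"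
  shows "(\<integral>\<^sup>+x. \<integral>\<^sup>+y. F (lincomb d 1 x a y, y) \<partial>lebesgue_R d \<partial>lebesgue_R d)
       = (\<integral>\<^sup>+x. \<integral>\<^sup>+y. F (x, y) \<partial>lebesgue_R d \<partial>lebesgue_R d)"
proof -
  have "(\<integral>\<^sup>+x. \<integral>\<^sup>+y. F (lincomb d 1 x a y, y) \<partial>lebesgue_R d \<partial>lebesgue_R d)
      = (\<integral>\<^sup>+y. \<integral>\<^sup>+x. F (lincomb d 1 x a y, y) \<partial>lebesgue_R d \<partial>lebesgue_R d)"
    by (rule leb2.Fubini'[symmetric]) measurable
  also have "\<dots> = (\<integral>\<^sup>+y. \<integral>\<^sup>+x. F (x, y) \<partial>lebesgue_R d \<partial>lebesgue_R d)"
  proof (rule nn_integral_cong)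
    fix y assume "y \<in> space (lebesgue_R d)"
    then have [measurable]: "(\<lambda>x. F (x, y)) \<in> borel_measurable (lebesgue_R d)" by measurable
    show "(\<integral>\<^sup>+x. F (lincomb d 1 x a y, y) \<partial>lebesgue_R d) = (\<integral>\<^sup>+x. F (x, y) \<partial>lebesgue_R d)"
      using nn_integral_translate[of "\<lambda>x. F (x, y)" d "\<lambda>i. a * y i"] by (simp add: lincomb_def)
  qed
  also have "\<dots> = (\<integral>\<^sup>+x. \<integral>\<^sup>+y. F (x, y) \<partial>lebesgue_R d \<partial>lebesgue_R d)"
    by (rule leb2.Fubini') measurable
  finally show ?thesis .
qed

lemma nn_integral_shear2:
  assumes F [measurable]: "F \<in> borel_measurable (lebesgue_R d \<Otimes>\<^sub>M lebesgue_R d)"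
  shows "(\<integral>\<^sup>+x. \<integral>\<^sup>+y. F (x, lincomb d a x 1 y) \<partial>lebesgue_R d \<partial>lebesgue_R d)
       = (\<integral>\<^sup>+x. \<integral>\<^sup>+y. F (x, y) \<partial>lebesgue_R d \<partial>lebesgue_R d)"
proof (rule nn_integral_cong)
  fix x assume "x \<in> space (lebesgue_R d)"
  then have [measurable]: "(\<lambda>y. F (x, y)) \<in> borel_measurable (lebesgue_R d)" by measurable
  show "(\<integral>\<^sup>+y. F (x, lincomb d a x 1 y) \<partial>lebesgue_R d) = (\<integral>\<^sup>+y. F (x, y) \<partial>lebesgue_R d)"
    using nn_integral_translate[of "\<lambda>y. F (x, y)" d "\<lambda>i. a * x i"]
    by (simp add: lincomb_def add.commute)
qed

text \<open>The three shears have parameters tan (t/2), - sin t and again tan (t/2). Each is a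
  translation in one variable with the other frozen, so translation invariance and Fubini replace a
  change of variables formula. The assumption on the cosine makes tan (t/2) meaningful.\<close>

lemma nn_integral_rotate:
  assumes F [measurable]: "F \<in> borel_measurable (lebesgue_R d \<Otimes>\<^sub>M lebesgue_R d)"
    and t: "cos (t / 2) \<noteq> 0"
  shows "(\<integral>\<^sup>+x. \<integral>\<^sup>+y. F (lincomb d (cos t) x (sin t) y, lincomb d (- sin t) x (cos t) y)
            \<partial>lebesgue_R d \<partial>lebesgue_R d)
       = (\<integral>\<^sup>+x. \<integral>\<^sup>+y. F (x, y) \<partial>lebesgue_R d \<partial>lebesgue_R d)"
proof -
  define a where "a = tan (t / 2)"
  define b where "b = - sin t"
  have s: "sin t = 2 * sin (t/2) * cos (t/2)" using sin_double[of "t/2"] by simp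
  have c: "cos t = 1 - 2 * (sin (t/2))\<^sup>2" using cos_double_sin[of "t/2"] by simp
  have c': "(cos (t/2))\<^sup>2 = 1 - (sin (t/2))\<^sup>2" by (rule cos_squared_eq)
  have 1: "1 + a * b = cos t" unfolding a_def b_def tan_def s c using t
    by (simp add: field_simps power2_eq_square)
  have 2: "a + a * (b * a + 1) = sin t"
  proof -
    have "a + a * (b * a + 1) = a * (1 + (1 + a * b))" by (simp add: algebra_simps)
    also have "\<dots> = a * (2 - 2 * (sin (t/2))\<^sup>2)" unfolding 1 c by simp
    also have "\<dots> = 2 * a * (cos (t/2))\<^sup>2" unfolding c' by simp
    also have "\<dots> = sin t" unfolding a_def tan_def s using t by (simp add: power2_eq_square)
    finally show ?thesis .
  qed
  have 3: "b * a + 1 = cos t" using 1 by (simp add: algebra_simps)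
  let ?G = "\<lambda>(x, y). F (lincomb d 1 x a y, y)"
  let ?H = "\<lambda>(x, y). ?G (x, lincomb d b x 1 y)"
  have "(\<integral>\<^sup>+x. \<integral>\<^sup>+y. F (x, y) \<partial>lebesgue_R d \<partial>lebesgue_R d) =
      (\<integral>\<^sup>+x. \<integral>\<^sup>+y. ?G (x, y) \<partial>lebesgue_R d \<partial>lebesgue_R d)"
    using nn_integral_shear1[of F d a] by simp
  also have "\<dots> = (\<integral>\<^sup>+x. \<integral>\<^sup>+y. ?H (x, y) \<partial>lebesgue_R d \<partial>lebesgue_R d)"
    by (subst nn_integral_shear2[of ?G d b, symmetric]) auto
  also have "\<dots> = (\<integral>\<^sup>+x. \<integral>\<^sup>+y. ?H (lincomb d 1 x a y, y) \<partial>lebesgue_R d \<partial>lebesgue_R d)"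
    by (rule nn_integral_shear1[symmetric]) measurable
  also have "\<dots> = (\<integral>\<^sup>+x. \<integral>\<^sup>+y. F (lincomb d (cos t) x (sin t) y, lincomb d (- sin t) x (cos t) y)
            \<partial>lebesgue_R d \<partial>lebesgue_R d)"
  proof (intro nn_integral_cong)
    fix x y assume "x \<in> space (lebesgue_R d)" "y \<in> space (lebesgue_R d)"
    have e2: "lincomb d b (lincomb d 1 x a y) 1 y = lincomb d (- sin t) x (cos t) y"
      unfolding 3[symmetric] b_def[symmetric]
      by (rule Rspace_eqI[OF lincomb_in lincomb_in]) (simp add: algebra_simps)
    have e1: "lincomb d 1 (lincomb d 1 x a y) a (lincomb d b (lincomb d 1 x a y) 1 y)
        = lincomb d (cos t) x (sin t) y"
      unfolding 1[symmetric] 2[symmetric] by (rule Rspace_eqI[OF lincomb_in lincomb_in]) (simp add: algebra_simps)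
    show "?H (lincomb d 1 x a y, y) = F (lincomb d (cos t) x (sin t) y, lincomb d (- sin t) x (cos t) y)"
      using e1 e2 by simp
  qed
  finally show ?thesis by simp
qed

section \<open>Quadratic forms, Schur complements and the Gaussian normalizing constant\<close>

definition bf :: "nat \<Rightarrow> real mat \<Rightarrow> (nat \<Rightarrow> real) \<Rightarrow> (nat \<Rightarrow> real) \<Rightarrow> real" where
  "bf d A x y = (\<Sum>i<d. \<Sum>j<d. A $$ (i, j) * x i * y j)"

lemma scalar_prod_mult_mat_vec:
  assumes "A \<in> carrier_mat d d"
  shows "Matrix.scalar_prod (Matrix.vec d x) (A *\<^sub>v Matrix.vec d y) = bf d A x y"
  using assms
  by (simp add: bf_def Matrix.scalar_prod_def atLeast0LessThan sum_distrib_left mult_ac)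

lemma bf_cong:
  "(\<And>i. i < d \<Longrightarrow> x i = x' i) \<Longrightarrow> (\<And>i. i < d \<Longrightarrow> y i = y' i) \<Longrightarrow> bf d A x y = bf d A x' y'"
  by (simp add: bf_def)

lemma bf_lincomb_left: "bf d A (lincomb d a x b y) z = a * bf d A x z + b * bf d A y z"
  by (simp add: bf_def sum.distrib sum_distrib_left algebra_simps)

lemma bf_lincomb_right: "bf d A z (lincomb d a x b y) = a * bf d A z x + b * bf d A z y"
  by (simp add: bf_def sum.distrib sum_distrib_left algebra_simps)

lemma bf_commute:
  assumes "A \<in> carrier_mat d d" "transpose_mat A = A"
  shows "bf d A x y = bf d A y x"
proof -
  have *: "A $$ (i, j) = A $$ (j, i)" if "i < d" "j < d" for i j
    using assms that by (metis carrier_matD(1) carrier_matD(2) index_transpose_mat(1))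
  have "bf d A x y = (\<Sum>j<d. \<Sum>i<d. A $$ (i, j) * x i * y j)"
    unfolding bf_def by (rule sum.swap)
  also have "\<dots> = bf d A y x" unfolding bf_def
    by (intro sum.cong refl) (use * in auto)
  finally show ?thesis .
qed

text \<open>The cross terms enter the two summands with opposite signs. This makes the product of
  two equal centred Gaussian densities invariant under rotation of the pair.\<close>

lemma bf_rotate:
  assumes "c\<^sup>2 + s\<^sup>2 = 1"
  shows "bf d A (lincomb d c x s y) (lincomb d c x s y)
       + bf d A (lincomb d (- s) x c y) (lincomb d (- s) x c y) = bf d A x x + bf d A y y"
proof -
  have "bf d A (lincomb d c x s y) (lincomb d c x s y)
       + bf d A (lincomb d (- s) x c y) (lincomb d (- s) x c y)
     = (c\<^sup>2 + s\<^sup>2) * (bf d A x x + bf d A y y)"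
    by (simp add: bf_lincomb_left bf_lincomb_right algebra_simps power2_eq_square)
  then show ?thesis using assms by simp
qed

lemma measurable_bf [measurable]:
  assumes "\<And>i. i < d \<Longrightarrow> (\<lambda>x. f x i) \<in> borel_measurable M"
    "\<And>i. i < d \<Longrightarrow> (\<lambda>x. g x i) \<in> borel_measurable M"
  shows "(\<lambda>x. bf d A (f x) (g x)) \<in> borel_measurable M"
  unfolding bf_def
  by (intro borel_measurable_sum borel_measurable_times borel_measurable_const assms) auto

lemma pos_def_mat_bf_pos:
  assumes "pos_def_mat d A" "i < d" "x i \<noteq> 0"
  shows "bf d A x x > 0"
proof -
  have "Matrix.vec d x \<noteq> 0\<^sub>v d" using assms(2,3) by (metis index_vec index_zero_vec(1))
  then show ?thesis
    using assms(1) scalar_prod_mult_mat_vec[of A d x x] unfolding pos_def_mat_def by (metis vec_carrier)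
qed

lemma pos_def_matI:
  assumes "A \<in> carrier_mat d d" "\<And>i j. i < d \<Longrightarrow> j < d \<Longrightarrow> A $$ (i, j) = A $$ (j, i)"
    "\<And>x i. i < d \<Longrightarrow> x i \<noteq> 0 \<Longrightarrow> bf d A x x > 0"
  shows "pos_def_mat d A"
  unfolding pos_def_mat_def
proof (intro conjI ballI impI)
  show "transpose_mat A = A" using assms(1,2) by (intro eq_matI) auto
  fix v :: "real Matrix.vec" assume v: "v \<in> carrier_vec d" "v \<noteq> 0\<^sub>v d"
  have e: "v = Matrix.vec d (\<lambda>i. vec_index v i)" using v(1) by auto
  obtain i where "i < d" "vec_index v i \<noteq> 0" using v
    by (metis carrier_vecD eq_vecI index_zero_vec(1) index_zero_vec(2))
  then have "bf d A (\<lambda>i. vec_index v i) (\<lambda>i. vec_index v i) > 0" by (rule assms(3))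
  then show "0 < Matrix.scalar_prod v (A *\<^sub>v v)"
    using scalar_prod_mult_mat_vec[OF assms(1), of "\<lambda>i. vec_index v i" "\<lambda>i. vec_index v i"] e by metis
qed (rule assms(1))

lemma pos_def_mat_sym: "pos_def_mat d A \<Longrightarrow> i < d \<Longrightarrow> j < d \<Longrightarrow> A $$ (i, j) = A $$ (j, i)"
  unfolding pos_def_mat_def by (metis carrier_matD(1) carrier_matD(2) index_transpose_mat(1))

definition schur :: "nat \<Rightarrow> real mat \<Rightarrow> real mat" where
  "schur d A = Matrix.mat d d (\<lambda>(i, j). A $$ (i, j) - A $$ (i, d) * A $$ (d, j) / A $$ (d, d))"

text \<open>Completing the square in the last variable, the one with index \<open>d\<close>; the
  Schur complement is the form left to the other variables.\<close>

lemma bf_schur: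
  assumes sym: "\<And>i j. i < Suc d \<Longrightarrow> j < Suc d \<Longrightarrow> A $$ (i, j) = A $$ (j, i)"
    and nz: "A $$ (d, d) \<noteq> 0"
  shows "bf (Suc d) A x x = bf d (schur d A) x x
       + A $$ (d, d) * (x d + (\<Sum>i<d. A $$ (i, d) * x i) / A $$ (d, d))\<^sup>2"
proof -
  define a where "a = A $$ (d, d)"
  define b where "b = (\<Sum>i<d. A $$ (i, d) * x i)"
  have b': "(\<Sum>j<d. A $$ (d, j) * x d * x j) = x d * b"
    unfolding b_def sum_distrib_left by (intro sum.cong refl) (use sym in auto)
  have b'': "(\<Sum>i<d. A $$ (i, d) * x i * x d) = x d * b"
    unfolding b_def sum_distrib_left by (intro sum.cong refl) auto
  have "bf (Suc d) A x x = bf d A x x + 2 * x d * b + a * (x d)\<^sup>2"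
    unfolding bf_def by (simp add: sum.distrib b' b'' a_def power2_eq_square)
  moreover have "bf d (schur d A) x x = bf d A x x - b\<^sup>2 / a"
  proof -
    have "bf d (schur d A) x x
        = (\<Sum>i<d. \<Sum>j<d. A $$ (i, j) * x i * x j - (A $$ (i, d) * x i) * (A $$ (j, d) * x j) / a)"
      unfolding bf_def schur_def a_def
      by (intro sum.cong refl) (use sym in \<open>auto simp: algebra_simps\<close>)
    also have "\<dots> = bf d A x x - (\<Sum>i<d. \<Sum>j<d. (A $$ (i, d) * x i) * (A $$ (j, d) * x j)) / a"
      by (simp add: bf_def sum_subtractf sum_divide_distrib)
    also have "(\<Sum>i<d. \<Sum>j<d. (A $$ (i, d) * x i) * (A $$ (j, d) * x j)) = b\<^sup>2"
      unfolding b_def power2_eq_square sum_product ..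
    finally show ?thesis .
  qed
  moreover have "a * (x d + b / a)\<^sup>2 = 2 * x d * b + a * (x d)\<^sup>2 + b\<^sup>2 / a"
    using nz unfolding a_def[symmetric] by (simp add: field_simps power2_eq_square)
  ultimately show ?thesis unfolding a_def[symmetric] b_def[symmetric] by simp
qed

text \<open>Block factorization \<open>A = U * W\<close>: \<open>U\<close> is unit upper triangular
  and contributes 1, \<open>W\<close> is block lower triangular with diagonal blocks
  \<open>schur d A\<close> and the pivot.\<close>

lemma det_schur:
  assumes A: "A \<in> carrier_mat (Suc d) (Suc d)" and nz: "A $$ (d, d) \<noteq> 0"
  shows "Determinant.det A = A $$ (d, d) * Determinant.det (schur d A)"
proof -
  define a where "a = A $$ (d, d)"
  define U where "U = four_block_mat (1\<^sub>m d) (Matrix.mat d 1 (\<lambda>(i, j). A $$ (i, d) / a)) (0\<^sub>m 1 d) (1\<^sub>m 1)"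
  define W where "W = four_block_mat (schur d A) (0\<^sub>m d 1) (Matrix.mat 1 d (\<lambda>(i, j). A $$ (d, j)))
     (Matrix.mat 1 1 (\<lambda>_. a))"
  have S: "schur d A \<in> carrier_mat d d" by (simp add: schur_def)
  have "A = U * W"
  proof -
    have "U * W = four_block_mat
      (1\<^sub>m d * schur d A + Matrix.mat d 1 (\<lambda>(i, j). A $$ (i, d) / a) * Matrix.mat 1 d (\<lambda>(i, j). A $$ (d, j)))
      (1\<^sub>m d * 0\<^sub>m d 1 + Matrix.mat d 1 (\<lambda>(i, j). A $$ (i, d) / a) * Matrix.mat 1 1 (\<lambda>_. a))
      (0\<^sub>m 1 d * schur d A + 1\<^sub>m 1 * Matrix.mat 1 d (\<lambda>(i, j). A $$ (d, j)))
      (0\<^sub>m 1 d * 0\<^sub>m d 1 + 1\<^sub>m 1 * Matrix.mat 1 1 (\<lambda>_. a))"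
      unfolding U_def W_def by (rule mult_four_block_mat) (use S in auto)
    also have "\<dots> = A"
    proof (rule eq_matI)
      fix i j assume ij: "i < dim_row A" "j < dim_col A"
      then have ij': "i < Suc d" "j < Suc d" using A by auto
      have si: "i < d \<or> i = d" "j < d \<or> j = d" using ij' by auto
      have z: "0\<^sub>m 1 d * schur d A = 0\<^sub>m 1 d" using S by auto
      show "four_block_mat
      (1\<^sub>m d * schur d A + Matrix.mat d 1 (\<lambda>(i, j). A $$ (i, d) / a) * Matrix.mat 1 d (\<lambda>(i, j). A $$ (d, j)))
      (1\<^sub>m d * 0\<^sub>m d 1 + Matrix.mat d 1 (\<lambda>(i, j). A $$ (i, d) / a) * Matrix.mat 1 1 (\<lambda>_. a))
      (0\<^sub>m 1 d * schur d A + 1\<^sub>m 1 * Matrix.mat 1 d (\<lambda>(i, j). A $$ (d, j)))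
      (0\<^sub>m 1 d * 0\<^sub>m d 1 + 1\<^sub>m 1 * Matrix.mat 1 1 (\<lambda>_. a)) $$ (i, j) = A $$ (i, j)"
        using ij' si S nz
        by (auto simp: scalar_prod_def schur_def a_def z)
    qed (use A S in auto)
    finally show ?thesis by simp
  qed
  moreover have "Determinant.det U = 1"
    unfolding U_def by (subst det_four_block_mat_lower_left_zero[of _ d _ 1]) auto
  moreover have "Determinant.det W = Determinant.det (schur d A) * a"
    unfolding W_def by (subst det_four_block_mat_upper_right_zero[of _ d _ 1]) (use S in \<open>auto simp: det_single\<close>)
  moreover have "U \<in> carrier_mat (Suc d) (Suc d)" "W \<in> carrier_mat (Suc d) (Suc d)"
    unfolding U_def W_def using S by (auto intro!: carrier_matI simp: schur_def)
  ultimately show ?thesis by (simp add: det_mult a_def)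
qed

text \<open>Two test vectors: the last basis vector for the pivot, and for the complement the
  extension of \<open>x\<close> by the last coordinate that annihilates the square in
  \<open>bf_schur\<close>.\<close>

lemma pos_def_schur:
  assumes "pos_def_mat (Suc d) A"
  shows "A $$ (d, d) > 0" "pos_def_mat d (schur d A)"
proof -
  let ?e = "\<lambda>i. if i = d then 1 else (0::real)"
  have sym: "\<And>i j. i < Suc d \<Longrightarrow> j < Suc d \<Longrightarrow> A $$ (i, j) = A $$ (j, i)"
    using assms pos_def_mat_sym by blast
  have "bf (Suc d) A ?e ?e > 0" using assms by (rule pos_def_mat_bf_pos[of _ _ d]) auto
  moreover have "bf (Suc d) A ?e ?e = A $$ (d, d)"
    by (simp add: bf_def if_distrib cong: if_cong)
  ultimately show a: "A $$ (d, d) > 0" by simp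
  show "pos_def_mat d (schur d A)"
  proof (rule pos_def_matI)
    show "schur d A $$ (i, j) = schur d A $$ (j, i)" if "i < d" "j < d" for i j
      using that sym[of i j] sym[of i d] sym[of j d] by (simp add: schur_def)
    fix x :: "nat \<Rightarrow> real" and i assume i: "i < d" "x i \<noteq> 0"
    define y where "y = x(d := - (\<Sum>i<d. A $$ (i, d) * x i) / A $$ (d, d))"
    have "bf (Suc d) A y y > 0" using assms i by (intro pos_def_mat_bf_pos[of _ _ i]) (auto simp: y_def)
    moreover have "(\<Sum>i<d. A $$ (i, d) * y i) = (\<Sum>i<d. A $$ (i, d) * x i)"
      by (intro sum.cong) (auto simp: y_def)
    moreover have "bf d (schur d A) y y = bf d (schur d A) x x"
      by (rule bf_cong) (auto simp: y_def)
    ultimately show "0 < bf d (schur d A) x x"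
      using a by (subst (asm) bf_schur[OF sym]) (auto simp: y_def)
  qed (simp add: schur_def)
qed

lemma nn_integral_normal_density: "\<sigma> > 0 \<Longrightarrow> (\<integral>\<^sup>+x. ennreal (normal_density \<mu> \<sigma> x) \<partial>lborel) = 1"
  using prob_space.emeasure_space_1[OF prob_space_normal_density[of \<sigma> \<mu>]]
  by (simp add: emeasure_density)

lemma nn_integral_exp_square:
  assumes a: "a > 0"
  shows "(\<integral>\<^sup>+t. ennreal (exp (- (a * (t + c)\<^sup>2 / 2))) \<partial>lborel) = ennreal (sqrt (2 * pi / a))"
proof -
  have eq: "exp (- (a * (t + c)\<^sup>2 / 2)) = sqrt (2 * pi / a) * normal_density (- c) (1 / sqrt a) t" for t
  proof -
    have s: "(1 / sqrt a)\<^sup>2 = 1 / a" using a by (simp add: power_divide)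
    have "sqrt (2 * pi / a) > 0" using a pi_gt_zero by simp
    then show ?thesis using a unfolding normal_density_def s by (simp add: field_simps)
  qed
  have "(\<integral>\<^sup>+t. ennreal (exp (- (a * (t + c)\<^sup>2 / 2))) \<partial>lborel)
      = (\<integral>\<^sup>+t. ennreal (sqrt (2 * pi / a)) * ennreal (normal_density (- c) (1 / sqrt a) t) \<partial>lborel)"
    unfolding eq using a by (intro nn_integral_cong ennreal_mult) auto
  also have "\<dots> = ennreal (sqrt (2 * pi / a))"
    using a by (subst nn_integral_cmult) (auto simp: nn_integral_normal_density)
  finally show ?thesis .
qed

lemma nn_integral_lebesgue_R_Suc:
  assumes [measurable]: "f \<in> borel_measurable (lebesgue_R (Suc d))"
  shows "(\<integral>\<^sup>+x. f x \<partial>lebesgue_R (Suc d)) = (\<integral>\<^sup>+x. \<integral>\<^sup>+t. f (x(d := t)) \<partial>lborel \<partial>lebesgue_R d)"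
proof -
  have "{..<Suc d} = insert d {..<d}" by auto
  then show ?thesis using lborel_prod.product_nn_integral_insert[of "{..<d}" d f] assms by simp
qed

text \<open>Induction on the dimension: the last variable is integrated out after completing the
  square, which leaves the Schur complement. The sign of the determinant belongs in the same
  induction, since the determinant is the pivot times that of the complement.\<close>

lemma gaussian_integral:
  assumes "pos_def_mat d A"
  shows "Determinant.det A > 0 \<and>
    (\<integral>\<^sup>+x. ennreal (exp (- bf d A x x / 2)) \<partial>lebesgue_R d) = ennreal (sqrt ((2 * pi) ^ d / Determinant.det A))"
  using assms
proof (induction d arbitrary: A)
  case 0
  then show ?case by (simp add: pos_def_mat_def bf_def PiM_empty nn_integral_count_space_finite)
next
  case (Suc d)
  define a where "a = A $$ (d, d)"
  have sym: "\<And>i j. i < Suc d \<Longrightarrow> j < Suc d \<Longrightarrow> A $$ (i, j) = A $$ (j, i)"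
    using Suc.prems pos_def_mat_sym by blast
  have a: "a > 0" using pos_def_schur(1)[OF Suc.prems] by (simp add: a_def)
  have S: "pos_def_mat d (schur d A)" using pos_def_schur(2)[OF Suc.prems] .
  have det: "Determinant.det A = a * Determinant.det (schur d A)"
    using det_schur[of A d] Suc.prems a by (simp add: a_def pos_def_mat_def)
  have dS: "Determinant.det (schur d A) > 0" using Suc.IH[OF S] by simp
  have bfx: "bf (Suc d) A (x(d := t)) (x(d := t)) = bf d (schur d A) x x + a * (t + (\<Sum>i<d. A $$ (i, d) * x i) / a)\<^sup>2"
    for x t
  proof -
    have "bf d (schur d A) (x(d := t)) (x(d := t)) = bf d (schur d A) x x"
      by (rule bf_cong) auto
    then show ?thesis using bf_schur[OF sym, of d "x(d := t)"] a by (simp add: a_def)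
  qed
  have "(\<integral>\<^sup>+x. ennreal (exp (- bf (Suc d) A x x / 2)) \<partial>lebesgue_R (Suc d))
      = (\<integral>\<^sup>+x. \<integral>\<^sup>+t. ennreal (exp (- bf d (schur d A) x x / 2)) *
           ennreal (exp (- (a * (t + (\<Sum>i<d. A $$ (i, d) * x i) / a)\<^sup>2 / 2))) \<partial>lborel \<partial>lebesgue_R d)"
    by (subst nn_integral_lebesgue_R_Suc)
       (auto simp: bfx ennreal_mult[symmetric] exp_add[symmetric] add_divide_distrib intro!: nn_integral_cong)
  also have "\<dots> = (\<integral>\<^sup>+x. ennreal (exp (- bf d (schur d A) x x / 2)) * ennreal (sqrt (2 * pi / a)) \<partial>lebesgue_R d)"
    by (intro nn_integral_cong, subst nn_integral_cmult) (auto simp: nn_integral_exp_square[OF a])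
  also have "\<dots> = ennreal (sqrt ((2 * pi) ^ d / Determinant.det (schur d A))) * ennreal (sqrt (2 * pi / a))"
    using Suc.IH[OF S] by (subst nn_integral_multc) auto
  also have "\<dots> = ennreal (sqrt ((2 * pi) ^ Suc d / Determinant.det A))"
    using a dS by (subst ennreal_mult[symmetric]) (auto simp: det real_sqrt_mult[symmetric] mult_ac)
  finally show ?case using det a dS by simp
qed

text \<open>\<open>mat_inverse\<close> returns an option, so a nonzero determinant is needed before
  \<open>the\<close> has meaning. The double inverse occurs because \<open>gaussian\<close> inverts
  its covariance, and the covariance of gamma* is itself an inverse.\<close>

lemma pos_def_mat_inverse:
  assumes "pos_def_mat d A"
  shows "inv_mat A \<in> carrier_mat d d" "A * inv_mat A = 1\<^sub>m d" "inv_mat A * A = 1\<^sub>m d"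
    "inv_mat (inv_mat A) = A" "Determinant.det (inv_mat A) = 1 / Determinant.det A"
proof -
  have A: "A \<in> carrier_mat d d" using assms by (simp add: pos_def_mat_def)
  have nz: "Determinant.det A \<noteq> 0" using gaussian_integral[OF assms] by simp
  have inv: "B * C = 1\<^sub>m d \<and> C * B = 1\<^sub>m d \<and> C \<in> carrier_mat d d"
    if "B \<in> carrier_mat d d" "Determinant.det B \<noteq> 0" "C = inv_mat B" for B C :: "real mat"
  proof -
    have "mat_inverse B \<noteq> None"
    proof
      assume "mat_inverse B = None"
      then show False
        by (rule notE[OF mat_inverse(1)[OF that(1)] det_non_zero_imp_unit[OF that(1,2)]])
    qed
    then obtain C' where "mat_inverse B = Some C'" by auto
    then show ?thesis using mat_inverse(2)[OF that(1)] that(3) by auto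
  qed
  note i = inv[OF A nz refl]
  show 1: "inv_mat A \<in> carrier_mat d d" "A * inv_mat A = 1\<^sub>m d" "inv_mat A * A = 1\<^sub>m d" using i by auto
  have dd: "Determinant.det A * Determinant.det (inv_mat A) = 1"
    using det_mult[OF A 1(1)] 1(2) by simp
  then show "Determinant.det (inv_mat A) = 1 / Determinant.det A" using nz by (simp add: field_simps)
  have "Determinant.det (inv_mat A) \<noteq> 0" using dd by auto
  note j = inv[OF 1(1) this refl]
  show "inv_mat (inv_mat A) = A"
  proof -
    have "inv_mat (inv_mat A) = (A * inv_mat A) * inv_mat (inv_mat A)"
      unfolding 1(2) by (rule left_mult_one_mat[symmetric]) (use j in auto)
    also have "\<dots> = A * (inv_mat A * inv_mat (inv_mat A))"
      by (rule assoc_mult_mat[OF A 1(1)]) (use j in auto)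
    also have "\<dots> = A" using A j by simp
    finally show ?thesis .
  qed
qed

definition gnorm :: "nat \<Rightarrow> real mat \<Rightarrow> real" where
  "gnorm d A = sqrt ((2 * pi) ^ d / Determinant.det A)"

lemma gnorm_pos: "pos_def_mat d A \<Longrightarrow> gnorm d A > 0"
  unfolding gnorm_def using gaussian_integral[of d A] by (simp add: pi_gt_zero)

text \<open>From here on Gaussians are given by their precision matrix, so that no inverse is left
  in the density.\<close>

lemma gaussian_inv_mat:
  assumes "pos_def_mat d A"
  shows "gaussian d \<mu> (inv_mat A) = density (lebesgue_R d)
    (\<lambda>x. ennreal (exp (- bf d A (\<lambda>i. x i - \<mu> i) (\<lambda>i. x i - \<mu> i) / 2) / gnorm d A))"
  using assms pos_def_mat_inverse[OF assms]
  by (simp add: gaussian_def Let_def scalar_prod_mult_mat_vec[of A] pos_def_mat_def gnorm_def)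

lemma nn_integral_gaussian_centred:
  assumes "pos_def_mat d A"
  shows "(\<integral>\<^sup>+x. ennreal (exp (- bf d A x x / 2) / gnorm d A) \<partial>lebesgue_R d) = 1"
proof -
  have g: "gnorm d A > 0" by (rule gnorm_pos[OF assms])
  have "(\<integral>\<^sup>+x. ennreal (exp (- bf d A x x / 2) / gnorm d A) \<partial>lebesgue_R d)
      = (\<integral>\<^sup>+x. ennreal (exp (- bf d A x x / 2)) * ennreal (1 / gnorm d A) \<partial>lebesgue_R d)"
    using g by (intro nn_integral_cong) (auto simp: ennreal_mult[symmetric])
  also have "\<dots> = ennreal (gnorm d A) * ennreal (1 / gnorm d A)"
    using gaussian_integral[OF assms] by (subst nn_integral_multc) (auto simp: gnorm_def)
  also have "\<dots> = 1" using g by (simp add: ennreal_mult[symmetric])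
  finally show ?thesis .
qed

lemma nn_integral_gaussian:
  assumes "pos_def_mat d A"
  shows "(\<integral>\<^sup>+x. ennreal (exp (- bf d A (\<lambda>i. x i - \<mu> i) (\<lambda>i. x i - \<mu> i) / 2) / gnorm d A) \<partial>lebesgue_R d) = 1"
proof -
  have "(\<integral>\<^sup>+x. ennreal (exp (- bf d A (\<lambda>i. x i - \<mu> i) (\<lambda>i. x i - \<mu> i) / 2) / gnorm d A) \<partial>lebesgue_R d)
     = (\<integral>\<^sup>+x. ennreal (exp (- bf d A (\<lambda>i\<in>{..<d}. x i + - \<mu> i) (\<lambda>i\<in>{..<d}. x i + - \<mu> i) / 2) / gnorm d A) \<partial>lebesgue_R d)"
    by (intro nn_integral_cong arg_cong[where f=ennreal] arg_cong[where f="\<lambda>t. exp (- t / 2) / gnorm d A"] bf_cong) auto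
  also have "\<dots> = (\<integral>\<^sup>+x. ennreal (exp (- bf d A x x / 2) / gnorm d A) \<partial>lebesgue_R d)"
    by (rule nn_integral_translate) measurable
  also have "\<dots> = 1" by (rule nn_integral_gaussian_centred[OF assms])
  finally show ?thesis .
qed

lemma prob_space_gaussian:
  assumes "pos_def_mat d A"
  shows "prob_space (gaussian d \<mu> (inv_mat A))"
proof -
  have "emeasure (gaussian d \<mu> (inv_mat A)) (Rspace d) = 1"
    unfolding gaussian_inv_mat[OF assms]
    by (subst emeasure_density)
       (auto intro!: trans[OF nn_integral_cong nn_integral_gaussian[OF assms]] simp: indicator_def)
  then show ?thesis by (intro prob_spaceI) (simp add: gaussian_inv_mat[OF assms])
qed

section \<open>The \<open>L\<^sup>1\<close> Poincare inequality\<close>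

lemma dot_le_enorm: "\<bar>dot d x y\<bar> \<le> enorm d x * enorm d y"
proof -
  have "\<bar>dot d x y\<bar> \<le> (\<Sum>i<d. \<bar>x i\<bar> * \<bar>y i\<bar>)"
    unfolding dot_def abs_mult[symmetric] by (rule sum_abs)
  also have "\<dots> \<le> enorm d x * enorm d y" by (rule L2_set_mult_ineq)
  finally show ?thesis .
qed

lemma dot_self: "dot d x x = (enorm d x)\<^sup>2"
  by (simp add: dot_def L2_set_def power2_eq_square sum_nonneg)

lemma dot_commute: "dot d x y = dot d y x"
  by (simp add: dot_def mult.commute)

lemma dot_cong:
  "(\<And>i. i < d \<Longrightarrow> x i = x' i) \<Longrightarrow> (\<And>i. i < d \<Longrightarrow> y i = y' i) \<Longrightarrow> dot d x y = dot d x' y'"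
  by (simp add: dot_def)

lemma enorm_cong: "(\<And>i. i < d \<Longrightarrow> x i = x' i) \<Longrightarrow> enorm d x = enorm d x'"
  by (simp add: L2_set_def)

lemma abs_le_exp_add_exp: "\<bar>x :: real\<bar> \<le> exp x + exp (- x)"
  using exp_ge_add_one_self[of x] exp_ge_add_one_self[of "- x"] exp_gt_zero[of x] exp_gt_zero[of "- x"]
  by linarith

text \<open>\<open>v\<close> is the image of \<open>u\<close> under the inverse of \<open>A\<close>;
  it is the direction of the shift that completes the square in \<open>gaussian_mgf\<close>.\<close>

lemma pos_def_mat_riesz:
  assumes "pos_def_mat d A"
  obtains v where "\<And>y. bf d A y v = dot d u y"
proof
  have A: "A \<in> carrier_mat d d" using assms by (simp add: pos_def_mat_def)
  note I = pos_def_mat_inverse(1,2)[OF assms]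
  let ?v = "inv_mat A *\<^sub>v Matrix.vec d u"
  have v: "?v = Matrix.vec d (vec_index ?v)" using I(1) by (intro eq_vecI) auto
  fix y
  have "bf d A y (vec_index ?v) = Matrix.scalar_prod (Matrix.vec d y) (A *\<^sub>v Matrix.vec d (vec_index ?v))"
    by (rule scalar_prod_mult_mat_vec[OF A, symmetric])
  also have "A *\<^sub>v Matrix.vec d (vec_index ?v) = A *\<^sub>v ?v" using v by simp
  also have "\<dots> = (A * inv_mat A) *\<^sub>v Matrix.vec d u"
    by (rule assoc_mult_mat_vec[symmetric, OF A I(1)]) simp
  also have "\<dots> = Matrix.vec d u" unfolding I(2) by simp
  also have "Matrix.scalar_prod (Matrix.vec d y) (Matrix.vec d u) = dot d u y"
    by (simp add: Matrix.scalar_prod_def dot_def atLeast0LessThan mult.commute)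
  finally show "bf d A y (vec_index ?v) = dot d u y" .
qed

lemma gaussian_mgf:
  assumes A: "pos_def_mat d A" and v: "\<And>y. bf d A y v = dot d u y"
  shows "(\<integral>\<^sup>+y. ennreal (exp (c * dot d u y)) * ennreal (exp (- bf d A y y / 2) / gnorm d A) \<partial>lebesgue_R d)
    = ennreal (exp (c\<^sup>2 * bf d A v v / 2))"
proof -
  have sym: "bf d A x y = bf d A y x" for x y
    using A by (intro bf_commute) (auto simp: pos_def_mat_def)
  have g: "gnorm d A > 0" by (rule gnorm_pos[OF A])
  have eq: "bf d A (\<lambda>i. y i - c * v i) (\<lambda>i. y i - c * v i) = bf d A y y - 2 * c * dot d u y + c\<^sup>2 * bf d A v v" for y
  proof -
    have "bf d A (\<lambda>i. y i - c * v i) (\<lambda>i. y i - c * v i) = bf d A (lincomb d 1 y (- c) v) (lincomb d 1 y (- c) v)"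
      by (rule bf_cong) auto
    also have "\<dots> = bf d A y y - 2 * c * dot d u y + c\<^sup>2 * bf d A v v"
      unfolding bf_lincomb_left bf_lincomb_right sym[of v y] v by (simp add: power2_eq_square algebra_simps)
    finally show ?thesis .
  qed
  have "(\<integral>\<^sup>+y. ennreal (exp (c * dot d u y)) * ennreal (exp (- bf d A y y / 2) / gnorm d A) \<partial>lebesgue_R d)
     = (\<integral>\<^sup>+y. ennreal (exp (c\<^sup>2 * bf d A v v / 2)) *
          ennreal (exp (- bf d A (\<lambda>i. y i - c * v i) (\<lambda>i. y i - c * v i) / 2) / gnorm d A) \<partial>lebesgue_R d)"
  proof (rule nn_integral_cong)
    fix y
    have "exp (c * dot d u y) * exp (- bf d A y y / 2)
      = exp (c\<^sup>2 * bf d A v v / 2) * exp (- bf d A (\<lambda>i. y i - c * v i) (\<lambda>i. y i - c * v i) / 2)"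
      unfolding eq exp_add[symmetric] by (simp add: field_simps)
    then show "ennreal (exp (c * dot d u y)) * ennreal (exp (- bf d A y y / 2) / gnorm d A)
      = ennreal (exp (c\<^sup>2 * bf d A v v / 2)) *
          ennreal (exp (- bf d A (\<lambda>i. y i - c * v i) (\<lambda>i. y i - c * v i) / 2) / gnorm d A)"
      using g by (simp add: ennreal_mult[symmetric])
  qed
  also have "\<dots> = ennreal (exp (c\<^sup>2 * bf d A v v / 2))"
    by (subst nn_integral_cmult, measurable) (simp only: nn_integral_gaussian[OF A] mult_1_right)
  finally show ?thesis .
qed

text \<open>The bound |x| <= exp x + exp (- x) at the scale
  \<open>c = sqrt \<kappa> / enorm d u\<close> replaces the absolute moment by two exponential
  moments, each at most exp (1/2) <= 2; hence the factor 4.\<close>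

lemma gaussian_abs_moment:
  assumes A: "pos_def_mat d A" and k: "\<kappa> > 0" and lower: "\<And>z. \<kappa> * (enorm d z)\<^sup>2 \<le> bf d A z z"
  shows "(\<integral>\<^sup>+y. ennreal \<bar>dot d u y\<bar> * ennreal (exp (- bf d A y y / 2) / gnorm d A) \<partial>lebesgue_R d)
    \<le> ennreal (4 / sqrt \<kappa> * enorm d u)"
proof (cases "enorm d u = 0")
  case True
  then have "\<bar>dot d u y\<bar> = 0" for y using dot_le_enorm[of d u y] by simp
  then show ?thesis by simp
next
  case False
  then have u: "enorm d u > 0" using L2_set_nonneg[of u "{..<d}"] by linarith
  obtain v where v: "\<And>y. bf d A y v = dot d u y" using pos_def_mat_riesz[OF A] by blast
  let ?q = "bf d A v v"
  define c where "c = sqrt \<kappa> / enorm d u"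
  have c: "c > 0" using k u by (simp add: c_def)
  \<comment> \<open>Cauchy-Schwarz in \<kappa> |v|^2 <= \<open>bf d A v v\<close> =
    \<open>dot d u v\<close> bounds |v| by |u| / \<kappa>, and then the form itself by |u|^2 /
    \<kappa>.\<close>
  have "\<kappa> * (enorm d v)\<^sup>2 \<le> enorm d u * enorm d v"
    using lower[of v] v[of v] dot_le_enorm[of d u v] by linarith
  then have "\<kappa> * enorm d v \<le> enorm d u"
    using L2_set_nonneg[of v "{..<d}"] u by (cases "enorm d v = 0") (auto simp: power2_eq_square)
  then have "?q * \<kappa> \<le> (enorm d u)\<^sup>2"
    using v[of v] dot_le_enorm[of d u v] u k
    by (smt (verit, best) mult.commute mult.left_commute mult_left_mono power2_eq_square)
  then have q: "c\<^sup>2 * ?q \<le> 1"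
    using u k by (simp add: c_def power_divide divide_simps mult.commute)
  have e: "exp (c\<^sup>2 * ?q / 2) \<le> 2"
  proof -
    have "exp (c\<^sup>2 * ?q / 2) \<le> exp (1/2)" using q by simp
    also have "\<dots> \<le> 2" by (rule exp_half_le2)
    finally show ?thesis .
  qed
  have "(\<integral>\<^sup>+y. ennreal \<bar>dot d u y\<bar> * ennreal (exp (- bf d A y y / 2) / gnorm d A) \<partial>lebesgue_R d)
     \<le> (\<integral>\<^sup>+y. ennreal (1 / c) *
          (ennreal (exp (c * dot d u y)) * ennreal (exp (- bf d A y y / 2) / gnorm d A)
         + ennreal (exp (- c * dot d u y)) * ennreal (exp (- bf d A y y / 2) / gnorm d A)) \<partial>lebesgue_R d)"
  proof (rule nn_integral_mono)
    fix y
    have "\<bar>dot d u y\<bar> \<le> 1 / c * (exp (c * dot d u y) + exp (- c * dot d u y))"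
      using abs_le_exp_add_exp[of "c * dot d u y"] c by (simp add: abs_mult field_simps)
    then have "ennreal \<bar>dot d u y\<bar> \<le> ennreal (1 / c) * (ennreal (exp (c * dot d u y)) + ennreal (exp (- c * dot d u y)))"
      using c by (simp add: ennreal_mult[symmetric] ennreal_plus[symmetric] del: ennreal_plus)
    then show "ennreal \<bar>dot d u y\<bar> * ennreal (exp (- bf d A y y / 2) / gnorm d A)
      \<le> ennreal (1 / c) *
          (ennreal (exp (c * dot d u y)) * ennreal (exp (- bf d A y y / 2) / gnorm d A)
         + ennreal (exp (- c * dot d u y)) * ennreal (exp (- bf d A y y / 2) / gnorm d A))"
      by (simp add: distrib_right[symmetric] mult.assoc[symmetric] mult_right_mono)
  qed
  also have "\<dots> = ennreal (1 / c) * (ennreal (exp (c\<^sup>2 * ?q / 2)) + ennreal (exp (c\<^sup>2 * ?q / 2)))"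
    using gaussian_mgf[OF A v, of c] gaussian_mgf[OF A v, of "- c"]
    by (subst nn_integral_cmult, simp, subst nn_integral_add) auto
  also have "\<dots> \<le> ennreal (1 / c) * ennreal 4"
  proof (rule mult_left_mono)
    have "ennreal (exp (c\<^sup>2 * ?q / 2)) + ennreal (exp (c\<^sup>2 * ?q / 2)) \<le> ennreal 2 + ennreal 2"
      using e by (intro add_mono ennreal_leI)
    also have "\<dots> = ennreal 4" by (subst ennreal_plus[symmetric]) auto
    finally show "ennreal (exp (c\<^sup>2 * ?q / 2)) + ennreal (exp (c\<^sup>2 * ?q / 2)) \<le> ennreal 4" .
  qed simp
  also have "\<dots> = ennreal (4 / sqrt \<kappa> * enorm d u)"
    using k u by (subst ennreal_mult[symmetric]) (auto simp: c_def mult.commute)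
  finally show ?thesis .
qed

text \<open>With a nonnegative integral on the right an infinite value is trivial, and a finite one
  supplies the integrability that identifies the gauge integral of the fundamental theorem with the
  Lebesgue integral.\<close>

lemma abs_diff_le_nn_integral_deriv:
  fixes h h' :: "real \<Rightarrow> real"
  assumes ab: "a \<le> b" and D: "\<And>t. (h has_real_derivative h' t) (at t)"
    and [measurable]: "h' \<in> borel_measurable borel"
  shows "ennreal \<bar>h b - h a\<bar> \<le> (\<integral>\<^sup>+t. indicator {a..b} t * ennreal \<bar>h' t\<bar> \<partial>lborel)"
proof (cases "(\<integral>\<^sup>+t. indicator {a..b} t * ennreal \<bar>h' t\<bar> \<partial>lborel) = \<infinity>")
  case False
  have n: "ennreal (norm (indicator {a..b} t *\<^sub>R h' t)) = indicator {a..b} t * ennreal \<bar>h' t\<bar>" for t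
    by (simp add: indicator_def)
  have "(\<integral>\<^sup>+t. ennreal (norm (indicator {a..b} t *\<^sub>R h' t)) \<partial>lborel) < \<infinity>"
    unfolding n using False by (simp add: top.not_eq_extremum)
  then have si: "set_integrable lborel {a..b} h'"
    unfolding set_integrable_def by (intro integrableI_bounded) auto
  have "(h' has_integral (h b - h a)) {a..b}"
    using ab D by (intro fundamental_theorem_of_calculus)
      (auto simp: has_real_derivative_iff_has_vector_derivative[symmetric] intro: DERIV_subset)
  then have "h b - h a = (LINT t:{a..b}|lborel. h' t)"
    using set_borel_integral_eq_integral(2)[OF si] by (simp add: integral_unique)
  then show ?thesis
    using integral_norm_bound_ennreal[OF si[unfolded set_integrable_def]]
    unfolding set_lebesgue_integral_def n by simp
qed auto

lemma nn_integral_gaussian_shift: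
  assumes A: "pos_def_mat d A" and [measurable]: "F \<in> borel_measurable (lebesgue_R d)"
  shows "(\<integral>\<^sup>+x. F x \<partial>gaussian d m (inv_mat A))
    = (\<integral>\<^sup>+x. F (\<lambda>i\<in>{..<d}. x i + m i) * ennreal (exp (- bf d A x x / 2) / gnorm d A) \<partial>lebesgue_R d)"
proof -
  have *: "bf d A (\<lambda>i. (\<lambda>i\<in>{..<d}. x i + m i) i - m i) (\<lambda>i. (\<lambda>i\<in>{..<d}. x i + m i) i - m i) = bf d A x x" for x
    by (rule bf_cong) auto
  let ?f = "\<lambda>x. ennreal (exp (- bf d A (\<lambda>i. x i - m i) (\<lambda>i. x i - m i) / 2) / gnorm d A)"
  have "(\<integral>\<^sup>+x. F x \<partial>gaussian d m (inv_mat A)) = (\<integral>\<^sup>+x. ?f x * F x \<partial>lebesgue_R d)"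
    unfolding gaussian_inv_mat[OF A] by (rule nn_integral_density) measurable
  also have "\<dots> = (\<integral>\<^sup>+x. ?f (\<lambda>i\<in>{..<d}. x i + m i) * F (\<lambda>i\<in>{..<d}. x i + m i) \<partial>lebesgue_R d)"
    by (rule nn_integral_translate[symmetric]) measurable
  finally show ?thesis unfolding * by (simp add: mult.commute)
qed

text \<open>
  The interpolation argument of Maurey and Pisier: rotating one of two independent copies into the
  other leaves the product measure invariant.
\<close>

lemma gaussian_poincare_l1_centred:
  assumes A: "pos_def_mat d A" and k: "\<kappa> > 0" and lower: "\<And>z. \<kappa> * (enorm d z)\<^sup>2 \<le> bf d A z z"
    and g [measurable]: "g \<in> borel_measurable (lebesgue_R d)"
    and D [measurable]: "\<And>i. i < d \<Longrightarrow> (\<lambda>x. D x i) \<in> borel_measurable (lebesgue_R d)"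
    and deriv: "\<And>x y t. x \<in> Rspace d \<Longrightarrow> y \<in> Rspace d \<Longrightarrow>
      ((\<lambda>t. g (lincomb d (cos t) x (sin t) y)) has_real_derivative
        dot d (D (lincomb d (cos t) x (sin t) y)) (lincomb d (- sin t) x (cos t) y)) (at t)"
  defines "P \<equiv> \<lambda>x. ennreal (exp (- bf d A x x / 2) / gnorm d A)"
  shows "(\<integral>\<^sup>+x. \<integral>\<^sup>+y. ennreal \<bar>g x - g y\<bar> * (P x * P y) \<partial>lebesgue_R d \<partial>lebesgue_R d)
    \<le> ennreal (8 / sqrt \<kappa>) * (\<integral>\<^sup>+x. ennreal (enorm d (D x)) * P x \<partial>lebesgue_R d)"
proof -
  let ?L = "lebesgue_R d"
  have [measurable]: "P \<in> borel_measurable ?L" unfolding P_def by measurable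
  interpret T: pair_sigma_finite lborel "?L \<Otimes>\<^sub>M ?L"
    by (rule pair_sigma_finite.intro[OF lborel.sigma_finite_measure_axioms leb2.sigma_finite_measure_axioms])
  define F where "F = (\<lambda>(x, y). ennreal \<bar>dot d (D x) y\<bar> * (P x * P y))"
  have [measurable]: "F \<in> borel_measurable (?L \<Otimes>\<^sub>M ?L)" unfolding F_def by measurable
  have g': "gnorm d A > 0" by (rule gnorm_pos[OF A])
  have PP: "P (lincomb d (cos t) x (sin t) y) * P (lincomb d (- sin t) x (cos t) y) = P x * P y" for t x y
    unfolding P_def using g' bf_rotate[of "cos t" "sin t" d A x y]
    by (simp add: ennreal_mult[symmetric] mult_exp_exp flip: add_divide_distrib minus_add_distrib)
  have "(\<integral>\<^sup>+x. \<integral>\<^sup>+y. ennreal \<bar>g x - g y\<bar> * (P x * P y) \<partial>?L \<partial>?L)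
    \<le> (\<integral>\<^sup>+x. \<integral>\<^sup>+y. \<integral>\<^sup>+t. indicator {0..pi/2} t *
         F (lincomb d (cos t) x (sin t) y, lincomb d (- sin t) x (cos t) y) \<partial>lborel \<partial>?L \<partial>?L)"
  proof (intro nn_integral_mono)
    fix x y assume "x \<in> space ?L" "y \<in> space ?L"
    then have x: "x \<in> Rspace d" and y: "y \<in> Rspace d" by auto
    \<comment> \<open>The path runs from \<open>x\<close> at 0 to \<open>y\<close> at pi/2. Its
      velocity is the second component of the rotated pair, so undoing the rotation makes position
      and velocity independent.\<close>
    let ?c = "\<lambda>t. lincomb d (cos t) x (sin t) y"
    let ?c' = "\<lambda>t. lincomb d (- sin t) x (cos t) y"
    have [measurable]: "(\<lambda>t. dot d (D (?c t)) (?c' t)) \<in> borel_measurable borel"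
      by measurable
    have e: "?c 0 = x" "?c (pi/2) = y"
      by (rule Rspace_eqI[OF lincomb_in x], simp) (rule Rspace_eqI[OF lincomb_in y], simp)
    have "ennreal \<bar>g x - g y\<bar> = ennreal \<bar>g (?c (pi/2)) - g (?c 0)\<bar>"
      unfolding e by (simp add: abs_minus_commute)
    also have "\<dots> \<le> (\<integral>\<^sup>+t. indicator {0..pi/2} t * ennreal \<bar>dot d (D (?c t)) (?c' t)\<bar> \<partial>lborel)"
      by (rule abs_diff_le_nn_integral_deriv, simp, rule deriv[OF x y], measurable)
    finally have "ennreal \<bar>g x - g y\<bar> * (P x * P y)
      \<le> (\<integral>\<^sup>+t. indicator {0..pi/2} t * ennreal \<bar>dot d (D (?c t)) (?c' t)\<bar> \<partial>lborel) * (P x * P y)"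
      by (rule mult_right_mono) simp
    also have "\<dots> = (\<integral>\<^sup>+t. indicator {0..pi/2} t * F (?c t, ?c' t) \<partial>lborel)"
      by (subst nn_integral_multc[symmetric]) (auto simp: F_def PP mult.assoc)
    finally show "ennreal \<bar>g x - g y\<bar> * (P x * P y) \<le> (\<integral>\<^sup>+t. indicator {0..pi/2} t * F (?c t, ?c' t) \<partial>lborel)" .
  qed
  also have "\<dots> = (\<integral>\<^sup>+z. \<integral>\<^sup>+t. indicator {0..pi/2} t *
         F (lincomb d (cos t) (fst z) (sin t) (snd z), lincomb d (- sin t) (fst z) (cos t) (snd z)) \<partial>lborel \<partial>(?L \<Otimes>\<^sub>M ?L))"
    by (subst leb.nn_integral_fst[symmetric]) auto
  also have "\<dots> = (\<integral>\<^sup>+t. \<integral>\<^sup>+z. indicator {0..pi/2} t *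
         F (lincomb d (cos t) (fst z) (sin t) (snd z), lincomb d (- sin t) (fst z) (cos t) (snd z)) \<partial>(?L \<Otimes>\<^sub>M ?L) \<partial>lborel)"
    by (rule T.Fubini') measurable
  also have "\<dots> = (\<integral>\<^sup>+t. indicator {0..pi/2} t * (\<integral>\<^sup>+x. \<integral>\<^sup>+y. F (x, y) \<partial>?L \<partial>?L) \<partial>lborel)"
  proof (rule nn_integral_cong)
    fix t :: real
    have "(\<integral>\<^sup>+z. F (lincomb d (cos t) (fst z) (sin t) (snd z), lincomb d (- sin t) (fst z) (cos t) (snd z)) \<partial>(?L \<Otimes>\<^sub>M ?L))
      = (\<integral>\<^sup>+x. \<integral>\<^sup>+y. F (x, y) \<partial>?L \<partial>?L)" if t: "t \<in> {0..pi/2}"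
    proof -
      have "cos (t / 2) > 0" using t pi_gt_zero by (intro cos_gt_zero_pi; simp; linarith)
      then have "cos (t / 2) \<noteq> 0" by simp
      from nn_integral_rotate[OF _ this, of F d] show ?thesis
        by (subst leb.nn_integral_fst[symmetric]) auto
    qed
    then show "(\<integral>\<^sup>+z. indicator {0..pi/2} t *
         F (lincomb d (cos t) (fst z) (sin t) (snd z), lincomb d (- sin t) (fst z) (cos t) (snd z)) \<partial>(?L \<Otimes>\<^sub>M ?L))
       = indicator {0..pi/2} t * (\<integral>\<^sup>+x. \<integral>\<^sup>+y. F (x, y) \<partial>?L \<partial>?L)"
      by (subst nn_integral_cmult) (auto simp: indicator_def)
  qed
  also have "\<dots> = ennreal (pi/2) * (\<integral>\<^sup>+x. \<integral>\<^sup>+y. F (x, y) \<partial>?L \<partial>?L)"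
    by (subst nn_integral_multc) auto
  also have "\<dots> \<le> ennreal (pi/2) * (\<integral>\<^sup>+x. ennreal (4 / sqrt \<kappa>) * (ennreal (enorm d (D x)) * P x) \<partial>?L)"
  proof (intro mult_left_mono nn_integral_mono)
    fix x assume "x \<in> space ?L"
    have P4: "ennreal (4 / sqrt \<kappa> * enorm d (D x)) = ennreal (4 / sqrt \<kappa>) * ennreal (enorm d (D x))"
      using k by (intro ennreal_mult) auto
    have "(\<integral>\<^sup>+y. F (x, y) \<partial>?L) = P x * (\<integral>\<^sup>+y. ennreal \<bar>dot d (D x) y\<bar> * P y \<partial>?L)"
      by (subst nn_integral_cmult[symmetric]) (auto simp: F_def mult_ac)
    also have "\<dots> \<le> P x * ennreal (4 / sqrt \<kappa> * enorm d (D x))"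
      unfolding P_def by (intro mult_left_mono gaussian_abs_moment[OF A k lower]) auto
    finally show "(\<integral>\<^sup>+y. F (x, y) \<partial>?L) \<le> ennreal (4 / sqrt \<kappa>) * (ennreal (enorm d (D x)) * P x)"
      unfolding P4 by (simp only: mult_ac)
  qed auto
  also have "\<dots> = ennreal (pi/2 * (4 / sqrt \<kappa>)) * (\<integral>\<^sup>+x. ennreal (enorm d (D x)) * P x \<partial>?L)"
    using k by (subst nn_integral_cmult, measurable, subst ennreal_mult) (simp_all only: mult.assoc, auto)
  \<comment> \<open>pi/2 times the 4 of the absolute moment is 2 pi <= 8.\<close>
  also have "\<dots> \<le> ennreal (8 / sqrt \<kappa>) * (\<integral>\<^sup>+x. ennreal (enorm d (D x)) * P x \<partial>?L)"
    using k pi_less_4 by (intro mult_right_mono ennreal_leI) (auto simp: field_simps)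
  finally show ?thesis .
qed

text \<open>Differentiability along curves in \<open>Rspace d\<close> keeps the hypothesis within
  one-variable calculus; the centred version is applied to the function translated by
  \<open>m\<close>.\<close>

lemma gaussian_poincare_l1:
  assumes A: "pos_def_mat d A" and k: "\<kappa> > 0" and lower: "\<And>z. \<kappa> * (enorm d z)\<^sup>2 \<le> bf d A z z"
    and g [measurable]: "g \<in> borel_measurable (lebesgue_R d)"
    and D [measurable]: "\<And>i. i < d \<Longrightarrow> (\<lambda>x. D x i) \<in> borel_measurable (lebesgue_R d)"
    and deriv: "\<And>c c' t. (\<And>t. c t \<in> Rspace d) \<Longrightarrow> (\<And>i t. i < d \<Longrightarrow> ((\<lambda>t. c t i) has_real_derivative c' t i) (at t)) \<Longrightarrow>
      ((\<lambda>t. g (c t)) has_real_derivative dot d (D (c t)) (c' t)) (at t)"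
  shows "(\<integral>\<^sup>+x. \<integral>\<^sup>+y. ennreal \<bar>g x - g y\<bar> \<partial>gaussian d m (inv_mat A) \<partial>gaussian d m (inv_mat A))
    \<le> ennreal (8 / sqrt \<kappa>) * (\<integral>\<^sup>+x. ennreal (enorm d (D x)) \<partial>gaussian d m (inv_mat A))"
proof -
  let ?L = "lebesgue_R d" and ?s = "\<lambda>x. \<lambda>i\<in>{..<d}. x i + m i"
  let ?P = "\<lambda>x. ennreal (exp (- bf d A x x / 2) / gnorm d A)"
  have [measurable]: "?s \<in> ?L \<rightarrow>\<^sub>M ?L" by (rule measurable_restrict_lebesgue_R) measurable
  have [measurable]: "(\<lambda>x. \<integral>\<^sup>+y. ennreal \<bar>g x - g y\<bar> \<partial>gaussian d m (inv_mat A)) \<in> borel_measurable ?L"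
    unfolding nn_integral_gaussian_shift[OF A] by (subst nn_integral_gaussian_shift[OF A]) measurable
  have "(\<integral>\<^sup>+x. \<integral>\<^sup>+y. ennreal \<bar>g x - g y\<bar> \<partial>gaussian d m (inv_mat A) \<partial>gaussian d m (inv_mat A))
    = (\<integral>\<^sup>+x. (\<integral>\<^sup>+y. ennreal \<bar>g (?s x) - g (?s y)\<bar> * ?P y \<partial>?L) * ?P x \<partial>?L)"
    by (subst nn_integral_gaussian_shift[OF A], simp, subst nn_integral_gaussian_shift[OF A]) auto
  also have "\<dots> = (\<integral>\<^sup>+x. \<integral>\<^sup>+y. ennreal \<bar>g (?s x) - g (?s y)\<bar> * (?P x * ?P y) \<partial>?L \<partial>?L)"
    by (intro nn_integral_cong, subst nn_integral_multc[symmetric]) (auto simp: mult_ac)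
  also have "\<dots> \<le> ennreal (8 / sqrt \<kappa>) * (\<integral>\<^sup>+x. ennreal (enorm d (D (?s x))) * ?P x \<partial>?L)"
  proof (rule gaussian_poincare_l1_centred[OF A k lower])
    fix x y t assume "x \<in> Rspace d" "y \<in> Rspace d"
    let ?c' = "lincomb d (- sin t) x (cos t) y"
    have "((\<lambda>t. g (?s (lincomb d (cos t) x (sin t) y))) has_real_derivative
        dot d (D (?s (lincomb d (cos t) x (sin t) y))) (\<lambda>i. - sin t * x i + cos t * y i)) (at t)"
    proof (rule deriv)
      show "?s (lincomb d (cos t) x (sin t) y) \<in> Rspace d" for t by auto
      fix i t assume i: "i < d"
      have "((\<lambda>t. cos t * x i + sin t * y i + m i) has_real_derivative (- sin t * x i + cos t * y i)) (at t)"
        by (auto intro!: derivative_eq_intros)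
      then show "((\<lambda>t. ?s (lincomb d (cos t) x (sin t) y) i) has_real_derivative (- sin t * x i + cos t * y i)) (at t)"
        using i by simp
    qed
    moreover have "dot d (D (?s (lincomb d (cos t) x (sin t) y))) (\<lambda>i. - sin t * x i + cos t * y i)
      = dot d (D (?s (lincomb d (cos t) x (sin t) y))) ?c'" by (rule dot_cong) auto
    ultimately show "((\<lambda>t. g (?s (lincomb d (cos t) x (sin t) y))) has_real_derivative
        dot d (D (?s (lincomb d (cos t) x (sin t) y))) ?c') (at t)" by simp
  qed measurable
  also have "\<dots> = ennreal (8 / sqrt \<kappa>) * (\<integral>\<^sup>+x. ennreal (enorm d (D x)) \<partial>gaussian d m (inv_mat A))"
    by (subst nn_integral_gaussian_shift[OF A]) auto
  finally show ?thesis .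
qed

section \<open>Concentration for Gaussian features\<close>

definition stdG :: "nat \<Rightarrow> (nat \<Rightarrow> real) measure" where
  "stdG d = gaussian d (\<lambda>i\<in>{..<d}. 0) (1\<^sub>m d)"

abbreviation feat :: "nat \<Rightarrow> nat \<Rightarrow> (nat \<Rightarrow> nat \<Rightarrow> real) measure" where
  "feat d n \<equiv> PiM {..<n} (\<lambda>_. stdG d)"

abbreviation N01 :: "real measure" where
  "N01 \<equiv> density lborel (\<lambda>x. ennreal (std_normal_density x))"

lemma prob_space_N01: "prob_space N01"
  by (rule prob_space_normal_density) simp

interpretation N01: product_sigma_finite "\<lambda>_::nat. N01"
  by (intro product_sigma_finite.intro prob_space_imp_sigma_finite prob_space_N01)

lemma bf_one: "bf d (1\<^sub>m d) x y = dot d x y"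
proof -
  have "bf d (1\<^sub>m d) x y = (\<Sum>i<d. \<Sum>j<d. if j = i then x i * y i else 0)"
    unfolding bf_def by (intro sum.cong refl) auto
  then show ?thesis by (simp add: dot_def)
qed

lemma pos_def_one: "pos_def_mat d (1\<^sub>m d)"
proof (rule pos_def_matI)
  fix x :: "nat \<Rightarrow> real" and i assume i: "i < d" "x i \<noteq> 0"
  have "0 < (x i)\<^sup>2" using i by simp
  also have "\<dots> \<le> (\<Sum>i<d. (x i)\<^sup>2)" using i by (intro member_le_sum) auto
  finally show "0 < bf d (1\<^sub>m d) x x" by (simp add: bf_one dot_def power2_eq_square)
qed auto

text \<open>The density is a product over the coordinates. As a product measure the law has
  independent coordinates, which gives access to sums of independent normals and to product
  integrals.\<close>

lemma stdG_eq_PiM: "stdG d = PiM {..<d} (\<lambda>_. N01)"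
proof (rule N01.PiM_eqI)
  have inv: "inv_mat (1\<^sub>m d :: real mat) = 1\<^sub>m d"
    using pos_def_mat_inverse(1,2)[OF pos_def_one, of d] by (metis left_mult_one_mat)
  have st: "stdG d = density (lebesgue_R d) (\<lambda>x. \<Prod>i<d. ennreal (std_normal_density (x i)))"
  proof -
    have "stdG d = gaussian d (\<lambda>i\<in>{..<d}. 0) (inv_mat (1\<^sub>m d))" using inv by (simp add: stdG_def)
    also have "\<dots> = density (lebesgue_R d) (\<lambda>x. \<Prod>i<d. ennreal (std_normal_density (x i)))"
      unfolding gaussian_inv_mat[OF pos_def_one]
    proof (intro density_cong AE_I2)
      fix x :: "nat \<Rightarrow> real"
      have *: "bf d (1\<^sub>m d) (\<lambda>i. x i - (\<lambda>i\<in>{..<d}. 0) i) (\<lambda>i. x i - (\<lambda>i\<in>{..<d}. 0) i) = (\<Sum>i<d. (x i)\<^sup>2)"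
        by (simp add: bf_one dot_def power2_eq_square)
      have n: "std_normal_density t = exp (- (t\<^sup>2 / 2)) / sqrt (2 * pi)" for t
        by (simp add: normal_density_def)
      have g: "gnorm d (1\<^sub>m d) = sqrt (2 * pi) ^ d"
        by (simp only: gnorm_def det_one div_by_1 real_sqrt_power)
      have "(\<Prod>i<d. std_normal_density (x i)) = exp (- (\<Sum>i<d. (x i)\<^sup>2) / 2) / sqrt (2 * pi) ^ d"
        unfolding n prod_dividef by (simp add: exp_sum[symmetric] sum_negf sum_divide_distrib)
      then have "exp (- (\<Sum>i<d. (x i)\<^sup>2) / 2) / gnorm d (1\<^sub>m d) = (\<Prod>i<d. std_normal_density (x i))"
        unfolding g by (rule sym)
      then show "ennreal (exp (- bf d (1\<^sub>m d) (\<lambda>i. x i - (\<lambda>i\<in>{..<d}. 0) i) (\<lambda>i. x i - (\<lambda>i\<in>{..<d}. 0) i) / 2) / gnorm d (1\<^sub>m d))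
        = (\<Prod>i<d. ennreal (std_normal_density (x i)))"
        unfolding * by (subst prod_ennreal) auto
    qed (auto intro!: measurable_compose[OF measurable_coord])
    finally show ?thesis .
  qed
  show "sets (stdG d) = sets (PiM {..<d} (\<lambda>_. N01))"
    unfolding st by (simp cong: sets_PiM_cong)
  fix A :: "nat \<Rightarrow> real set"
  assume A: "\<And>i. i \<in> {..<d} \<Longrightarrow> A i \<in> sets N01"
  have "emeasure (stdG d) (Pi\<^sub>E {..<d} A)
    = (\<integral>\<^sup>+x. (\<Prod>i<d. ennreal (std_normal_density (x i))) * indicator (Pi\<^sub>E {..<d} A) x \<partial>lebesgue_R d)"
    unfolding st using A
    by (intro emeasure_density) (auto intro!: sets_PiM_I_finite measurable_compose[OF measurable_coord])
  also have "\<dots> = (\<integral>\<^sup>+x. (\<Prod>i<d. ennreal (std_normal_density (x i)) * indicator (A i) (x i)) \<partial>lebesgue_R d)"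
  proof (rule nn_integral_cong)
    fix x assume "x \<in> space (lebesgue_R d)"
    then have "indicator (Pi\<^sub>E {..<d} A) x = (\<Prod>i<d. indicator (A i) (x i) :: ennreal)"
      by (auto simp: indicator_def PiE_iff prod_zero_iff intro!: prod.neutral[symmetric])
    then show "(\<Prod>i<d. ennreal (std_normal_density (x i))) * indicator (Pi\<^sub>E {..<d} A) x
      = (\<Prod>i<d. ennreal (std_normal_density (x i)) * indicator (A i) (x i))"
      by (simp add: prod.distrib)
  qed
  also have "\<dots> = (\<Prod>i<d. \<integral>\<^sup>+t. ennreal (std_normal_density t) * indicator (A i) t \<partial>lborel)"
    using A by (intro lborel_prod.product_nn_integral_prod) auto
  also have "\<dots> = (\<Prod>i<d. emeasure N01 (A i))"
    using A by (intro prod.cong refl) (auto simp: emeasure_density)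
  finally show "emeasure (stdG d) (Pi\<^sub>E {..<d} A) = (\<Prod>i<d. emeasure N01 (A i))" .
qed simp

lemma prob_space_stdG: "prob_space (stdG d)"
  unfolding stdG_eq_PiM by (rule prob_space_PiM) (rule prob_space_N01)

lemma space_stdG [simp]: "space (stdG d) = Rspace d"
  and sets_stdG [measurable_cong, simp]: "sets (stdG d) = sets (lebesgue_R d)"
  by (auto simp: stdG_def gaussian_def)

interpretation stdG: product_sigma_finite "\<lambda>_::nat. stdG d" for d
  by (intro product_sigma_finite.intro prob_space_imp_sigma_finite prob_space_stdG)

interpretation feat: prob_space "feat d n" for d n
  by (rule prob_space_PiM) (rule prob_space_stdG)

lemma N01_scale_distributed:
  assumes "c \<noteq> 0" "distributed M lborel X std_normal_density" "prob_space M"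
  shows "distributed M lborel (\<lambda>x. X x * c) (normal_density 0 \<bar>c\<bar>)"
proof -
  interpret prob_space M by fact
  show ?thesis using normal_density_affine[OF assms(2) _ assms(1), of 0] by (simp add: mult.commute)
qed

lemma stdG_dot_distributed:
  assumes u: "enorm d u > 0"
  shows "distributed (stdG d) lborel (\<lambda>x. dot d x u) (normal_density 0 (enorm d u))"
proof -
  interpret prob_space "stdG d" by (rule prob_space_stdG)
  \<comment> \<open>A coordinate with coefficient 0 would contribute a degenerate normal, so the sum
    of independent normals runs over the support of \<open>u\<close>.\<close>
  define I where "I = {i\<in>{..<d}. u i \<noteq> 0}"
  have ne: "I \<noteq> {}"
  proof
    assume "I = {}"
    then have "enorm d u = 0" by (auto simp: I_def L2_set_def intro!: sum.neutral)
    then show False using u by simp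
  qed
  have m: "(\<lambda>x. x i) \<in> stdG d \<rightarrow>\<^sub>M N01" if "i \<in> {..<d}" for i
    using that by (simp add: stdG_eq_PiM measurable_component_singleton)
  have comp: "distr (stdG d) N01 (\<lambda>x. x i) = N01" if "i \<in> {..<d}" for i
    unfolding stdG_eq_PiM using that by (intro distr_PiM_component prob_space_N01)
  have "distr (stdG d) (PiM {..<d} (\<lambda>_. N01)) (\<lambda>x. \<lambda>i\<in>{..<d}. x i) = distr (stdG d) (stdG d) (\<lambda>x. x)"
    by (intro distr_cong) (auto simp: stdG_eq_PiM space_PiM)
  also have "\<dots> = PiM {..<d} (\<lambda>i. distr (stdG d) N01 (\<lambda>x. x i))"
    unfolding distr_id by (subst stdG_eq_PiM) (intro PiM_cong refl comp[symmetric])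
  finally have iv: "indep_vars (\<lambda>_. N01) (\<lambda>i x. x i) I"
    using ne m
    by (intro indep_vars_subset[of _ _ "{..<d}" I]) (subst indep_vars_iff_distr_eq_PiM', auto simp: I_def)
  have iv2: "indep_vars (\<lambda>_. borel) (\<lambda>i x. x i * u i) I"
    by (rule indep_vars_compose2[OF iv]) auto
  have nd: "distributed (stdG d) lborel (\<lambda>x. x i * u i) (normal_density 0 \<bar>u i\<bar>)" if "i \<in> I" for i
  proof -
    have i: "i \<in> {..<d}" "u i \<noteq> 0" using that by (auto simp: I_def)
    have "distr (stdG d) lborel (\<lambda>x. x i) = distr (stdG d) N01 (\<lambda>x. x i)"
      by (rule distr_cong) auto
    then have "distributed (stdG d) lborel (\<lambda>x. x i) std_normal_density"
      using m[OF i(1)] comp[OF i(1)] unfolding distributed_def by auto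
    then show ?thesis using i by (intro N01_scale_distributed) (auto intro: prob_space_axioms)
  qed
  have eqn: "enorm d u = sqrt (\<Sum>i\<in>I. \<bar>u i\<bar>\<^sup>2)"
    unfolding L2_set_def
    by (intro arg_cong[where f=sqrt] sum.mono_neutral_cong_right) (auto simp: I_def)
  have eqd: "dot d x u = (\<Sum>i\<in>I. x i * u i)" for x
    unfolding dot_def by (intro sum.mono_neutral_right) (auto simp: I_def)
  have "distributed (stdG d) lborel (\<lambda>x. \<Sum>i\<in>I. x i * u i) (normal_density (\<Sum>i\<in>I. 0) (sqrt (\<Sum>i\<in>I. \<bar>u i\<bar>\<^sup>2)))"
    by (rule sum_indep_normal[OF _ ne iv2]) (use nd in \<open>auto simp: I_def\<close>)
  then show ?thesis unfolding eqn eqd by simp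
qed

lemma nn_integral_stdG_dot:
  assumes "enorm d u > 0" "F \<in> borel_measurable borel"
  shows "(\<integral>\<^sup>+x. F (dot d x u) \<partial>stdG d) = (\<integral>\<^sup>+t. ennreal (normal_density 0 (enorm d u) t) * F t \<partial>lborel)"
  using distributed_nn_integral[OF stdG_dot_distributed[OF assms(1)], of F] assms(2) by simp

text \<open>Adding t^2/(4 v) <= t^2/(4 \<sigma>^2) halves the rate in the exponent, which doubles
  the variance; sqrt 2 is the change of normalization.\<close>

lemma normal_density_mult_exp_square:
  assumes "0 < \<sigma>" "\<sigma>\<^sup>2 \<le> v"
  shows "normal_density 0 \<sigma> t * exp (t\<^sup>2 / (4 * v)) \<le> sqrt 2 * normal_density 0 (sqrt 2 * \<sigma>) t"
proof -
  have v: "v > 0" using assms by (meson less_le_trans zero_less_power)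
  have "t\<^sup>2 / (4 * v) \<le> t\<^sup>2 / (4 * \<sigma>\<^sup>2)" using assms v by (intro divide_left_mono) auto
  then have "exp (- (t\<^sup>2 / (2 * \<sigma>\<^sup>2))) * exp (t\<^sup>2 / (4 * v)) \<le> exp (- (t\<^sup>2 / (4 * \<sigma>\<^sup>2)))"
    unfolding exp_add[symmetric] by simp
  then have "1 / sqrt (2 * pi * \<sigma>\<^sup>2) * (exp (- (t\<^sup>2 / (2 * \<sigma>\<^sup>2))) * exp (t\<^sup>2 / (4 * v)))
      \<le> 1 / sqrt (2 * pi * \<sigma>\<^sup>2) * exp (- (t\<^sup>2 / (4 * \<sigma>\<^sup>2)))"
    by (intro mult_left_mono) auto
  moreover have "sqrt 2 * normal_density 0 (sqrt 2 * \<sigma>) t = 1 / sqrt (2 * pi * \<sigma>\<^sup>2) * exp (- (t\<^sup>2 / (4 * \<sigma>\<^sup>2)))"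
    using assms(1) by (simp add: normal_density_def power_mult_distrib real_sqrt_mult divide_simps)
  ultimately show ?thesis by (simp add: normal_density_def)
qed

text \<open>The square, tail and cube events below all go through this bound. \<open>v\<close> is a
  proxy for the variance, so one estimate serves all vectors of bounded norm.\<close>

lemma nn_integral_stdG_exp_square:
  assumes v: "v > 0" "(enorm d u)\<^sup>2 \<le> v"
  shows "(\<integral>\<^sup>+x. ennreal (exp ((dot d x u)\<^sup>2 / (4 * v))) \<partial>stdG d) \<le> 2"
proof (cases "enorm d u = 0")
  case True
  interpret prob_space "stdG d" by (rule prob_space_stdG)
  have "dot d x u = 0" for x using dot_le_enorm[of d x u] True by simp
  then show ?thesis using emeasure_space_1 by simp
next
  case False
  then have u: "enorm d u > 0" using L2_set_nonneg[of u "{..<d}"] by linarith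
  have "(\<integral>\<^sup>+x. ennreal (exp ((dot d x u)\<^sup>2 / (4 * v))) \<partial>stdG d)
    = (\<integral>\<^sup>+t. ennreal (normal_density 0 (enorm d u) t) * ennreal (exp (t\<^sup>2 / (4 * v))) \<partial>lborel)"
    by (rule nn_integral_stdG_dot[OF u]) measurable
  also have "\<dots> \<le> (\<integral>\<^sup>+t. ennreal (sqrt 2) * ennreal (normal_density 0 (sqrt 2 * enorm d u) t) \<partial>lborel)"
    using normal_density_mult_exp_square[OF u v(2)]
    by (intro nn_integral_mono) (auto simp: ennreal_mult[symmetric] intro!: ennreal_leI)
  also have "\<dots> = ennreal (sqrt 2)"
    using u by (subst nn_integral_cmult) (auto simp: nn_integral_normal_density)
  also have "\<dots> \<le> ennreal 2" by (intro ennreal_leI) (rule sqrt2_less_2[THEN less_imp_le])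
  finally show ?thesis by simp
qed

text \<open>For norm at least 1/2 the density of the projection is at most 1 / sqrt (2 pi / 4) <= 1,
  so the probability is at most the length of the interval.\<close>

lemma stdG_small_ball:
  assumes u: "enorm d u \<ge> 1/2" and a: "a \<ge> 0"
  shows "emeasure (stdG d) {x\<in>Rspace d. \<bar>dot d x u\<bar> \<le> a} \<le> ennreal (2 * a)"
proof -
  have u0: "enorm d u > 0" using u by linarith
  have "emeasure (stdG d) {x\<in>Rspace d. \<bar>dot d x u\<bar> \<le> a}
     = (\<integral>\<^sup>+x. indicator {-a..a} (dot d x u) \<partial>stdG d)"
  proof -
    have S: "{x\<in>space (stdG d). \<bar>dot d x u\<bar> \<le> a} \<in> sets (stdG d)" by measurable
    have "emeasure (stdG d) {x\<in>Rspace d. \<bar>dot d x u\<bar> \<le> a}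
      = (\<integral>\<^sup>+x. indicator {x\<in>Rspace d. \<bar>dot d x u\<bar> \<le> a} x \<partial>stdG d)"
      using nn_integral_indicator[OF S] by simp
    also have "\<dots> = (\<integral>\<^sup>+x. indicator {-a..a} (dot d x u) \<partial>stdG d)"
    proof (rule nn_integral_cong)
      fix x assume "x \<in> space (stdG d)"
      then have "x \<in> {x\<in>Rspace d. \<bar>dot d x u\<bar> \<le> a} \<longleftrightarrow> dot d x u \<in> {-a..a}"
        by (simp add: abs_le_iff minus_le_iff[of a] conj_commute)
      then show "indicator {x\<in>Rspace d. \<bar>dot d x u\<bar> \<le> a} x = (indicator {-a..a} (dot d x u) :: ennreal)"
        unfolding indicator_def by simp
    qed
    finally show ?thesis .
  qed
  also have "\<dots> = (\<integral>\<^sup>+t. ennreal (normal_density 0 (enorm d u) t) * indicator {-a..a} t \<partial>lborel)"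
    by (rule nn_integral_stdG_dot[OF u0]) measurable
  also have "\<dots> \<le> (\<integral>\<^sup>+t. ennreal 1 * indicator {-a..a} t \<partial>lborel)"
  proof (intro nn_integral_mono mult_right_mono ennreal_leI)
    fix t
    have "1 \<le> sqrt (2 * pi * (enorm d u)\<^sup>2)"
    proof -
      have "(1/2)\<^sup>2 \<le> (enorm d u)\<^sup>2" using u by (intro power_mono) auto
      then have "2 * 3 * (1/4) \<le> 2 * pi * (enorm d u)\<^sup>2"
        using pi_gt3 by (intro mult_mono) (auto simp: power2_eq_square)
      then show ?thesis by simp
    qed
    then have "1 / sqrt (2 * pi * (enorm d u)\<^sup>2) \<le> 1" by simp
    moreover have "exp (- (t - 0)\<^sup>2 / (2 * (enorm d u)\<^sup>2)) \<le> 1" by simp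
    ultimately show "normal_density 0 (enorm d u) t \<le> 1"
      unfolding normal_density_def by (intro mult_le_one) auto
  qed auto
  also have "\<dots> = ennreal (2 * a)" using a by simp
  finally show ?thesis .
qed

lemma measurable_feat_dot [measurable]:
  assumes "i < n"
  shows "(\<lambda>X. dot d (X i) v) \<in> borel_measurable (feat d n)"
proof -
  have "(\<lambda>X. X i) \<in> feat d n \<rightarrow>\<^sub>M stdG d" using assms by (intro measurable_component_singleton) simp
  moreover have "(\<lambda>x. dot d x v) \<in> borel_measurable (stdG d)" by measurable
  ultimately show ?thesis by (rule measurable_compose)
qed

lemma nn_integral_feat_prod:
  assumes "f \<in> borel_measurable (lebesgue_R d)"
  shows "(\<integral>\<^sup>+X. (\<Prod>i<n. f (X i)) \<partial>feat d n) = (\<integral>\<^sup>+x. f x \<partial>stdG d) ^ n"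
  using stdG.product_nn_integral_prod[of "{..<n}" "\<lambda>_. f" d] assms by simp

lemma feat_chernoff:
  assumes f [measurable]: "f \<in> borel_measurable (lebesgue_R d)"
    and m: "(\<integral>\<^sup>+x. ennreal (exp (f x)) \<partial>stdG d) \<le> ennreal m" "m \<ge> 0"
  shows "measure (feat d n) {X \<in> space (feat d n). t < (\<Sum>i<n. f (X i))} \<le> exp (- t) * m ^ n"
proof -
  have meas: "(\<lambda>X. \<Sum>i<n. f (X i)) \<in> borel_measurable (feat d n)"
    by (intro borel_measurable_sum measurable_compose[OF measurable_component_singleton]) auto
  then have S: "{X \<in> space (feat d n). t < (\<Sum>i<n. f (X i))} \<in> sets (feat d n)" by measurable
  have "emeasure (feat d n) {X \<in> space (feat d n). t < (\<Sum>i<n. f (X i))}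
     = (\<integral>\<^sup>+X. indicator {X \<in> space (feat d n). t < (\<Sum>i<n. f (X i))} X \<partial>feat d n)"
    using nn_integral_indicator[OF S] by simp
  also have "\<dots> \<le> (\<integral>\<^sup>+X. ennreal (exp (- t)) * (\<Prod>i<n. ennreal (exp (f (X i)))) \<partial>feat d n)"
  proof (rule nn_integral_mono)
    fix X
    have "1 \<le> exp (- t) * (\<Prod>i<n. exp (f (X i)))" if "t < (\<Sum>i<n. f (X i))"
      unfolding exp_sum[OF finite_lessThan, symmetric] exp_add[symmetric] using that by simp
    then show "indicator {X \<in> space (feat d n). t < (\<Sum>i<n. f (X i))} X
       \<le> ennreal (exp (- t)) * (\<Prod>i<n. ennreal (exp (f (X i))))"
      by (auto simp: indicator_def prod_ennreal ennreal_mult[symmetric] prod_nonneg simp flip: ennreal_1)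
  qed
  also have "\<dots> = ennreal (exp (- t)) * (\<integral>\<^sup>+x. ennreal (exp (f x)) \<partial>stdG d) ^ n"
  proof (subst nn_integral_cmult)
    show "(\<lambda>X. \<Prod>i<n. ennreal (exp (f (X i)))) \<in> borel_measurable (feat d n)"
      by (intro borel_measurable_prod_ennreal measurable_compose[OF measurable_component_singleton]) auto
  qed (subst nn_integral_feat_prod, auto)
  also have "\<dots> \<le> ennreal (exp (- t)) * ennreal m ^ n"
    using m by (intro mult_left_mono power_mono) auto
  also have "\<dots> = ennreal (exp (- t) * m ^ n)"
    using m(2) by (simp add: ennreal_mult ennreal_power)
  finally show ?thesis
    using m(2) unfolding feat.emeasure_eq_measure by (subst (asm) ennreal_le_iff) auto
qed

lemma two_power_exp_le: "exp (- (2 * real n)) * 2 ^ n \<le> exp (- real n)"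
proof -
  have "(2::real) \<le> exp 1" using exp_ge_add_one_self[of "1::real"] by simp
  then have "(2::real) ^ n \<le> exp 1 ^ n" by (intro power_mono) auto
  also have "\<dots> = exp (real n)" by (simp add: exp_of_nat_mult[symmetric])
  finally have "exp (- (2 * real n)) * 2 ^ n \<le> exp (- (2 * real n)) * exp (real n)"
    by (intro mult_left_mono) auto
  also have "\<dots> = exp (- real n)" unfolding exp_add[symmetric] by simp
  finally show ?thesis .
qed

text \<open>A weight of 16 per hit keeps the exponential moment at most 1 + e^16 p <= 2, while more
  than n/8 hits push the weighted sum above 2 n; Chernoff gives 2^n e^(-2 n) <= e^(-n).\<close>

lemma feat_count:
  assumes A: "A \<in> sets (lebesgue_R d)" and p: "emeasure (stdG d) A \<le> ennreal (exp (- 16))"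
  shows "measure (feat d n) {X \<in> space (feat d n). real n / 8 < real (card {i\<in>{..<n}. X i \<in> A})} \<le> exp (- real n)"
proof -
  let ?f = "\<lambda>x. 16 * indicator A x :: real"
  have [measurable]: "A \<in> sets (lebesgue_R d)" by (rule A)
  have AS: "A \<in> sets (stdG d)" using A by simp
  interpret S: prob_space "stdG d" by (rule prob_space_stdG)
  have "(\<integral>\<^sup>+x. ennreal (exp (?f x)) \<partial>stdG d) \<le> (\<integral>\<^sup>+x. 1 + ennreal (exp 16) * indicator A x \<partial>stdG d)"
    by (intro nn_integral_mono) (auto simp: indicator_def add_increasing)
  also have "\<dots> = 1 + ennreal (exp 16) * emeasure (stdG d) A"
    by (subst nn_integral_add) (auto simp: nn_integral_cmult S.emeasure_space_1[simplified])
  also have "\<dots> \<le> 1 + ennreal (exp 16) * ennreal (exp (- 16))"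
    using p by (intro add_left_mono mult_left_mono) auto
  also have "\<dots> = ennreal 2"
    by (simp add: ennreal_mult[symmetric] exp_add[symmetric])
  finally have "measure (feat d n) {X \<in> space (feat d n). 2 * real n < (\<Sum>i<n. ?f (X i))} \<le> exp (- (2 * real n)) * 2 ^ n"
    by (intro feat_chernoff) auto
  also have "(\<lambda>X. \<Sum>i<n. ?f (X i)) = (\<lambda>X. 16 * real (card {i\<in>{..<n}. X i \<in> A}))"
    by (auto simp: sum_distrib_left[symmetric] indicator_def sum.If_cases Int_def intro!: ext)
  also have "exp (- (2 * real n)) * 2 ^ n \<le> exp (- real n)" by (rule two_power_exp_le)
  finally show ?thesis by (simp add: field_simps)
qed

section \<open>Lattice nets of the unit ball and the passage from a net to all directions\<close>

definition grid :: "nat \<Rightarrow> nat \<Rightarrow> (nat \<Rightarrow> real) set" where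
  "grid d m = (\<lambda>z. \<lambda>i\<in>{..<d}. real_of_int (z i) / (real m * sqrt (real d))) `
     (PiE {..<d} (\<lambda>_. {- \<lceil>real m * sqrt (real d)\<rceil>..\<lceil>real m * sqrt (real d)\<rceil>}))"

lemma finite_grid [simp]: "finite (grid d m)"
  unfolding grid_def by (intro finite_imageI finite_PiE) auto

text \<open>The mesh 1/(m sqrt d) leaves O(m sqrt d) values per coordinate. The price over a
  volumetric net is the sqrt d, that is d log d in the union bounds; in exchange the count is
  elementary.\<close>

lemma card_grid:
  assumes "d \<ge> 1" "m \<ge> 1"
  shows "real (card (grid d m)) \<le> (5 * real m * sqrt (real d)) ^ d"
proof -
  let ?N = "\<lceil>real m * sqrt (real d)\<rceil>"
  have 1: "1 \<le> real m * sqrt (real d)" using assms using mult_mono[of 1 "real m" 1 "sqrt (real d)"] by simp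
  have N0: "?N \<ge> 0" using 1 by linarith
  have "real (card (grid d m)) \<le> real (card (PiE {..<d} (\<lambda>_. {- ?N..?N})))"
    unfolding grid_def by (intro of_nat_mono card_image_le finite_PiE) auto
  also have "\<dots> = real (nat (2 * ?N + 1)) ^ d" by (simp add: card_PiE)
  also have "\<dots> \<le> (5 * real m * sqrt (real d)) ^ d"
  proof (rule power_mono)
    have "real (nat (2 * ?N + 1)) = 2 * real_of_int ?N + 1" using N0 by simp
    also have "\<dots> \<le> 2 * (real m * sqrt (real d) + 1) + 1"
      using mult_left_mono[OF of_int_ceiling_le_add_one[of "real m * sqrt (real d)"], of 2] by simp
    also have "\<dots> \<le> 5 * (real m * sqrt (real d))" using 1 by argo
    also have "\<dots> = 5 * real m * sqrt (real d)" by (simp only: mult.assoc)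
    finally show "real (nat (2 * ?N + 1)) \<le> 5 * real m * sqrt (real d)" .
  qed simp
  finally show ?thesis .
qed

lemma enorm_abs: "enorm d (\<lambda>i. \<bar>x i\<bar>) = enorm d x"
  by (simp add: L2_set_def)

lemma abs_le_enorm: "i < d \<Longrightarrow> \<bar>x i\<bar> \<le> enorm d x"
  using member_le_L2_set[of "{..<d}" i "\<lambda>i. \<bar>x i\<bar>"] by (simp add: enorm_abs)

text \<open>Rounding down moves each coordinate by at most 1/(m sqrt d), hence the whole vector by
  at most 1/m in Euclidean norm.\<close>

lemma grid_approx:
  assumes u: "enorm d u \<le> 1" and m: "m \<ge> 1"
  shows "\<exists>v\<in>grid d m. enorm d (\<lambda>i. u i - v i) \<le> 1 / real m"
proof -
  define h where "h = real m * sqrt (real d)"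
  define z where "z = (\<lambda>i\<in>{..<d}. \<lfloor>u i * h\<rfloor>)"
  define v where "v = (\<lambda>i\<in>{..<d}. real_of_int (z i) / h)"
  have h0: "h \<ge> 0" by (simp add: h_def)
  have "z \<in> PiE {..<d} (\<lambda>_. {- \<lceil>h\<rceil>..\<lceil>h\<rceil>})"
  proof (rule PiE_I)
    fix i assume i: "i \<in> {..<d}"
    then have "\<bar>u i\<bar> \<le> 1" using abs_le_enorm[of i d u] u by auto
    then have "\<bar>u i * h\<bar> \<le> h" using h0 by (simp add: abs_mult mult_left_le_one_le)
    then have "- \<lceil>h\<rceil> \<le> \<lfloor>u i * h\<rfloor>" "\<lfloor>u i * h\<rfloor> \<le> \<lceil>h\<rceil>" by linarith+
    then show "z i \<in> {- \<lceil>h\<rceil>..\<lceil>h\<rceil>}" using i by (simp add: z_def)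
  qed (simp add: z_def)
  then have "v \<in> grid d m" unfolding grid_def v_def h_def by blast
  moreover have "enorm d (\<lambda>i. u i - v i) \<le> 1 / real m"
  proof (cases "d = 0")
    case False
    then have h: "h > 0" using m by (simp add: h_def)
    have "\<bar>u i - v i\<bar> \<le> 1 / h" if "i \<in> {..<d}" for i
    proof -
      have "u i - v i = (u i * h - \<lfloor>u i * h\<rfloor>) / h" using that h by (simp add: v_def z_def field_simps)
      moreover have "\<bar>u i * h - \<lfloor>u i * h\<rfloor>\<bar> \<le> 1" by linarith
      ultimately show ?thesis using h by (simp add: divide_right_mono)
    qed
    then have "enorm d (\<lambda>i. \<bar>u i - v i\<bar>) \<le> enorm d (\<lambda>i. 1 / h)" by (intro L2_set_mono) auto
    also have "\<dots> = 1 / real m" using h False by (simp add: L2_set_constant h_def)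
    finally show ?thesis by (simp add: enorm_abs)
  qed (simp)
  ultimately show ?thesis by blast
qed

lemma enorm_scale: "enorm d (\<lambda>i. c * x i) = \<bar>c\<bar> * enorm d x"
  by (simp add: L2_set_def power_mult_distrib sum_distrib_left[symmetric] real_sqrt_mult)

text \<open>A net of precision 1/4 absorbs its own error: with x = v + w/4, quasi-subadditivity and
  scaling give sup N <= 4 K + (4/16) sup N, where \<open>L\<close> makes the supremum finite. The
  hypotheses are shaped to fit both sums of squares and sums of cubes, the latter because c^3 <= c^2
  on [0,1].\<close>

lemma grid_sup_bound:
  fixes N :: "(nat \<Rightarrow> real) \<Rightarrow> real"
  assumes bdd: "\<And>x. enorm d x \<le> 1 \<Longrightarrow> N x \<le> L"
    and scale: "\<And>c x. 0 \<le> c \<Longrightarrow> c \<le> 1 \<Longrightarrow> N (\<lambda>i. c * x i) \<le> c\<^sup>2 * N x"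
    and add: "\<And>x y. N (\<lambda>i. x i + y i) \<le> 4 * (N x + N y)"
    and net: "\<And>v. v \<in> grid d 4 \<Longrightarrow> enorm d v \<le> 2 \<Longrightarrow> N v \<le> K"
    and u: "enorm d u \<le> 1"
  shows "N u \<le> 16 / 3 * K"
proof -
  define S where "S = (SUP x\<in>{x. enorm d x \<le> 1}. N x)"
  have bA: "bdd_above (N ` {x. enorm d x \<le> 1})" using bdd by (intro bdd_aboveI2) auto
  have S: "N x \<le> S" if "enorm d x \<le> 1" for x
    unfolding S_def using that bA by (intro cSUP_upper) auto
  have "N x \<le> 4 * K + S / 4" if x: "enorm d x \<le> 1" for x
  proof -
    obtain v where v: "v \<in> grid d 4" "enorm d (\<lambda>i. x i - v i) \<le> 1 / 4"
      using grid_approx[OF x, of 4] by auto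
    let ?w = "\<lambda>i. 4 * (x i - v i)"
    have w: "enorm d ?w \<le> 1" using v(2) by (subst enorm_scale) auto
    have "enorm d v = enorm d (\<lambda>i. x i + - 1 * (x i - v i))" by simp
    also have "\<dots> \<le> enorm d x + enorm d (\<lambda>i. - 1 * (x i - v i))" by (rule L2_set_triangle_ineq)
    also have "\<dots> \<le> 2" unfolding enorm_scale using v(2) x by simp
    finally have Nv: "N v \<le> K" by (rule net[OF v(1)])
    have "x = (\<lambda>i. v i + 1 / 4 * ?w i)" by (auto simp: fun_eq_iff field_simps)
    then have "N x = N (\<lambda>i. v i + 1 / 4 * ?w i)" by (rule arg_cong)
    also have "\<dots> \<le> 4 * (N v + N (\<lambda>i. 1 / 4 * ?w i))" by (rule add)
    also have "N (\<lambda>i. 1 / 4 * ?w i) \<le> (1 / 4)\<^sup>2 * N ?w" by (rule scale) auto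
    also have "N ?w \<le> S" by (rule S[OF w])
    finally show ?thesis using Nv by (simp add: power2_eq_square)
  qed
  then have "S \<le> 4 * K + S / 4"
    unfolding S_def[of] by (intro cSUP_least) (use u in auto)
  then show ?thesis using S[OF u] by linarith
qed

lemma feat_union_bound:
  assumes "finite V" "\<And>v. v \<in> V \<Longrightarrow> {X \<in> space (feat d n). P v X} \<in> sets (feat d n)"
    "\<And>v. v \<in> V \<Longrightarrow> measure (feat d n) {X \<in> space (feat d n). P v X} \<le> p"
  shows "measure (feat d n) {X \<in> space (feat d n). \<exists>v\<in>V. P v X} \<le> real (card V) * p"
proof -
  have eq: "{X \<in> space (feat d n). \<exists>v\<in>V. P v X} = (\<Union>v\<in>V. {X \<in> space (feat d n). P v X})" by auto
  have "measure (feat d n) {X \<in> space (feat d n). \<exists>v\<in>V. P v X} \<le> (\<Sum>v\<in>V. measure (feat d n) {X \<in> space (feat d n). P v X})"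
    unfolding eq using assms(1,2) by (intro feat.finite_measure_subadditive_finite) auto
  also have "\<dots> \<le> real (card V) * p"
    using sum_bounded_above[of V _ p] assms(3) by auto
  finally show ?thesis .
qed

lemma dot_add_right: "dot d x (\<lambda>i. y i + z i) = dot d x y + dot d x z"
  by (simp add: dot_def sum.distrib algebra_simps)

lemma dot_diff_right: "dot d x (\<lambda>i. y i - z i) = dot d x y - dot d x z"
  by (simp add: dot_def sum_subtractf algebra_simps)

lemma dot_scale_right: "dot d x (\<lambda>i. c * y i) = c * dot d x y"
  by (simp add: dot_def sum_distrib_left algebra_simps)

lemma enorm_eq_0_dot: "enorm d u = 0 \<Longrightarrow> dot d x u = 0"
  using dot_le_enorm[of d x u] by simp

lemma normalized_vector:
  assumes "enorm d u \<noteq> 0"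
  shows "enorm d (\<lambda>i. u i / enorm d u) = 1" "dot d x u = enorm d u * dot d x (\<lambda>i. u i / enorm d u)"
proof -
  have p: "enorm d u > 0" using assms L2_set_nonneg[of u "{..<d}"] by linarith
  show "enorm d (\<lambda>i. u i / enorm d u) = 1"
    using enorm_scale[of "1 / enorm d u" u d] p by simp
  show "dot d x u = enorm d u * dot d x (\<lambda>i. u i / enorm d u)"
    using dot_scale_right[of d x "1 / enorm d u" u] p by simp
qed

lemma cube_add_le: "\<bar>a + b :: real\<bar> ^ 3 \<le> 4 * (\<bar>a\<bar> ^ 3 + \<bar>b\<bar> ^ 3)"
proof -
  define x y where "x = \<bar>a\<bar>" and "y = \<bar>b\<bar>"
  have xy: "x \<ge> 0" "y \<ge> 0" by (auto simp: x_def y_def)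
  have "\<bar>a + b\<bar> ^ 3 \<le> (x + y) ^ 3" unfolding x_def y_def by (intro power_mono) auto
  also have "\<dots> \<le> 4 * (x ^ 3 + y ^ 3)"
  proof -
    have "4 * (x ^ 3 + y ^ 3) - (x + y) ^ 3 = 3 * (x + y) * (x - y)\<^sup>2"
      by (simp add: power2_eq_square power3_eq_cube algebra_simps)
    then show ?thesis using xy by (smt (verit) zero_le_mult_iff zero_le_power2)
  qed
  finally show ?thesis by (simp add: x_def y_def)
qed

lemma square_add_le: "(a + b :: real)\<^sup>2 \<le> 4 * (a\<^sup>2 + b\<^sup>2)"
proof -
  have "2 * (a\<^sup>2 + b\<^sup>2) - (a + b)\<^sup>2 = (a - b)\<^sup>2" by (simp add: power2_eq_square algebra_simps)
  then show ?thesis using zero_le_power2[of "a - b"] zero_le_power2[of a] zero_le_power2[of b] by argo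
qed

text \<open>Homogeneity leaves unit vectors only; 171 is 16/3 times 32, rounded up.\<close>

lemma sum_square_dot_bound:
  assumes net: "\<And>v. v \<in> grid d 4 \<Longrightarrow> enorm d v \<le> 2 \<Longrightarrow> (\<Sum>i<n. (dot d (X i) v)\<^sup>2) \<le> 32 * real n"
  shows "(\<Sum>i<n. (dot d (X i) u)\<^sup>2) \<le> 171 * real n * (enorm d u)\<^sup>2"
proof (cases "enorm d u = 0")
  case True
  then show ?thesis by (simp add: enorm_eq_0_dot)
next
  case False
  let ?N = "\<lambda>u. \<Sum>i<n. (dot d (X i) u)\<^sup>2"
  let ?w = "\<lambda>i. u i / enorm d u"
  have "?N ?w \<le> 16 / 3 * (32 * real n)"
  proof (rule grid_sup_bound[where N = ?N and L = "\<Sum>i<n. (enorm d (X i))\<^sup>2"])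
    show "?N x \<le> (\<Sum>i<n. (enorm d (X i))\<^sup>2)" if "enorm d x \<le> 1" for x
    proof (rule sum_mono)
      fix i
      have "\<bar>dot d (X i) x\<bar> \<le> enorm d (X i) * enorm d x" by (rule dot_le_enorm)
      also have "\<dots> \<le> enorm d (X i)" using that by (simp add: mult_left_le)
      finally show "(dot d (X i) x)\<^sup>2 \<le> (enorm d (X i))\<^sup>2" by (rule power2_le_iff_abs_le[THEN iffD2, rotated]) simp
    qed
    show "?N (\<lambda>i. c * x i) \<le> c\<^sup>2 * ?N x" for c x
      by (simp add: dot_scale_right power_mult_distrib sum_distrib_left)
    show "?N (\<lambda>i. x i + y i) \<le> 4 * (?N x + ?N y)" for x y
      unfolding dot_add_right sum.distrib[symmetric] sum_distrib_left
      by (intro sum_mono) (rule square_add_le)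
  qed (use net normalized_vector(1)[OF False] in auto)
  moreover have "?N u = (enorm d u)\<^sup>2 * ?N ?w"
    by (subst normalized_vector(2)[OF False]) (simp add: power_mult_distrib sum_distrib_left)
  ultimately show ?thesis
    using mult_left_mono[of "?N ?w" "171 * real n" "(enorm d u)\<^sup>2"] by (simp add: mult_ac)
qed

text \<open>Same net argument as for squares; 4438 is 16/3 times 832, rounded up.\<close>

lemma sum_cube_dot_bound:
  assumes net: "\<And>v. v \<in> grid d 4 \<Longrightarrow> enorm d v \<le> 2 \<Longrightarrow> (\<Sum>i<n. \<bar>dot d (X i) v\<bar> ^ 3) \<le> 832 * real n"
  shows "(\<Sum>i<n. \<bar>dot d (X i) u\<bar> ^ 3) \<le> 4438 * real n * (enorm d u) ^ 3"
proof (cases "enorm d u = 0")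
  case True
  then show ?thesis by (simp add: enorm_eq_0_dot)
next
  case False
  let ?N = "\<lambda>u. \<Sum>i<n. \<bar>dot d (X i) u\<bar> ^ 3"
  let ?w = "\<lambda>i. u i / enorm d u"
  have "?N ?w \<le> 16 / 3 * (832 * real n)"
  proof (rule grid_sup_bound[where N = ?N and L = "\<Sum>i<n. (enorm d (X i)) ^ 3"])
    show "?N x \<le> (\<Sum>i<n. (enorm d (X i)) ^ 3)" if "enorm d x \<le> 1" for x
    proof (rule sum_mono)
      fix i
      have "\<bar>dot d (X i) x\<bar> \<le> enorm d (X i) * enorm d x" by (rule dot_le_enorm)
      also have "\<dots> \<le> enorm d (X i)" using that by (simp add: mult_left_le)
      finally show "\<bar>dot d (X i) x\<bar> ^ 3 \<le> (enorm d (X i)) ^ 3" by (intro power_mono) auto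
    qed
    show "?N (\<lambda>i. c * x i) \<le> c\<^sup>2 * ?N x" if "0 \<le> c" "c \<le> 1" for c x
    proof -
      have "?N (\<lambda>i. c * x i) = c ^ 3 * ?N x"
        using that by (simp add: dot_scale_right abs_mult power_mult_distrib sum_distrib_left)
      also have "\<dots> \<le> c\<^sup>2 * ?N x"
        using that by (intro mult_right_mono power_decreasing sum_nonneg) auto
      finally show ?thesis .
    qed
    show "?N (\<lambda>i. x i + y i) \<le> 4 * (?N x + ?N y)" for x y
      unfolding dot_add_right sum.distrib[symmetric] sum_distrib_left
      by (intro sum_mono) (rule cube_add_le)
  qed (use net normalized_vector(1)[OF False] in auto)
  moreover have "?N u = (enorm d u) ^ 3 * ?N ?w"
    by (subst normalized_vector(2)[OF False]) (simp add: abs_mult power_mult_distrib sum_distrib_left)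
  ultimately show ?thesis
    using mult_left_mono[of "?N ?w" "4438 * real n" "(enorm d u) ^ 3"] by (simp add: mult_ac)
qed

lemma markov_count:
  fixes f :: "nat \<Rightarrow> real"
  assumes a: "a > 0" and s: "(\<Sum>i<n. (f i)\<^sup>2) \<le> K"
  shows "real (card {i\<in>{..<n}. \<bar>f i\<bar> > a}) \<le> K / a\<^sup>2"
proof -
  have "a\<^sup>2 * real (card {i\<in>{..<n}. \<bar>f i\<bar> > a}) = (\<Sum>i\<in>{i\<in>{..<n}. \<bar>f i\<bar> > a}. a\<^sup>2)" by simp
  also have "\<dots> \<le> (\<Sum>i\<in>{i\<in>{..<n}. \<bar>f i\<bar> > a}. (f i)\<^sup>2)"
    using a by (intro sum_mono) (auto intro!: abs_le_square_iff[THEN iffD1])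
  also have "\<dots> \<le> (\<Sum>i<n. (f i)\<^sup>2)" by (intro sum_mono2) auto
  finally show ?thesis using a s by (simp add: field_simps)
qed

text \<open>An index that is small for \<open>u\<close> but not for the nearby net point
  \<open>v\<close> has a large component along u - v. By Chebyshev and the second moment bound there
  are at most 171 n / 40^2 <= n/8 of these, in addition to the n/8 of the net point.\<close>

lemma small_dot_count:
  assumes op: "\<And>u. (\<Sum>i<n. (dot d (X i) u)\<^sup>2) \<le> 171 * real n * (enorm d u)\<^sup>2"
    and a: "a > 0" and m: "m \<ge> 2" "40 \<le> a * real m"
    and net: "\<And>v. v \<in> grid d m \<Longrightarrow> 1 / 2 \<le> enorm d v \<Longrightarrow>
      real (card {i\<in>{..<n}. \<bar>dot d (X i) v\<bar> \<le> 2 * a}) \<le> real n / 8"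
    and u: "enorm d u = 1"
  shows "real (card {i\<in>{..<n}. \<bar>dot d (X i) u\<bar> < a}) \<le> real n / 4"
proof -
  obtain v where v: "v \<in> grid d m" "enorm d (\<lambda>i. u i - v i) \<le> 1 / real m"
    using grid_approx[of u d m] u m by auto
  have "1 / real m \<le> 1 / 2" using m(1) by (simp add: field_simps)
  moreover have "enorm d u \<le> enorm d v + enorm d (\<lambda>i. u i - v i)"
    using L2_set_triangle_ineq[of v "\<lambda>i. u i - v i" "{..<d}"] by simp
  ultimately have "1 / 2 \<le> enorm d v" using v(2) u by linarith
  then have c1: "real (card {i\<in>{..<n}. \<bar>dot d (X i) v\<bar> \<le> 2 * a}) \<le> real n / 8" by (rule net[OF v(1)])
  have "(\<Sum>i<n. (dot d (X i) (\<lambda>i. u i - v i))\<^sup>2) \<le> 171 * real n * (enorm d (\<lambda>i. u i - v i))\<^sup>2" by (rule op)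
  also have "\<dots> \<le> 171 * real n * (1 / real m)\<^sup>2"
    using v(2) by (intro mult_left_mono power_mono) auto
  finally have "real (card {i\<in>{..<n}. \<bar>dot d (X i) (\<lambda>i. u i - v i)\<bar> > a}) \<le> 171 * real n * (1 / real m)\<^sup>2 / a\<^sup>2"
    by (rule markov_count[OF a])
  also have "\<dots> = 171 * real n / (a * real m)\<^sup>2" by (simp add: power_divide power_mult_distrib)
  also have "\<dots> \<le> 171 * real n / 40\<^sup>2"
    using m by (intro divide_left_mono power_mono mult_pos_pos) auto
  also have "\<dots> \<le> real n / 8" by simp
  finally have c2: "real (card {i\<in>{..<n}. \<bar>dot d (X i) (\<lambda>i. u i - v i)\<bar> > a}) \<le> real n / 8" .
  have "{i\<in>{..<n}. \<bar>dot d (X i) u\<bar> < a} \<subseteq> {i\<in>{..<n}. \<bar>dot d (X i) v\<bar> \<le> 2 * a} \<union> {i\<in>{..<n}. \<bar>dot d (X i) (\<lambda>i. u i - v i)\<bar> > a}"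
  proof
    fix i assume "i \<in> {i\<in>{..<n}. \<bar>dot d (X i) u\<bar> < a}"
    then have i: "i < n" "\<bar>dot d (X i) u\<bar> < a" by auto
    have "\<bar>dot d (X i) v\<bar> \<le> \<bar>dot d (X i) u\<bar> + \<bar>dot d (X i) (\<lambda>i. u i - v i)\<bar>"
      unfolding dot_diff_right by arith
    then have "\<bar>dot d (X i) v\<bar> \<le> 2 * a \<or> \<bar>dot d (X i) (\<lambda>i. u i - v i)\<bar> > a"
      using i(2) by argo
    then show "i \<in> {i\<in>{..<n}. \<bar>dot d (X i) v\<bar> \<le> 2 * a} \<union> {i\<in>{..<n}. \<bar>dot d (X i) (\<lambda>i. u i - v i)\<bar> > a}"
      using i(1) by blast
  qed
  then have "card {i\<in>{..<n}. \<bar>dot d (X i) u\<bar> < a} \<le> card ({i\<in>{..<n}. \<bar>dot d (X i) v\<bar> \<le> 2 * a} \<union> {i\<in>{..<n}. \<bar>dot d (X i) (\<lambda>i. u i - v i)\<bar> > a})"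
    by (intro card_mono) auto
  also have "\<dots> \<le> card {i\<in>{..<n}. \<bar>dot d (X i) v\<bar> \<le> 2 * a} + card {i\<in>{..<n}. \<bar>dot d (X i) (\<lambda>i. u i - v i)\<bar> > a}"
    by (rule card_Un_le)
  finally show ?thesis
    using c1 c2 by (simp add: field_simps flip: of_nat_le_iff[where 'a = real])
qed

text \<open>Norm at most 2 means proxy 4, so 32 n becomes 2 n after division by 16, against an
  exponential moment of at most 2^n.\<close>

lemma feat_square_fail:
  assumes "enorm d v \<le> 2"
  shows "measure (feat d n) {X \<in> space (feat d n). 32 * real n < (\<Sum>i<n. (dot d (X i) v)\<^sup>2)} \<le> exp (- real n)"
proof -
  let ?f = "\<lambda>x. (dot d x v)\<^sup>2 / (4 * 4)"
  have "(enorm d v)\<^sup>2 \<le> 2\<^sup>2" using assms by (intro power_mono) auto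
  then have "measure (feat d n) {X \<in> space (feat d n). 2 * real n < (\<Sum>i<n. ?f (X i))} \<le> exp (- (2 * real n)) * 2 ^ n"
    using nn_integral_stdG_exp_square[of 4 v d] by (intro feat_chernoff) auto
  also have "\<dots> \<le> exp (- real n)" by (rule two_power_exp_le)
  finally show ?thesis by (simp add: sum_divide_distrib[symmetric] field_simps)
qed

text \<open>The threshold is \<open>2 * small_thr\<close> written out; the small ball bound doubles
  it once more, to exactly the e^(-16) of \<open>feat_count\<close>.\<close>

lemma feat_small_fail:
  assumes "1 / 2 \<le> enorm d v"
  shows "measure (feat d n) {X \<in> space (feat d n).
      real n / 8 < real (card {i\<in>{..<n}. \<bar>dot d (X i) v\<bar> \<le> 2 * (exp (- 16) / 4)})} \<le> exp (- real n)"
proof -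
  let ?A = "{x\<in>Rspace d. \<bar>dot d x v\<bar> \<le> 2 * (exp (- 16) / 4)}"
  have "{x\<in>space (lebesgue_R d). \<bar>dot d x v\<bar> \<le> 2 * (exp (- 16) / 4)} \<in> sets (lebesgue_R d)" by measurable
  then have A: "?A \<in> sets (lebesgue_R d)" by simp
  have "emeasure (stdG d) ?A \<le> ennreal (2 * (2 * (exp (- 16) / 4)))"
    by (rule stdG_small_ball[OF assms]) simp
  then have p: "emeasure (stdG d) ?A \<le> ennreal (exp (- 16))" by simp
  have "{i\<in>{..<n}. X i \<in> ?A} = {i\<in>{..<n}. \<bar>dot d (X i) v\<bar> \<le> 2 * (exp (- 16) / 4)}"
    if "X \<in> space (feat d n)" for X
    using that by (auto simp: space_PiM PiE_iff)
  then have "{X \<in> space (feat d n). real n / 8 < real (card {i\<in>{..<n}. X i \<in> ?A})}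
     = {X \<in> space (feat d n). real n / 8 < real (card {i\<in>{..<n}. \<bar>dot d (X i) v\<bar> \<le> 2 * (exp (- 16) / 4)})}"
    by (intro Collect_cong conj_cong refl) presburger
  then show ?thesis using feat_count[OF A p, of n] by simp
qed

lemma stdG_tail:
  assumes v: "v > 0" "(enorm d u)\<^sup>2 \<le> v"
  shows "emeasure (stdG d) {x\<in>Rspace d. t < (dot d x u)\<^sup>2 / (4 * v)} \<le> ennreal (2 * exp (- t))"
proof -
  have S: "{x\<in>space (stdG d). t < (dot d x u)\<^sup>2 / (4 * v)} \<in> sets (stdG d)" by measurable
  have "emeasure (stdG d) {x\<in>Rspace d. t < (dot d x u)\<^sup>2 / (4 * v)}
     = (\<integral>\<^sup>+x. indicator {x\<in>Rspace d. t < (dot d x u)\<^sup>2 / (4 * v)} x \<partial>stdG d)"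
    using nn_integral_indicator[OF S] by simp
  also have "\<dots> \<le> (\<integral>\<^sup>+x. ennreal (exp (- t)) * ennreal (exp ((dot d x u)\<^sup>2 / (4 * v))) \<partial>stdG d)"
  proof (rule nn_integral_mono)
    fix x
    have "1 \<le> exp (- t) * exp ((dot d x u)\<^sup>2 / (4 * v))" if "t < (dot d x u)\<^sup>2 / (4 * v)"
      unfolding exp_add[symmetric] using that by simp
    then show "indicator {x\<in>Rspace d. t < (dot d x u)\<^sup>2 / (4 * v)} x
       \<le> ennreal (exp (- t)) * ennreal (exp ((dot d x u)\<^sup>2 / (4 * v)))"
      by (simp add: indicator_def ennreal_mult[symmetric] flip: ennreal_1)
  qed
  also have "\<dots> = ennreal (exp (- t)) * (\<integral>\<^sup>+x. ennreal (exp ((dot d x u)\<^sup>2 / (4 * v))) \<partial>stdG d)"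
    by (rule nn_integral_cmult) measurable
  also have "\<dots> \<le> ennreal (exp (- t)) * 2"
    by (intro mult_left_mono nn_integral_stdG_exp_square v) auto
  also have "\<dots> = ennreal (2 * exp (- t))" by (simp add: ennreal_mult mult.commute)
  finally show ?thesis .
qed

text \<open>Since 81 > 4 * 20, a projection beyond \<open>9 * C\<close> has probability at most 2
  e^(-20) <= e^(-16), the level of \<open>feat_count\<close>.\<close>

lemma feat_large_fail:
  assumes C: "C > 0" "enorm d \<theta> \<le> C"
  shows "measure (feat d n) {X \<in> space (feat d n).
      real n / 8 < real (card {i\<in>{..<n}. 9 * C < \<bar>dot d (X i) \<theta>\<bar>})} \<le> exp (- real n)"
proof -
  let ?A = "{x\<in>Rspace d. 20 < (dot d x \<theta>)\<^sup>2 / (4 * C\<^sup>2)}"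
  have "{x\<in>space (lebesgue_R d). 20 < (dot d x \<theta>)\<^sup>2 / (4 * C\<^sup>2)} \<in> sets (lebesgue_R d)" by measurable
  then have A: "?A \<in> sets (lebesgue_R d)" by simp
  have "(enorm d \<theta>)\<^sup>2 \<le> C\<^sup>2" using C by (intro power_mono) auto
  then have "emeasure (stdG d) ?A \<le> ennreal (2 * exp (- 20))"
    using C by (intro stdG_tail) auto
  also have "2 * exp (- 20) \<le> exp (- 16 :: real)"
  proof -
    have "(2::real) \<le> exp 4" using exp_ge_add_one_self[of "4::real"] by simp
    then have "2 * exp (- 20) \<le> exp 4 * exp (- 20 :: real)" by (intro mult_right_mono) auto
    also have "\<dots> = exp (- 16)" unfolding exp_add[symmetric] by simp
    finally show ?thesis .
  qed
  finally have p: "emeasure (stdG d) ?A \<le> ennreal (exp (- 16))" by (simp add: ennreal_leI)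
  have "{X \<in> space (feat d n). real n / 8 < real (card {i\<in>{..<n}. 9 * C < \<bar>dot d (X i) \<theta>\<bar>})}
    \<subseteq> {X \<in> space (feat d n). real n / 8 < real (card {i\<in>{..<n}. X i \<in> ?A})}"
  proof safe
    fix X assume X: "X \<in> space (feat d n)" and c: "real n / 8 < real (card {i\<in>{..<n}. 9 * C < \<bar>dot d (X i) \<theta>\<bar>})"
    have "{i\<in>{..<n}. 9 * C < \<bar>dot d (X i) \<theta>\<bar>} \<subseteq> {i\<in>{..<n}. X i \<in> ?A}"
    proof (clarsimp, intro conjI)
      fix i assume i: "i < n" "9 * C < \<bar>dot d (X i) \<theta>\<bar>"
      show "X i \<in> Rspace d" using X i by (auto simp: space_PiM PiE_iff)
      have "(9 * C)\<^sup>2 \<le> (dot d (X i) \<theta>)\<^sup>2" using i C by (intro abs_le_square_iff[THEN iffD1]) auto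
      moreover have "C\<^sup>2 > 0" using C by simp
      moreover have "(9 * C)\<^sup>2 = 81 * C\<^sup>2" by (simp add: power_mult_distrib)
      ultimately have "20 * (4 * C\<^sup>2) < (dot d (X i) \<theta>)\<^sup>2" by linarith
      then show "20 < (dot d (X i) \<theta>)\<^sup>2 / (4 * C\<^sup>2)" using C by (simp add: pos_less_divide_eq)
    qed
    then have "card {i\<in>{..<n}. 9 * C < \<bar>dot d (X i) \<theta>\<bar>} \<le> card {i\<in>{..<n}. X i \<in> ?A}" by (intro card_mono) auto
    then show "real n / 8 < real (card {i\<in>{..<n}. X i \<in> ?A})" using c by linarith
  qed
  moreover have "{X \<in> space (feat d n). real n / 8 < real (card {i\<in>{..<n}. X i \<in> ?A})} \<in> sets (feat d n)"
  proof -
    have "real (card {i\<in>{..<n}. X i \<in> ?A}) = (\<Sum>i<n. indicator ?A (X i))" for X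
      by (auto simp: indicator_def sum.If_cases Int_def)
    moreover have "(\<lambda>X. \<Sum>i<n. indicator ?A (X i) :: real) \<in> borel_measurable (feat d n)"
      using A by (intro borel_measurable_sum measurable_compose[OF measurable_component_singleton]) auto
    ultimately show ?thesis by simp
  qed
  ultimately show ?thesis using feat.finite_measure_mono feat_count[OF A p, of n] by (meson order_trans)
qed

text \<open>With y = x^2/32, the inequality (|x| - 8)^2 >= 0 trades one factor |x| for y. The cube
  is then at most 64 y^2 + 128 y, which the second order Taylor polynomial of exp dominates.\<close>

lemma cube_le_exp_square: "\<bar>x :: real\<bar> ^ 3 \<le> 128 * exp (x\<^sup>2 / 32)"
proof -
  define y where "y = x\<^sup>2 / 32"
  have y: "y \<ge> 0" "\<bar>x\<bar>\<^sup>2 = 32 * y" by (auto simp: y_def)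
  have "0 \<le> (\<bar>x\<bar> - 8)\<^sup>2" by simp
  then have "16 * \<bar>x\<bar> \<le> 32 * y + 64" using y by (simp add: power2_eq_square algebra_simps)
  then have "16 * \<bar>x\<bar> * \<bar>x\<bar>\<^sup>2 \<le> (32 * y + 64) * \<bar>x\<bar>\<^sup>2" by (rule mult_right_mono) simp
  then have "\<bar>x\<bar> ^ 3 \<le> 64 * y\<^sup>2 + 128 * y"
    unfolding y(2) using y(2) by (simp add: power3_eq_cube power2_eq_square algebra_simps)
  also have "\<dots> \<le> 128 * (1 + y + y\<^sup>2 / 2)" by simp
  also have "\<dots> \<le> 128 * exp y" using exp_lower_Taylor_quadratic[OF y(1)] by simp
  finally show ?thesis by (simp add: y_def)
qed

text \<open>The cube of a Gaussian has no exponential moment, hence the truncation at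
  \<open>T\<close>. Below it f = |z|^3/(32 T) is at most z^2/32 and also at most (4/T) exp (z^2/32),
  so f exp f has mean O(1/T).\<close>

lemma nn_integral_trunc_cube:
  assumes v: "enorm d v \<le> 2" and T: "T > 0"
  shows "(\<integral>\<^sup>+x. ennreal (exp (if \<bar>dot d x v\<bar> \<le> T then \<bar>dot d x v\<bar> ^ 3 / (32 * T) else 0)) \<partial>stdG d) \<le> ennreal (exp (8 / T))"
proof -
  interpret S: prob_space "stdG d" by (rule prob_space_stdG)
  have "(enorm d v)\<^sup>2 \<le> 2\<^sup>2" using v by (intro power_mono) auto
  then have v4: "(enorm d v)\<^sup>2 \<le> 4" by simp
  have pt: "exp (if \<bar>z\<bar> \<le> T then \<bar>z\<bar> ^ 3 / (32 * T) else 0) \<le> 1 + 4 / T * exp (z\<^sup>2 / (4 * 4))" for z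
  proof (cases "\<bar>z\<bar> \<le> T")
    case True
    define f where "f = \<bar>z\<bar> ^ 3 / (32 * T)"
    have f0: "f \<ge> 0" using T by (simp add: f_def)
    have "\<bar>z\<bar> ^ 3 \<le> T * z\<^sup>2"
      using mult_right_mono[OF True, of "\<bar>z\<bar>\<^sup>2"] by (simp add: power3_eq_cube power2_eq_square mult.assoc)
    then have f1: "f \<le> z\<^sup>2 / 32" using T by (simp add: f_def field_simps)
    have f2: "f \<le> 4 / T * exp (z\<^sup>2 / 32)"
      using cube_le_exp_square[of z] T by (simp add: f_def field_simps)
    \<comment> \<open>The inequality 1 - f <= exp (- f), multiplied by exp f, gives exp f <= 1 + f
      exp f.\<close>
    have "exp f * (1 - f) \<le> exp f * exp (- f)"
      using exp_ge_add_one_self[of "- f"] by (intro mult_left_mono) auto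
    then have "exp f \<le> 1 + f * exp f" by (simp add: exp_add[symmetric] algebra_simps)
    also have "f * exp f \<le> 4 / T * exp (z\<^sup>2 / 32) * exp (z\<^sup>2 / 32)"
      using f1 f2 f0 T by (intro mult_mono) auto
    also have "\<dots> = 4 / T * exp (z\<^sup>2 / (4 * 4))" by (simp add: exp_add[symmetric])
    finally show ?thesis using True by (simp add: f_def)
  qed (use T in simp)
  have "(\<integral>\<^sup>+x. ennreal (exp (if \<bar>dot d x v\<bar> \<le> T then \<bar>dot d x v\<bar> ^ 3 / (32 * T) else 0)) \<partial>stdG d)
    \<le> (\<integral>\<^sup>+x. 1 + ennreal (4 / T) * ennreal (exp ((dot d x v)\<^sup>2 / (4 * 4))) \<partial>stdG d)"
    using pt T by (intro nn_integral_mono)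
      (simp add: ennreal_mult[symmetric] ennreal_plus[symmetric] ennreal_leI flip: ennreal_1 del: ennreal_plus)
  also have "\<dots> = 1 + ennreal (4 / T) * (\<integral>\<^sup>+x. ennreal (exp ((dot d x v)\<^sup>2 / (4 * 4))) \<partial>stdG d)"
    using S.emeasure_space_1 by (subst nn_integral_add) (auto simp: nn_integral_cmult)
  also have "\<dots> \<le> 1 + ennreal (4 / T) * 2"
    by (intro add_left_mono mult_left_mono nn_integral_stdG_exp_square v4) auto
  also have "\<dots> = ennreal (1 + 8 / T)"
  proof -
    have "ennreal (4 / T) * 2 = ennreal (4 / T) * ennreal 2" by simp
    also have "\<dots> = ennreal (8 / T)" using T by (subst ennreal_mult[symmetric]) auto
    finally show ?thesis using T by simp
  qed
  also have "\<dots> \<le> ennreal (exp (8 / T))" by (intro ennreal_leI) simp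
  finally show ?thesis .
qed

lemma feat_component:
  assumes "i < n" "A \<in> sets (lebesgue_R d)"
  shows "emeasure (feat d n) {X \<in> space (feat d n). X i \<in> A} = emeasure (stdG d) A"
proof -
  have "distr (feat d n) (stdG d) (\<lambda>X. X i) = stdG d"
    using assms by (intro distr_PiM_component prob_space_stdG) auto
  then have "emeasure (stdG d) A = emeasure (distr (feat d n) (stdG d) (\<lambda>X. X i)) A" by simp
  also have "\<dots> = emeasure (feat d n) ((\<lambda>X. X i) -` A \<inter> space (feat d n))"
    using assms by (intro emeasure_distr measurable_component_singleton) auto
  also have "(\<lambda>X. X i) -` A \<inter> space (feat d n) = {X \<in> space (feat d n). X i \<in> A}" by auto
  finally show ?thesis by simp
qed

text \<open>Either some projection exceeds \<open>T\<close>, which a union over the n samples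
  controls, or the truncated sum is the full one. 832 is 32 times 26, and of the exponent 26 n/T the
  exponential moment takes 8 n/T. The later choice T = n^(1/3) balances n/T against T^2.\<close>

lemma feat_cube_fail:
  assumes v: "enorm d v \<le> 2" and T: "T > 0"
  shows "measure (feat d n) {X \<in> space (feat d n). 832 * real n < (\<Sum>i<n. \<bar>dot d (X i) v\<bar> ^ 3)}
    \<le> exp (- (real n / T)) + real n * (2 * exp (- (T\<^sup>2 / 16)))"
proof -
  let ?f = "\<lambda>x. if \<bar>dot d x v\<bar> \<le> T then \<bar>dot d x v\<bar> ^ 3 / (32 * T) else 0"
  let ?A = "{x\<in>Rspace d. T\<^sup>2 / 16 < (dot d x v)\<^sup>2 / (4 * 4)}"
  let ?B = "{X \<in> space (feat d n). 26 * real n / T < (\<Sum>i<n. ?f (X i))}"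
  let ?C = "{X \<in> space (feat d n). \<exists>i\<in>{..<n}. X i \<in> ?A}"
  have "{x\<in>space (lebesgue_R d). T\<^sup>2 / 16 < (dot d x v)\<^sup>2 / (4 * 4)} \<in> sets (lebesgue_R d)" by measurable
  then have A: "?A \<in> sets (lebesgue_R d)" by simp
  have comp: "{X \<in> space (feat d n). X i \<in> ?A} \<in> sets (feat d n)" if "i \<in> {..<n}" for i
    using that A by (intro measurable_sets_Collect[OF measurable_component_singleton]) auto
  have fm: "?f \<in> borel_measurable (lebesgue_R d)" by measurable
  have Bm: "?B \<in> sets (feat d n)"
  proof -
    have "(\<lambda>X. \<Sum>i<n. ?f (X i)) \<in> borel_measurable (feat d n)"
      using fm by (intro borel_measurable_sum measurable_compose[OF measurable_component_singleton]) auto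
    then show ?thesis by measurable
  qed
  have B: "measure (feat d n) ?B \<le> exp (- (real n / T))"
  proof -
    have "measure (feat d n) ?B \<le> exp (- (26 * real n / T)) * exp (8 / T) ^ n"
      by (rule feat_chernoff[OF fm nn_integral_trunc_cube[OF v T]]) simp
    also have "\<dots> = exp (- (18 * (real n / T)))"
      unfolding exp_of_nat_mult[symmetric] exp_add[symmetric] by (simp add: field_simps)
    also have "\<dots> \<le> exp (- (real n / T))"
      using divide_nonneg_pos[of "real n" T] T by (subst exp_le_cancel_iff) linarith
    finally show ?thesis .
  qed
  have C: "measure (feat d n) ?C \<le> real (card {..<n}) * (2 * exp (- (T\<^sup>2 / 16)))"
  proof (rule feat_union_bound)
    fix i assume i: "i \<in> {..<n}"
    show "{X \<in> space (feat d n). X i \<in> ?A} \<in> sets (feat d n)" by (rule comp[OF i])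
    have "(enorm d v)\<^sup>2 \<le> 2\<^sup>2" using v by (intro power_mono) auto
    then have "emeasure (feat d n) {X \<in> space (feat d n). X i \<in> ?A} \<le> ennreal (2 * exp (- (T\<^sup>2 / 16)))"
      using i stdG_tail[of 4 v d "T\<^sup>2 / 16"] by (subst feat_component[OF _ A]) simp_all
    then show "measure (feat d n) {X \<in> space (feat d n). X i \<in> ?A} \<le> 2 * exp (- (T\<^sup>2 / 16))"
      unfolding feat.emeasure_eq_measure by (subst (asm) ennreal_le_iff) auto
  qed simp
  have Cm: "?C \<in> sets (feat d n)"
  proof -
    have "?C = (\<Union>i\<in>{..<n}. {X \<in> space (feat d n). X i \<in> ?A})" by blast
    then show ?thesis using comp by (simp only:) (intro sets.finite_UN, auto)
  qed
  have "{X \<in> space (feat d n). 832 * real n < (\<Sum>i<n. \<bar>dot d (X i) v\<bar> ^ 3)} \<subseteq> ?B \<union> ?C"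
  proof (rule subsetI, rule ccontr)
    fix X assume X: "X \<in> {X \<in> space (feat d n). 832 * real n < (\<Sum>i<n. \<bar>dot d (X i) v\<bar> ^ 3)}" and n: "X \<notin> ?B \<union> ?C"
    have XR: "X i \<in> Rspace d" if "i < n" for i using X that by (auto simp: space_PiM PiE_iff)
    have le: "\<bar>dot d (X i) v\<bar> \<le> T" if i: "i \<in> {..<n}" for i
    proof (rule ccontr)
      assume "\<not> \<bar>dot d (X i) v\<bar> \<le> T"
      then have "T\<^sup>2 < \<bar>dot d (X i) v\<bar>\<^sup>2" using T by (intro power_strict_mono) auto
      then have "X i \<in> ?A" using XR i by simp
      then show False using n X i by blast
    qed
    have "832 * real n < (\<Sum>i<n. \<bar>dot d (X i) v\<bar> ^ 3)" using X by simp
    also have "(\<Sum>i<n. \<bar>dot d (X i) v\<bar> ^ 3) = (32 * T) * (\<Sum>i<n. ?f (X i))"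
      unfolding sum_distrib_left by (intro sum.cong refl) (use le T in auto)
    finally have "26 * real n / T < (\<Sum>i<n. ?f (X i))" using T by (simp add: field_simps)
    then show False using n X by blast
  qed
  then have "measure (feat d n) {X \<in> space (feat d n). 832 * real n < (\<Sum>i<n. \<bar>dot d (X i) v\<bar> ^ 3)} \<le> measure (feat d n) (?B \<union> ?C)"
    using Bm Cm by (intro feat.finite_measure_mono) auto
  also have "\<dots> \<le> measure (feat d n) ?B + measure (feat d n) ?C"
    using Bm Cm by (rule measure_Un_le)
  finally show ?thesis using B C by simp
qed

section \<open>The logistic model\<close>

definition sigmoid :: "real \<Rightarrow> real" where
  "sigmoid w = exp w / (1 + exp w)"

lemma one_plus_exp_pos: "1 + exp (w :: real) > 0"
  by (simp add: add_pos_pos)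

lemma psi_deriv: "(psi has_real_derivative sigmoid w) (at w)"
  unfolding psi_def sigmoid_def using one_plus_exp_pos[of w]
  by (auto intro!: derivative_eq_intros)

lemma deriv_psi [simp]: "deriv psi = sigmoid"
  using psi_deriv DERIV_imp_deriv by (intro ext) blast

lemma sigmoid_deriv: "(sigmoid has_real_derivative sigmoid w * (1 - sigmoid w)) (at w)"
  unfolding sigmoid_def using one_plus_exp_pos[of w]
  by (auto intro!: derivative_eq_intros simp: field_simps power2_eq_square)

lemma deriv_sigmoid [simp]: "deriv sigmoid w = sigmoid w * (1 - sigmoid w)"
  by (rule DERIV_imp_deriv[OF sigmoid_deriv])

lemma sigmoid_bounds: "0 < sigmoid w" "sigmoid w < 1"
  using one_plus_exp_pos[of w] by (auto simp: sigmoid_def field_simps)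

lemma sigmoid_measurable [measurable]: "sigmoid \<in> borel_measurable borel"
  unfolding sigmoid_def by measurable

text \<open>Hoeffding's lemma for a centred Bernoulli variable; a negative \<open>l\<close> is
  reduced to a positive one by exchanging the two outcomes.\<close>

lemma bernoulli_mgf:
  fixes p l :: real
  assumes p: "0 \<le> p" "p \<le> 1"
  shows "p * exp (l * (1 - p)) + (1 - p) * exp (l * (0 - p)) \<le> exp (l\<^sup>2 / 8)"
proof -
  have *: "p * exp (l * (1 - p)) + (1 - p) * exp (l * (0 - p)) \<le> exp (l\<^sup>2 / 8)"
    if p: "0 \<le> p" "p \<le> 1" and l: "l \<ge> 0" for p l :: real
  proof -
    have pos: "1 + p * (exp l - 1) > 0" using p l by (intro add_pos_nonneg mult_nonneg_nonneg) auto
    have "p * exp (l * (1 - p)) + (1 - p) * exp (l * (0 - p)) = exp (- l * p) * (1 + p * (exp l - 1))"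
      by (simp add: algebra_simps exp_add[symmetric] exp_diff exp_minus divide_inverse)
    also have "\<dots> = exp (- l * p + ln (1 + p * (exp l - 1)))" unfolding exp_add using pos by simp
    also have "\<dots> \<le> exp (l\<^sup>2 / 8)" using Hoeffdings_lemma_aux[OF l p(1)] by simp
    finally show ?thesis .
  qed
  show ?thesis
  proof (cases "l \<ge> 0")
    case False
    then show ?thesis using *[of "1 - p" "- l"] p by (simp add: algebra_simps)
  qed (use * p in blast)
qed

abbreviation lab :: "nat \<Rightarrow> (nat \<Rightarrow> bool) measure" where
  "lab n \<equiv> PiM {..<n} (\<lambda>_. count_space UNIV)"

interpretation lab: product_sigma_finite "\<lambda>_::nat. count_space (UNIV :: bool set)"
  by (intro product_sigma_finite.intro sigma_finite_measure_count_space_finite) auto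

interpretation labS: sigma_finite_measure "lab n" for n
  using lab.sigma_finite by simp

definition lik :: "nat \<Rightarrow> nat \<Rightarrow> (nat \<Rightarrow> real) \<Rightarrow> (nat \<Rightarrow> nat \<Rightarrow> real) \<Rightarrow> (nat \<Rightarrow> bool) \<Rightarrow> ennreal" where
  "lik d n \<theta>s X Y = (\<Prod>i<n. ennreal (pmf (bernoulli_pmf (sigmoid (dot d (X i) \<theta>s))) (Y i)))"

lemma logistic_law_eq:
  "logistic_law d n \<theta>s = density (feat d n \<Otimes>\<^sub>M lab n) (\<lambda>(X, Y). lik d n \<theta>s X Y)"
  by (simp add: logistic_law_def stdG_def lik_def)

text \<open>Given the features the labels are independent, so the integral factors; \<open>g\<close>
  will carry the exponentials in \<open>score_mgf\<close>.\<close>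

lemma nn_integral_lab_prod:
  fixes g :: "nat \<Rightarrow> bool \<Rightarrow> real"
  assumes g: "\<And>i b. g i b \<ge> 0"
  shows "(\<integral>\<^sup>+Y. lik d n \<theta>s X Y * (\<Prod>i<n. ennreal (g i (Y i))) \<partial>lab n)
    = (\<Prod>i<n. ennreal (sigmoid (dot d (X i) \<theta>s) * g i True + (1 - sigmoid (dot d (X i) \<theta>s)) * g i False))"
proof -
  let ?p = "\<lambda>i. sigmoid (dot d (X i) \<theta>s)"
  have "(\<integral>\<^sup>+Y. lik d n \<theta>s X Y * (\<Prod>i<n. ennreal (g i (Y i))) \<partial>lab n)
    = (\<integral>\<^sup>+Y. (\<Prod>i<n. ennreal (pmf (bernoulli_pmf (?p i)) (Y i)) * ennreal (g i (Y i))) \<partial>lab n)"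
    by (simp add: lik_def prod.distrib)
  also have "\<dots> = (\<Prod>i<n. \<integral>\<^sup>+b. ennreal (pmf (bernoulli_pmf (?p i)) b) * ennreal (g i b) \<partial>count_space UNIV)"
    by (rule lab.product_nn_integral_prod) auto
  also have "\<dots> = (\<Prod>i<n. ennreal (?p i * g i True + (1 - ?p i) * g i False))"
  proof (intro prod.cong refl)
    fix i
    have "0 \<le> ?p i" "?p i \<le> 1" using sigmoid_bounds[of "dot d (X i) \<theta>s"] by auto
    then show "(\<integral>\<^sup>+b. ennreal (pmf (bernoulli_pmf (?p i)) b) * ennreal (g i b) \<partial>count_space UNIV)
      = ennreal (?p i * g i True + (1 - ?p i) * g i False)"
      using g by (simp add: nn_integral_count_space_finite UNIV_bool ennreal_mult[symmetric] ennreal_plus[symmetric] del: ennreal_plus)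
  qed
  finally show ?thesis .
qed

lemma nn_integral_lik: "(\<integral>\<^sup>+Y. lik d n \<theta>s X Y \<partial>lab n) = 1"
  using nn_integral_lab_prod[where g = "\<lambda>_ _. 1"] by simp

lemma measurable_pair_dot [measurable]:
  assumes "i < n"
  shows "(\<lambda>z. dot d (fst z i) v) \<in> borel_measurable (feat d n \<Otimes>\<^sub>M M)"
  using measurable_compose[OF measurable_fst measurable_feat_dot[OF assms]] .

lemma measurable_pair_label [measurable]:
  assumes "i < n"
  shows "(\<lambda>z. snd z i) \<in> M \<Otimes>\<^sub>M lab n \<rightarrow>\<^sub>M count_space UNIV"
  using assms by (intro measurable_compose[OF measurable_snd measurable_component_singleton]) auto

lemma measurable_lik [measurable]:
  "(\<lambda>(X, Y). lik d n \<theta>s X Y) \<in> borel_measurable (feat d n \<Otimes>\<^sub>M lab n)"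
proof -
  have eq: "(\<lambda>(X, Y). lik d n \<theta>s X Y) = (\<lambda>z. \<Prod>i<n. ennreal (if snd z i then sigmoid (dot d (fst z i) \<theta>s)
      else 1 - sigmoid (dot d (fst z i) \<theta>s)))"
  proof
    fix z :: "(nat \<Rightarrow> nat \<Rightarrow> real) \<times> (nat \<Rightarrow> bool)"
    obtain X Y where z: "z = (X, Y)" by (cases z)
    have "pmf (bernoulli_pmf (sigmoid (dot d (X i) \<theta>s))) (Y i) =
       (if Y i then sigmoid (dot d (X i) \<theta>s) else 1 - sigmoid (dot d (X i) \<theta>s))" for i
    proof -
      have "0 \<le> sigmoid (dot d (X i) \<theta>s)" "sigmoid (dot d (X i) \<theta>s) \<le> 1"
        using sigmoid_bounds[of "dot d (X i) \<theta>s"] by auto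
      then show ?thesis by (cases "Y i") auto
    qed
    then show "(\<lambda>(X, Y). lik d n \<theta>s X Y) z = (\<Prod>i<n. ennreal (if snd z i then sigmoid (dot d (fst z i) \<theta>s)
      else 1 - sigmoid (dot d (fst z i) \<theta>s)))"
      unfolding z fst_conv snd_conv by (simp add: lik_def)
  qed
  show ?thesis unfolding eq
  proof (rule borel_measurable_prod_ennreal)
    fix i assume "i \<in> {..<n}"
    then have i: "i < n" by simp
    note [measurable] = measurable_pair_dot[OF i] measurable_pair_label[OF i]
    show "(\<lambda>z. ennreal (if snd z i then sigmoid (dot d (fst z i) \<theta>s)
      else 1 - sigmoid (dot d (fst z i) \<theta>s))) \<in> borel_measurable (feat d n \<Otimes>\<^sub>M lab n)"
      by measurable
  qed
qed

lemma nn_integral_logistic: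
  assumes [measurable]: "F \<in> borel_measurable (feat d n \<Otimes>\<^sub>M lab n)"
  shows "(\<integral>\<^sup>+z. F z \<partial>logistic_law d n \<theta>s) = (\<integral>\<^sup>+X. \<integral>\<^sup>+Y. lik d n \<theta>s X Y * F (X, Y) \<partial>lab n \<partial>feat d n)"
proof -
  have "(\<integral>\<^sup>+z. F z \<partial>logistic_law d n \<theta>s) = (\<integral>\<^sup>+z. (\<lambda>(X, Y). lik d n \<theta>s X Y) z * F z \<partial>(feat d n \<Otimes>\<^sub>M lab n))"
    unfolding logistic_law_eq by (rule nn_integral_density) auto
  also have "\<dots> = (\<integral>\<^sup>+X. \<integral>\<^sup>+Y. (\<lambda>(X, Y). lik d n \<theta>s X Y) (X, Y) * F (X, Y) \<partial>lab n \<partial>feat d n)"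
    by (rule labS.nn_integral_fst[symmetric]) measurable
  finally show ?thesis by simp
qed

lemma space_logistic_law: "space (logistic_law d n \<theta>s) = space (feat d n) \<times> space (lab n)"
  by (simp add: logistic_law_eq space_pair_measure)

lemma sets_logistic_law [measurable_cong]: "sets (logistic_law d n \<theta>s) = sets (feat d n \<Otimes>\<^sub>M lab n)"
  by (simp add: logistic_law_eq)

lemma prob_space_logistic_law: "prob_space (logistic_law d n \<theta>s)"
proof (rule prob_spaceI)
  have "emeasure (logistic_law d n \<theta>s) (space (logistic_law d n \<theta>s)) = (\<integral>\<^sup>+z. 1 \<partial>logistic_law d n \<theta>s)" by simp
  also have "\<dots> = 1"
    by (subst nn_integral_logistic) (auto simp: nn_integral_lik feat.emeasure_space_1)
  finally show "emeasure (logistic_law d n \<theta>s) (space (logistic_law d n \<theta>s)) = 1" .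
qed

text \<open>The conditional mass functions of the labels sum to 1, so the features keep their law;
  this carries over every event that involves the features alone.\<close>

lemma measure_logistic_feature:
  assumes A: "A \<in> sets (feat d n)"
  shows "measure (logistic_law d n \<theta>s) {z \<in> space (logistic_law d n \<theta>s). fst z \<in> A} = measure (feat d n) A"
proof -
  interpret L: prob_space "logistic_law d n \<theta>s" by (rule prob_space_logistic_law)
  have [measurable]: "A \<in> sets (feat d n)" by (rule A)
  have S: "{z \<in> space (logistic_law d n \<theta>s). fst z \<in> A} \<in> sets (logistic_law d n \<theta>s)" by measurable
  have "emeasure (logistic_law d n \<theta>s) {z \<in> space (logistic_law d n \<theta>s). fst z \<in> A}
    = (\<integral>\<^sup>+z. indicator {z \<in> space (logistic_law d n \<theta>s). fst z \<in> A} z \<partial>logistic_law d n \<theta>s)"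
    using nn_integral_indicator[OF S] by simp
  also have "\<dots> = (\<integral>\<^sup>+z. indicator A (fst z) \<partial>logistic_law d n \<theta>s)"
    by (intro nn_integral_cong) (simp add: indicator_def)
  also have "\<dots> = (\<integral>\<^sup>+X. \<integral>\<^sup>+Y. lik d n \<theta>s X Y * indicator A X \<partial>lab n \<partial>feat d n)"
    by (subst nn_integral_logistic) auto
  also have "\<dots> = (\<integral>\<^sup>+X. indicator A X \<partial>feat d n)"
  proof (rule nn_integral_cong)
    fix X assume "X \<in> space (feat d n)"
    then have [measurable]: "lik d n \<theta>s X \<in> borel_measurable (lab n)"
      using measurable_Pair2[OF measurable_lik, of X d n \<theta>s] by simp
    show "(\<integral>\<^sup>+Y. lik d n \<theta>s X Y * indicator A X \<partial>lab n) = indicator A X"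
      by (subst nn_integral_multc) (auto simp: nn_integral_lik)
  qed
  also have "\<dots> = emeasure (feat d n) A" using A by simp
  finally show ?thesis by (simp add: measure_def)
qed

text \<open>Gradient at \<open>\<theta>s\<close> of the log likelihood, not of its negative: it is
  the opposite of the later \<open>U \<theta>s\<close>.\<close>

definition score :: "nat \<Rightarrow> nat \<Rightarrow> (nat \<Rightarrow> real) \<Rightarrow> (nat \<Rightarrow> nat \<Rightarrow> real) \<Rightarrow> (nat \<Rightarrow> bool) \<Rightarrow> nat \<Rightarrow> real" where
  "score d n \<theta>s X Y j = (\<Sum>i<n. (of_bool (Y i) - sigmoid (dot d (X i) \<theta>s)) * X i j)"

lemma dot_score: "dot d g (score d n \<theta>s X Y) = (\<Sum>i<n. (of_bool (Y i) - sigmoid (dot d (X i) \<theta>s)) * dot d (X i) g)"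
proof -
  have "dot d g (score d n \<theta>s X Y) = (\<Sum>j<d. \<Sum>i<n. (of_bool (Y i) - sigmoid (dot d (X i) \<theta>s)) * (X i j * g j))"
    by (simp add: dot_def score_def sum_distrib_left mult_ac)
  also have "\<dots> = (\<Sum>i<n. \<Sum>j<d. (of_bool (Y i) - sigmoid (dot d (X i) \<theta>s)) * (X i j * g j))"
    by (rule sum.swap)
  finally show ?thesis by (simp add: dot_def sum_distrib_left)
qed

lemma measurable_pair_coord [measurable]:
  assumes "i < n" "j < d"
  shows "(\<lambda>z. fst z i j) \<in> borel_measurable (feat d n \<Otimes>\<^sub>M M)"
proof -
  have 1: "(\<lambda>z. fst z i) \<in> feat d n \<Otimes>\<^sub>M M \<rightarrow>\<^sub>M stdG d"
    using assms by (intro measurable_compose[OF measurable_fst measurable_component_singleton]) auto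
  have 2: "(\<lambda>x. x j) \<in> borel_measurable (stdG d)" using assms by measurable
  show ?thesis by (rule measurable_compose[OF 1 2])
qed

lemma measurable_score [measurable]:
  assumes "j < d"
  shows "(\<lambda>z. score d n \<theta>s (fst z) (snd z) j) \<in> borel_measurable (feat d n \<Otimes>\<^sub>M lab n)"
  unfolding score_def
proof (rule borel_measurable_sum)
  fix i assume "i \<in> {..<n}"
  then have i: "i < n" by simp
  note [measurable] = measurable_pair_dot[OF i] measurable_pair_label[OF i] measurable_pair_coord[OF i assms]
  show "(\<lambda>z. (of_bool (snd z i) - sigmoid (dot d (fst z i) \<theta>s)) * fst z i j) \<in> borel_measurable (feat d n \<Otimes>\<^sub>M lab n)"
    by measurable
qed

lemma nn_integral_stdG_exp_dot:
  "(\<integral>\<^sup>+g. ennreal (exp (c * dot d u g)) \<partial>stdG d) = ennreal (exp (c\<^sup>2 * (enorm d u)\<^sup>2 / 2))"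
proof -
  have inv: "inv_mat (1\<^sub>m d :: real mat) = 1\<^sub>m d"
    using pos_def_mat_inverse(1,2)[OF pos_def_one, of d] by (metis left_mult_one_mat)
  have "(\<integral>\<^sup>+g. ennreal (exp (c * dot d u g)) \<partial>stdG d)
     = (\<integral>\<^sup>+g. ennreal (exp (c * dot d u g)) \<partial>gaussian d (\<lambda>i\<in>{..<d}. 0) (inv_mat (1\<^sub>m d)))"
    by (simp only: stdG_def inv)
  also have "\<dots> = (\<integral>\<^sup>+y. ennreal (exp (c * dot d u (\<lambda>i\<in>{..<d}. y i + (\<lambda>i\<in>{..<d}. 0) i))) *
      ennreal (exp (- bf d (1\<^sub>m d) y y / 2) / gnorm d (1\<^sub>m d)) \<partial>lebesgue_R d)"
    by (rule nn_integral_gaussian_shift[OF pos_def_one]) measurable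
  also have "\<dots> = (\<integral>\<^sup>+y. ennreal (exp (c * dot d u y)) *
      ennreal (exp (- bf d (1\<^sub>m d) y y / 2) / gnorm d (1\<^sub>m d)) \<partial>lebesgue_R d)"
    by (simp add: dot_def)
  also have "\<dots> = ennreal (exp (c\<^sup>2 * bf d (1\<^sub>m d) u u / 2))"
    by (rule gaussian_mgf[OF pos_def_one]) (simp add: bf_one dot_commute)
  finally show ?thesis by (simp add: bf_one dot_self)
qed

text \<open>Each coordinate contributes sqrt 2 <= 2. The 2^d reappears in \<open>score_fail\<close>,
  where d s^2 absorbs it.\<close>

lemma nn_integral_stdG_exp_enorm: "(\<integral>\<^sup>+g. ennreal (exp ((enorm d g)\<^sup>2 / 4)) \<partial>stdG d) \<le> ennreal (2 ^ d)"
proof -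
  have "(\<integral>\<^sup>+g. ennreal (exp ((enorm d g)\<^sup>2 / 4)) \<partial>stdG d)
    = (\<integral>\<^sup>+g. (\<Prod>i<d. ennreal (exp ((g i)\<^sup>2 / 4))) \<partial>PiM {..<d} (\<lambda>_. N01))"
    unfolding stdG_eq_PiM
    by (intro nn_integral_cong) (simp add: prod_ennreal exp_sum[symmetric] L2_set_def sum_nonneg sum_divide_distrib)
  also have "\<dots> = (\<Prod>i<d. \<integral>\<^sup>+t. ennreal (exp (t\<^sup>2 / 4)) \<partial>N01)"
    by (rule N01.product_nn_integral_prod) auto
  also have "\<dots> \<le> ennreal 2 ^ d"
    unfolding prod_constant card_lessThan
  proof (rule power_mono)
    have "(\<integral>\<^sup>+t. ennreal (exp (t\<^sup>2 / 4)) \<partial>N01) = (\<integral>\<^sup>+t. ennreal (std_normal_density t) * ennreal (exp (t\<^sup>2 / 4)) \<partial>lborel)"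
      by (rule nn_integral_density) auto
    also have "\<dots> \<le> (\<integral>\<^sup>+t. ennreal (sqrt 2) * ennreal (normal_density 0 (sqrt 2 * 1) t) \<partial>lborel)"
      using normal_density_mult_exp_square[of 1 1]
      by (intro nn_integral_mono) (auto simp: ennreal_mult[symmetric] intro!: ennreal_leI)
    also have "\<dots> = ennreal (sqrt 2)"
      by (subst nn_integral_cmult) (auto simp: nn_integral_normal_density)
    also have "\<dots> \<le> ennreal 2" by (intro ennreal_leI) (rule sqrt2_less_2[THEN less_imp_le])
    finally show "(\<integral>\<^sup>+t. ennreal (exp (t\<^sup>2 / 4)) \<partial>N01) \<le> ennreal 2" .
  qed simp
  also have "\<dots> = ennreal (2 ^ d)" by (rule ennreal_power) simp
  finally show ?thesis .
qed

text \<open>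
  Averaging the exponential moments of \<open>dot d g S\<close> over an independent Gaussian \<open>g\<close> produces the
  exponential moment of \<open>(enorm d S)\<^sup>2\<close> without any covering of the sphere.
\<close>

lemma score_mgf:
  assumes X: "X \<in> space (feat d n)" and n: "n \<ge> 1" and B: "B > 0"
    and op: "\<And>u. (\<Sum>i<n. (dot d (X i) u)\<^sup>2) \<le> B * real n * (enorm d u)\<^sup>2"
  shows "(\<integral>\<^sup>+Y. lik d n \<theta>s X Y * ennreal (exp ((enorm d (score d n \<theta>s X Y))\<^sup>2 / (B * real n))) \<partial>lab n) \<le> ennreal (2 ^ d)"
proof -
  \<comment> \<open>The Gaussian average exp (c^2 |S|^2/2) has to equal exp (|S|^2/(B n)), which
    fixes c. Hoeffding and the second moment bound then leave c^2 B n |g|^2/8 = |g|^2/4 in the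
    exponent.\<close>
  define c where "c = sqrt (2 / (B * real n))"
  have c2: "c\<^sup>2 = 2 / (B * real n)" using B by (simp add: c_def)
  interpret P: pair_sigma_finite "stdG d" "lab n"
    by (intro pair_sigma_finite.intro labS.sigma_finite_measure_axioms
        prob_space_imp_sigma_finite prob_space_stdG)
  have lm [measurable]: "lik d n \<theta>s X \<in> borel_measurable (lab n)"
    using measurable_Pair2[OF measurable_lik, of X d n \<theta>s] X by simp
  have sm: "(\<lambda>Y. score d n \<theta>s X Y j) \<in> borel_measurable (lab n)" if "j < d" for j
    using measurable_Pair2[OF measurable_score[OF that], of X n \<theta>s] X by simp
  have [measurable]: "(\<lambda>z. dot d (score d n \<theta>s X (snd z)) (fst z)) \<in> borel_measurable (stdG d \<Otimes>\<^sub>M lab n)"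
    by (intro measurable_dot measurable_compose[OF measurable_snd sm] measurable_compose[OF measurable_fst]) auto
  have "(\<integral>\<^sup>+Y. lik d n \<theta>s X Y * ennreal (exp ((enorm d (score d n \<theta>s X Y))\<^sup>2 / (B * real n))) \<partial>lab n)
     = (\<integral>\<^sup>+Y. \<integral>\<^sup>+g. lik d n \<theta>s X Y * ennreal (exp (c * dot d (score d n \<theta>s X Y) g)) \<partial>stdG d \<partial>lab n)"
    by (intro nn_integral_cong, subst nn_integral_cmult) (auto simp: nn_integral_stdG_exp_dot c2)
  also have "\<dots> = (\<integral>\<^sup>+g. \<integral>\<^sup>+Y. lik d n \<theta>s X Y * ennreal (exp (c * dot d (score d n \<theta>s X Y) g)) \<partial>lab n \<partial>stdG d)"
    by (rule P.Fubini') measurable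
  also have "\<dots> \<le> (\<integral>\<^sup>+g. ennreal (exp ((enorm d g)\<^sup>2 / 4)) \<partial>stdG d)"
  proof (rule nn_integral_mono)
    fix g
    let ?p = "\<lambda>i. sigmoid (dot d (X i) \<theta>s)"
    define e where "e = (\<lambda>i b. exp ((c * dot d (X i) g) * (of_bool b - ?p i)))"
    have "(\<integral>\<^sup>+Y. lik d n \<theta>s X Y * ennreal (exp (c * dot d (score d n \<theta>s X Y) g)) \<partial>lab n)
       = (\<integral>\<^sup>+Y. lik d n \<theta>s X Y * (\<Prod>i<n. ennreal (e i (Y i))) \<partial>lab n)"
    proof (intro nn_integral_cong arg_cong2[where f = "(*)"] refl)
      fix Y
      have "c * dot d (score d n \<theta>s X Y) g = (\<Sum>i<n. (c * dot d (X i) g) * (of_bool (Y i) - ?p i))"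
        unfolding dot_commute[of d _ g] dot_score sum_distrib_left by (simp add: mult_ac)
      then show "ennreal (exp (c * dot d (score d n \<theta>s X Y) g)) = (\<Prod>i<n. ennreal (e i (Y i)))"
        by (simp add: e_def prod_ennreal exp_sum)
    qed
    also have "\<dots> = (\<Prod>i<n. ennreal (?p i * e i True + (1 - ?p i) * e i False))"
      by (rule nn_integral_lab_prod) (simp add: e_def)
    also have "\<dots> \<le> (\<Prod>i<n. ennreal (exp ((c * dot d (X i) g)\<^sup>2 / 8)))"
    proof (intro prod_mono_ennreal ennreal_leI)
      fix i
      show "?p i * e i True + (1 - ?p i) * e i False \<le> exp ((c * dot d (X i) g)\<^sup>2 / 8)"
        using bernoulli_mgf[of "?p i" "c * dot d (X i) g"] sigmoid_bounds[of "dot d (X i) \<theta>s"]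
        by (simp add: e_def)
    qed
    also have "\<dots> = ennreal (exp (c\<^sup>2 * (\<Sum>i<n. (dot d (X i) g)\<^sup>2) / 8))"
      by (simp add: prod_ennreal exp_sum[symmetric] power_mult_distrib sum_distrib_left sum_divide_distrib)
    also have "\<dots> \<le> ennreal (exp ((enorm d g)\<^sup>2 / 4))"
    proof (intro ennreal_leI)
      have "c\<^sup>2 * (\<Sum>i<n. (dot d (X i) g)\<^sup>2) \<le> c\<^sup>2 * (B * real n * (enorm d g)\<^sup>2)"
        by (intro mult_left_mono op) simp
      also have "\<dots> = 2 * (enorm d g)\<^sup>2" unfolding c2 using B n by simp
      finally show "exp (c\<^sup>2 * (\<Sum>i<n. (dot d (X i) g)\<^sup>2) / 8) \<le> exp ((enorm d g)\<^sup>2 / 4)" by simp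
    qed
    finally show "(\<integral>\<^sup>+Y. lik d n \<theta>s X Y * ennreal (exp (c * dot d (score d n \<theta>s X Y) g)) \<partial>lab n)
      \<le> ennreal (exp ((enorm d g)\<^sup>2 / 4))" .
  qed
  also have "\<dots> \<le> ennreal (2 ^ d)" by (rule nn_integral_stdG_exp_enorm)
  finally show ?thesis .
qed

text \<open>Markov's inequality conditionally on the features; \<open>G\<close> collects features
  with the second moment bound.\<close>

lemma score_fail:
  assumes n: "n \<ge> 1" and B: "B > 0" and G: "G \<in> sets (feat d n)"
    and op: "\<And>X u. X \<in> G \<Longrightarrow> (\<Sum>i<n. (dot d (X i) u)\<^sup>2) \<le> B * real n * (enorm d u)\<^sup>2"
  shows "measure (logistic_law d n \<theta>s) {z \<in> space (logistic_law d n \<theta>s).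
      fst z \<in> G \<and> t * (B * real n) < (enorm d (score d n \<theta>s (fst z) (snd z)))\<^sup>2} \<le> exp (- t) * 2 ^ d"
proof -
  interpret L: prob_space "logistic_law d n \<theta>s" by (rule prob_space_logistic_law)
  let ?S = "\<lambda>z. (enorm d (score d n \<theta>s (fst z) (snd z)))\<^sup>2"
  let ?A = "{z \<in> space (logistic_law d n \<theta>s). fst z \<in> G \<and> t * (B * real n) < ?S z}"
  have [measurable]: "G \<in> sets (feat d n)" by (rule G)
  have [measurable]: "?S \<in> borel_measurable (feat d n \<Otimes>\<^sub>M lab n)"
    by (intro borel_measurable_power measurable_enorm measurable_score)
  have Bn: "B * real n > 0" using B n by simp
  have A: "?A \<in> sets (logistic_law d n \<theta>s)" by measurable
  have "emeasure (logistic_law d n \<theta>s) ?A = (\<integral>\<^sup>+z. indicator ?A z \<partial>logistic_law d n \<theta>s)"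
    using nn_integral_indicator[OF A] by simp
  also have "\<dots> \<le> (\<integral>\<^sup>+z. ennreal (exp (- t)) * (indicator G (fst z) * ennreal (exp (?S z / (B * real n)))) \<partial>logistic_law d n \<theta>s)"
  proof (rule nn_integral_mono)
    fix z
    have "1 \<le> exp (- t) * exp (?S z / (B * real n))" if "t * (B * real n) < ?S z"
    proof -
      have "t \<le> ?S z / (B * real n)" using that Bn by (simp add: pos_le_divide_eq)
      then show ?thesis unfolding exp_add[symmetric] by simp
    qed
    then show "indicator ?A z \<le> ennreal (exp (- t)) * (indicator G (fst z) * ennreal (exp (?S z / (B * real n))))"
      by (simp add: indicator_def ennreal_mult[symmetric] flip: ennreal_1)
  qed
  also have "\<dots> = (\<integral>\<^sup>+X. \<integral>\<^sup>+Y. lik d n \<theta>s X Y * (ennreal (exp (- t)) * (indicator G X *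
      ennreal (exp ((enorm d (score d n \<theta>s X Y))\<^sup>2 / (B * real n))))) \<partial>lab n \<partial>feat d n)"
    by (subst nn_integral_logistic) auto
  also have "\<dots> \<le> (\<integral>\<^sup>+X. ennreal (exp (- t) * 2 ^ d) \<partial>feat d n)"
  proof (rule nn_integral_mono)
    fix X assume X: "X \<in> space (feat d n)"
    have lm [measurable]: "lik d n \<theta>s X \<in> borel_measurable (lab n)"
      using measurable_Pair2[OF measurable_lik, of X d n \<theta>s] X by simp
    have sm: "(\<lambda>Y. score d n \<theta>s X Y j) \<in> borel_measurable (lab n)" if "j < d" for j
      using measurable_Pair2[OF measurable_score[OF that], of X n \<theta>s] X by simp
    have [measurable]: "(\<lambda>Y. enorm d (score d n \<theta>s X Y)) \<in> borel_measurable (lab n)"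
      by (rule measurable_enorm[OF sm])
    show "(\<integral>\<^sup>+Y. lik d n \<theta>s X Y * (ennreal (exp (- t)) * (indicator G X *
      ennreal (exp ((enorm d (score d n \<theta>s X Y))\<^sup>2 / (B * real n))))) \<partial>lab n) \<le> ennreal (exp (- t) * 2 ^ d)"
    proof (cases "X \<in> G")
      case True
      have "(\<integral>\<^sup>+Y. lik d n \<theta>s X Y * (ennreal (exp (- t)) * (indicator G X *
          ennreal (exp ((enorm d (score d n \<theta>s X Y))\<^sup>2 / (B * real n))))) \<partial>lab n)
        = ennreal (exp (- t)) * (\<integral>\<^sup>+Y. lik d n \<theta>s X Y * ennreal (exp ((enorm d (score d n \<theta>s X Y))\<^sup>2 / (B * real n))) \<partial>lab n)"
        using True by (subst nn_integral_cmult[symmetric]) (auto simp: mult_ac)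
      also have "\<dots> \<le> ennreal (exp (- t)) * ennreal (2 ^ d)"
        using op[OF True] by (intro mult_left_mono score_mgf[OF X n B]) auto
      finally show ?thesis by (simp add: ennreal_mult)
    qed simp
  qed
  also have "\<dots> = ennreal (exp (- t) * 2 ^ d)" by (simp add: feat.emeasure_space_1)
  finally show ?thesis
    unfolding L.emeasure_eq_measure by (subst (asm) ennreal_le_iff) auto
qed

text \<open>Chosen so that the small ball bound at \<open>2 * small_thr\<close> is e^(-16), the
  level that \<open>feat_count\<close> accepts.\<close>

definition small_thr :: real where
  "small_thr = exp (- 16) / 4"

text \<open>Fine enough for \<open>small_thr * grid_fine >= 40\<close>, as
  \<open>small_dot_count\<close> asks: the net error must be small compared with the
  threshold.\<close>

definition grid_fine :: nat where
  "grid_fine = nat \<lceil>160 * exp (16 :: real)\<rceil>"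

lemma small_thr_pos: "small_thr > 0"
  by (simp add: small_thr_def)

lemma grid_fine_ge: "4 \<le> grid_fine" "40 \<le> small_thr * real grid_fine"
proof -
  have m: "real grid_fine \<ge> 160 * exp 16" unfolding grid_fine_def by (simp add: real_nat_ceiling_ge)
  have "exp 16 \<ge> (1::real)" by simp
  then have "real grid_fine \<ge> 4" using m by linarith
  then show "4 \<le> grid_fine" by simp
  have "small_thr * (160 * exp 16) = 40 * exp (- 16 + 16)"
    unfolding small_thr_def exp_add by simp
  then have "small_thr * (160 * exp 16) = 40" by simp
  then show "40 \<le> small_thr * real grid_fine"
    using mult_left_mono[OF m less_imp_le[OF small_thr_pos]] by linarith
qed

text \<open>What the deterministic part uses about the sample: second moments from above, a lower
  bound in every direction, bounded linear predictors for most samples, third moments when d <= sqrt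
  n, and a score of norm at most sqrt 171 s sqrt (n d).\<close>

definition good_data :: "nat \<Rightarrow> nat \<Rightarrow> (nat \<Rightarrow> real) \<Rightarrow> real \<Rightarrow> real \<Rightarrow> (nat \<Rightarrow> nat \<Rightarrow> real) \<Rightarrow> (nat \<Rightarrow> bool) \<Rightarrow> bool" where
  "good_data d n \<theta>s C s X Y \<longleftrightarrow>
     (\<forall>u. (\<Sum>i<n. (dot d (X i) u)\<^sup>2) \<le> 171 * real n * (enorm d u)\<^sup>2) \<and>
     (\<forall>u. enorm d u = 1 \<longrightarrow> real (card {i\<in>{..<n}. \<bar>dot d (X i) u\<bar> < small_thr}) \<le> real n / 4) \<and>
     real (card {i\<in>{..<n}. 9 * C < \<bar>dot d (X i) \<theta>s\<bar>}) \<le> real n / 8 \<and>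
     (real d \<le> sqrt (real n) \<longrightarrow> (\<forall>u. (\<Sum>i<n. \<bar>dot d (X i) u\<bar> ^ 3) \<le> 4438 * real n * (enorm d u) ^ 3)) \<and>
     (enorm d (score d n \<theta>s X Y))\<^sup>2 \<le> real d * s\<^sup>2 * (171 * real n)"

lemma card_filter_lessThan:
  fixes n :: nat
  shows "real (card {i\<in>{..<n}. P i}) = (\<Sum>i<n. if P i then 1 else 0)"
proof -
  have "(\<Sum>i<n. if P i then 1 else 0) = (\<Sum>i\<in>{i\<in>{..<n}. P i}. 1 :: real)"
    by (rule sum.inter_filter[symmetric]) simp
  then show ?thesis by simp
qed

lemma sets_feat_card:
  assumes "\<And>i. i < n \<Longrightarrow> {X \<in> space (feat d n). P (X i)} \<in> sets (feat d n)"
  shows "{X \<in> space (feat d n). c < real (card {i\<in>{..<n}. P (X i)})} \<in> sets (feat d n)"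
proof -
  have "(\<lambda>X. \<Sum>i<n. if P (X i) then 1 else 0 :: real) \<in> borel_measurable (feat d n)"
    by (intro borel_measurable_sum measurable_If) (use assms in auto)
  then show ?thesis unfolding card_filter_lessThan by measurable
qed

lemma sets_feat_dot_sum:
  assumes "f \<in> borel_measurable borel"
  shows "{X \<in> space (feat d n). c < (\<Sum>i<n. f (dot d (X i) v) :: real)} \<in> sets (feat d n)"
proof -
  have "(\<lambda>X. \<Sum>i<n. f (dot d (X i) v)) \<in> borel_measurable (feat d n)"
    by (intro borel_measurable_sum measurable_compose[OF measurable_feat_dot assms]) auto
  then show ?thesis by measurable
qed

lemma sets_feat_bex:
  assumes "finite V" "\<And>v. v \<in> V \<Longrightarrow> {X \<in> space (feat d n). P v X} \<in> sets (feat d n)"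
  shows "{X \<in> space (feat d n). \<exists>v\<in>V. P v X} \<in> sets (feat d n)"
proof -
  have "{X \<in> space (feat d n). \<exists>v\<in>V. P v X} = (\<Union>v\<in>V. {X \<in> space (feat d n). P v X})" by blast
  then show ?thesis using assms by (simp only:) (intro sets.finite_UN, auto)
qed

lemma card_subset_grid:
  assumes "V \<subseteq> grid d m" "d \<ge> 1" "m \<ge> 1" "(5 * real m * sqrt (real d)) ^ d \<le> K"
  shows "real (card V) \<le> K"
proof -
  have "real (card V) \<le> real (card (grid d m))" using assms(1) by (intro of_nat_mono card_mono) auto
  then show ?thesis using card_grid[OF assms(2,3)] assms(4) by linarith
qed

text \<open>For the squares and the small components a net of at most exp (n/2) points meets failure
  probabilities exp (- n); \<open>cub\<close> is the corresponding balance for the cubes. The score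
  fails with probability at most 2^d exp (- d s^2).\<close>

lemma good_data_prob:
  assumes d: "d \<ge> 1" and n: "n \<ge> 4" and C: "C > 0" "enorm d \<theta>s \<le> C" and s: "s \<ge> 12"
    and fine: "(5 * real grid_fine * sqrt (real d)) ^ d \<le> exp (real n / 2)"
    and cub: "real d \<le> sqrt (real n) \<Longrightarrow> T > 0 \<and>
      (20 * sqrt (real d)) ^ d * (exp (- (real n / T)) + real n * (2 * exp (- (T\<^sup>2 / 16)))) \<le> exp (- sqrt (real n))"
  shows "\<exists>E \<in> sets (logistic_law d n \<theta>s).
     measure (logistic_law d n \<theta>s) E \<ge> 1 - 8 * exp (- sqrt (real n)) - exp (- real d * s\<^sup>2 / 10) \<and>
     (\<forall>(X, Y) \<in> E. good_data d n \<theta>s C s X Y \<and> X \<in> space (feat d n))"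
proof -
  let ?F = "feat d n" and ?L = "logistic_law d n \<theta>s"
  interpret L: prob_space ?L by (rule prob_space_logistic_law)
  let ?V4 = "{v\<in>grid d 4. enorm d v \<le> 2}" and ?Vm = "{v\<in>grid d grid_fine. 1 / 2 \<le> enorm d v}"
  let ?N1 = "{X \<in> space ?F. \<exists>v\<in>?V4. 32 * real n < (\<Sum>i<n. (dot d (X i) v)\<^sup>2)}"
  let ?N2 = "{X \<in> space ?F. \<exists>v\<in>?Vm. real n / 8 < real (card {i\<in>{..<n}. \<bar>dot d (X i) v\<bar> \<le> 2 * small_thr})}"
  let ?N3 = "{X \<in> space ?F. real n / 8 < real (card {i\<in>{..<n}. 9 * C < \<bar>dot d (X i) \<theta>s\<bar>})}"
  let ?N4 = "{X \<in> space ?F. \<exists>v\<in>(if real d \<le> sqrt (real n) then ?V4 else {}). 832 * real n < (\<Sum>i<n. \<bar>dot d (X i) v\<bar> ^ 3)}"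
  let ?l = "\<lambda>A. {z \<in> space ?L. fst z \<in> A}"
  let ?t = "real d * s\<^sup>2"
  \<comment> \<open>Restricting to the complement of \<open>?N1\<close> supplies the second moment
    bound that \<open>score_fail\<close> needs.\<close>
  let ?N5 = "{z \<in> space ?L. fst z \<in> space ?F - ?N1 \<and> ?t * (171 * real n) < (enorm d (score d n \<theta>s (fst z) (snd z)))\<^sup>2}"
  have S1: "?N1 \<in> sets ?F" by (intro sets_feat_bex sets_feat_dot_sum[of "\<lambda>t. t\<^sup>2"]) auto
  have S2: "?N2 \<in> sets ?F"
    by (intro sets_feat_bex sets_feat_card) auto
  have S3: "?N3 \<in> sets ?F"
    by (intro sets_feat_card) auto
  have S4: "?N4 \<in> sets ?F" by (intro sets_feat_bex sets_feat_dot_sum[of "\<lambda>t. \<bar>t\<bar> ^ 3"]) auto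
  have fst_m: "?l A \<in> sets ?L" if "A \<in> sets ?F" for A
    using that by (intro measurable_sets_Collect[of fst _ ?F]) (auto simp: sets_logistic_law cong: measurable_cong_sets)
  have enm: "(\<lambda>z. (enorm d (score d n \<theta>s (fst z) (snd z)))\<^sup>2) \<in> borel_measurable (feat d n \<Otimes>\<^sub>M lab n)"
    by (intro borel_measurable_power measurable_enorm measurable_score)
  have S5: "?N5 \<in> sets ?L"
  proof -
    have "?l (space ?F - ?N1) \<in> sets ?L" using S1 by (intro fst_m) auto
    moreover have "{z \<in> space ?L. ?t * (171 * real n) < (enorm d (score d n \<theta>s (fst z) (snd z)))\<^sup>2} \<in> sets ?L"
      using enm by measurable
    ultimately have "?l (space ?F - ?N1) \<inter> {z \<in> space ?L. ?t * (171 * real n) < (enorm d (score d n \<theta>s (fst z) (snd z)))\<^sup>2} \<in> sets ?L"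
      by (rule sets.Int)
    moreover have "?l (space ?F - ?N1) \<inter> {z \<in> space ?L. ?t * (171 * real n) < (enorm d (score d n \<theta>s (fst z) (snd z)))\<^sup>2} = ?N5"
      by blast
    ultimately show ?thesis by simp
  qed
  have sqn: "sqrt (real n) \<le> real n / 2"
  proof -
    have "2 \<le> sqrt (real n)" using n by (simp add: real_le_rsqrt)
    then have "2 * sqrt (real n) \<le> sqrt (real n) * sqrt (real n)" by (intro mult_right_mono) auto
    then show ?thesis by simp
  qed
  \<comment> \<open>The count for the coarse net is at most that for the fine one, so a single
    hypothesis serves both.\<close>
  have fine4: "(5 * real 4 * sqrt (real d)) ^ d \<le> exp (real n / 2)"
    using grid_fine_ge(1) by (intro order_trans[OF power_mono fine] mult_right_mono mult_left_mono) auto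
  have half: "exp (real n / 2) * exp (- real n) \<le> exp (- sqrt (real n))"
    unfolding exp_add[symmetric] using sqn by simp
  have P1: "measure ?F ?N1 \<le> exp (- sqrt (real n))"
  proof -
    have "measure ?F ?N1 \<le> real (card ?V4) * exp (- real n)"
      by (intro feat_union_bound feat_square_fail sets_feat_dot_sum[of "\<lambda>t. t\<^sup>2"]) auto
    also have "\<dots> \<le> exp (real n / 2) * exp (- real n)"
      by (intro mult_right_mono card_subset_grid[OF _ d _ fine4]) auto
    finally show ?thesis using half by linarith
  qed
  have P2: "measure ?F ?N2 \<le> exp (- sqrt (real n))"
  proof -
    have "measure ?F ?N2 \<le> real (card ?Vm) * exp (- real n)"
      unfolding small_thr_def by (intro feat_union_bound feat_small_fail sets_feat_card) auto
    also have "\<dots> \<le> exp (real n / 2) * exp (- real n)"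
      using grid_fine_ge(1) by (intro mult_right_mono card_subset_grid[OF _ d _ fine]) auto
    finally show ?thesis using half by linarith
  qed
  have P3: "measure ?F ?N3 \<le> exp (- sqrt (real n))"
  proof -
    have "exp (- real n) \<le> exp (- sqrt (real n))" using sqn by simp
    then show ?thesis using feat_large_fail[OF C, of n] by linarith
  qed
  have P4: "measure ?F ?N4 \<le> exp (- sqrt (real n))"
  proof (cases "real d \<le> sqrt (real n)")
    case True
    note c = cub[OF True]
    have "measure ?F ?N4 \<le> real (card ?V4) * (exp (- (real n / T)) + real n * (2 * exp (- (T\<^sup>2 / 16))))"
      using True c by (simp only: if_True) (intro feat_union_bound feat_cube_fail sets_feat_dot_sum[of "\<lambda>t. \<bar>t\<bar> ^ 3"]; auto)
    also have "\<dots> \<le> (20 * sqrt (real d)) ^ d * (exp (- (real n / T)) + real n * (2 * exp (- (T\<^sup>2 / 16))))"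
      using d by (intro mult_right_mono card_subset_grid[of _ d 4]) auto
    finally show ?thesis using c by linarith
  qed simp
  have P5: "measure ?L ?N5 \<le> exp (- real d * s\<^sup>2 / 10)"
  proof -
    have "measure ?L ?N5 \<le> exp (- ?t) * 2 ^ d"
    proof (rule score_fail)
      show "(\<Sum>i<n. (dot d (X i) u)\<^sup>2) \<le> 171 * real n * (enorm d u)\<^sup>2" if "X \<in> space ?F - ?N1" for X u
        using that by (intro sum_square_dot_bound) (auto simp: not_less)
    qed (use n S1 in auto)
    also have "(2::real) ^ d \<le> exp (real d)"
    proof -
      have "(2::real) \<le> exp 1" using exp_ge_add_one_self[of "1::real"] by simp
      then have "(2::real) ^ d \<le> exp 1 ^ d" by (intro power_mono) auto
      then show ?thesis by (simp add: exp_of_nat_mult[symmetric])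
    qed
    also have "exp (- ?t) * exp (real d) \<le> exp (- real d * s\<^sup>2 / 10)"
    proof -
      \<comment> \<open>As s^2 >= 144, nine tenths of d s^2 outweigh the factor e^d and one tenth
        remains.\<close>
      have "12 * 12 \<le> s * s" using s by (intro mult_mono) auto
      then have "144 \<le> s\<^sup>2" by (simp add: power2_eq_square)
      then have "real d * 144 \<le> ?t" by (intro mult_left_mono) auto
      then have "- ?t + real d \<le> - real d * s\<^sup>2 / 10" by (simp add: field_simps)
      then show ?thesis unfolding exp_add[symmetric] by simp
    qed
    finally show ?thesis by simp
  qed
  let ?N = "?l ?N1 \<union> ?l ?N2 \<union> ?l ?N3 \<union> ?l ?N4 \<union> ?N5"
  have SN: "?N \<in> sets ?L" using fst_m S1 S2 S3 S4 S5 by (intro sets.Un) blast+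
  have "measure ?L ?N \<le> measure ?L (?l ?N1) + measure ?L (?l ?N2) + measure ?L (?l ?N3) + measure ?L (?l ?N4) + measure ?L ?N5"
    using fst_m[OF S1] fst_m[OF S2] fst_m[OF S3] fst_m[OF S4] S5
    by (intro order_trans[OF measure_Un_le] add_mono order_refl sets.Un)
  also have "\<dots> \<le> 4 * exp (- sqrt (real n)) + exp (- real d * s\<^sup>2 / 10)"
    using P1 P2 P3 P4 P5 measure_logistic_feature[OF S1, of \<theta>s] measure_logistic_feature[OF S2, of \<theta>s]
      measure_logistic_feature[OF S3, of \<theta>s] measure_logistic_feature[OF S4, of \<theta>s] by linarith
  finally have mN: "measure ?L ?N \<le> 8 * exp (- sqrt (real n)) + exp (- real d * s\<^sup>2 / 10)"
    using exp_gt_zero[of "- sqrt (real n)"] by linarith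
  show ?thesis
  proof (intro bexI[of _ "space ?L - ?N"] conjI ballI)
    show "space ?L - ?N \<in> sets ?L" using SN by auto
    show "1 - 8 * exp (- sqrt (real n)) - exp (- real d * s\<^sup>2 / 10) \<le> measure ?L (space ?L - ?N)"
      using L.prob_compl[OF SN] mN by linarith
    fix z assume z: "z \<in> space ?L - ?N"
    obtain X Y where XY: "z = (X, Y)" by (cases z)
    have X: "X \<in> space ?F" using z XY by (auto simp: space_logistic_law)
    have n1: "X \<notin> ?N1" and n2: "X \<notin> ?N2" and n3: "X \<notin> ?N3" and n4: "X \<notin> ?N4" and n5: "(X, Y) \<notin> ?N5"
      using z unfolding XY by auto
    have g1: "(\<Sum>i<n. (dot d (X i) u)\<^sup>2) \<le> 171 * real n * (enorm d u)\<^sup>2" for u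
      using n1 X by (intro sum_square_dot_bound) (auto simp: not_less)
    have g2: "real (card {i\<in>{..<n}. \<bar>dot d (X i) u\<bar> < small_thr}) \<le> real n / 4" if "enorm d u = 1" for u
      using n2 X grid_fine_ge by (intro small_dot_count[OF g1 small_thr_pos, where m = grid_fine] that) (auto simp: not_less)
    have g3: "real (card {i\<in>{..<n}. 9 * C < \<bar>dot d (X i) \<theta>s\<bar>}) \<le> real n / 8"
      using n3 X by (auto simp: not_less)
    have g4: "(\<Sum>i<n. \<bar>dot d (X i) u\<bar> ^ 3) \<le> 4438 * real n * (enorm d u) ^ 3" if "real d \<le> sqrt (real n)" for u
      using n4 X that by (intro sum_cube_dot_bound) (auto simp: not_less)
    have g5: "(enorm d (score d n \<theta>s X Y))\<^sup>2 \<le> ?t * (171 * real n)"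
      using n5 n1 X z unfolding XY by (auto simp: not_less)
    show "case z of (X, Y) \<Rightarrow> good_data d n \<theta>s C s X Y \<and> X \<in> space ?F"
      unfolding XY good_data_def using g1 g2 g3 g4 g5 X by simp
  qed
qed

section \<open>The likelihood and its minimizer\<close>

abbreviation dsig :: "real \<Rightarrow> real" where
  "dsig w \<equiv> sigmoid w * (1 - sigmoid w)"

lemma dsig_pos: "dsig w > 0"
  using sigmoid_bounds[of w] by (intro mult_pos_pos) auto

lemma dsig_le: "dsig w \<le> 1 / 4"
proof -
  have "0 \<le> (sigmoid w - 1 / 2)\<^sup>2" by simp
  then show ?thesis by (simp add: power2_eq_square algebra_simps)
qed

lemma sigmoid_minus: "sigmoid (- w) = 1 - sigmoid w"
  using one_plus_exp_pos[of w] one_plus_exp_pos[of "- w"]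
  by (simp add: sigmoid_def field_simps exp_minus)

text \<open>By symmetry w >= 0, where sigmoid w >= 1/2 and 1 + exp w <= 2 exp w.\<close>

lemma dsig_ge: "dsig w \<ge> exp (- \<bar>w\<bar>) / 4"
proof -
  have *: "dsig w \<ge> exp (- w) / 4" if "w \<ge> 0" for w :: real
  proof -
    have e: "exp w \<ge> 1" using that by simp
    have "1 / (2 * exp w) \<le> 1 / (1 + exp w)" using e one_plus_exp_pos[of w] by (intro frac_le) simp_all
    moreover have "1 - sigmoid w = 1 / (1 + exp w)"
      using one_plus_exp_pos[of w] by (simp add: sigmoid_def field_simps)
    moreover have "1 / (2 * exp w) = exp (- w) / 2" by (simp add: exp_minus field_simps)
    ultimately have 1: "1 - sigmoid w \<ge> exp (- w) / 2" by simp
    have 2: "sigmoid w \<ge> 1 / 2" using e one_plus_exp_pos[of w] by (simp add: sigmoid_def field_simps)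
    have "(1 / 2) * (exp (- w) / 2) \<le> dsig w" using 1 2 sigmoid_bounds[of w] by (intro mult_mono) auto
    then show ?thesis by simp
  qed
  show ?thesis
  proof (cases "w \<ge> 0")
    case False
    then show ?thesis using *[of "- w"] by (simp add: sigmoid_minus mult.commute)
  qed (use * in simp)
qed

text \<open>The third derivative of \<open>psi\<close> is bounded; this makes the error of the
  Hessian linear in the distance from \<open>\<theta>s\<close>.\<close>

lemma dsig_lipschitz: "\<bar>dsig a - dsig b\<bar> \<le> \<bar>a - b\<bar>"
proof -
  have D: "(dsig has_real_derivative dsig w * (1 - 2 * sigmoid w)) (at w)" for w
    by (auto intro!: derivative_eq_intros sigmoid_deriv simp: algebra_simps)
  have b: "\<bar>dsig w * (1 - 2 * sigmoid w)\<bar> \<le> 1" for w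
  proof -
    have "\<bar>dsig w\<bar> \<le> 1" using dsig_pos[of w] dsig_le[of w] by linarith
    moreover have "\<bar>1 - 2 * sigmoid w\<bar> \<le> 1" using sigmoid_bounds[of w] by (auto simp: abs_le_iff)
    ultimately show ?thesis unfolding abs_mult by (intro mult_le_one) auto
  qed
  have "norm (dsig a - dsig b) \<le> 1 * norm (a - b)"
  proof (rule field_differentiable_bound[of UNIV])
    show "norm (dsig w * (1 - 2 * sigmoid w)) \<le> 1" for w using b[of w] by simp
  qed (use D in auto)
  then show ?thesis by simp
qed

text \<open>The mean value point lies between \<open>a\<close> and \<open>b\<close>, so its distance
  to a third point \<open>c\<close> is bounded on whichever side \<open>c\<close> lies. Later
  \<open>c\<close> is the linear predictor at \<open>\<theta>s\<close>, where the Fisher matrix is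
  evaluated.\<close>

lemma sigmoid_mvt: "\<exists>t. \<bar>t - c\<bar> \<le> \<bar>a - c\<bar> + \<bar>b - c\<bar> \<and> sigmoid a - sigmoid b = dsig t * (a - b)"
proof -
  have *: "\<exists>t. min a b \<le> t \<and> t \<le> max a b \<and> sigmoid a - sigmoid b = dsig t * (a - b)" for a b :: real
  proof (cases a b rule: linorder_cases)
    case less
    from MVT2[OF less, of sigmoid dsig] sigmoid_deriv obtain z where
      "a < z" "z < b" "sigmoid b - sigmoid a = (b - a) * dsig z" by blast
    then show ?thesis by (intro exI[of _ z]) (auto simp: algebra_simps)
  next
    case greater
    from MVT2[OF greater, of sigmoid dsig] sigmoid_deriv obtain z where
      "b < z" "z < a" "sigmoid a - sigmoid b = (a - b) * dsig z" by blast
    then show ?thesis by (intro exI[of _ z]) (auto simp: mult.commute)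
  qed auto
  obtain t where t: "min a b \<le> t" "t \<le> max a b" "sigmoid a - sigmoid b = dsig t * (a - b)" using * by blast
  have "\<bar>t - c\<bar> \<le> \<bar>a - c\<bar> + \<bar>b - c\<bar>" using t(1,2) by (auto simp: min_def max_def abs_if split: if_splits)
  then show ?thesis using t(3) by blast
qed

text \<open>The three bounds below are this expansion with \<open>dsig t\<close> at least 0, at most
  1/4, and at least exp (- K)/4.\<close>

lemma psi_taylor:
  "\<exists>t. min a b \<le> t \<and> t \<le> max a b \<and> psi b = psi a + sigmoid a * (b - a) + dsig t / 2 * (b - a)\<^sup>2"
proof (cases "a = b")
  case False
  define D where "D = (\<lambda>m::nat. if m = 0 then psi else if m = 1 then sigmoid else dsig)"
  have DD: "\<forall>m t. m < 2 \<and> min a b \<le> t \<and> t \<le> max a b \<longrightarrow> (D m has_real_derivative D (Suc m) t) (at t)"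
  proof (intro allI impI)
    fix m :: nat and t assume "m < 2 \<and> min a b \<le> t \<and> t \<le> max a b"
    then have "m = 0 \<or> m = 1" by auto
    then show "(D m has_real_derivative D (Suc m) t) (at t)"
      using psi_deriv[of t] sigmoid_deriv[of t] by (auto simp: D_def)
  qed
  have "\<exists>t. (if b < a then b < t \<and> t < a else a < t \<and> t < b) \<and>
    psi b = (\<Sum>m<2. D m a / fact m * (b - a) ^ m) + D 2 t / fact 2 * (b - a)\<^sup>2"
    by (rule Taylor[OF _ _ DD]) (use False in \<open>auto simp: D_def\<close>)
  then obtain t where t: "if b < a then b < t \<and> t < a else a < t \<and> t < b"
    "psi b = (\<Sum>m<2. D m a / fact m * (b - a) ^ m) + D 2 t / fact 2 * (b - a)\<^sup>2" by blast
  have "psi b = psi a + sigmoid a * (b - a) + dsig t / 2 * (b - a)\<^sup>2"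
    using t(2) by (simp add: D_def numeral_2_eq_2)
  then show ?thesis using t(1) by (intro exI[of _ t]) (auto split: if_splits)
qed auto

lemma psi_tangent: "psi b \<ge> psi a + sigmoid a * (b - a)"
proof -
  obtain t where "psi b = psi a + sigmoid a * (b - a) + dsig t / 2 * (b - a)\<^sup>2" using psi_taylor by blast
  moreover have "dsig t / 2 * (b - a)\<^sup>2 \<ge> 0"
    using less_imp_le[OF dsig_pos[of t]] by (intro mult_nonneg_nonneg[OF divide_nonneg_nonneg]) simp_all
  ultimately show ?thesis by argo
qed

lemma psi_upper: "psi b \<le> psi a + sigmoid a * (b - a) + (b - a)\<^sup>2 / 8"
proof -
  obtain t where "psi b = psi a + sigmoid a * (b - a) + dsig t / 2 * (b - a)\<^sup>2" using psi_taylor by blast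
  moreover have "dsig t / 2 * (b - a)\<^sup>2 \<le> (1 / 4) / 2 * (b - a)\<^sup>2"
    using dsig_le[of t] by (intro mult_right_mono divide_right_mono) auto
  ultimately show ?thesis by argo
qed

lemma psi_strong:
  assumes "\<bar>a\<bar> \<le> K" "\<bar>b\<bar> \<le> K"
  shows "psi b \<ge> psi a + sigmoid a * (b - a) + exp (- K) / 4 / 2 * (b - a)\<^sup>2"
proof -
  obtain t where t: "min a b \<le> t" "t \<le> max a b" "psi b = psi a + sigmoid a * (b - a) + dsig t / 2 * (b - a)\<^sup>2"
    using psi_taylor by blast
  have "\<bar>t\<bar> \<le> K" using t(1,2) assms by (auto simp: min_def max_def abs_le_iff split: if_splits)
  then have "exp (- K) / 4 \<le> exp (- \<bar>t\<bar>) / 4" by simp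
  also have "\<dots> \<le> dsig t" by (rule dsig_ge)
  finally have "exp (- K) / 4 / 2 * (b - a)\<^sup>2 \<le> dsig t / 2 * (b - a)\<^sup>2"
    by (intro mult_right_mono divide_right_mono) auto
  then show ?thesis using t(3) by argo
qed

text \<open>After normalizing the three vectors, a b c <= (a^3 + b^3 + c^3)/3 in each term carries
  the diagonal bound over with the same constant.\<close>

lemma trilinear_bound:
  assumes cub: "\<And>u. (\<Sum>i<n. \<bar>dot d (X i) u\<bar> ^ 3) \<le> M * (enorm d u) ^ 3"
  shows "(\<Sum>i<n. \<bar>dot d (X i) x\<bar> * \<bar>dot d (X i) y\<bar> * \<bar>dot d (X i) z\<bar>) \<le> M * enorm d x * enorm d y * enorm d z"
proof (cases "enorm d x = 0 \<or> enorm d y = 0 \<or> enorm d z = 0")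
  case True
  then show ?thesis by (auto simp: enorm_eq_0_dot)
next
  case False
  let ?N = "\<lambda>u i. u i / enorm d u"
  have p: "enorm d x > 0" "enorm d y > 0" "enorm d z > 0"
    using False L2_set_nonneg[of x "{..<d}"] L2_set_nonneg[of y "{..<d}"] L2_set_nonneg[of z "{..<d}"] by linarith+
  have amgm: "a * b * c \<le> (a ^ 3 + b ^ 3 + c ^ 3) / 3" if "a \<ge> 0" "b \<ge> 0" "c \<ge> 0" for a b c :: real
  proof -
    have "a ^ 3 + b ^ 3 + c ^ 3 - 3 * (a * b * c) = (a + b + c) * ((a - b)\<^sup>2 + (b - c)\<^sup>2 + (c - a)\<^sup>2) / 2"
      by (simp add: power2_eq_square power3_eq_cube algebra_simps)
    moreover have "\<dots> \<ge> 0" using that by (intro divide_nonneg_nonneg mult_nonneg_nonneg add_nonneg_nonneg) auto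
    ultimately show ?thesis by argo
  qed
  have sp: "\<bar>dot d (X i) u\<bar> = enorm d u * \<bar>dot d (X i) (?N u)\<bar>" if "enorm d u > 0" for u i
    using normalized_vector(2)[of u d "X i"] that by (simp add: abs_mult)
  have "(\<Sum>i<n. \<bar>dot d (X i) x\<bar> * \<bar>dot d (X i) y\<bar> * \<bar>dot d (X i) z\<bar>)
    = (enorm d x * enorm d y * enorm d z) * (\<Sum>i<n. \<bar>dot d (X i) (?N x)\<bar> * \<bar>dot d (X i) (?N y)\<bar> * \<bar>dot d (X i) (?N z)\<bar>)"
    unfolding sum_distrib_left by (intro sum.cong refl) (simp only: sp[OF p(1)] sp[OF p(2)] sp[OF p(3)] mult_ac)
  also have "\<dots> \<le> (enorm d x * enorm d y * enorm d z) * M"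
  proof (rule mult_left_mono)
    have "(\<Sum>i<n. \<bar>dot d (X i) (?N x)\<bar> * \<bar>dot d (X i) (?N y)\<bar> * \<bar>dot d (X i) (?N z)\<bar>)
      \<le> (\<Sum>i<n. (\<bar>dot d (X i) (?N x)\<bar> ^ 3 + \<bar>dot d (X i) (?N y)\<bar> ^ 3 + \<bar>dot d (X i) (?N z)\<bar> ^ 3) / 3)"
      by (intro sum_mono amgm) auto
    also have "\<dots> = ((\<Sum>i<n. \<bar>dot d (X i) (?N x)\<bar> ^ 3) + (\<Sum>i<n. \<bar>dot d (X i) (?N y)\<bar> ^ 3) + (\<Sum>i<n. \<bar>dot d (X i) (?N z)\<bar> ^ 3)) / 3"
      by (simp add: sum.distrib sum_divide_distrib[symmetric])
    also have "\<dots> \<le> (M + M + M) / 3"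
    proof -
      have "(\<Sum>i<n. \<bar>dot d (X i) (?N u)\<bar> ^ 3) \<le> M" if "enorm d u > 0" for u
        using cub[of "?N u"] normalized_vector(1)[of u d] that by simp
      then show ?thesis using p by (intro divide_right_mono add_mono) auto
    qed
    finally show "(\<Sum>i<n. \<bar>dot d (X i) (?N x)\<bar> * \<bar>dot d (X i) (?N y)\<bar> * \<bar>dot d (X i) (?N z)\<bar>) \<le> M" by simp
  qed (use p in simp)
  finally show ?thesis by (simp add: mult_ac)
qed

lemma enorm_le_dual:
  assumes "M \<ge> 0" "\<And>u. dot d v u \<le> M * enorm d u"
  shows "enorm d v \<le> M"
proof (cases "enorm d v = 0")
  case False
  then have "enorm d v > 0" using L2_set_nonneg[of v "{..<d}"] by linarith
  then show ?thesis using assms(2)[of v] by (simp add: dot_self power2_eq_square)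
qed (use assms(1) in simp)

section \<open>Deterministic analysis of a fixed good sample\<close>

locale logistic_sample =
  fixes d n :: nat and \<theta>s :: "nat \<Rightarrow> real" and C s :: real
    and X :: "nat \<Rightarrow> nat \<Rightarrow> real" and Y :: "nat \<Rightarrow> bool"
  assumes n: "n \<ge> 1" and d: "d \<ge> 1" and C: "C > 0" and \<theta>s: "\<theta>s \<in> Rspace d" and s: "s \<ge> 12"
    and good: "good_data d n \<theta>s C s X Y"
begin

text \<open>
  \<open>L\<close> is \<open>n\<close> times the normalized negative log likelihood, \<open>U\<close> its gradient, and \<open>H\<close> its second
  derivative at \<open>\<theta>s\<close>, that is the quadratic form of \<open>n F*\<close>.  The constant \<open>kap\<close> bounds \<open>H / n\<close> from
  below: for each direction at least half of the samples have \<open>|X\<^sub>i \<cdot> \<theta>s| \<le> 9 C\<close> and a component of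
  size at least \<open>small_thr\<close>.
\<close>

definition kap :: real where
  "kap = exp (- (9 * C + 1)) / 8 * small_thr\<^sup>2"

definition sig :: real where
  "sig = sqrt (real d / real n)"

definition L :: "(nat \<Rightarrow> real) \<Rightarrow> real" where
  "L \<theta> = (\<Sum>i<n. psi (dot d (X i) \<theta>) - of_bool (Y i) * dot d (X i) \<theta>)"

definition U :: "(nat \<Rightarrow> real) \<Rightarrow> nat \<Rightarrow> real" where
  "U \<theta> j = (\<Sum>i<n. (sigmoid (dot d (X i) \<theta>) - of_bool (Y i)) * X i j)"

definition H :: "(nat \<Rightarrow> real) \<Rightarrow> (nat \<Rightarrow> real) \<Rightarrow> real" where
  "H x y = (\<Sum>i<n. dsig (dot d (X i) \<theta>s) * (dot d (X i) x * dot d (X i) y))"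

lemma kap_pos: "kap > 0"
  using small_thr_pos by (simp add: kap_def)

lemma sig_pos: "sig > 0"
  using n d by (simp add: sig_def)

lemma sig_sq: "real n * sig\<^sup>2 = real d"
  using n by (simp add: sig_def)

lemma op: "(\<Sum>i<n. (dot d (X i) u)\<^sup>2) \<le> 171 * real n * (enorm d u)\<^sup>2"
  using good by (simp add: good_data_def)

lemma L_neg_loglik: "real n * neg_loglik d n X Y \<theta> = L \<theta>"
  using n by (simp add: neg_loglik_def L_def)

lemma dot_U: "dot d (U \<theta>) h = (\<Sum>i<n. (sigmoid (dot d (X i) \<theta>) - of_bool (Y i)) * dot d (X i) h)"
proof -
  have "dot d (U \<theta>) h = (\<Sum>j<d. \<Sum>i<n. (sigmoid (dot d (X i) \<theta>) - of_bool (Y i)) * (X i j * h j))"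
    unfolding dot_def[of d "U \<theta>"] U_def sum_distrib_right by (simp add: mult.assoc)
  also have "\<dots> = (\<Sum>i<n. \<Sum>j<d. (sigmoid (dot d (X i) \<theta>) - of_bool (Y i)) * (X i j * h j))"
    by (rule sum.swap)
  finally show ?thesis unfolding dot_def[of d _ h] sum_distrib_left .
qed

lemma L_expand:
  "L \<theta>' - L \<theta> - dot d (U \<theta>) (\<lambda>i. \<theta>' i - \<theta> i)
   = (\<Sum>i<n. psi (dot d (X i) \<theta>') - psi (dot d (X i) \<theta>) - sigmoid (dot d (X i) \<theta>) * (dot d (X i) \<theta>' - dot d (X i) \<theta>))"
  unfolding dot_U L_def dot_diff_right sum_subtractf[symmetric] by (intro sum.cong refl) (simp add: algebra_simps)

lemma L_tangent: "L \<theta>' \<ge> L \<theta> + dot d (U \<theta>) (\<lambda>i. \<theta>' i - \<theta> i)"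
proof -
  have "0 \<le> (\<Sum>i<n. psi (dot d (X i) \<theta>') - psi (dot d (X i) \<theta>) - sigmoid (dot d (X i) \<theta>) * (dot d (X i) \<theta>' - dot d (X i) \<theta>))"
    using psi_tangent by (intro sum_nonneg) (simp add: algebra_simps)
  then show ?thesis using L_expand[of \<theta>' \<theta>] by linarith
qed

text \<open>171/8, from the second moment bound and \<open>dsig\<close> <= 1/4, is rounded up to
  22.\<close>

lemma L_upper: "L \<theta>' \<le> L \<theta> + dot d (U \<theta>) (\<lambda>i. \<theta>' i - \<theta> i) + 22 * real n * (enorm d (\<lambda>i. \<theta>' i - \<theta> i))\<^sup>2"
proof -
  have "(\<Sum>i<n. psi (dot d (X i) \<theta>') - psi (dot d (X i) \<theta>) - sigmoid (dot d (X i) \<theta>) * (dot d (X i) \<theta>' - dot d (X i) \<theta>))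
    \<le> (\<Sum>i<n. (dot d (X i) (\<lambda>i. \<theta>' i - \<theta> i))\<^sup>2 / 8)"
  proof (rule sum_mono)
    fix i
    show "psi (dot d (X i) \<theta>') - psi (dot d (X i) \<theta>) - sigmoid (dot d (X i) \<theta>) * (dot d (X i) \<theta>' - dot d (X i) \<theta>)
      \<le> (dot d (X i) (\<lambda>i. \<theta>' i - \<theta> i))\<^sup>2 / 8"
      using psi_upper[of "dot d (X i) \<theta>'" "dot d (X i) \<theta>"] unfolding dot_diff_right by argo
  qed
  also have "\<dots> = (\<Sum>i<n. (dot d (X i) (\<lambda>i. \<theta>' i - \<theta> i))\<^sup>2) / 8" by (simp add: sum_divide_distrib)
  also have "\<dots> \<le> 171 * real n * (enorm d (\<lambda>i. \<theta>' i - \<theta> i))\<^sup>2 / 8" by (intro divide_right_mono op) auto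
  also have "\<dots> \<le> 22 * real n * (enorm d (\<lambda>i. \<theta>' i - \<theta> i))\<^sup>2"
    using mult_nonneg_nonneg[of "real n" "(enorm d (\<lambda>i. \<theta>' i - \<theta> i))\<^sup>2"] by (simp add: mult.assoc)
  finally show ?thesis using L_expand[of \<theta>' \<theta>] by linarith
qed

text \<open>Chebyshev at radius 1/60 loses 171/3600 <= 1/16 of the samples for each of
  \<open>a\<close> and \<open>b\<close>; with 1/8 for large predictors and 1/4 for small components,
  half of the samples remain.\<close>

lemma good_count:
  assumes h: "enorm d h = 1" and a: "enorm d a \<le> 1 / 60" and b: "enorm d b \<le> 1 / 60"
  shows "real n / 2 \<le> real (card {i\<in>{..<n}. \<bar>dot d (X i) \<theta>s\<bar> \<le> 9 * C \<and> \<bar>dot d (X i) a\<bar> \<le> 1 \<and> \<bar>dot d (X i) b\<bar> \<le> 1 \<and> small_thr \<le> \<bar>dot d (X i) h\<bar>})"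
proof -
  let ?G = "{i\<in>{..<n}. \<bar>dot d (X i) \<theta>s\<bar> \<le> 9 * C \<and> \<bar>dot d (X i) a\<bar> \<le> 1 \<and> \<bar>dot d (X i) b\<bar> \<le> 1 \<and> small_thr \<le> \<bar>dot d (X i) h\<bar>}"
  let ?B1 = "{i\<in>{..<n}. 9 * C < \<bar>dot d (X i) \<theta>s\<bar>}"
  let ?B2 = "\<lambda>a. {i\<in>{..<n}. \<bar>dot d (X i) a\<bar> > 1}"
  let ?B3 = "{i\<in>{..<n}. \<bar>dot d (X i) h\<bar> < small_thr}"
  have B2: "real (card (?B2 a)) \<le> real n / 16" if a: "enorm d a \<le> 1 / 60" for a
  proof -
    have "(\<Sum>i<n. (dot d (X i) a)\<^sup>2) \<le> 171 * real n * (enorm d a)\<^sup>2" by (rule op)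
    also have "\<dots> \<le> 171 * real n * (1 / 60)\<^sup>2" using a by (intro mult_left_mono power_mono) auto
    also have "\<dots> \<le> real n / 16" by (simp add: power2_eq_square)
    finally have "real (card (?B2 a)) \<le> real n / 16 / 1\<^sup>2" by (intro markov_count) auto
    then show ?thesis by simp
  qed
  have "{..<n} \<subseteq> ?G \<union> (?B1 \<union> (?B2 a \<union> (?B2 b \<union> ?B3)))" by force
  then have "card {..<n} \<le> card (?G \<union> (?B1 \<union> (?B2 a \<union> (?B2 b \<union> ?B3))))" by (intro card_mono) auto
  also have "\<dots> \<le> card ?G + (card ?B1 + (card (?B2 a) + (card (?B2 b) + card ?B3)))"
    by (intro order_trans[OF card_Un_le] add_mono order_refl)
  finally have "real n \<le> real (card ?G + (card ?B1 + (card (?B2 a) + (card (?B2 b) + card ?B3))))"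
    using of_nat_le_iff[where 'a = real] by simp
  then have "real n \<le> real (card ?G) + (real (card ?B1) + (real (card (?B2 a)) + (real (card (?B2 b)) + real (card ?B3))))"
    by simp
  moreover have "real (card ?B1) \<le> real n / 8" "real (card ?B3) \<le> real n / 4"
    using good h by (auto simp: good_data_def)
  ultimately show ?thesis using B2[OF a] B2[OF b] by argo
qed

text \<open>Common core of \<open>L_strong\<close> and \<open>H_lower\<close>: each of the n/2 good
  samples contributes at least exp (- (9 C + 1))/4 times \<open>small_thr\<close> squared times
  |h|^2, which is the origin of \<open>kap\<close>.\<close>

lemma sum_good_square:
  assumes a: "enorm d a \<le> 1 / 60" and b: "enorm d b \<le> 1 / 60"
    and f: "\<And>i. i < n \<Longrightarrow> 0 \<le> f i"
      "\<And>i. i < n \<Longrightarrow> \<bar>dot d (X i) \<theta>s\<bar> \<le> 9 * C \<Longrightarrow> \<bar>dot d (X i) a\<bar> \<le> 1 \<Longrightarrow> \<bar>dot d (X i) b\<bar> \<le> 1 \<Longrightarrow>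
        exp (- (9 * C + 1)) / 4 * (dot d (X i) h)\<^sup>2 \<le> f i"
  shows "kap * real n * (enorm d h)\<^sup>2 \<le> (\<Sum>i<n. f i)"
proof (cases "enorm d h = 0")
  case True
  then show ?thesis using f(1) by (auto intro!: sum_nonneg)
next
  case False
  let ?h = "\<lambda>i. h i / enorm d h"
  let ?G = "{i\<in>{..<n}. \<bar>dot d (X i) \<theta>s\<bar> \<le> 9 * C \<and> \<bar>dot d (X i) a\<bar> \<le> 1 \<and> \<bar>dot d (X i) b\<bar> \<le> 1 \<and> small_thr \<le> \<bar>dot d (X i) ?h\<bar>}"
  let ?c = "exp (- (9 * C + 1)) / 4"
  have "kap * real n * (enorm d h)\<^sup>2 = real n / 2 * (?c * ((enorm d h)\<^sup>2 * small_thr\<^sup>2))"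
    by (simp add: kap_def)
  also have "\<dots> \<le> real (card ?G) * (?c * ((enorm d h)\<^sup>2 * small_thr\<^sup>2))"
    by (intro mult_right_mono good_count normalized_vector(1)[OF False] a b) auto
  also have "\<dots> = (\<Sum>i\<in>?G. ?c * ((enorm d h)\<^sup>2 * small_thr\<^sup>2))" by simp
  also have "\<dots> \<le> (\<Sum>i\<in>?G. f i)"
  proof (rule sum_mono)
    fix i assume i: "i \<in> ?G"
    have "(enorm d h)\<^sup>2 * small_thr\<^sup>2 \<le> (enorm d h)\<^sup>2 * (dot d (X i) ?h)\<^sup>2"
      using i small_thr_pos by (intro mult_left_mono abs_le_square_iff[THEN iffD1]) auto
    also have "\<dots> = (dot d (X i) h)\<^sup>2"
      by (subst normalized_vector(2)[OF False, of "X i"]) (simp add: power_mult_distrib)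
    finally have "?c * ((enorm d h)\<^sup>2 * small_thr\<^sup>2) \<le> ?c * (dot d (X i) h)\<^sup>2" by (intro mult_left_mono) auto
    also have "\<dots> \<le> f i" using i by (intro f(2)) auto
    finally show "?c * ((enorm d h)\<^sup>2 * small_thr\<^sup>2) \<le> f i" .
  qed
  also have "\<dots> \<le> (\<Sum>i<n. f i)" using f(1) by (intro sum_mono2) auto
  finally show ?thesis .
qed

text \<open>Taking the displacements of both points from \<open>\<theta>s\<close> as
  \<open>a\<close> and \<open>b\<close> bounds both predictors by 9 C + 1 on the good samples. The
  factor 2 in \<open>?f\<close> undoes the 1/2 of the Taylor remainder.\<close>

lemma L_strong:
  assumes t: "enorm d (\<lambda>i. \<theta> i - \<theta>s i) \<le> 1 / 60" and t': "enorm d (\<lambda>i. \<theta>' i - \<theta>s i) \<le> 1 / 60"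
  shows "L \<theta>' \<ge> L \<theta> + dot d (U \<theta>) (\<lambda>i. \<theta>' i - \<theta> i) + kap / 2 * real n * (enorm d (\<lambda>i. \<theta>' i - \<theta> i))\<^sup>2"
proof -
  let ?h = "\<lambda>i. \<theta>' i - \<theta> i"
  let ?f = "\<lambda>i. 2 * (psi (dot d (X i) \<theta>') - psi (dot d (X i) \<theta>) - sigmoid (dot d (X i) \<theta>) * (dot d (X i) \<theta>' - dot d (X i) \<theta>))"
  have "kap * real n * (enorm d ?h)\<^sup>2 \<le> (\<Sum>i<n. ?f i)"
  proof (rule sum_good_square[OF t t'])
    fix i
    show "0 \<le> ?f i" using psi_tangent[of "dot d (X i) \<theta>" "dot d (X i) \<theta>'"] by argo
    assume b: "\<bar>dot d (X i) \<theta>s\<bar> \<le> 9 * C" "\<bar>dot d (X i) (\<lambda>i. \<theta> i - \<theta>s i)\<bar> \<le> 1" "\<bar>dot d (X i) (\<lambda>i. \<theta>' i - \<theta>s i)\<bar> \<le> 1"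
    have "\<bar>dot d (X i) \<theta>\<bar> \<le> 9 * C + 1" "\<bar>dot d (X i) \<theta>'\<bar> \<le> 9 * C + 1"
      using b unfolding dot_diff_right by linarith+
    from psi_strong[OF this] show "exp (- (9 * C + 1)) / 4 * (dot d (X i) ?h)\<^sup>2 \<le> ?f i"
      unfolding dot_diff_right by argo
  qed
  then show ?thesis using L_expand[of \<theta>' \<theta>] unfolding sum_distrib_left[symmetric] by argo
qed

lemma H_lower: "kap * real n * (enorm d h)\<^sup>2 \<le> H h h"
  unfolding H_def
proof (rule sum_good_square[of "\<lambda>_. 0" "\<lambda>_. 0"])
  fix i
  show "0 \<le> dsig (dot d (X i) \<theta>s) * (dot d (X i) h * dot d (X i) h)"
    by (rule mult_nonneg_nonneg[OF less_imp_le[OF dsig_pos] zero_le_square])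
  assume "\<bar>dot d (X i) \<theta>s\<bar> \<le> 9 * C"
  then have "exp (- (9 * C + 1)) / 4 \<le> exp (- \<bar>dot d (X i) \<theta>s\<bar>) / 4" by simp
  also have "\<dots> \<le> dsig (dot d (X i) \<theta>s)" by (rule dsig_ge)
  finally show "exp (- (9 * C + 1)) / 4 * (dot d (X i) h)\<^sup>2 \<le> dsig (dot d (X i) \<theta>s) * (dot d (X i) h * dot d (X i) h)"
    unfolding power2_eq_square by (intro mult_right_mono) auto
qed (auto simp: L2_set_def)

definition A :: "real mat" where
  "A = real n \<cdot>\<^sub>m fisher d n X \<theta>s"

lemma bf_A: "bf d A x y = H x y"
proof -
  have e: "A $$ (j, k) = (\<Sum>i<n. dsig (dot d (X i) \<theta>s) * (X i j * X i k))" if "j < d" "k < d" for j k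
    using that n by (simp add: A_def fisher_def mult.assoc)
  have "bf d A x y = (\<Sum>j<d. \<Sum>k<d. \<Sum>i<n. dsig (dot d (X i) \<theta>s) * ((X i j * x j) * (X i k * y k)))"
    unfolding bf_def by (intro sum.cong refl) (simp add: e sum_distrib_left mult_ac)
  also have "\<dots> = (\<Sum>j<d. \<Sum>i<n. \<Sum>k<d. dsig (dot d (X i) \<theta>s) * ((X i j * x j) * (X i k * y k)))"
    by (intro sum.cong refl sum.swap)
  also have "\<dots> = (\<Sum>i<n. \<Sum>j<d. \<Sum>k<d. dsig (dot d (X i) \<theta>s) * ((X i j * x j) * (X i k * y k)))"
    by (rule sum.swap)
  also have "\<dots> = H x y"
    unfolding H_def dot_def[of d _ x] dot_def[of d _ y] sum_product by (simp only: sum_distrib_left)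
  finally show ?thesis .
qed

lemma A_lower: "kap * real n * (enorm d h)\<^sup>2 \<le> bf d A h h"
  using H_lower by (simp add: bf_A)

lemma enorm_pos: "i < d \<Longrightarrow> x i \<noteq> 0 \<Longrightarrow> enorm d x > 0"
  using abs_le_enorm[of i d x] by linarith

lemma pos_def_A: "pos_def_mat d A"
proof (rule pos_def_matI)
  show "A \<in> carrier_mat d d" by (simp add: A_def fisher_def)
  show "A $$ (i, j) = A $$ (j, i)" if "i < d" "j < d" for i j
    using that by (simp add: A_def fisher_def mult_ac)
  fix x :: "nat \<Rightarrow> real" and i assume "i < d" "x i \<noteq> 0"
  then have "0 < kap * real n * (enorm d x)\<^sup>2"
    using kap_pos n enorm_pos[of i x] by (intro mult_pos_pos zero_less_power) auto
  then show "0 < bf d A x x" using A_lower[of x] by linarith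
qed

lemma pos_def_fisher: "pos_def_mat d (fisher d n X \<theta>s)"
proof (rule pos_def_matI)
  show "fisher d n X \<theta>s \<in> carrier_mat d d" by (simp add: fisher_def)
  show "fisher d n X \<theta>s $$ (i, j) = fisher d n X \<theta>s $$ (j, i)" if "i < d" "j < d" for i j
    using that by (simp add: fisher_def mult_ac)
  fix x :: "nat \<Rightarrow> real" and i assume "i < d" "x i \<noteq> 0"
  then have "0 < bf d A x x" by (rule pos_def_mat_bf_pos[OF pos_def_A])
  also have "bf d A x x = real n * bf d (fisher d n X \<theta>s) x x"
    unfolding bf_def sum_distrib_left by (intro sum.cong refl) (simp add: A_def fisher_def)
  finally show "0 < bf d (fisher d n X \<theta>s) x x" using n by (simp add: zero_less_mult_iff)
qed

text \<open>sqrt 171 rounded up to 14; n sig is sqrt (n d).\<close>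

lemma score_bound: "enorm d (U \<theta>s) \<le> 14 * s * real n * sig"
proof -
  have "enorm d (U \<theta>s) = enorm d (\<lambda>j. - 1 * score d n \<theta>s X Y j)"
    by (rule enorm_cong) (simp add: U_def score_def sum_negf[symmetric] algebra_simps)
  also have "\<dots> = enorm d (score d n \<theta>s X Y)" by (subst enorm_scale) simp
  finally have eq: "enorm d (U \<theta>s) = enorm d (score d n \<theta>s X Y)" .
  have "(enorm d (score d n \<theta>s X Y))\<^sup>2 \<le> real d * s\<^sup>2 * (171 * real n)"
    using good by (simp add: good_data_def)
  also have "\<dots> = 171 * (s * real n * sig)\<^sup>2"
    unfolding sig_sq[symmetric] by (simp add: power_mult_distrib power2_eq_square[of "real n"])
  also have "\<dots> \<le> 14\<^sup>2 * (s * real n * sig)\<^sup>2" by (intro mult_right_mono) auto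
  also have "\<dots> = (14 * s * real n * sig)\<^sup>2" by (simp add: power_mult_distrib)
  finally have le: "(enorm d (score d n \<theta>s X Y))\<^sup>2 \<le> (14 * s * real n * sig)\<^sup>2" .
  have "0 \<le> 14 * s * real n * sig"
    using s less_imp_le[OF sig_pos] by (intro mult_nonneg_nonneg) auto
  then show ?thesis unfolding eq by (rule power2_le_imp_le[OF le])
qed

lemma L_line:
  "((\<lambda>t. L (\<lambda>i\<in>{..<d}. \<theta> i + t * h i)) has_real_derivative dot d (U (\<lambda>i\<in>{..<d}. \<theta> i + t * h i)) h) (at t)"
proof -
  have e: "dot d x (\<lambda>i\<in>{..<d}. \<theta> i + t * h i) = dot d x \<theta> + t * dot d x h" for x t
    by (simp add: dot_def sum.distrib sum_distrib_left algebra_simps)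
  show ?thesis unfolding L_def dot_U e
  proof (rule DERIV_sum)
    fix i
    have "((\<lambda>t. dot d (X i) \<theta> + t * dot d (X i) h) has_real_derivative dot d (X i) h) (at t)"
      by (auto intro!: derivative_eq_intros)
    note D = this
    have "((\<lambda>t. psi (dot d (X i) \<theta> + t * dot d (X i) h)) has_real_derivative
        sigmoid (dot d (X i) \<theta> + t * dot d (X i) h) * dot d (X i) h) (at t)"
      by (rule DERIV_chain2[OF psi_deriv D])
    from DERIV_diff[OF this DERIV_cmult[OF D, of "of_bool (Y i)"]]
    show "((\<lambda>t. psi (dot d (X i) \<theta> + t * dot d (X i) h) - of_bool (Y i) * (dot d (X i) \<theta> + t * dot d (X i) h))
      has_real_derivative (sigmoid (dot d (X i) \<theta> + t * dot d (X i) h) - of_bool (Y i)) * dot d (X i) h) (at t)"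
      by (simp only: left_diff_distrib)
  qed
qed

end

section \<open>Compact balls, convexity along rays and stationarity at a minimizer\<close>

lemma enorm_triangle: "enorm d (\<lambda>i. x i - z i) \<le> enorm d (\<lambda>i. x i - y i) + enorm d (\<lambda>i. y i - z i)"
  using L2_set_triangle_ineq[of "\<lambda>i. x i - y i" "\<lambda>i. y i - z i" "{..<d}"] by simp

lemma enorm_minus_commute: "enorm d (\<lambda>i. x i - y i) = enorm d (\<lambda>i. y i - x i)"
  by (simp add: L2_set_def power2_commute)

lemma continuous_on_coord: "continuous_on S (\<lambda>x::nat \<Rightarrow> real. x i)"
  by (rule continuous_on_subset[OF continuous_on_product_coordinates]) simp

lemma continuous_on_enorm_diff: "continuous_on S (\<lambda>x. enorm d (\<lambda>i. x i - c i))"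
  unfolding L2_set_def by (intro continuous_intros continuous_on_coord)

lemma continuous_on_dot: "continuous_on S (\<lambda>x. dot d a x)"
  unfolding dot_def by (intro continuous_intros continuous_on_coord)

text \<open>Outside \<open>{..<d}\<close> the functions are \<open>undefined\<close>, so the ball is
  a closed subset of a product of intervals and singletons, and Tychonoff applies.\<close>

lemma compact_ecball: "compact (ecball d c r)"
proof -
  let ?B = "\<lambda>i. if i < d then {c i - r..c i + r} else {undefined :: real}"
  have "compactin (product_topology (\<lambda>i. euclidean) UNIV) (PiE UNIV ?B)"
    by (subst compactin_PiE) auto
  then have K: "compact (PiE UNIV ?B)" by (simp add: euclidean_product_topology)
  have "ecball d c r = PiE UNIV ?B \<inter> {x. enorm d (\<lambda>i. x i - c i) \<le> r}"
  proof (rule equalityI; rule subsetI)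
    fix x assume x: "x \<in> ecball d c r"
    have "x i \<in> ?B i" for i
    proof (cases "i < d")
      case True
      have "\<bar>x i - c i\<bar> \<le> enorm d (\<lambda>i. x i - c i)" using abs_le_enorm[OF True, of "\<lambda>i. x i - c i"] .
      also have "\<dots> \<le> r" using x by (simp add: ecball_def)
      finally show ?thesis using True by (auto simp: abs_le_iff)
    next
      case False
      then show ?thesis using x by (auto simp: ecball_def PiE_def extensional_def)
    qed
    then show "x \<in> PiE UNIV ?B \<inter> {x. enorm d (\<lambda>i. x i - c i) \<le> r}" using x by (auto simp: ecball_def)
  next
    fix x assume x: "x \<in> PiE UNIV ?B \<inter> {x. enorm d (\<lambda>i. x i - c i) \<le> r}"
    have "x i = undefined" if "\<not> i < d" for i
      using x that PiE_mem[of x UNIV ?B i] by auto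
    then show "x \<in> ecball d c r" using x by (auto simp: ecball_def PiE_def extensional_def)
  qed
  moreover have "closed {x. enorm d (\<lambda>i. x i - c i) \<le> r}"
    by (intro closed_Collect_le continuous_on_enorm_diff continuous_intros)
  ultimately show ?thesis using K by (simp add: compact_Int_closed)
qed

context logistic_sample
begin

lemma continuous_on_psi: "continuous_on S psi"
  using psi_deriv by (meson DERIV_continuous_on has_field_derivative_at_within)

lemma continuous_on_L: "continuous_on S L"
proof -
  have "continuous_on S (\<lambda>x. psi (dot d a x))" for a
    by (rule continuous_on_compose2[OF continuous_on_psi continuous_on_dot]) auto
  then show ?thesis unfolding L_def by (intro continuous_intros continuous_on_dot)
qed

text \<open>Convexity from the tangents at the intermediate point: weighted by t and 1 - t, their
  gradient terms cancel.\<close>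

lemma L_ray:
  assumes t: "0 < t" "t \<le> 1"
  shows "L (\<lambda>i\<in>{..<d}. \<theta>0 i + t * (\<theta> i - \<theta>0 i)) - L \<theta>0 \<le> t * (L \<theta> - L \<theta>0)"
proof -
  let ?w = "\<lambda>i\<in>{..<d}. \<theta>0 i + t * (\<theta> i - \<theta>0 i)"
  let ?P = "dot d (U ?w) (\<lambda>i. \<theta> i - \<theta>0 i)"
  have 1: "dot d (U ?w) (\<lambda>i. \<theta> i - ?w i) = (1 - t) * ?P"
    unfolding dot_scale_right[symmetric] by (intro dot_cong) (auto simp: algebra_simps)
  have 2: "dot d (U ?w) (\<lambda>i. \<theta>0 i - ?w i) = - t * ?P"
    unfolding dot_scale_right[symmetric] by (intro dot_cong) (auto simp: algebra_simps)
  have a: "L ?w + (1 - t) * ?P \<le> L \<theta>" using L_tangent[of ?w \<theta>] unfolding 1 .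
  have b: "L ?w - t * ?P \<le> L \<theta>0" using L_tangent[of ?w \<theta>0] unfolding 2 by simp
  have "t * (L ?w + (1 - t) * ?P) + (1 - t) * (L ?w - t * ?P) \<le> t * L \<theta> + (1 - t) * L \<theta>0"
    using a b t by (intro add_mono mult_left_mono) auto
  moreover have "t * (L ?w + (1 - t) * ?P) + (1 - t) * (L ?w - t * ?P) = L ?w" by (simp add: algebra_simps)
  ultimately show ?thesis by (simp add: algebra_simps)
qed

text \<open>Bounds known at radius \<open>r\<close> are carried outward along the ray with this
  point; the convexity inequality is multiplied by the distance to avoid a quotient.\<close>

lemma ray_point:
  assumes r: "0 < r" "r \<le> enorm d (\<lambda>i. \<theta> i - \<theta>0 i)"
  defines "w \<equiv> (\<lambda>i\<in>{..<d}. \<theta>0 i + r / enorm d (\<lambda>i. \<theta> i - \<theta>0 i) * (\<theta> i - \<theta>0 i))"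
  shows "enorm d (\<lambda>i. w i - \<theta>0 i) = r"
    "(L w - L \<theta>0) * enorm d (\<lambda>i. \<theta> i - \<theta>0 i) \<le> r * (L \<theta> - L \<theta>0)"
proof -
  let ?e = "enorm d (\<lambda>i. \<theta> i - \<theta>0 i)"
  have e: "?e > 0" using r by linarith
  have "enorm d (\<lambda>i. w i - \<theta>0 i) = enorm d (\<lambda>i. r / ?e * (\<theta> i - \<theta>0 i))"
    by (rule enorm_cong) (simp add: w_def)
  also have "\<dots> = \<bar>r / ?e\<bar> * ?e" by (rule enorm_scale)
  also have "\<dots> = r" using e r by simp
  finally show "enorm d (\<lambda>i. w i - \<theta>0 i) = r" .
  have "L w - L \<theta>0 \<le> r / ?e * (L \<theta> - L \<theta>0)"
    unfolding w_def by (rule L_ray) (use r e in auto)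
  then show "(L w - L \<theta>0) * ?e \<le> r * (L \<theta> - L \<theta>0)" using e by (simp add: field_simps)
qed

lemma U_zero:
  assumes t: "th \<in> Rspace d" and m: "\<And>\<theta>. \<theta> \<in> Rspace d \<Longrightarrow> L th \<le> L \<theta>"
  shows "dot d (U th) h = 0"
proof -
  have e: "(\<lambda>i\<in>{..<d}. th i + 0 * h i) = th" using t by (intro Rspace_eqI) auto
  have "((\<lambda>t. L (\<lambda>i\<in>{..<d}. th i + t * h i)) has_real_derivative dot d (U th) h) (at 0)"
    using L_line[of th h 0] unfolding e .
  moreover have "\<forall>t. \<bar>0 - t\<bar> < 1 \<longrightarrow> L (\<lambda>i\<in>{..<d}. th i + 0 * h i) \<le> L (\<lambda>i\<in>{..<d}. th i + t * h i)"
    unfolding e by (intro allI impI m) (simp add: restrict_PiE_iff del: restrict_apply)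
  ultimately show ?thesis by (intro DERIV_local_min[where d = 1]) auto
qed

end

section \<open>Existence, location and uniqueness of the MLE, and the growth of the likelihood
  around it\<close>

locale logistic_mle = logistic_sample +
  assumes small: "29 / kap * s * sig \<le> 1 / 120"
begin

text \<open>At this radius the quadratic term kap/2 n r1^2 = 29/2 s n sig r1 outweighs the score
  term 14 s n sig r1, so on the sphere \<open>L\<close> is at least its value at
  \<open>\<theta>s\<close>.\<close>

definition r1 :: real where
  "r1 = 29 / kap * s * sig"

lemma r1_pos: "r1 > 0"
  using kap_pos s sig_pos by (simp add: r1_def)

lemma r1_le: "r1 \<le> 1 / 120"
  using small by (simp add: r1_def)

text \<open>The compact ball contains a minimizer over the ball. On the sphere, hence by convexity
  along rays everywhere outside, \<open>L\<close> is at least its value at the centre, so this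
  minimizer is global.\<close>

lemma mle_exists:
  "\<exists>th\<in>Rspace d. enorm d (\<lambda>i. th i - \<theta>s i) \<le> r1 \<and> (\<forall>\<theta>\<in>Rspace d. L th \<le> L \<theta>)"
proof -
  have "\<theta>s \<in> ecball d \<theta>s r1" using \<theta>s r1_pos by (simp add: ecball_def L2_set_def)
  then obtain th where th: "th \<in> ecball d \<theta>s r1" "\<And>\<theta>. \<theta> \<in> ecball d \<theta>s r1 \<Longrightarrow> L th \<le> L \<theta>"
    using continuous_attains_inf[OF compact_ecball _ continuous_on_L, of d \<theta>s r1] by blast
  have "L th \<le> L \<theta>" if t: "\<theta> \<in> Rspace d" for \<theta>
  proof (cases "enorm d (\<lambda>i. \<theta> i - \<theta>s i) \<le> r1")
    case True
    then show ?thesis using t by (intro th(2)) (simp add: ecball_def)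
  next
    case False
    then have r: "r1 \<le> enorm d (\<lambda>i. \<theta> i - \<theta>s i)" by simp
    let ?w = "\<lambda>i\<in>{..<d}. \<theta>s i + r1 / enorm d (\<lambda>i. \<theta> i - \<theta>s i) * (\<theta> i - \<theta>s i)"
    note w = ray_point[OF r1_pos r]
    have "L ?w \<ge> L \<theta>s + dot d (U \<theta>s) (\<lambda>i. ?w i - \<theta>s i) + kap / 2 * real n * (enorm d (\<lambda>i. ?w i - \<theta>s i))\<^sup>2"
      using w(1) r1_le by (intro L_strong) (auto simp: L2_set_def)
    moreover have "dot d (U \<theta>s) (\<lambda>i. ?w i - \<theta>s i) \<ge> - (14 * s * real n * sig * r1)"
    proof -
      have "\<bar>dot d (U \<theta>s) (\<lambda>i. ?w i - \<theta>s i)\<bar> \<le> enorm d (U \<theta>s) * enorm d (\<lambda>i. ?w i - \<theta>s i)" by (rule dot_le_enorm)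
      also have "\<dots> \<le> 14 * s * real n * sig * r1"
        unfolding w(1) using r1_pos by (intro mult_right_mono score_bound) auto
      finally show ?thesis by linarith
    qed
    moreover have "kap / 2 * real n * r1\<^sup>2 = 29 / 2 * s * real n * sig * r1"
      using kap_pos by (simp add: r1_def power2_eq_square field_simps)
    moreover have "14 * s * real n * sig * r1 \<le> 29 / 2 * s * real n * sig * r1"
      using s sig_pos r1_pos by (intro mult_right_mono) auto
    ultimately have "L ?w \<ge> L \<theta>s" unfolding w(1) by linarith
    then have "0 \<le> (L ?w - L \<theta>s) * enorm d (\<lambda>i. \<theta> i - \<theta>s i)" by (intro mult_nonneg_nonneg) auto
    then have "0 \<le> r1 * (L \<theta> - L \<theta>s)" using w(2) by linarith
    then have "L \<theta>s \<le> L \<theta>" using r1_pos by (simp add: zero_le_mult_iff)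
    then show ?thesis using th(2)[OF \<open>\<theta>s \<in> ecball d \<theta>s r1\<close>] by linarith
  qed
  then show ?thesis using th(1) by (intro bexI[of _ th]) (auto simp: ecball_def)
qed

definition th :: "nat \<Rightarrow> real" where
  "th = (SOME th. th \<in> Rspace d \<and> enorm d (\<lambda>i. th i - \<theta>s i) \<le> r1 \<and> (\<forall>\<theta>\<in>Rspace d. L th \<le> L \<theta>))"

lemma th: "th \<in> Rspace d" "enorm d (\<lambda>i. th i - \<theta>s i) \<le> r1" "\<theta> \<in> Rspace d \<Longrightarrow> L th \<le> L \<theta>"
  using someI_ex[of "\<lambda>th. th \<in> Rspace d \<and> enorm d (\<lambda>i. th i - \<theta>s i) \<le> r1 \<and> (\<forall>\<theta>\<in>Rspace d. L th \<le> L \<theta>)"] mle_exists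
  unfolding th_def by blast+

lemma U_th: "dot d (U th) h = 0"
  by (rule U_zero[OF th(1) th(3)])

lemma growth_near:
  assumes "enorm d (\<lambda>i. \<theta> i - \<theta>s i) \<le> 1 / 60"
  shows "kap / 2 * real n * (enorm d (\<lambda>i. \<theta> i - th i))\<^sup>2 \<le> L \<theta> - L th"
proof -
  have "enorm d (\<lambda>i. th i - \<theta>s i) \<le> 1 / 60" using th(2) r1_le by linarith
  from L_strong[OF this assms] show ?thesis unfolding U_th by linarith
qed

text \<open>\<open>r + r1 \<le> 1 / 60\<close> keeps the point at distance \<open>r\<close> from the
  MLE inside the region of strong convexity around \<open>\<theta>s\<close>; from there convexity
  carries the bound outward.\<close>

lemma growth_far:
  assumes r: "0 < r" "r + r1 \<le> 1 / 60" "r \<le> enorm d (\<lambda>i. \<theta> i - th i)"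
  shows "kap / 2 * real n * r * enorm d (\<lambda>i. \<theta> i - th i) \<le> L \<theta> - L th"
proof -
  let ?e = "enorm d (\<lambda>i. \<theta> i - th i)"
  let ?w = "\<lambda>i\<in>{..<d}. th i + r / ?e * (\<theta> i - th i)"
  note w = ray_point[OF r(1,3)]
  have "enorm d (\<lambda>i. ?w i - \<theta>s i) \<le> 1 / 60"
    using enorm_triangle[of ?w \<theta>s d th] w(1) th(2) r(2) by linarith
  from growth_near[OF this] have "kap / 2 * real n * r\<^sup>2 \<le> L ?w - L th" unfolding w(1) .
  then have "kap / 2 * real n * r\<^sup>2 * ?e \<le> (L ?w - L th) * ?e" by (intro mult_right_mono) auto
  also have "\<dots> \<le> r * (L \<theta> - L th)" by (rule w(2))
  finally have "r * (kap / 2 * real n * r * ?e) \<le> r * (L \<theta> - L th)" by (simp add: power2_eq_square mult_ac)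
  then show ?thesis using r(1) by simp
qed

lemma L_less:
  assumes t: "\<theta> \<in> Rspace d" "\<theta> \<noteq> th"
  shows "L th < L \<theta>"
proof -
  let ?e = "enorm d (\<lambda>i. \<theta> i - th i)"
  obtain i where i: "i < d" "\<theta> i \<noteq> th i" using t th(1) Rspace_eqI by blast
  then have e: "?e > 0" by (intro enorm_pos) auto
  let ?r = "min ?e (1 / 120)"
  have "kap / 2 * real n * ?r * ?e \<le> L \<theta> - L th"
    using e r1_le by (intro growth_far) auto
  moreover have "kap / 2 * real n * ?r * ?e > 0"
    using e kap_pos n by (intro mult_pos_pos) auto
  ultimately show ?thesis by linarith
qed

text \<open>Multiplying by n does not move minimizers. Since the minimizer is unique, the choice
  operator behind \<open>mle\<close> can only return it.\<close>

lemma is_arg_min_iff: "is_arg_min (neg_loglik d n X Y) (\<lambda>\<theta>. \<theta> \<in> Rspace d) \<theta> \<longleftrightarrow> \<theta> = th"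
proof -
  have lt: "neg_loglik d n X Y \<theta> < neg_loglik d n X Y \<theta>' \<longleftrightarrow> L \<theta> < L \<theta>'" for \<theta> \<theta>'
    using n by (simp add: L_neg_loglik[symmetric])
  show ?thesis unfolding is_arg_min_def lt
    using th(1,3) L_less by (metis less_le_not_le)
qed

lemma mle_unique: "mle_exists_unique d n X Y"
  unfolding mle_exists_unique_def is_arg_min_iff by simp

lemma mle_eq: "mle d n X Y = th"
  unfolding mle_def arg_min_on_def arg_min_def is_arg_min_iff by simp

lemma L_upper_th: "L \<theta> \<le> L th + 22 * real n * (enorm d (\<lambda>i. \<theta> i - th i))\<^sup>2"
  using L_upper[of \<theta> th] unfolding U_th by linarith

text \<open>Minus the gradient of the log ratio of the likelihood to the density of gamma*: the
  gradient of \<open>L\<close> minus its linearization at the MLE, with the Hessian taken at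
  \<open>\<theta>s\<close>.\<close>

definition V :: "(nat \<Rightarrow> real) \<Rightarrow> nat \<Rightarrow> real" where
  "V \<theta> j = U \<theta> j - (\<Sum>k<d. A $$ (j, k) * (\<theta> k - th k))"

lemma dot_V: "dot d (V \<theta>) u = dot d (U \<theta>) u - bf d A (\<lambda>i. \<theta> i - th i) u"
proof -
  have "dot d (V \<theta>) u = dot d (U \<theta>) u - bf d A u (\<lambda>i. \<theta> i - th i)"
    unfolding dot_def V_def bf_def sum_subtractf[symmetric]
    by (intro sum.cong refl) (simp add: right_diff_distrib sum_distrib_left mult_ac)
  also have "bf d A u (\<lambda>i. \<theta> i - th i) = bf d A (\<lambda>i. \<theta> i - th i) u"
    using pos_def_A by (intro bf_commute) (auto simp: pos_def_mat_def)
  finally show ?thesis .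
qed

text \<open>The gradient at the MLE vanishes and can be subtracted. By the mean value theorem each
  sample then contributes (dsig t - dsig z)(x - y), with x, y, z the predictors at
  \<open>\<theta>\<close>, the MLE and \<open>\<theta>s\<close>; the Lipschitz bound turns this into
  products of three linear forms, for which the third moments are made.\<close>

lemma V_bound:
  assumes dn: "real d \<le> sqrt (real n)"
  shows "enorm d (V \<theta>) \<le> 4438 * real n * (enorm d (\<lambda>i. \<theta> i - \<theta>s i) + enorm d (\<lambda>i. th i - \<theta>s i)) * enorm d (\<lambda>i. \<theta> i - th i)"
proof (rule enorm_le_dual)
  fix u
  let ?a = "\<lambda>i. \<theta> i - \<theta>s i" and ?b = "\<lambda>i. th i - \<theta>s i" and ?h = "\<lambda>i. \<theta> i - th i"
  have cub: "(\<Sum>i<n. \<bar>dot d (X i) u\<bar> ^ 3) \<le> 4438 * real n * (enorm d u) ^ 3" for u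
    using good dn by (simp add: good_data_def)
  have "dot d (V \<theta>) u = dot d (U \<theta>) u - dot d (U th) u - H ?h u"
    unfolding dot_V bf_A U_th by simp
  also have "\<dots> = (\<Sum>i<n. (sigmoid (dot d (X i) \<theta>) - sigmoid (dot d (X i) th) - dsig (dot d (X i) \<theta>s) * dot d (X i) ?h) * dot d (X i) u)"
    unfolding dot_U H_def sum_subtractf[symmetric] by (intro sum.cong refl) (simp add: algebra_simps)
  also have "\<dots> \<le> (\<Sum>i<n. \<bar>dot d (X i) ?a\<bar> * \<bar>dot d (X i) ?h\<bar> * \<bar>dot d (X i) u\<bar> + \<bar>dot d (X i) ?b\<bar> * \<bar>dot d (X i) ?h\<bar> * \<bar>dot d (X i) u\<bar>)"
  proof (rule sum_mono)
    fix i
    let ?x = "dot d (X i) \<theta>" and ?y = "dot d (X i) th" and ?z = "dot d (X i) \<theta>s" and ?u = "dot d (X i) u"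
    obtain t where t: "\<bar>t - ?z\<bar> \<le> \<bar>?x - ?z\<bar> + \<bar>?y - ?z\<bar>" "sigmoid ?x - sigmoid ?y = dsig t * (?x - ?y)"
      using sigmoid_mvt by blast
    have "(sigmoid ?x - sigmoid ?y - dsig ?z * (?x - ?y)) * ?u = (dsig t - dsig ?z) * (?x - ?y) * ?u"
      unfolding t(2) by (simp add: algebra_simps)
    also have "\<dots> \<le> \<bar>(dsig t - dsig ?z) * (?x - ?y) * ?u\<bar>" by simp
    also have "\<dots> = \<bar>dsig t - dsig ?z\<bar> * \<bar>?x - ?y\<bar> * \<bar>?u\<bar>" by (simp only: abs_mult)
    also have "\<dots> \<le> (\<bar>?x - ?z\<bar> + \<bar>?y - ?z\<bar>) * \<bar>?x - ?y\<bar> * \<bar>?u\<bar>"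
      using dsig_lipschitz[of t ?z] t(1) by (intro mult_right_mono) (simp_all del: mult_le_cancel_right)
    finally show "(sigmoid ?x - sigmoid ?y - dsig ?z * dot d (X i) ?h) * ?u
      \<le> \<bar>dot d (X i) ?a\<bar> * \<bar>dot d (X i) ?h\<bar> * \<bar>?u\<bar> + \<bar>dot d (X i) ?b\<bar> * \<bar>dot d (X i) ?h\<bar> * \<bar>?u\<bar>"
      unfolding dot_diff_right by (simp only: distrib_right)
  qed
  also have "\<dots> \<le> 4438 * real n * enorm d ?a * enorm d ?h * enorm d u + 4438 * real n * enorm d ?b * enorm d ?h * enorm d u"
    unfolding sum.distrib by (intro add_mono trilinear_bound cub)
  finally show "dot d (V \<theta>) u \<le> 4438 * real n * (enorm d ?a + enorm d ?b) * enorm d ?h * enorm d u"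
    by (simp add: algebra_simps)
qed (auto intro!: mult_nonneg_nonneg add_nonneg_nonneg)

end

section \<open>Total variation bounds\<close>

text \<open>Here \<open>p\<close> is the posterior, \<open>q\<close> is gamma*, \<open>h\<close> the
  cutoff and \<open>g\<close> the density of the cut-off posterior, of mass m. Then P(B) - Q(B) is
  the mass cut off within B, plus the integral of g - m over B, minus Q(B) (1 - m). Jensen bounds
  the mean of |g - m| by the double integral, and 1 - m is at most \<open>T\<close>.\<close>

lemma tv_dist_le:
  fixes M :: "'a measure" and p q g h :: "'a \<Rightarrow> real"
  assumes P: "prob_space (density M (\<lambda>x. ennreal (p x)))" and Q: "prob_space (density M (\<lambda>x. ennreal (q x)))"
    and pm [measurable]: "p \<in> borel_measurable M" and qm [measurable]: "q \<in> borel_measurable M"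
    and gm [measurable]: "g \<in> borel_measurable M" and cm [measurable]: "h \<in> borel_measurable M"
    and pos: "\<And>x. x \<in> space M \<Longrightarrow> 0 \<le> p x" "\<And>x. x \<in> space M \<Longrightarrow> 0 \<le> q x"
    and g: "\<And>x. x \<in> space M \<Longrightarrow> 0 \<le> g x"
    and chi: "\<And>x. x \<in> space M \<Longrightarrow> 0 \<le> h x" "\<And>x. x \<in> space M \<Longrightarrow> h x \<le> 1"
    and eq: "\<And>x. x \<in> space M \<Longrightarrow> g x * q x = h x * p x"
    and T: "(\<integral>\<^sup>+x. ennreal (1 - h x) \<partial>density M (\<lambda>x. ennreal (p x))) \<le> ennreal T" "T \<ge> 0"
    and D: "(\<integral>\<^sup>+x. \<integral>\<^sup>+y. ennreal \<bar>g x - g y\<bar> \<partial>density M (\<lambda>x. ennreal (q x)) \<partial>density M (\<lambda>x. ennreal (q x))) \<le> ennreal D" "D \<ge> 0"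
  shows "tv_dist (density M (\<lambda>x. ennreal (p x))) (density M (\<lambda>x. ennreal (q x))) \<le> 2 * T + D"
proof -
  let ?P = "density M (\<lambda>x. ennreal (p x))" and ?Q = "density M (\<lambda>x. ennreal (q x))"
  interpret P: prob_space ?P by fact
  interpret Q: prob_space ?Q by fact
  have c1: "integrable ?P (\<lambda>x. 1 - h x)"
    by (rule P.integrable_const_bound[of _ 1]) (use chi in auto)
  have c2: "integrable ?P h"
    by (rule P.integrable_const_bound[of _ 1]) (use chi in auto)
  have gi: "integrable ?Q g"
  proof -
    have "integrable M (\<lambda>x. p x *\<^sub>R h x)"
      using c2 pos by (subst (asm) integrable_density) auto
    then have "integrable M (\<lambda>x. q x *\<^sub>R g x)"
      by (rule Bochner_Integration.integrable_cong[THEN iffD1, rotated 2]) (use eq in \<open>auto simp: mult.commute\<close>)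
    then show ?thesis using pos by (subst integrable_density) auto
  qed
  have tail: "(LINT x|?P. 1 - h x) \<le> T"
  proof -
    have "ennreal (LINT x|?P. 1 - h x) = (\<integral>\<^sup>+x. ennreal (1 - h x) \<partial>?P)"
      using c1 chi by (intro nn_integral_eq_integral[symmetric]) auto
    then show ?thesis using T by (metis ennreal_le_iff)
  qed
  define m where "m = (LINT x|?Q. g x)"
  have set_eq: "(LINT x|?P. indicator B x * h x) = (LINT x|?Q. indicator B x * g x)" if "B \<in> sets M" for B
  proof -
    have "(LINT x|?P. indicator B x * h x) = (LINT x|M. p x *\<^sub>R (indicator B x * h x))"
      using pos that by (intro integral_density) auto
    also have "\<dots> = (LINT x|M. q x *\<^sub>R (indicator B x * g x))"
      by (intro Bochner_Integration.integral_cong refl) (use eq in \<open>auto simp: mult_ac\<close>)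
    also have "\<dots> = (LINT x|?Q. indicator B x * g x)"
      using pos that by (intro integral_density[symmetric]) auto
    finally show ?thesis .
  qed
  have e1: "(LINT x|?P. indicator (space M) x * h x) = (LINT x|?P. h x)"
    by (intro Bochner_Integration.integral_cong refl) simp
  have e2: "(LINT x|?Q. indicator (space M) x * g x) = (LINT x|?Q. g x)"
    by (intro Bochner_Integration.integral_cong refl) simp
  have m_eq: "m = (LINT x|?P. h x)"
    using set_eq[of "space M"] unfolding m_def e1 e2 by simp
  have m1: "1 - m = (LINT x|?P. 1 - h x)" unfolding m_eq using c2 by (simp add: P.prob_space[simplified])
  have m01: "0 \<le> 1 - m" "1 - m \<le> T"
    unfolding m1 using tail chi by (auto intro!: Bochner_Integration.integral_nonneg_AE)
  have gm1: "(LINT x|?Q. \<bar>g x - m\<bar>) \<le> D"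
  proof -
    have "(\<integral>\<^sup>+x. ennreal \<bar>g x - m\<bar> \<partial>?Q) \<le> (\<integral>\<^sup>+x. \<integral>\<^sup>+y. ennreal \<bar>g x - g y\<bar> \<partial>?Q \<partial>?Q)"
    proof (rule nn_integral_mono)
      fix x
      have i: "integrable ?Q (\<lambda>y. g x - g y)" using gi by simp
      have "(LINT y|?Q. g x - g y) = g x - m" unfolding m_def using gi by (simp add: Q.prob_space[simplified])
      then show "ennreal \<bar>g x - m\<bar> \<le> (\<integral>\<^sup>+y. ennreal \<bar>g x - g y\<bar> \<partial>?Q)"
        using integral_norm_bound_ennreal[OF i] by simp
    qed
    also have "\<dots> \<le> ennreal D" by (rule D(1))
    finally have "(\<integral>\<^sup>+x. ennreal \<bar>g x - m\<bar> \<partial>?Q) \<le> ennreal D" .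
    moreover have "(\<integral>\<^sup>+x. ennreal \<bar>g x - m\<bar> \<partial>?Q) = ennreal (LINT x|?Q. \<bar>g x - m\<bar>)"
      using gi by (intro nn_integral_eq_integral) auto
    ultimately show ?thesis using D(2) by simp
  qed
  show ?thesis unfolding tv_dist_def
  proof (rule cSUP_least)
    fix B assume "B \<in> sets ?P"
    then have B [measurable]: "B \<in> sets M" by simp
    have "measure ?P B = (LINT x|?P. indicator B x)" using B by simp
    also have "\<dots> = (LINT x|?P. indicator B x * (1 - h x) + indicator B x * h x)" by (simp add: algebra_simps)
    also have "\<dots> = (LINT x|?P. indicator B x * (1 - h x)) + (LINT x|?P. indicator B x * h x)"
      using B by (intro Bochner_Integration.integral_add integrable_mult_indicator[of _ _ "\<lambda>x. 1 - h x", simplified]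
        integrable_mult_indicator[of _ _ h, simplified] c1 c2) auto
    finally have 1: "measure ?P B = (LINT x|?P. indicator B x * (1 - h x)) + (LINT x|?Q. indicator B x * g x)"
      using set_eq[OF B] by simp
    have ig: "integrable ?Q (\<lambda>x. indicator B x * g x)"
      using integrable_mult_indicator[of B ?Q g] gi B by simp
    have 2: "(LINT x|?Q. indicator B x * (g x - m)) = (LINT x|?Q. indicator B x * g x) - measure ?Q B * m"
    proof -
      have ib: "integrable ?Q (\<lambda>x. indicator B x * m)"
        using integrable_mult_indicator[of B ?Q "\<lambda>_. m"] B by simp
      have "(LINT x|?Q. indicator B x * (g x - m)) = (LINT x|?Q. indicator B x * g x - indicator B x * m)"
        by (simp only: right_diff_distrib)
      also have "\<dots> = (LINT x|?Q. indicator B x * g x) - (LINT x|?Q. indicator B x * m)"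
        by (rule Bochner_Integration.integral_diff[OF ig ib])
      finally show ?thesis using B by simp
    qed
    have a: "0 \<le> (LINT x|?P. indicator B x * (1 - h x))" using chi by (intro Bochner_Integration.integral_nonneg_AE) auto
    have "(LINT x|?P. indicator B x * (1 - h x)) \<le> (LINT x|?P. 1 - h x)"
      using chi c1 B integrable_mult_indicator[of B ?P "\<lambda>x. 1 - h x"]
      by (intro Bochner_Integration.integral_mono) (auto simp: indicator_def)
    then have b: "(LINT x|?P. indicator B x * (1 - h x)) \<le> T" using tail by linarith
    have "\<bar>LINT x|?Q. indicator B x * (g x - m)\<bar> \<le> (LINT x|?Q. \<bar>indicator B x * (g x - m)\<bar>)"
      by (rule integral_abs_bound)
    also have "\<dots> \<le> (LINT x|?Q. \<bar>g x - m\<bar>)"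
      using gi B integrable_mult_indicator[of B ?Q "\<lambda>x. g x - m"]
      by (intro Bochner_Integration.integral_mono) (auto simp: indicator_def)
    finally have c: "\<bar>LINT x|?Q. indicator B x * (g x - m)\<bar> \<le> D" using gm1 by linarith
    have q: "0 \<le> measure ?Q B * (1 - m)" using m01 by simp
    have q': "measure ?Q B * (1 - m) \<le> 1 * T"
      by (rule mult_mono[OF Q.prob_le_1 m01(2)]) (use m01 in auto)
    have "measure ?P B - measure ?Q B = (LINT x|?P. indicator B x * (1 - h x))
       + (LINT x|?Q. indicator B x * (g x - m)) - measure ?Q B * (1 - m)"
      unfolding 1 2 by (simp add: algebra_simps)
    then show "\<bar>measure ?P B - measure ?Q B\<bar> \<le> 2 * T + D" using a b c q q' by linarith
  qed auto
qed

section \<open>Differentiation along curves and the oscillation of the log prior\<close>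

lemma tendsto_fun:
  fixes f :: "'a \<Rightarrow> nat \<Rightarrow> real"
  assumes "\<And>i. ((\<lambda>x. f x i) \<longlongrightarrow> l i) F"
  shows "(f \<longlongrightarrow> l) F"
proof -
  have "limitin (product_topology (\<lambda>i. euclidean) UNIV) f l F"
    using assms by (simp add: limitin_componentwise)
  then show ?thesis by (simp add: euclidean_product_topology)
qed

text \<open>Chain rule: the increment is its linear part plus \<open>r\<close> times the length of
  the displacement. After division by u - t the length becomes a convergent quotient up to a sign,
  and \<open>r\<close> tends to 0.\<close>

lemma C1_on_path_deriv:
  assumes C1: "C1_on d f S" and S: "c t \<in> S" and R: "\<And>u. c u \<in> Rspace d"
    and c: "\<And>i. i < d \<Longrightarrow> ((\<lambda>u. c u i) has_real_derivative c' i) (at t)"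
  shows "((\<lambda>u. f (c u)) has_real_derivative dot d (grad d f (c t)) c') (at t)"
proof -
  let ?x = "c t" and ?G = "grad d f (c t)"
  define r where "r = (\<lambda>y. (f y - f ?x - dot d ?G (\<lambda>i. y i - ?x i)) / enorm d (\<lambda>i. y i - ?x i))"
  have "(r \<longlongrightarrow> 0) (at ?x within Rspace d)" using C1 S unfolding C1_on_def r_def by blast
  \<comment> \<open>The quotient at the point itself is 0/0 = 0 by convention, which agrees with its
    limit.\<close>
  moreover have "r ?x = 0" by (simp add: r_def L2_set_def)
  ultimately have rc: "continuous (at ?x within Rspace d) r" by (simp add: continuous_within)
  have lim: "(c \<longlongrightarrow> ?x) (at t)"
  proof (rule tendsto_fun)
    fix i
    show "((\<lambda>u. c u i) \<longlongrightarrow> c t i) (at t)"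
    proof (cases "i < d")
      case True
      then show ?thesis using DERIV_isCont[OF c[OF True]] by (simp add: isCont_def)
    next
      case False
      then have "c u i = undefined" for u using R[of u] by (auto simp: PiE_def extensional_def)
      then show ?thesis by simp
    qed
  qed
  have "((\<lambda>u. r (c u)) \<longlongrightarrow> r ?x) (at t)"
    by (rule continuous_within_tendsto_compose[OF rc _ lim]) (simp add: R)
  then have r0: "((\<lambda>u. r (c u)) \<longlongrightarrow> 0) (at t)" using \<open>r ?x = 0\<close> by simp
  have q: "((\<lambda>u. (c u i - c t i) / (u - t)) \<longlongrightarrow> c' i) (at t)" if "i < d" for i
    using c[OF that] by (simp add: has_field_derivative_iff)
  have qe: "((\<lambda>u. enorm d (\<lambda>i. (c u i - c t i) / (u - t))) \<longlongrightarrow> enorm d c') (at t)"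
    unfolding L2_set_def by (intro tendsto_intros q) auto
  \<comment> \<open>The norm of the difference quotient is a length divided by |u - t|, so the sign
    of u - t has to be restored.\<close>
  have fe: "(f (c u) - f (c t)) / (u - t) = dot d ?G (\<lambda>i. (c u i - c t i) / (u - t))
      + sgn (u - t) * (r (c u) * enorm d (\<lambda>i. (c u i - c t i) / (u - t)))" if "u \<noteq> t" for u
  proof -
    have e: "enorm d (\<lambda>i. (c u i - c t i) / (u - t)) = enorm d (\<lambda>i. c u i - c t i) / \<bar>u - t\<bar>"
      using enorm_scale[of "1 / (u - t)" "\<lambda>i. c u i - c t i" d] by simp
    have g: "dot d ?G (\<lambda>i. (c u i - c t i) / (u - t)) = dot d ?G (\<lambda>i. c u i - c t i) / (u - t)"
      using dot_scale_right[of d ?G "1 / (u - t)" "\<lambda>i. c u i - c t i"] by simp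
    have "f (c u) - f (c t) = dot d ?G (\<lambda>i. c u i - c t i) + r (c u) * enorm d (\<lambda>i. c u i - c t i)"
    proof (cases "enorm d (\<lambda>i. c u i - c t i) = 0")
      case True
      have "c u i = c t i" if "i < d" for i
        using abs_le_enorm[OF that, of "\<lambda>i. c u i - c t i"] True by simp
      then have "c u = c t" by (rule Rspace_eqI[OF R R])
      then show ?thesis using \<open>r ?x = 0\<close> by (simp add: dot_def)
    qed (simp add: r_def)
    moreover have sg: "sgn (u - t) / \<bar>u - t\<bar> = 1 / (u - t)" using that by (simp add: sgn_if minus_divide_right)
    moreover have "sgn (u - t) * (r (c u) * (enorm d (\<lambda>i. c u i - c t i) / \<bar>u - t\<bar>))
        = r (c u) * enorm d (\<lambda>i. c u i - c t i) * (sgn (u - t) / \<bar>u - t\<bar>)"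
      by (simp add: mult_ac)
    ultimately show ?thesis unfolding e g by (simp add: add_divide_distrib)
  qed
  have "((\<lambda>u. dot d ?G (\<lambda>i. (c u i - c t i) / (u - t))
      + sgn (u - t) * (r (c u) * enorm d (\<lambda>i. (c u i - c t i) / (u - t)))) \<longlongrightarrow> dot d ?G c' + 0) (at t)"
  proof (rule tendsto_add)
    show "((\<lambda>u. dot d ?G (\<lambda>i. (c u i - c t i) / (u - t))) \<longlongrightarrow> dot d ?G c') (at t)"
      unfolding dot_def by (intro tendsto_intros q) auto
    have z: "((\<lambda>u. r (c u) * enorm d (\<lambda>i. (c u i - c t i) / (u - t))) \<longlongrightarrow> 0) (at t)"
      using tendsto_mult[OF r0 qe] by simp
    show "((\<lambda>u. sgn (u - t) * (r (c u) * enorm d (\<lambda>i. (c u i - c t i) / (u - t)))) \<longlongrightarrow> 0) (at t)"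
      by (rule Lim_null_comparison[OF _ tendsto_rabs_zero[OF z]])
         (auto simp: abs_mult abs_sgn_eq intro!: eventually_mono[OF eventually_True])
  qed
  then have "((\<lambda>u. (f (c u) - f (c t)) / (u - t)) \<longlongrightarrow> dot d ?G c' + 0) (at t)"
    by (rule Lim_transform_eventually) (auto simp: eventually_at_filter fe)
  then have "((\<lambda>u. (f (c u) - f (c t)) / (u - t)) \<longlongrightarrow> dot d ?G c') (at t)" by simp
  then show ?thesis by (simp add: has_field_derivative_iff)
qed

lemma grad_ln:
  assumes C1: "C1_on d f S" and x: "x \<in> S" "x \<in> Rspace d" and pos: "f x > 0" and i: "i < d"
  shows "grad d (\<lambda>y. ln (f y)) x i = grad d f x i / f x"
proof -
  let ?c = "\<lambda>u. x(i := u)" and ?c' = "\<lambda>j. if j = i then 1 else (0::real)"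
  have e: "?c (x i) = x" by simp
  have "((\<lambda>u. f (?c u)) has_real_derivative dot d (grad d f (?c (x i))) ?c') (at (x i))"
  proof (rule C1_on_path_deriv[OF C1])
    show "?c (x i) \<in> S" using x by simp
    show "?c u \<in> Rspace d" for u using x(2) i by (auto simp: PiE_def extensional_def)
    show "((\<lambda>u. ?c u j) has_real_derivative ?c' j) (at (x i))" for j
      by (cases "j = i") (auto intro!: derivative_eq_intros)
  qed
  moreover have "dot d (grad d f x) ?c' = grad d f x i"
    using i by (simp add: dot_def if_distrib[of "\<lambda>t. _ * t"] cong: if_cong)
  ultimately have D: "((\<lambda>u. f (?c u)) has_real_derivative grad d f x i) (at (x i))" by (simp only: e)
  have "((\<lambda>u. ln (f (?c u))) has_real_derivative 1 / f (?c (x i)) * grad d f x i) (at (x i))"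
    by (rule DERIV_chain2[OF DERIV_ln_divide D]) (simp add: pos)
  then have "deriv (\<lambda>u. ln (f (?c u))) (x i) = grad d f x i / f x" by (intro DERIV_imp_deriv) simp
  then show ?thesis using i by (simp add: grad_def)
qed

lemma ecball_convex:
  assumes x: "x \<in> ecball d c r" and y: "y \<in> ecball d c r" and u: "0 \<le> u" "u \<le> 1"
  shows "lincomb d (1 - u) y u x \<in> ecball d c r"
proof -
  have "enorm d (\<lambda>i. lincomb d (1 - u) y u x i - c i) = enorm d (\<lambda>i. (1 - u) * (y i - c i) + u * (x i - c i))"
    by (rule enorm_cong) (simp add: algebra_simps)
  also have "\<dots> \<le> enorm d (\<lambda>i. (1 - u) * (y i - c i)) + enorm d (\<lambda>i. u * (x i - c i))"
    by (rule L2_set_triangle_ineq)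
  also have "\<dots> = (1 - u) * enorm d (\<lambda>i. y i - c i) + u * enorm d (\<lambda>i. x i - c i)"
    using u by (simp add: enorm_scale)
  also have "\<dots> \<le> (1 - u) * r + u * r"
    using x y u by (intro add_mono mult_left_mono) (auto simp: ecball_def)
  finally show ?thesis by (simp add: ecball_def algebra_simps)
qed

text \<open>Mean value theorem on the segment, which stays in the convex ball. It converts the
  gradient bound into control of prior ratios.\<close>

lemma ln_lipschitz_ball:
  assumes C1: "C1_on d f S" and B: "ecball d c r \<subseteq> S" and pos: "\<And>z. z \<in> Rspace d \<Longrightarrow> f z > 0"
    and gb: "\<And>z. z \<in> S \<Longrightarrow> enorm d (grad d (\<lambda>y. ln (f y)) z) \<le> \<delta>"
    and x: "x \<in> ecball d c r" and y: "y \<in> ecball d c r"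
  shows "\<bar>ln (f x) - ln (f y)\<bar> \<le> \<delta> * enorm d (\<lambda>i. x i - y i)"
proof -
  let ?p = "\<lambda>u. lincomb d (1 - u) y u x" and ?h = "\<lambda>i. x i - y i"
  have R: "?p u \<in> Rspace d" for u by (rule lincomb_in)
  have xR: "x \<in> Rspace d" and yR: "y \<in> Rspace d" using x y by (auto simp: ecball_def)
  have p1: "?p 1 = x" by (rule Rspace_eqI[OF lincomb_in xR]) simp
  have p0: "?p 0 = y" by (rule Rspace_eqI[OF lincomb_in yR]) simp
  have D: "((\<lambda>u. ln (f (?p u))) has_real_derivative dot d (grad d (\<lambda>y. ln (f y)) (?p u)) ?h) (at u within {0..1})"
    if u: "u \<in> {0..1}" for u
  proof -
    have S: "?p u \<in> S" using u B ecball_convex[OF x y, of u] by auto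
    have fp: "f (?p u) > 0" by (rule pos[OF R])
    have "((\<lambda>u. f (?p u)) has_real_derivative dot d (grad d f (?p u)) ?h) (at u)"
    proof (rule C1_on_path_deriv[where c = ?p, OF C1 S R])
      fix i assume i: "i < d"
      have "((\<lambda>u. (1 - u) * y i + u * x i) has_real_derivative x i - y i) (at u)"
        by (auto intro!: derivative_eq_intros)
      then show "((\<lambda>u. ?p u i) has_real_derivative x i - y i) (at u)" using i by simp
    qed
    then have "((\<lambda>u. ln (f (?p u))) has_real_derivative 1 / f (?p u) * dot d (grad d f (?p u)) ?h) (at u)"
      by (rule DERIV_chain2[where g = "\<lambda>u. f (?p u)" and x = u, OF DERIV_ln_divide[OF fp]])
    moreover have "1 / f (?p u) * dot d (grad d f (?p u)) ?h = dot d (grad d (\<lambda>y. ln (f y)) (?p u)) ?h"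
      unfolding dot_def sum_distrib_left
      by (intro sum.cong refl) (simp add: grad_ln[where S = S, OF C1 S R fp])
    ultimately show ?thesis by (simp add: has_field_derivative_at_within)
  qed
  have "norm (ln (f (?p 1)) - ln (f (?p 0))) \<le> \<delta> * enorm d ?h * norm (1 - 0 :: real)"
  proof (rule field_differentiable_bound[of "{0..1}" "\<lambda>u. ln (f (?p u))"])
    fix u :: real assume u: "u \<in> {0..1}"
    show "((\<lambda>u. ln (f (?p u))) has_field_derivative dot d (grad d (\<lambda>y. ln (f y)) (?p u)) ?h) (at u within {0..1})"
      by (rule D[OF u])
    have "?p u \<in> S" using u B ecball_convex[OF x y, of u] by auto
    have "\<bar>dot d (grad d (\<lambda>y. ln (f y)) (?p u)) ?h\<bar> \<le> enorm d (grad d (\<lambda>y. ln (f y)) (?p u)) * enorm d ?h"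
      by (rule dot_le_enorm)
    also have "\<dots> \<le> \<delta> * enorm d ?h" by (intro mult_right_mono gb \<open>?p u \<in> S\<close>) auto
    finally show "norm (dot d (grad d (\<lambda>y. ln (f y)) (?p u)) ?h) \<le> \<delta> * enorm d ?h" by simp
  qed auto
  then show ?thesis unfolding p0 p1 by simp
qed

section \<open>A continuously differentiable cutoff\<close>

definition possq :: "real \<Rightarrow> real" where
  "possq x = (max 0 x)\<^sup>2"

lemma possq_deriv: "(possq has_real_derivative 2 * max 0 x) (at x)"
proof (cases x "0::real" rule: linorder_cases)
  case less
  have "((\<lambda>_. 0) has_real_derivative 0) (at x)" by simp
  then have "(possq has_real_derivative 0) (at x)"
    by (rule DERIV_cong_ev[THEN iffD1, rotated 3])
      (auto simp: possq_def intro!: eventually_mono[OF eventually_nhds_in_open[of "{..<0}" x]] less)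
  then show ?thesis using less by simp
next
  case greater
  have "((\<lambda>x. x\<^sup>2) has_real_derivative 2 * x) (at x)" by (auto intro!: derivative_eq_intros)
  then have "(possq has_real_derivative 2 * x) (at x)"
    by (rule DERIV_cong_ev[THEN iffD1, rotated 3])
      (auto simp: possq_def intro!: eventually_mono[OF eventually_nhds_in_open[of "{0<..}" x]] greater)
  then show ?thesis using greater by simp
next
  case equal
  have "((\<lambda>h. possq h / h) \<longlongrightarrow> 0) (at 0)"
  proof (rule Lim_null_comparison)
    have "\<bar>possq h / h\<bar> \<le> \<bar>h\<bar>" for h :: real
      by (cases "h > 0") (auto simp: possq_def max_def power2_eq_square)
    then show "\<forall>\<^sub>F h in at 0. norm (possq h / h) \<le> \<bar>h\<bar>" by simp
    show "((\<lambda>h::real. \<bar>h\<bar>) \<longlongrightarrow> 0) (at 0)" by (rule tendsto_rabs_zero) (rule tendsto_ident_at)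
  qed
  then show ?thesis using equal by (simp add: has_field_derivative_iff possq_def)
qed

text \<open>Equal to 1 up to u = 1 and to 0 from u = 2 on. Nesting two squared positive parts gives
  a C1 transition, which matches the one derivative in the Poincare inequality.\<close>

definition cutoff :: "real \<Rightarrow> real" where
  "cutoff u = possq (1 - possq (u - 1))"

definition cutoff' :: "real \<Rightarrow> real" where
  "cutoff' u = 2 * max 0 (1 - possq (u - 1)) * (- (2 * max 0 (u - 1)))"

lemma cutoff_deriv: "(cutoff has_real_derivative cutoff' u) (at u)"
proof -
  have "((\<lambda>u. 1 - possq (u - 1)) has_real_derivative (- (2 * max 0 (u - 1)))) (at u)"
    by (auto intro!: derivative_eq_intros DERIV_chain2[OF possq_deriv])
  from DERIV_chain2[OF possq_deriv this] show ?thesis unfolding cutoff_def cutoff'_def .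
qed

lemma cutoff_range: "0 \<le> cutoff u" "cutoff u \<le> 1"
proof -
  show "0 \<le> cutoff u" by (simp add: cutoff_def possq_def)
  have "0 \<le> max 0 (1 - possq (u - 1))" "max 0 (1 - possq (u - 1)) \<le> 1" by (auto simp: possq_def)
  then show "cutoff u \<le> 1" unfolding cutoff_def possq_def[of "1 - _"] by (rule power_le_one)
qed

lemma cutoff_one: "u \<le> 1 \<Longrightarrow> cutoff u = 1" "u \<le> 1 \<Longrightarrow> cutoff' u = 0"
  by (auto simp: cutoff_def cutoff'_def possq_def)

lemma cutoff_zero:
  assumes "u \<ge> 2"
  shows "cutoff u = 0" "cutoff' u = 0"
proof -
  have "1 \<le> (u - 1)\<^sup>2" using assms by (intro one_le_power) auto
  moreover have "possq (u - 1) = (u - 1)\<^sup>2" using assms by (simp add: possq_def max_def)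
  ultimately have "max 0 (1 - possq (u - 1)) = 0" by simp
  then show "cutoff u = 0" "cutoff' u = 0" by (simp_all add: cutoff_def cutoff'_def possq_def[of "1 - _"])
qed

lemma cutoff'_le: "\<bar>cutoff' u\<bar> \<le> 4"
proof (cases "u \<ge> 2")
  case False
  then have "\<bar>max 0 (u - 1)\<bar> \<le> 1" by auto
  moreover have "\<bar>max 0 (1 - possq (u - 1))\<bar> \<le> 1" by (auto simp: possq_def)
  ultimately have "\<bar>max 0 (1 - possq (u - 1))\<bar> * \<bar>max 0 (u - 1)\<bar> \<le> 1" by (intro mult_le_one) auto
  then show ?thesis by (simp add: cutoff'_def abs_mult)
qed (simp add: cutoff_zero)

lemma measurable_cutoff [measurable]: "cutoff \<in> borel_measurable borel" "cutoff' \<in> borel_measurable borel"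
  unfolding cutoff_def cutoff'_def possq_def by measurable

section \<open>Integrals to be compared with the normalizing constant, and curve derivatives of the
  exponents\<close>

lemma nn_integral_lebesgue_R_prod:
  assumes "f \<in> borel_measurable borel"
  shows "(\<integral>\<^sup>+x. (\<Prod>i<d. f (x i)) \<partial>lebesgue_R d) = (\<integral>\<^sup>+t. f t \<partial>lborel) ^ d"
  using lborel_prod.product_nn_integral_prod[of "{..<d}" "\<lambda>_. f"] assms by simp

lemma nn_integral_exp_abs_le:
  assumes a: "a > 0"
  shows "(\<integral>\<^sup>+t. ennreal (exp (- a * \<bar>t\<bar>)) \<partial>lborel) \<le> ennreal (2 / a)"
proof -
  let ?e = "\<lambda>t. ennreal (exponential_density a t)"
  have 1: "(\<integral>\<^sup>+t. ?e t \<partial>lborel) = 1"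
    using prob_space.emeasure_space_1[OF prob_space_exponential_density[OF a]] by (simp add: emeasure_density)
  have 2: "(\<integral>\<^sup>+t. ?e (- t) \<partial>lborel) = 1"
    using nn_integral_real_affine[of ?e "- 1" 0] 1 by simp
  have pos: "exponential_density a t \<ge> 0" for t using a by (simp add: exponential_density_def)
  have pt: "exp (- a * \<bar>t\<bar>) \<le> 1 / a * (exponential_density a t + exponential_density a (- t))" for t
    using a pos[of "- t"] pos[of t] by (cases "t \<ge> 0") (auto simp: exponential_density_def field_simps)
  have "(\<integral>\<^sup>+t. ennreal (exp (- a * \<bar>t\<bar>)) \<partial>lborel) \<le> (\<integral>\<^sup>+t. ennreal (1 / a) * (?e t + ?e (- t)) \<partial>lborel)"
  proof (rule nn_integral_mono)
    fix t
    show "ennreal (exp (- a * \<bar>t\<bar>)) \<le> ennreal (1 / a) * (?e t + ?e (- t))"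
      using pt[of t] a pos by (subst ennreal_plus[symmetric], simp, simp, subst ennreal_mult[symmetric]) (auto intro!: ennreal_leI)
  qed
  also have "\<dots> = ennreal (1 / a) * ((\<integral>\<^sup>+t. ?e t \<partial>lborel) + (\<integral>\<^sup>+t. ?e (- t) \<partial>lborel))"
  proof -
    have m [measurable]: "?e \<in> borel_measurable lborel" by simp
    have m2 [measurable]: "(\<lambda>t. ?e (- t)) \<in> borel_measurable lborel"
      using measurable_compose[of uminus borel borel ?e borel] m by simp
    show ?thesis by (simp add: nn_integral_cmult nn_integral_add)
  qed
  also have "\<dots> = ennreal (1 / a) * ennreal 2" unfolding 1 2 by simp
  also have "\<dots> = ennreal (2 / a)" using a by (subst ennreal_mult[symmetric]) auto
  finally show ?thesis .
qed

lemma sum_abs_le_enorm: "(\<Sum>i<d. \<bar>x i\<bar>) \<le> sqrt (real d) * enorm d x"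
proof -
  have "(\<Sum>i<d. \<bar>1::real\<bar> * \<bar>x i\<bar>) \<le> enorm d (\<lambda>_. 1) * enorm d x" by (rule L2_set_mult_ineq)
  then show ?thesis by (simp add: L2_set_def)
qed

text \<open>Comparison with the l1 norm, which is at most sqrt d times the Euclidean one, makes the
  integrand a product. It costs a factor C^d that the tail exponent absorbs.\<close>

lemma nn_integral_exp_enorm_le:
  assumes e: "e > 0" and d: "d \<ge> 1"
  shows "(\<integral>\<^sup>+x. ennreal (exp (- e * enorm d x)) \<partial>lebesgue_R d) \<le> ennreal ((2 * sqrt (real d) / e) ^ d)"
proof -
  let ?a = "e / sqrt (real d)"
  have a: "?a > 0" using e d by simp
  have "(\<integral>\<^sup>+x. ennreal (exp (- e * enorm d x)) \<partial>lebesgue_R d) \<le> (\<integral>\<^sup>+x. (\<Prod>i<d. ennreal (exp (- ?a * \<bar>x i\<bar>))) \<partial>lebesgue_R d)"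
  proof (rule nn_integral_mono)
    fix x
    have "?a * (\<Sum>i<d. \<bar>x i\<bar>) \<le> ?a * (sqrt (real d) * enorm d x)"
      using a by (intro mult_left_mono sum_abs_le_enorm) auto
    also have "\<dots> = e * enorm d x" using d by simp
    finally have "exp (- e * enorm d x) \<le> exp (\<Sum>i<d. - ?a * \<bar>x i\<bar>)"
      unfolding sum_distrib_left[symmetric] by simp
    then show "ennreal (exp (- e * enorm d x)) \<le> (\<Prod>i<d. ennreal (exp (- ?a * \<bar>x i\<bar>)))"
      by (simp add: prod_ennreal exp_sum ennreal_leI)
  qed
  also have "\<dots> = (\<integral>\<^sup>+t. ennreal (exp (- ?a * \<bar>t\<bar>)) \<partial>lborel) ^ d"
    by (rule nn_integral_lebesgue_R_prod) measurable
  also have "\<dots> \<le> ennreal (2 / ?a) ^ d"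
    by (intro power_mono nn_integral_exp_abs_le a) auto
  also have "\<dots> = ennreal ((2 * sqrt (real d) / e) ^ d)"
    using a e by (subst ennreal_power) auto
  finally show ?thesis .
qed

lemma nn_integral_exp_enorm_square:
  assumes a: "a > 0"
  shows "(\<integral>\<^sup>+x. ennreal (exp (- a * (enorm d x)\<^sup>2 / 2)) \<partial>lebesgue_R d) = ennreal (sqrt (2 * pi / a) ^ d)"
proof -
  have "(\<integral>\<^sup>+x. ennreal (exp (- a * (enorm d x)\<^sup>2 / 2)) \<partial>lebesgue_R d)
     = (\<integral>\<^sup>+x. (\<Prod>i<d. ennreal (exp (- (a * (x i + 0)\<^sup>2 / 2)))) \<partial>lebesgue_R d)"
    by (intro nn_integral_cong) (simp add: prod_ennreal exp_sum[symmetric] L2_set_def sum_nonneg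
        sum_negf sum_divide_distrib sum_distrib_left)
  also have "\<dots> = (\<integral>\<^sup>+t. ennreal (exp (- (a * (t + 0)\<^sup>2 / 2))) \<partial>lborel) ^ d"
    by (rule nn_integral_lebesgue_R_prod) measurable
  also have "\<dots> = ennreal (sqrt (2 * pi / a) ^ d)"
    unfolding nn_integral_exp_square[OF a] using a by (intro ennreal_power) auto
  finally show ?thesis .
qed

lemma emeasure_cube:
  assumes "h \<ge> 0"
  shows "emeasure (lebesgue_R d) (PiE {..<d} (\<lambda>i. {m i - h..m i + h})) = ennreal ((2 * h) ^ d)"
  using assms by (subst lborel_prod.emeasure_PiM) (auto simp: ennreal_power)

lemma nn_integral_recentre:
  assumes [measurable]: "f \<in> borel_measurable (lebesgue_R d)"
  shows "(\<integral>\<^sup>+x. f (\<lambda>i\<in>{..<d}. x i - m i) \<partial>lebesgue_R d) = (\<integral>\<^sup>+x. f x \<partial>lebesgue_R d)"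
  using nn_integral_translate[of f d "\<lambda>i. - m i"] by simp

text \<open>The gradient is continuous on the ball, so the indicator extends it by 0; the compact
  ball is Borel in the product topology, and the identity into that topology is measurable
  coordinate by coordinate.\<close>

lemma measurable_C1_grad:
  assumes C1: "C1_on d f S" and B: "ecball d c r \<subseteq> S" and i: "i < d"
  shows "(\<lambda>x. indicator (ecball d c r) x * grad d f x i) \<in> borel_measurable (lebesgue_R d)"
proof -
  have id: "(\<lambda>x. x) \<in> lebesgue_R d \<rightarrow>\<^sub>M borel"
  proof (rule measurable_coordinatewise_then_product)
    fix j :: nat
    show "(\<lambda>x. x j) \<in> borel_measurable (lebesgue_R d)"
    proof (cases "j < d")
      case False
      have "(\<lambda>_. undefined) \<in> borel_measurable (lebesgue_R d)" by simp
      then show ?thesis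
        by (rule measurable_cong[THEN iffD1, rotated]) (use False in \<open>auto simp: space_PiM PiE_def extensional_def\<close>)
    qed measurable
  qed
  have "continuous_on (ecball d c r) (\<lambda>x. grad d f x i)"
    using C1 i B unfolding C1_on_def by (blast intro: continuous_on_subset)
  moreover have "ecball d c r \<in> sets borel" by (intro borel_compact compact_ecball)
  ultimately have "(\<lambda>x. indicator (ecball d c r) x *\<^sub>R grad d f x i) \<in> borel_measurable borel"
    by (rule borel_measurable_continuous_on_indicator[rotated])
  from measurable_compose[OF id this] show ?thesis by simp
qed

lemma measurable_dot_const [measurable]: "(\<lambda>x. dot d a x) \<in> borel_measurable (lebesgue_R d)"
  by measurable

lemma psi_measurable [measurable]: "psi \<in> borel_measurable borel"
  unfolding psi_def by measurable

context logistic_sample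
begin

lemma kap_le_1: "kap \<le> 1"
proof -
  have "small_thr \<le> 1" unfolding small_thr_def by (simp add: order_trans[of _ 1])
  then have "small_thr\<^sup>2 \<le> 1" using small_thr_pos by (simp add: power_le_one)
  moreover have "exp (- (9 * C + 1)) / 8 \<le> 1" using C by (simp add: order_trans[of _ 1])
  ultimately show ?thesis unfolding kap_def by (intro mult_le_one) auto
qed

lemma measurable_L [measurable]: "L \<in> borel_measurable (lebesgue_R d)"
proof -
  have "(\<lambda>x. psi (dot d a x)) \<in> borel_measurable (lebesgue_R d)" for a
    by (rule measurable_compose[OF measurable_dot_const psi_measurable])
  then show ?thesis unfolding L_def by (intro borel_measurable_sum borel_measurable_diff borel_measurable_times
      borel_measurable_const measurable_dot_const)
qed

lemma n_sig: "real n * sig = sqrt (real n * real d)"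
proof -
  have "real n * sig = sqrt ((real n)\<^sup>2) * sqrt (real d / real n)" by (simp add: sig_def)
  also have "\<dots> = sqrt ((real n)\<^sup>2 * (real d / real n))" by (simp only: real_sqrt_mult)
  also have "(real n)\<^sup>2 * (real d / real n) = real n * real d" using n by (simp add: power2_eq_square)
  finally show ?thesis .
qed

lemma L_path:
  assumes c: "\<And>i. i < d \<Longrightarrow> ((\<lambda>t. c t i) has_real_derivative c' i) (at t)"
  shows "((\<lambda>t. L (c t)) has_real_derivative dot d (U (c t)) c') (at t)"
proof -
  have D: "((\<lambda>t. dot d a (c t)) has_real_derivative dot d a c') (at t)" for a
    unfolding dot_def by (intro DERIV_sum DERIV_cmult c) auto
  show ?thesis unfolding L_def dot_U
  proof (rule DERIV_sum)
    fix i
    have "((\<lambda>t. psi (dot d (X i) (c t))) has_real_derivative sigmoid (dot d (X i) (c t)) * dot d (X i) c') (at t)"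
      by (rule DERIV_chain2[OF psi_deriv D])
    from DERIV_diff[OF this DERIV_cmult[OF D, of "of_bool (Y i)"]]
    show "((\<lambda>t. psi (dot d (X i) (c t)) - of_bool (Y i) * dot d (X i) (c t))
      has_real_derivative (sigmoid (dot d (X i) (c t)) - of_bool (Y i)) * dot d (X i) c') (at t)"
      by (simp only: left_diff_distrib)
  qed
qed

end

lemma bf_path:
  assumes c: "\<And>i. i < d \<Longrightarrow> ((\<lambda>t. c t i) has_real_derivative c' i) (at t)"
    and A: "A \<in> carrier_mat d d" "transpose_mat A = A"
  shows "((\<lambda>t. bf d A (\<lambda>i. c t i - m i) (\<lambda>i. c t i - m i)) has_real_derivative 2 * bf d A (\<lambda>i. c t i - m i) c') (at t)"
proof -
  let ?z = "\<lambda>t i. c t i - m i"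
  have "((\<lambda>t. bf d A (?z t) (?z t)) has_real_derivative
    (\<Sum>i<d. \<Sum>j<d. A $$ (i, j) * c' i * ?z t j + A $$ (i, j) * ?z t i * c' j)) (at t)"
    unfolding bf_def
  proof (intro DERIV_sum)
    fix i j assume "i \<in> {..<d}" "j \<in> {..<d}"
    then have "((\<lambda>t. c t i) has_real_derivative c' i) (at t)" "((\<lambda>t. c t j) has_real_derivative c' j) (at t)"
      using c by auto
    then show "((\<lambda>t. A $$ (i, j) * ?z t i * ?z t j) has_real_derivative
      A $$ (i, j) * c' i * ?z t j + A $$ (i, j) * ?z t i * c' j) (at t)"
      by (auto intro!: derivative_eq_intros)
  qed
  also have "(\<Sum>i<d. \<Sum>j<d. A $$ (i, j) * c' i * ?z t j + A $$ (i, j) * ?z t i * c' j)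
    = bf d A c' (?z t) + bf d A (?z t) c'"
    by (simp add: bf_def sum.distrib)
  also have "\<dots> = 2 * bf d A (?z t) c'" using bf_commute[OF A, of c' "?z t"] by simp
  finally show ?thesis .
qed

lemma enorm_square_path:
  assumes c: "\<And>i. i < d \<Longrightarrow> ((\<lambda>t. c t i) has_real_derivative c' i) (at t)"
  shows "((\<lambda>t. (enorm d (\<lambda>i. c t i - m i))\<^sup>2) has_real_derivative 2 * dot d (\<lambda>i. c t i - m i) c') (at t)"
proof -
  have "((\<lambda>t. \<Sum>i<d. (c t i - m i)\<^sup>2) has_real_derivative (\<Sum>i<d. 2 * ((c t i - m i) * c' i))) (at t)"
  proof (rule DERIV_sum)
    fix i assume "i \<in> {..<d}"
    then have "((\<lambda>t. c t i) has_real_derivative c' i) (at t)" using c by auto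
    then show "((\<lambda>t. (c t i - m i)\<^sup>2) has_real_derivative 2 * ((c t i - m i) * c' i)) (at t)"
      by (auto intro!: derivative_eq_intros)
  qed
  then show ?thesis by (simp add: dot_def L2_set_def sum_nonneg sum_distrib_left)
qed

section \<open>The posterior distribution\<close>

text \<open>\<open>\<delta>\<close> and \<open>M\<close> are finite stand-ins for the quantities of
  the prior. \<open>S\<close> will be the ball of radius \<open>C1 * s * sig\<close>, and the
  argument takes place in the smaller ball of radius \<open>rho\<close> inside it.\<close>

locale logistic_tv = logistic_mle +
  fixes \<pi>0 :: "(nat \<Rightarrow> real) \<Rightarrow> real" and \<delta> M :: real and S :: "(nat \<Rightarrow> real) set"
  assumes prior: "positive_prior d \<pi>0"
    and rho_small: "120 / kap * s * sig \<le> 1 / 60"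
    and C1: "C1_on d \<pi>0 S" and BS: "ecball d \<theta>s (120 / kap * s * sig) \<subseteq> S"
    and gb: "\<And>z. z \<in> S \<Longrightarrow> enorm d (grad d (\<lambda>y. ln (\<pi>0 y)) z) \<le> \<delta>" and \<delta>0: "\<delta> \<ge> 0"
    and h\<delta>: "120 / kap * \<delta> \<le> sqrt (real n * real d)"
    and M: "\<And>z. z \<in> Rspace d \<Longrightarrow> \<pi>0 z \<le> M"
begin

text \<open>120/kap is about four times the 29/kap of \<open>r1\<close>: a point within 2/5 rho of
  the MLE is then within 7/10 rho of \<open>\<theta>s\<close>, where the cutoff, which starts to
  fall at rho / sqrt 2, is still 1.\<close>

definition rho :: real where
  "rho = 120 / kap * s * sig"

lemma rho_pos: "rho > 0"
  using kap_pos s sig_pos by (simp add: rho_def)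

lemma rho_le: "rho \<le> 1 / 60"
  using rho_small by (simp add: rho_def)

lemma r1_rho: "r1 = 29 / 120 * rho"
  by (simp add: r1_def rho_def)

abbreviation z :: "(nat \<Rightarrow> real) \<Rightarrow> nat \<Rightarrow> real" where
  "z \<theta> \<equiv> (\<lambda>i. \<theta> i - th i)"

lemma sig_le_rho: "sig \<le> rho / 1000"
proof -
  have "1 * 12 \<le> 1 / kap * s"
    using kap_pos kap_le_1 s by (intro mult_mono) auto
  then have "12 * sig \<le> 1 / kap * s * sig" using sig_pos by (intro mult_right_mono) auto
  then have "120 * (12 * sig) \<le> 120 * (1 / kap * s * sig)" by (rule mult_left_mono) simp
  also have "\<dots> = rho" by (simp add: rho_def)
  finally show ?thesis using sig_pos by linarith
qed

lemma pi_pos: "\<theta> \<in> Rspace d \<Longrightarrow> \<pi>0 \<theta> > 0"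
  using prior by (simp add: positive_prior_def)

lemma pi_meas [measurable]: "\<pi>0 \<in> borel_measurable (lebesgue_R d)"
  using prior by (simp add: positive_prior_def)

lemma th_ball: "th \<in> ecball d \<theta>s rho"
  using th(1,2) r1_rho rho_pos by (simp add: ecball_def)

lemma \<theta>s_ball: "\<theta>s \<in> ecball d \<theta>s rho"
  using \<theta>s rho_pos by (simp add: ecball_def L2_set_def)

lemma pi_ratio:
  assumes "x \<in> ecball d \<theta>s rho" "y \<in> ecball d \<theta>s rho"
  shows "\<pi>0 x \<le> \<pi>0 y * exp (\<delta> * enorm d (\<lambda>i. x i - y i))"
proof -
  have "ln (\<pi>0 x) - ln (\<pi>0 y) \<le> \<delta> * enorm d (\<lambda>i. x i - y i)"
    using ln_lipschitz_ball[OF C1 _ pi_pos gb, of \<theta>s rho x y] BS assms unfolding rho_def by fastforce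
  then have "exp (ln (\<pi>0 x)) \<le> exp (ln (\<pi>0 y) + \<delta> * enorm d (\<lambda>i. x i - y i))" by simp
  moreover have "\<pi>0 x > 0" "\<pi>0 y > 0" using assms by (auto intro: pi_pos simp: ecball_def)
  ultimately show ?thesis by (simp add: exp_add)
qed

text \<open>Since n sig^2 = d, the log prior changes by at most kap d / 120 over a distance
  sig.\<close>

lemma delta_le: "\<delta> \<le> kap / 120 * (real n * sig)"
  using h\<delta> kap_pos unfolding n_sig by (simp add: field_simps)

text \<open>The posterior density up to a factor, normalized so that the likelihood part is 1 at the MLE.\<close>

definition e :: "(nat \<Rightarrow> real) \<Rightarrow> real" where
  "e \<theta> = exp (- (L \<theta> - L th)) * \<pi>0 \<theta>"

lemma e_meas [measurable]: "e \<in> borel_measurable (lebesgue_R d)"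
  unfolding e_def by measurable

lemma e_pos: "\<theta> \<in> Rspace d \<Longrightarrow> e \<theta> > 0"
  unfolding e_def using pi_pos by simp

lemma e_le: "\<theta> \<in> Rspace d \<Longrightarrow> e \<theta> \<le> \<pi>0 \<theta>"
  unfolding e_def using th(3)[of \<theta>] pi_pos[of \<theta>] by (simp add: mult_left_le_one_le)

lemma nn_e_fin: "(\<integral>\<^sup>+\<theta>. ennreal (e \<theta>) \<partial>lebesgue_R d) \<le> 1"
proof -
  have "(\<integral>\<^sup>+\<theta>. ennreal (e \<theta>) \<partial>lebesgue_R d) \<le> (\<integral>\<^sup>+\<theta>. ennreal (\<pi>0 \<theta>) \<partial>lebesgue_R d)"
    using e_le by (intro nn_integral_mono ennreal_leI) auto
  then show ?thesis using prior by (simp add: positive_prior_def)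
qed

lemma e_integrable: "integrable (lebesgue_R d) e"
proof (rule integrableI_bounded)
  have "(\<integral>\<^sup>+\<theta>. ennreal (norm (e \<theta>)) \<partial>lebesgue_R d) = (\<integral>\<^sup>+\<theta>. ennreal (e \<theta>) \<partial>lebesgue_R d)"
    using e_pos by (intro nn_integral_cong) (simp add: less_imp_le)
  also have "\<dots> < \<infinity>" using nn_e_fin by (simp add: order_le_less_trans)
  finally show "(\<integral>\<^sup>+\<theta>. ennreal (norm (e \<theta>)) \<partial>lebesgue_R d) < \<infinity>" .
qed simp

definition Z :: real where
  "Z = (LINT \<theta>|lebesgue_R d. e \<theta>)"

lemma nn_e: "(\<integral>\<^sup>+\<theta>. ennreal (e \<theta>) \<partial>lebesgue_R d) = ennreal Z"
  unfolding Z_def using e_pos by (intro nn_integral_eq_integral e_integrable) (auto intro!: AE_I2 less_imp_le)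

text \<open>The cube of half side 1 / sqrt n around the MLE lies within distance sig of it. There
  \<open>L\<close> rises by at most 22 d and the prior drops by at most a factor e^d, hence the 23;
  the remaining factor is the volume of the cube.\<close>

lemma Z_lower: "\<pi>0 th * ((2 / sqrt (real n)) ^ d * exp (- 23 * real d)) \<le> Z"
proof -
  define h where "h = 1 / sqrt (real n)"
  let ?Q = "PiE {..<d} (\<lambda>i. {th i - h..th i + h})"
  have h0: "h \<ge> 0" by (simp add: h_def)
  have Qm: "?Q \<in> sets (lebesgue_R d)" by (intro sets_PiM_I_finite) auto
  have pt: "\<pi>0 th * exp (- 23 * real d) \<le> e \<theta>" if q: "\<theta> \<in> ?Q" for \<theta>
  proof -
    have tR: "\<theta> \<in> Rspace d" using q by (auto simp: PiE_def)
    have "enorm d (\<lambda>i. \<bar>z \<theta> i\<bar>) \<le> enorm d (\<lambda>_. h)"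
    proof (rule L2_set_mono)
      fix i assume i: "i \<in> {..<d}"
      then have "\<theta> i \<in> {th i - h..th i + h}" using q by (auto simp: PiE_def Pi_def)
      then show "\<bar>z \<theta> i\<bar> \<le> h" by (auto simp: abs_le_iff)
    qed simp
    also have "enorm d (\<lambda>_. h) = sig" using h0
      by (simp add: L2_set_def h_def sig_def real_sqrt_divide real_sqrt_mult power_divide)
    finally have zs: "enorm d (z \<theta>) \<le> sig" by (simp add: enorm_abs)
    have "enorm d (\<lambda>i. \<theta> i - \<theta>s i) \<le> rho"
      using enorm_triangle[of \<theta> \<theta>s d th] zs th(2) sig_le_rho r1_rho rho_pos by linarith
    then have tb: "\<theta> \<in> ecball d \<theta>s rho" using tR by (simp add: ecball_def)
    have "real n * (enorm d (z \<theta>))\<^sup>2 \<le> real n * sig\<^sup>2" using zs by (intro mult_left_mono power_mono) auto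
    then have Lb: "L \<theta> - L th \<le> 22 * real d" using L_upper_th[of \<theta>] unfolding sig_sq by (simp add: mult.assoc)
    have "\<delta> * enorm d (\<lambda>i. th i - \<theta> i) \<le> kap / 120 * (real n * sig) * sig"
      unfolding enorm_minus_commute[of th] using delta_le \<delta>0 zs
      by (intro mult_mono) auto
    also have "\<dots> = kap / 120 * real d" unfolding sig_sq[symmetric] by (simp add: power2_eq_square)
    also have "\<dots> \<le> 1 * real d" using kap_le_1 kap_pos by (intro mult_right_mono) auto
    finally have db: "\<delta> * enorm d (\<lambda>i. th i - \<theta> i) \<le> real d" by simp
    have "\<pi>0 th \<le> \<pi>0 \<theta> * exp (real d)"
      using pi_ratio[OF th_ball tb] db pi_pos[OF tR] by (smt (verit, best) exp_le_cancel_iff mult_left_mono)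
    then have "\<pi>0 th * exp (- 23 * real d) \<le> \<pi>0 \<theta> * exp (real d) * exp (- 23 * real d)" by (rule mult_right_mono) simp
    also have "\<dots> = \<pi>0 \<theta> * exp (- (22 * real d))" by (simp add: mult.assoc exp_add[symmetric])
    also have "\<dots> \<le> \<pi>0 \<theta> * exp (- (L \<theta> - L th))" using Lb pi_pos[OF tR] by (intro mult_left_mono) auto
    finally show ?thesis by (simp add: e_def mult.commute)
  qed
  have "ennreal (\<pi>0 th * exp (- 23 * real d)) * ennreal ((2 * h) ^ d) = (\<integral>\<^sup>+\<theta>. ennreal (\<pi>0 th * exp (- 23 * real d)) * indicator ?Q \<theta> \<partial>lebesgue_R d)"
    using Qm emeasure_cube[OF h0, of d th] by (simp add: nn_integral_cmult_indicator)
  also have "\<dots> \<le> (\<integral>\<^sup>+\<theta>. ennreal (e \<theta>) \<partial>lebesgue_R d)"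
    using pt by (intro nn_integral_mono) (auto simp: indicator_def intro!: ennreal_leI)
  finally have "ennreal (\<pi>0 th * exp (- 23 * real d) * (2 * h) ^ d) \<le> ennreal Z"
    unfolding nn_e using pi_pos[OF th(1)] h0 by (simp add: ennreal_mult)
  moreover have "Z \<ge> 0" unfolding Z_def using e_pos by (intro Bochner_Integration.integral_nonneg) (auto intro: less_imp_le)
  ultimately have "\<pi>0 th * exp (- 23 * real d) * (2 * h) ^ d \<le> Z" by (simp add: ennreal_le_iff)
  then show ?thesis by (simp add: h_def mult_ac)
qed

lemma Z_pos: "Z > 0"
proof -
  have "\<pi>0 th * ((2 / sqrt (real n)) ^ d * exp (- 23 * real d)) > 0"
    using pi_pos[OF th(1)] n by simp
  then show ?thesis using Z_lower by linarith
qed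

text \<open>With \<open>M\<close> the supremum of the prior, the quotient is the exponential of d
  times M0*, and \<open>T\<close> is the last term of the bound.\<close>

definition T :: real where
  "T = M / \<pi>0 \<theta>s * exp (- (real d * (s / 12)\<^sup>2))"

lemma M_pos: "M > 0"
  using M[OF \<theta>s] pi_pos[OF \<theta>s] by linarith

lemma T_pos: "T > 0"
  using M_pos pi_pos[OF \<theta>s] by (simp add: T_def)

text \<open>The linear growth has slope \<open>2 * ?b\<close>: half of it gives the factor exp (- b
  r) with b r = 576 s^2 d / kap, half is left to be integrated. The integral is at most the volume
  factor of \<open>Z_lower\<close>, and 576 s^2 d pays for a prior ratio e^(s d), for e^(23 d) and
  for the exponent d (s/12)^2 in \<open>T\<close>.\<close>

lemma tail_mass: "(\<integral>\<^sup>+\<theta>. indicator {\<theta>. 2 / 5 * rho \<le> enorm d (z \<theta>)} \<theta> * ennreal (e \<theta>) \<partial>lebesgue_R d) \<le> ennreal (T * Z)"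
proof -
  define r where "r = 2 / 5 * rho"
  have r0: "r > 0" using rho_pos by (simp add: r_def)
  have knr: "kap * real n * r = 48 * s * (real n * sig)" using kap_pos by (simp add: r_def rho_def)
  let ?b = "kap * real n * r / 4"
  have b0: "?b > 0" using kap_pos n r0 by simp
  have pt: "indicator {\<theta>. r \<le> enorm d (z \<theta>)} \<theta> * ennreal (e \<theta>)
    \<le> ennreal (M * exp (- ?b * r)) * ennreal (exp (- ?b * enorm d (\<lambda>i\<in>{..<d}. \<theta> i - th i)))" if tR: "\<theta> \<in> Rspace d" for \<theta>
  proof (cases "r \<le> enorm d (z \<theta>)")
    case True
    have en: "enorm d (\<lambda>i\<in>{..<d}. \<theta> i - th i) = enorm d (z \<theta>)" by (rule enorm_cong) simp
    have "r + r1 \<le> 1 / 60" using rho_le rho_pos r1_rho unfolding r_def by linarith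
    from growth_far[OF r0 this True] have "2 * ?b * enorm d (z \<theta>) \<le> L \<theta> - L th" by (simp add: mult_ac)
    moreover have "?b * r \<le> ?b * enorm d (z \<theta>)" using True b0 by (intro mult_left_mono) auto
    ultimately have "- (L \<theta> - L th) \<le> - ?b * r + - ?b * enorm d (z \<theta>)" by linarith
    then have "exp (- (L \<theta> - L th)) \<le> exp (- ?b * r) * exp (- ?b * enorm d (z \<theta>))"
      unfolding exp_add[symmetric] by simp
    then have "exp (- (L \<theta> - L th)) * \<pi>0 \<theta> \<le> exp (- ?b * r) * exp (- ?b * enorm d (z \<theta>)) * M"
      using M[OF tR] pi_pos[OF tR] by (intro mult_mono) auto
    then show ?thesis unfolding e_def en using True M_pos
      by (simp add: ennreal_mult[symmetric] mult_ac ennreal_leI)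
  qed simp
  have [measurable]: "(\<lambda>\<theta>. \<lambda>i\<in>{..<d}. \<theta> i - th i) \<in> lebesgue_R d \<rightarrow>\<^sub>M lebesgue_R d"
    by (rule measurable_restrict_lebesgue_R) measurable
  have "(\<integral>\<^sup>+\<theta>. indicator {\<theta>. r \<le> enorm d (z \<theta>)} \<theta> * ennreal (e \<theta>) \<partial>lebesgue_R d)
    \<le> (\<integral>\<^sup>+\<theta>. ennreal (M * exp (- ?b * r)) * ennreal (exp (- ?b * enorm d (\<lambda>i\<in>{..<d}. \<theta> i - th i))) \<partial>lebesgue_R d)"
    using pt by (intro nn_integral_mono) auto
  also have "\<dots> = ennreal (M * exp (- ?b * r)) * (\<integral>\<^sup>+\<theta>. ennreal (exp (- ?b * enorm d (\<lambda>i\<in>{..<d}. \<theta> i - th i))) \<partial>lebesgue_R d)"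
    by (rule nn_integral_cmult) measurable
  also have "(\<integral>\<^sup>+\<theta>. ennreal (exp (- ?b * enorm d (\<lambda>i\<in>{..<d}. \<theta> i - th i))) \<partial>lebesgue_R d)
    = (\<integral>\<^sup>+\<theta>. ennreal (exp (- ?b * enorm d \<theta>)) \<partial>lebesgue_R d)"
    by (rule nn_integral_recentre[of "\<lambda>x. ennreal (exp (- ?b * enorm d x))"]) measurable
  also have "\<dots> \<le> ennreal ((2 * sqrt (real d) / ?b) ^ d)" by (rule nn_integral_exp_enorm_le[OF b0 d])
  finally have 1: "(\<integral>\<^sup>+\<theta>. indicator {\<theta>. r \<le> enorm d (z \<theta>)} \<theta> * ennreal (e \<theta>) \<partial>lebesgue_R d)
     \<le> ennreal (M * exp (- ?b * r)) * ennreal ((2 * sqrt (real d) / ?b) ^ d)" by (simp add: mult_left_mono)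
  have 2: "(2 * sqrt (real d) / ?b) ^ d \<le> (2 / sqrt (real n)) ^ d"
  proof (rule power_mono)
    have "2 * sqrt (real d) / ?b = 8 * sqrt (real d) / (48 * s * (sqrt (real n) * sqrt (real d)))"
      unfolding knr n_sig real_sqrt_mult by simp
    also have "\<dots> = (1 / (6 * s)) / sqrt (real n)" using d s by (simp add: field_simps)
    also have "\<dots> \<le> 2 / sqrt (real n)" using s by (intro divide_right_mono) (auto simp: field_simps)
    finally show "2 * sqrt (real d) / ?b \<le> 2 / sqrt (real n)" .
  qed (use b0 in simp)
  have 3: "?b * r = 576 / kap * (s\<^sup>2 * real d)"
    unfolding knr unfolding r_def rho_def sig_sq[symmetric] by (simp add: power2_eq_square)
  have 4: "exp (- ?b * r) \<le> exp (- (576 * (s\<^sup>2 * real d)))"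
  proof -
    have "576 * (s\<^sup>2 * real d) \<le> 576 / kap * (s\<^sup>2 * real d)"
      using kap_pos kap_le_1 by (intro mult_right_mono) (auto simp: field_simps)
    then have "- ?b * r \<le> - (576 * (s\<^sup>2 * real d))" using 3 by linarith
    then show ?thesis by (simp only: exp_le_cancel_iff)
  qed
  \<comment> \<open>\<open>T\<close> refers to the prior at \<open>\<theta>s\<close> but
    \<open>Z_lower\<close> to the prior at the MLE; the two points are at distance at most
    \<open>r1\<close>.\<close>
  have 5: "\<pi>0 \<theta>s \<le> \<pi>0 th * exp (s * real d)"
  proof -
    have "\<delta> * enorm d (\<lambda>i. \<theta>s i - th i) \<le> kap / 120 * (real n * sig) * r1"
      unfolding enorm_minus_commute[of \<theta>s] using delta_le \<delta>0 th(2) by (intro mult_mono) auto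
    also have "\<dots> = 29 / 120 * (s * real d)"
      unfolding r1_def sig_sq[symmetric] using kap_pos by (simp add: power2_eq_square)
    also have "\<dots> \<le> 1 * (s * real d)" using s by (intro mult_right_mono) auto
    finally have "exp (\<delta> * enorm d (\<lambda>i. \<theta>s i - th i)) \<le> exp (s * real d)" by simp
    then show ?thesis using pi_ratio[OF \<theta>s_ball th_ball] pi_pos[OF th(1)]
      by (meson mult_left_mono less_imp_le order_trans)
  qed
  have 6: "exp (- (576 * (s\<^sup>2 * real d))) * exp (s * real d) \<le> exp (- (real d * (s / 12)\<^sup>2)) * exp (- 23 * real d)"
  proof -
    have "12 * 12 \<le> s * s" "12 * s \<le> s * s" using s by (intro mult_mono; simp)+
    then have "144 \<le> s\<^sup>2" "12 * s \<le> s\<^sup>2" by (simp_all add: power2_eq_square)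
    then have "- (576 * s\<^sup>2) + s \<le> - ((s / 12)\<^sup>2) + - 23" by (simp add: power_divide)
    then have "real d * (- (576 * s\<^sup>2) + s) \<le> real d * (- ((s / 12)\<^sup>2) + - 23)" by (rule mult_left_mono) simp
    then have "- (576 * (s\<^sup>2 * real d)) + s * real d \<le> - (real d * (s / 12)\<^sup>2) + - 23 * real d"
      by (simp add: algebra_simps)
    then show ?thesis unfolding exp_add[symmetric] by simp
  qed
  have "M * exp (- ?b * r) * (2 * sqrt (real d) / ?b) ^ d \<le> M * exp (- (576 * (s\<^sup>2 * real d))) * (2 / sqrt (real n)) ^ d"
    using 2 4 M_pos b0 by (intro mult_mono) auto
  also have "\<dots> = M / \<pi>0 \<theta>s * (2 / sqrt (real n)) ^ d * (\<pi>0 \<theta>s * exp (- (576 * (s\<^sup>2 * real d))))"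
    using pi_pos[OF \<theta>s] by simp
  also have "\<dots> \<le> M / \<pi>0 \<theta>s * (2 / sqrt (real n)) ^ d * (\<pi>0 th * (exp (- (real d * (s / 12)\<^sup>2)) * exp (- 23 * real d)))"
  proof (intro mult_left_mono)
    have "\<pi>0 \<theta>s * exp (- (576 * (s\<^sup>2 * real d))) \<le> \<pi>0 th * exp (s * real d) * exp (- (576 * (s\<^sup>2 * real d)))"
      using 5 by (rule mult_right_mono) simp
    also have "\<dots> = \<pi>0 th * (exp (- (576 * (s\<^sup>2 * real d))) * exp (s * real d))" by (simp only: mult_ac)
    also have "\<dots> \<le> \<pi>0 th * (exp (- (real d * (s / 12)\<^sup>2)) * exp (- 23 * real d))"
      using 6 pi_pos[OF th(1)] by (intro mult_left_mono) auto
    finally show "\<pi>0 \<theta>s * exp (- (576 * (s\<^sup>2 * real d))) \<le> \<pi>0 th * (exp (- (real d * (s / 12)\<^sup>2)) * exp (- 23 * real d))" .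
    show "0 \<le> M / \<pi>0 \<theta>s * (2 / sqrt (real n)) ^ d" using M_pos pi_pos[OF \<theta>s] by simp
  qed
  also have "\<dots> = T * (\<pi>0 th * ((2 / sqrt (real n)) ^ d * exp (- 23 * real d)))" by (simp add: T_def mult_ac)
  also have "\<dots> \<le> T * Z" using Z_lower T_pos by (intro mult_left_mono) auto
  finally have "ennreal (M * exp (- ?b * r) * (2 * sqrt (real d) / ?b) ^ d) \<le> ennreal (T * Z)" by (rule ennreal_leI)
  then show ?thesis using 1 M_pos b0 unfolding r_def[symmetric] by (simp add: ennreal_mult)
qed

end

context logistic_tv
begin

lemma ball_measurable: "ecball d \<theta>s rho \<in> sets (lebesgue_R d)"
proof -
  have "{\<theta> \<in> space (lebesgue_R d). enorm d (\<lambda>i. \<theta> i - \<theta>s i) \<le> rho} \<in> sets (lebesgue_R d)" by measurable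
  then show ?thesis by (simp add: ecball_def)
qed

text \<open>Within 20/kap sig of the MLE the distance is bounded outright. Beyond, with w = kap n
  |z|^2, the likelihood gives exp (- w/2), the prior ratio at most exp (w/8) and |z| at most sig exp
  (w/8); of the remaining exp (- w/4) one half is at most exp (- 50 d / kap), the other is
  integrated as a Gaussian. The order sig instead of rho saves a factor s.\<close>

lemma first_moment:
  "(\<integral>\<^sup>+\<theta>. indicator (ecball d \<theta>s rho) \<theta> * ennreal (enorm d (z \<theta>) * e \<theta>) \<partial>lebesgue_R d) \<le> ennreal (21 / kap * sig * Z)"
proof -
  let ?B = "ecball d \<theta>s rho" and ?a = "kap * real n / 4"
  have a0: "?a > 0" using kap_pos n by simp
  define c where "c = sig * (\<pi>0 th * exp (- (50 / kap * real d)))"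
  have c0: "c \<ge> 0" using sig_pos pi_pos[OF th(1)] by (simp add: c_def)
  have [measurable]: "(\<lambda>\<theta>. \<lambda>i\<in>{..<d}. \<theta> i - th i) \<in> lebesgue_R d \<rightarrow>\<^sub>M lebesgue_R d"
    by (rule measurable_restrict_lebesgue_R) measurable
  have pt: "enorm d (z \<theta>) * e \<theta> \<le> 20 / kap * sig * e \<theta> + c * exp (- ?a * (enorm d (\<lambda>i\<in>{..<d}. \<theta> i - th i))\<^sup>2 / 2)"
    if B: "\<theta> \<in> ?B" for \<theta>
  proof -
    have tR: "\<theta> \<in> Rspace d" using B by (simp add: ecball_def)
    let ?y = "enorm d (z \<theta>)"
    have en: "enorm d (\<lambda>i\<in>{..<d}. \<theta> i - th i) = ?y" by (rule enorm_cong) simp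
    have y0: "?y \<ge> 0" by simp
    show ?thesis
    proof (cases "?y \<le> 20 / kap * sig")
      case True
      then have "?y * e \<theta> \<le> 20 / kap * sig * e \<theta>" using e_pos[OF tR] by (intro mult_right_mono) auto
      moreover have "0 \<le> c * exp (- ?a * (enorm d (\<lambda>i\<in>{..<d}. \<theta> i - th i))\<^sup>2 / 2)" using c0 by simp
      ultimately show ?thesis by linarith
    next
      case False
      then have y: "20 / kap * sig < ?y" by simp
      let ?w = "kap * real n * ?y\<^sup>2"
      have ys: "sig \<le> kap / 20 * ?y" using y kap_pos by (simp add: field_simps)
      have "kap / 2 * real n * ?y\<^sup>2 \<le> L \<theta> - L th"
        using B rho_le by (intro growth_near) (simp add: ecball_def)
      then have 1: "?w / 2 \<le> L \<theta> - L th" by simp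
      have "\<delta> \<le> kap / 120 * (real n * (kap / 20 * ?y))"
        by (rule order_trans[OF delta_le]) (intro mult_left_mono ys, use kap_pos in auto)
      then have "\<delta> * ?y \<le> kap / 120 * (real n * (kap / 20 * ?y)) * ?y" using y0 by (rule mult_right_mono)
      also have "\<dots> = kap / 2400 * ?w" by (simp add: power2_eq_square)
      also have "\<dots> \<le> 1 / 8 * ?w" using kap_pos kap_le_1 n by (intro mult_right_mono) auto
      finally have 2: "\<delta> * ?y \<le> ?w / 8" by simp
      \<comment> \<open>Beyond 20/kap sig, w is at least 400 d / kap; an eighth of this is the 50 d
        / kap in \<open>c\<close>.\<close>
      have sw: "real d * (20 / kap) * (20 / kap) * kap \<le> ?w"
      proof -
        have "(20 / kap * sig)\<^sup>2 \<le> ?y\<^sup>2" using y sig_pos kap_pos by (intro power_mono) auto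
        then have "kap * real n * (20 / kap * sig)\<^sup>2 \<le> ?w" using kap_pos by (intro mult_left_mono) auto
        moreover have "kap * real n * (20 / kap * sig)\<^sup>2 = kap * (20 / kap)\<^sup>2 * (real n * sig\<^sup>2)"
          by (simp only: power_mult_distrib mult_ac)
        ultimately have "kap * (20 / kap)\<^sup>2 * real d \<le> ?w" unfolding sig_sq by (simp only:)
        then show ?thesis by (simp only: power2_eq_square mult_ac)
      qed
      have 3: "50 / kap * real d \<le> ?w / 8" using sw kap_pos by (simp add: field_simps)
      \<comment> \<open>In units q of sig, w = kap q^2 d >= 20 q, hence q <= w/8 <= exp
        (w/8).\<close>
      have 4: "?y \<le> sig * exp (?w / 8)"
      proof -
        define q where "q = ?y / sig"
        have q: "q \<ge> 20 / kap" "?y = q * sig" using y sig_pos by (auto simp: q_def field_simps)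
        have q0: "q \<ge> 0" using q(1) kap_pos by (smt (verit) divide_pos_pos)
        have "20 \<le> kap * q" using q(1) kap_pos by (simp add: field_simps)
        then have "20 * q \<le> kap * q * q" using q0 by (intro mult_right_mono) auto
        moreover have "kap * q * q * 1 \<le> kap * q * q * real d" using d kap_pos q0 by (intro mult_left_mono) auto
        moreover have "?w = kap * q * q * real d"
          unfolding q(2) sig_sq[symmetric] by (simp add: power2_eq_square)
        ultimately have "q \<le> ?w / 8" using q0 by linarith
        also have "\<dots> \<le> exp (?w / 8)" using exp_ge_add_one_self[of "?w / 8"] by linarith
        finally show ?thesis unfolding q(2) using sig_pos by (simp add: mult.commute)
      qed
      have "e \<theta> \<le> exp (- (?w / 2)) * (\<pi>0 th * exp (?w / 8))"
        unfolding e_def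
      proof (rule mult_mono)
        show "\<pi>0 \<theta> \<le> \<pi>0 th * exp (?w / 8)"
          using pi_ratio[OF B th_ball] 2 pi_pos[OF th(1)] by (smt (verit, best) exp_le_cancel_iff mult_left_mono)
      qed (use 1 pi_pos[OF tR] in auto)
      then have "?y * e \<theta> \<le> sig * exp (?w / 8) * (exp (- (?w / 2)) * (\<pi>0 th * exp (?w / 8)))"
        using 4 e_pos[OF tR] sig_pos by (intro mult_mono) auto
      also have "\<dots> = sig * \<pi>0 th * (exp (?w / 8) * exp (- (?w / 2)) * exp (?w / 8))" by (simp only: mult_ac)
      also have "exp (?w / 8) * exp (- (?w / 2)) * exp (?w / 8) = exp (- (?w / 8)) * exp (- (?w / 8))"
        unfolding exp_add[symmetric] by simp
      also have "sig * \<pi>0 th * (exp (- (?w / 8)) * exp (- (?w / 8))) \<le> sig * \<pi>0 th * (exp (- (50 / kap * real d)) * exp (- (?w / 8)))"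
        using 3 sig_pos pi_pos[OF th(1)] by (intro mult_left_mono mult_right_mono) auto
      also have "\<dots> = c * exp (- ?a * ?y\<^sup>2 / 2)" by (simp add: c_def)
      finally have "?y * e \<theta> \<le> c * exp (- ?a * ?y\<^sup>2 / 2)" .
      moreover have "0 \<le> 20 / kap * sig * e \<theta>" using e_pos[OF tR] kap_pos sig_pos by simp
      ultimately show ?thesis unfolding en by linarith
    qed
  qed
  have "(\<integral>\<^sup>+\<theta>. indicator ?B \<theta> * ennreal (enorm d (z \<theta>) * e \<theta>) \<partial>lebesgue_R d)
    \<le> (\<integral>\<^sup>+\<theta>. ennreal (20 / kap * sig) * ennreal (e \<theta>) + ennreal c * ennreal (exp (- ?a * (enorm d (\<lambda>i\<in>{..<d}. \<theta> i - th i))\<^sup>2 / 2)) \<partial>lebesgue_R d)"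
  proof (rule nn_integral_mono)
    fix \<theta> assume "\<theta> \<in> space (lebesgue_R d)"
    then have tR: "\<theta> \<in> Rspace d" by simp
    have k: "0 \<le> 20 / kap * sig" "0 \<le> e \<theta>" using kap_pos sig_pos e_pos[OF tR] by auto
    then have "ennreal (20 / kap * sig * e \<theta> + c * exp (- ?a * (enorm d (\<lambda>i\<in>{..<d}. \<theta> i - th i))\<^sup>2 / 2))
      = ennreal (20 / kap * sig) * ennreal (e \<theta>) + ennreal c * ennreal (exp (- ?a * (enorm d (\<lambda>i\<in>{..<d}. \<theta> i - th i))\<^sup>2 / 2))"
      using c0 by (subst ennreal_plus) (auto simp: ennreal_mult[symmetric] simp del: times_divide_eq_left)
    then show "indicator ?B \<theta> * ennreal (enorm d (z \<theta>) * e \<theta>)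
      \<le> ennreal (20 / kap * sig) * ennreal (e \<theta>) + ennreal c * ennreal (exp (- ?a * (enorm d (\<lambda>i\<in>{..<d}. \<theta> i - th i))\<^sup>2 / 2))"
      using pt[of \<theta>] by (cases "\<theta> \<in> ?B") (auto intro!: ennreal_leI dest: sym)
  qed
  also have "\<dots> = ennreal (20 / kap * sig) * ennreal Z + ennreal c * ennreal (sqrt (2 * pi / ?a) ^ d)"
  proof -
    have "(\<integral>\<^sup>+\<theta>. ennreal (exp (- ?a * (enorm d (\<lambda>i\<in>{..<d}. \<theta> i - th i))\<^sup>2 / 2)) \<partial>lebesgue_R d)
      = (\<integral>\<^sup>+\<theta>. ennreal (exp (- ?a * (enorm d \<theta>)\<^sup>2 / 2)) \<partial>lebesgue_R d)"
      by (rule nn_integral_recentre[of "\<lambda>x. ennreal (exp (- ?a * (enorm d x)\<^sup>2 / 2))"]) measurable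
    then show ?thesis unfolding nn_integral_exp_enorm_square[OF a0, symmetric] nn_e[symmetric]
      by (subst nn_integral_add) (auto simp: nn_integral_cmult)
  qed
  also have "\<dots> = ennreal (20 / kap * sig * Z + c * sqrt (2 * pi / ?a) ^ d)"
    using kap_pos sig_pos Z_pos c0 a0 by (simp add: ennreal_mult[symmetric] ennreal_plus[symmetric] del: ennreal_plus)
  also have "\<dots> \<le> ennreal (21 / kap * sig * Z)"
  proof (rule ennreal_leI)
    have k1: "1 \<le> 1 / kap" using kap_pos kap_le_1 by simp
    \<comment> \<open>The root is 2 / sqrt n, the factor of \<open>Z_lower\<close>, times sqrt (2 pi
      / kap). The crude bound exp (8/kap) for the latter leaves 42/kap >= 23 of the 50/kap.\<close>
    have s1: "sqrt (2 * pi / ?a) \<le> (2 / sqrt (real n)) * exp (8 / kap)"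
    proof -
      have p: "2 * pi / kap \<ge> 1"
      proof -
        have "1 * 1 \<le> 2 * pi * (1 / kap)" using k1 pi_ge_two by (intro mult_mono) auto
        then show ?thesis by simp
      qed
      have "2 * pi / ?a = (2 / sqrt (real n))\<^sup>2 * (2 * pi / kap)" using n by (simp add: power_divide)
      then have "sqrt (2 * pi / ?a) = (2 / sqrt (real n)) * sqrt (2 * pi / kap)"
        by (simp add: real_sqrt_mult del: times_divide_eq_left times_divide_eq_right)
      moreover have "sqrt (2 * pi / kap) \<le> exp (8 / kap)"
      proof -
      have "sqrt (2 * pi / kap) \<le> 2 * pi / kap"
      proof -
        have "2 * pi / kap * 1 \<le> 2 * pi / kap * (2 * pi / kap)" using p by (intro mult_left_mono) auto
        then have "2 * pi / kap \<le> (2 * pi / kap)\<^sup>2" by (simp add: power2_eq_square)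
        then have "sqrt (2 * pi / kap) \<le> sqrt ((2 * pi / kap)\<^sup>2)" by (rule real_sqrt_le_mono)
        then show ?thesis using p by simp
      qed
      also have "2 * pi / kap \<le> 8 / kap" using kap_pos pi_less_4 by (intro divide_right_mono) auto
      also have "8 / kap \<le> exp (8 / kap)" using exp_ge_add_one_self[of "8 / kap"] by linarith
      finally show ?thesis .
      qed
      ultimately show ?thesis by (simp only:) (intro mult_left_mono, auto)
    qed
    have "sqrt (2 * pi / ?a) ^ d \<le> ((2 / sqrt (real n)) * exp (8 / kap)) ^ d"
      using a0 by (intro power_mono s1) auto
    also have "\<dots> = (2 / sqrt (real n)) ^ d * exp (8 / kap * real d)"
      unfolding power_mult_distrib exp_of_nat_mult[symmetric] by (simp only: mult.commute)
    finally have s2: "sqrt (2 * pi / ?a) ^ d \<le> (2 / sqrt (real n)) ^ d * exp (8 / kap * real d)" .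
    have e2: "exp (- (50 / kap * real d)) * exp (8 / kap * real d) \<le> exp (- 23 * real d)"
    proof -
      have "23 * real d \<le> 42 * (1 / kap) * real d" using k1 by (intro mult_right_mono) auto
      then have "- (50 / kap * real d) + 8 / kap * real d \<le> - 23 * real d" by (simp add: field_simps)
      then show ?thesis unfolding exp_add[symmetric] by simp
    qed
    have "c * sqrt (2 * pi / ?a) ^ d \<le> c * ((2 / sqrt (real n)) ^ d * exp (8 / kap * real d))"
      using s2 c0 by (rule mult_left_mono)
    also have "\<dots> = sig * \<pi>0 th * (2 / sqrt (real n)) ^ d * (exp (- (50 / kap * real d)) * exp (8 / kap * real d))"
      by (simp only: c_def mult_ac)
    also have "\<dots> \<le> sig * \<pi>0 th * (2 / sqrt (real n)) ^ d * exp (- 23 * real d)"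
      using e2 sig_pos pi_pos[OF th(1)] by (intro mult_left_mono) auto
    also have "\<dots> = sig * (\<pi>0 th * ((2 / sqrt (real n)) ^ d * exp (- 23 * real d)))" by (simp only: mult_ac)
    also have "\<dots> \<le> sig * Z" using sig_pos by (intro mult_left_mono Z_lower) auto
    also have "\<dots> \<le> 1 / kap * (sig * Z)"
      using mult_right_mono[OF k1, of "sig * Z"] sig_pos Z_pos by simp
    finally show "20 / kap * sig * Z + c * sqrt (2 * pi / ?a) ^ d \<le> 21 / kap * sig * Z" by simp
  qed
  finally show ?thesis .
qed

text \<open>The squared norm keeps \<open>h\<close> differentiable at \<open>\<theta>s\<close>; it
  is 1 within rho / sqrt 2 of that point and 0 from distance rho on.\<close>

definition h :: "(nat \<Rightarrow> real) \<Rightarrow> real" where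
  "h \<theta> = cutoff (2 / rho\<^sup>2 * (enorm d (\<lambda>i. \<theta> i - \<theta>s i))\<^sup>2)"

definition h' :: "(nat \<Rightarrow> real) \<Rightarrow> nat \<Rightarrow> real" where
  "h' \<theta> j = cutoff' (2 / rho\<^sup>2 * (enorm d (\<lambda>i. \<theta> i - \<theta>s i))\<^sup>2) * (4 / rho\<^sup>2) * (\<theta> j - \<theta>s j)"

text \<open>Ratio of the posterior density to the density of gamma*, with the prior factor left out;
  compare \<open>E_q\<close>.\<close>

definition E :: "(nat \<Rightarrow> real) \<Rightarrow> real" where
  "E \<theta> = gnorm d A / Z * exp (- (L \<theta> - L th) + bf d A (z \<theta>) (z \<theta>) / 2)"

text \<open>\<open>G\<close> is the density of the cut-off posterior with respect to \<open>\<gamma>*\<close>, and \<open>DG\<close> its gradient.\<close>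

definition G :: "(nat \<Rightarrow> real) \<Rightarrow> real" where
  "G \<theta> = E \<theta> * (h \<theta> * \<pi>0 \<theta>)"

definition DG :: "(nat \<Rightarrow> real) \<Rightarrow> nat \<Rightarrow> real" where
  "DG \<theta> j = E \<theta> * (h \<theta> * (indicator (ecball d \<theta>s rho) \<theta> * grad d \<pi>0 \<theta> j)
     + indicator (ecball d \<theta>s rho) \<theta> * (h' \<theta> j * \<pi>0 \<theta>) - V \<theta> j * (h \<theta> * \<pi>0 \<theta>))"

lemma gnorm_A: "gnorm d A > 0"
  by (rule gnorm_pos[OF pos_def_A])

lemma E_pos: "E \<theta> > 0"
  using gnorm_A Z_pos by (simp add: E_def)

lemma h_range: "0 \<le> h \<theta>" "h \<theta> \<le> 1"
  using cutoff_range by (auto simp: h_def)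

lemma h_zero:
  assumes "rho \<le> enorm d (\<lambda>i. \<theta> i - \<theta>s i)"
  shows "h \<theta> = 0"
proof -
  have "rho\<^sup>2 \<le> (enorm d (\<lambda>i. \<theta> i - \<theta>s i))\<^sup>2" using assms rho_pos by (intro power_mono) auto
  then have "2 / rho\<^sup>2 * rho\<^sup>2 \<le> 2 / rho\<^sup>2 * (enorm d (\<lambda>i. \<theta> i - \<theta>s i))\<^sup>2" by (intro mult_left_mono) auto
  then show ?thesis using rho_pos unfolding h_def by (intro cutoff_zero) simp
qed

text \<open>r1 + 2/5 rho <= 7/10 rho and 2 (7/10)^2 < 1. It places the region where the cutoff acts
  inside the one that \<open>tail_mass\<close> controls.\<close>

lemma far_of_cutoff:
  assumes "\<not> 2 / rho\<^sup>2 * (enorm d (\<lambda>i. \<theta> i - \<theta>s i))\<^sup>2 \<le> 1"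
  shows "2 / 5 * rho \<le> enorm d (z \<theta>)"
proof (rule ccontr)
  assume n: "\<not> 2 / 5 * rho \<le> enorm d (z \<theta>)"
  have "enorm d (\<lambda>i. \<theta> i - \<theta>s i) \<le> 7 / 10 * rho"
    using enorm_triangle[of \<theta> \<theta>s d th] n th(2) r1_rho rho_pos by linarith
  then have "(enorm d (\<lambda>i. \<theta> i - \<theta>s i))\<^sup>2 \<le> (7 / 10 * rho)\<^sup>2" by (intro power_mono) auto
  then have "2 / rho\<^sup>2 * (enorm d (\<lambda>i. \<theta> i - \<theta>s i))\<^sup>2 \<le> 2 / rho\<^sup>2 * (7 / 10 * rho)\<^sup>2" by (intro mult_left_mono) auto
  also have "\<dots> \<le> 1" using rho_pos by (simp add: power_mult_distrib power_divide)
  finally show False using assms by simp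
qed

lemma U_meas [measurable]: "(\<lambda>\<theta>. U \<theta> j) \<in> borel_measurable (lebesgue_R d)"
proof -
  have "(\<lambda>x. sigmoid (dot d a x)) \<in> borel_measurable (lebesgue_R d)" for a
    by (rule measurable_compose[OF measurable_dot_const sigmoid_measurable])
  then show ?thesis unfolding U_def by (intro borel_measurable_sum borel_measurable_diff borel_measurable_times
      borel_measurable_const)
qed

lemma V_meas [measurable]: "(\<lambda>\<theta>. V \<theta> j) \<in> borel_measurable (lebesgue_R d)"
  unfolding V_def
  by (intro borel_measurable_diff U_meas borel_measurable_sum borel_measurable_times borel_measurable_const) (auto intro: measurable_coord)

lemma h_meas [measurable]: "h \<in> borel_measurable (lebesgue_R d)"
  unfolding h_def by measurable

lemma E_meas [measurable]: "E \<in> borel_measurable (lebesgue_R d)"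
proof -
  have b: "(\<lambda>\<theta>. bf d A (z \<theta>) (z \<theta>)) \<in> borel_measurable (lebesgue_R d)"
    by (intro measurable_bf borel_measurable_diff measurable_coord borel_measurable_const)
  have "(\<lambda>\<theta>. - (L \<theta> - L th) + bf d A (z \<theta>) (z \<theta>) / 2) \<in> borel_measurable (lebesgue_R d)"
    by (intro borel_measurable_add borel_measurable_uminus borel_measurable_diff borel_measurable_divide
        measurable_L b borel_measurable_const)
  from measurable_compose[OF this borel_measurable_exp] show ?thesis
    unfolding E_def by (intro borel_measurable_times borel_measurable_const)
qed

lemma G_meas [measurable]: "G \<in> borel_measurable (lebesgue_R d)"
  unfolding G_def by measurable

lemma DG_meas [measurable]:
  assumes [simp]: "j < d"
  shows "(\<lambda>\<theta>. DG \<theta> j) \<in> borel_measurable (lebesgue_R d)"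
proof -
  have [measurable]: "(\<lambda>\<theta>. indicator (ecball d \<theta>s rho) \<theta> * grad d \<pi>0 \<theta> j) \<in> borel_measurable (lebesgue_R d)"
    using BS by (intro measurable_C1_grad[OF C1]) (auto simp: rho_def)
  have [measurable]: "ecball d \<theta>s rho \<in> sets (lebesgue_R d)" by (rule ball_measurable)
  have [measurable]: "(\<lambda>\<theta>. h' \<theta> j) \<in> borel_measurable (lebesgue_R d)" unfolding h'_def by measurable
  show ?thesis unfolding DG_def by measurable
qed

text \<open>On the closed ball, boundary included, the prior is differentiable and the product rule
  applies. Outside, \<open>G\<close> vanishes near the point because \<open>h\<close> is 0 from
  distance rho on, and \<open>DG\<close> is 0 as well.\<close>

lemma G_path:
  assumes cR: "\<And>t. c t \<in> Rspace d" and c: "\<And>i t. i < d \<Longrightarrow> ((\<lambda>t. c t i) has_real_derivative c' t i) (at t)"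
  shows "((\<lambda>t. G (c t)) has_real_derivative dot d (DG (c t)) (c' t)) (at t)"
proof -
  have ct: "\<And>i. i < d \<Longrightarrow> ((\<lambda>t. c t i) has_real_derivative c' t i) (at t)" by (rule c)
  have DE: "((\<lambda>t. E (c t)) has_real_derivative E (c t) * (- dot d (V (c t)) (c' t))) (at t)"
  proof -
    have A: "A \<in> carrier_mat d d" "transpose_mat A = A" using pos_def_A by (auto simp: pos_def_mat_def)
    note b = bf_path[where m = th, OF ct A]
    have "((\<lambda>t. - (L (c t) - L th) + bf d A (z (c t)) (z (c t)) / 2) has_real_derivative
       (- dot d (U (c t)) (c' t) + (2 * bf d A (z (c t)) (c' t)) / 2)) (at t)"
      by (auto intro!: derivative_eq_intros L_path[OF ct] b)
    then have "((\<lambda>t. - (L (c t) - L th) + bf d A (z (c t)) (z (c t)) / 2) has_real_derivative - dot d (V (c t)) (c' t)) (at t)"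
      by (simp add: dot_V)
    from DERIV_cmult[OF DERIV_chain2[OF DERIV_exp this], of "gnorm d A / Z"] show ?thesis
      unfolding E_def by (simp only: mult.assoc)
  qed
  show ?thesis
  proof (cases "c t \<in> ecball d \<theta>s rho")
    case True
    have Dp: "((\<lambda>t. \<pi>0 (c t)) has_real_derivative dot d (grad d \<pi>0 (c t)) (c' t)) (at t)"
      using True BS by (intro C1_on_path_deriv[OF C1] cR ct) (auto simp: rho_def)
    have Dh: "((\<lambda>t. h (c t)) has_real_derivative dot d (h' (c t)) (c' t)) (at t)"
    proof -
      have "((\<lambda>t. h (c t)) has_real_derivative
        cutoff' (2 / rho\<^sup>2 * (enorm d (\<lambda>i. c t i - \<theta>s i))\<^sup>2) * (2 / rho\<^sup>2 * (2 * dot d (\<lambda>i. c t i - \<theta>s i) (c' t)))) (at t)"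
        unfolding h_def by (rule DERIV_chain2[OF cutoff_deriv DERIV_cmult[OF enorm_square_path[OF ct]]])
      moreover have "cutoff' (2 / rho\<^sup>2 * (enorm d (\<lambda>i. c t i - \<theta>s i))\<^sup>2) * (2 / rho\<^sup>2 * (2 * dot d (\<lambda>i. c t i - \<theta>s i) (c' t)))
        = dot d (h' (c t)) (c' t)"
      proof -
        have "h' (c t) = (\<lambda>j. cutoff' (2 / rho\<^sup>2 * (enorm d (\<lambda>i. c t i - \<theta>s i))\<^sup>2) * (4 / rho\<^sup>2) * (c t j - \<theta>s j))"
          by (rule ext) (simp only: h'_def)
        note he = this
        show ?thesis unfolding he dot_commute[of d _ "c' t"] dot_scale_right by simp
      qed
      ultimately show ?thesis by simp
    qed
    have eqD: "dot d (DG (c t)) (c' t) = E (c t) * (h (c t) * dot d (grad d \<pi>0 (c t)) (c' t) + dot d (h' (c t)) (c' t) * \<pi>0 (c t)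
        - dot d (V (c t)) (c' t) * (h (c t) * \<pi>0 (c t)))"
      using True by (simp add: DG_def dot_def sum_distrib_left sum_distrib_right sum.distrib sum_subtractf algebra_simps)
    show ?thesis unfolding G_def
      by (rule DERIV_cong[OF DERIV_mult[OF DE DERIV_mult[OF Dh Dp]]]) (simp add: eqD algebra_simps)
  next
    case False
    have "continuous (at t) (\<lambda>t. enorm d (\<lambda>i. c t i - \<theta>s i))"
      unfolding L2_set_def by (intro continuous_intros DERIV_isCont[OF ct]) auto
    moreover have "rho < enorm d (\<lambda>i. c t i - \<theta>s i)" using False cR[of t] by (simp add: ecball_def)
    ultimately have "\<forall>\<^sub>F u in at t. rho < enorm d (\<lambda>i. c u i - \<theta>s i)"
        "rho < enorm d (\<lambda>i. c t i - \<theta>s i)"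
      by (auto simp: isCont_def dest: order_tendstoD(1))
    then have "\<forall>\<^sub>F u in nhds t. rho < enorm d (\<lambda>i. c u i - \<theta>s i)"
      by (simp add: eventually_nhds_conv_at)
    then have ev: "\<forall>\<^sub>F u in nhds t. G (c u) = 0"
      by (rule eventually_mono) (simp add: G_def h_zero)
    have "((\<lambda>u. 0) has_real_derivative 0) (at t)" by simp
    then have "((\<lambda>u. G (c u)) has_real_derivative 0) (at t)"
      by (rule DERIV_cong_ev[THEN iffD2, rotated 3]) (use ev in auto)
    moreover have "h (c t) = 0" using False cR[of t] by (intro h_zero) (simp add: ecball_def)
    then have "dot d (DG (c t)) (c' t) = 0" using False by (simp add: dot_def DG_def)
    ultimately show ?thesis by simp
  qed
qed

end

section \<open>Assembling the total variation bound for a fixed sample\<close>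

lemma tv_dist_le_1:
  assumes "prob_space P" "prob_space Q"
  shows "tv_dist P Q \<le> 1"
  unfolding tv_dist_def
proof (rule cSUP_least)
  interpret P: prob_space P by fact
  interpret Q: prob_space Q by fact
  fix B
  show "\<bar>measure P B - measure Q B\<bar> \<le> 1"
    using P.prob_le_1[of B] Q.prob_le_1[of B] measure_nonneg[of P B] measure_nonneg[of Q B]
    by (intro abs_leI; linarith)
qed auto

context logistic_tv
begin

definition q :: "(nat \<Rightarrow> real) \<Rightarrow> real" where
  "q \<theta> = exp (- bf d A (z \<theta>) (z \<theta>) / 2) / gnorm d A"

lemma gamma_star_eq: "gamma_star d n \<theta>s X Y = gaussian d th (inv_mat A)"
  by (simp add: gamma_star_def mle_eq A_def)

lemma gamma_star_density: "gamma_star d n \<theta>s X Y = density (lebesgue_R d) (\<lambda>\<theta>. ennreal (q \<theta>))"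
  unfolding gamma_star_eq gaussian_inv_mat[OF pos_def_A] q_def ..

lemma q_meas [measurable]: "q \<in> borel_measurable (lebesgue_R d)"
proof -
  have b: "(\<lambda>\<theta>. bf d A (z \<theta>) (z \<theta>)) \<in> borel_measurable (lebesgue_R d)"
    by (intro measurable_bf borel_measurable_diff measurable_coord borel_measurable_const)
  have "(\<lambda>\<theta>. - bf d A (z \<theta>) (z \<theta>) / 2) \<in> borel_measurable (lebesgue_R d)"
    by (intro borel_measurable_uminus borel_measurable_divide b borel_measurable_const)
  from measurable_compose[OF this borel_measurable_exp] show ?thesis
    unfolding q_def by (intro borel_measurable_divide borel_measurable_const)
qed

lemma q_nonneg: "q \<theta> \<ge> 0"
  using gnorm_A by (simp add: q_def)

lemma E_q: "E \<theta> * q \<theta> * \<pi>0 \<theta> = e \<theta> / Z"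
proof -
  let ?b = "bf d A (z \<theta>) (z \<theta>)"
  have "exp (- (L \<theta> - L th) + ?b / 2) * exp (- ?b / 2) = exp (- (L \<theta> - L th))"
    unfolding exp_add[symmetric] by simp
  then have "E \<theta> * q \<theta> = exp (- (L \<theta> - L th)) / Z"
    unfolding E_def q_def using gnorm_A by (simp add: field_simps)
  then show ?thesis by (simp add: e_def)
qed

lemma posterior_density: "posterior d n \<pi>0 X Y = density (lebesgue_R d) (\<lambda>\<theta>. ennreal (e \<theta> / Z))"
proof -
  have w: "exp (- real n * neg_loglik d n X Y \<theta>) * \<pi>0 \<theta> = exp (- L th) * e \<theta>" for \<theta>
    unfolding e_def mult.assoc[symmetric] exp_add[symmetric] using L_neg_loglik[of \<theta>] by simp
  have "(LINT \<theta>|lebesgue_R d. exp (- L th) * e \<theta>) = exp (- L th) * Z"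
    unfolding Z_def by simp
  then show ?thesis unfolding posterior_def Let_def w by simp
qed

lemma prob_posterior: "prob_space (posterior d n \<pi>0 X Y)"
proof (rule prob_spaceI)
  have "emeasure (posterior d n \<pi>0 X Y) (space (posterior d n \<pi>0 X Y)) = (\<integral>\<^sup>+\<theta>. ennreal (e \<theta> / Z) \<partial>lebesgue_R d)"
    unfolding posterior_density by (simp add: emeasure_density cong: nn_integral_cong)
      (auto intro!: nn_integral_cong simp: indicator_def)
  also have "\<dots> = (\<integral>\<^sup>+\<theta>. ennreal (1 / Z) * ennreal (e \<theta>) \<partial>lebesgue_R d)"
    using Z_pos e_pos by (intro nn_integral_cong) (simp add: ennreal_mult[symmetric] less_imp_le)
  also have "\<dots> = ennreal (1 / Z) * ennreal Z" by (subst nn_integral_cmult) (auto simp: nn_e)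
  also have "\<dots> = 1" using Z_pos by (simp add: ennreal_mult[symmetric])
  finally show "emeasure (posterior d n \<pi>0 X Y) (space (posterior d n \<pi>0 X Y)) = 1" .
qed

lemma prob_gamma_star: "prob_space (gamma_star d n \<theta>s X Y)"
  unfolding gamma_star_eq by (rule prob_space_gaussian[OF pos_def_A])

text \<open>The bound 4 for the derivative of the cutoff, the factor 4 / rho^2 and a distance of at
  most rho give 16 / rho.\<close>

lemma enorm_h': "\<theta> \<in> ecball d \<theta>s rho \<Longrightarrow> enorm d (h' \<theta>) \<le> 16 / rho * indicator {\<theta>. 2 / 5 * rho \<le> enorm d (z \<theta>)} \<theta>"
proof -
  assume B: "\<theta> \<in> ecball d \<theta>s rho"
  let ?u = "2 / rho\<^sup>2 * (enorm d (\<lambda>i. \<theta> i - \<theta>s i))\<^sup>2"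
  have he: "h' \<theta> = (\<lambda>j. cutoff' ?u * (4 / rho\<^sup>2) * (\<theta> j - \<theta>s j))" by (rule ext) (simp only: h'_def)
  show ?thesis
  proof (cases "?u \<le> 1")
    case True
    then have "cutoff' ?u = 0" by (rule cutoff_one)
    then have "enorm d (h' \<theta>) = 0" unfolding he by (simp add: L2_set_def)
    then show ?thesis using rho_pos by (simp add: indicator_def)
  next
    case False
    have "enorm d (h' \<theta>) = \<bar>cutoff' ?u\<bar> * (4 / rho\<^sup>2) * enorm d (\<lambda>i. \<theta> i - \<theta>s i)"
      unfolding he enorm_scale abs_mult by simp
    also have "\<dots> \<le> 4 * (4 / rho\<^sup>2) * rho"
      using cutoff'_le[of ?u] B by (intro mult_mono) (auto simp: ecball_def)
    also have "\<dots> = 16 / rho" using rho_pos by (simp add: power2_eq_square)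
    finally show ?thesis using far_of_cutoff[OF False] by simp
  qed
qed

text \<open>Multiplication by \<open>q\<close> turns \<open>E * \<pi>0\<close> into the posterior
  density, so the three terms are the Hessian error, the gradient of the log prior and the gradient
  of the cutoff, each weighted by the posterior. 8876 is twice 4438, since the point and the MLE are
  both within rho of \<open>\<theta>s\<close>.\<close>

lemma DG_bound:
  assumes dn: "real d \<le> sqrt (real n)" and tR: "\<theta> \<in> Rspace d"
  shows "enorm d (DG \<theta>) * q \<theta> \<le> 1 / Z * (8876 * real n * rho * (indicator (ecball d \<theta>s rho) \<theta> * (enorm d (z \<theta>) * e \<theta>))
    + \<delta> * e \<theta> + 16 / rho * (indicator {\<theta>. 2 / 5 * rho \<le> enorm d (z \<theta>)} \<theta> * e \<theta>))"
proof (cases "\<theta> \<in> ecball d \<theta>s rho")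
  case False
  then have "h \<theta> = 0" using tR by (intro h_zero) (simp add: ecball_def)
  then have "DG \<theta> = (\<lambda>_. 0)" using False by (auto simp: DG_def)
  then show ?thesis using False Z_pos \<delta>0 e_pos[OF tR] rho_pos by (simp add: L2_set_def indicator_def)
next
  case True
  let ?F = "{\<theta>. 2 / 5 * rho \<le> enorm d (z \<theta>)}"
  have BinS: "\<theta> \<in> S" using True BS by (auto simp: rho_def)
  have p: "\<pi>0 \<theta> > 0" by (rule pi_pos[OF tR])
  let ?a = "\<lambda>j. h \<theta> * grad d \<pi>0 \<theta> j" and ?b = "\<lambda>j. \<pi>0 \<theta> * h' \<theta> j" and ?v = "\<lambda>j. - (h \<theta> * \<pi>0 \<theta>) * V \<theta> j"
  have DGe: "DG \<theta> = (\<lambda>j. E \<theta> * ((?a j + ?b j) + ?v j))"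
    using True by (auto simp: DG_def algebra_simps)
  have "enorm d (grad d \<pi>0 \<theta>) = enorm d (\<lambda>j. \<pi>0 \<theta> * grad d (\<lambda>y. ln (\<pi>0 y)) \<theta> j)"
    by (rule enorm_cong) (use grad_ln[OF C1 BinS tR p] p in simp)
  also have "\<dots> = \<pi>0 \<theta> * enorm d (grad d (\<lambda>y. ln (\<pi>0 y)) \<theta>)" using p by (simp add: enorm_scale)
  also have "\<dots> \<le> \<pi>0 \<theta> * \<delta>" using p gb[OF BinS] by (intro mult_left_mono) auto
  finally have g: "enorm d (grad d \<pi>0 \<theta>) \<le> \<pi>0 \<theta> * \<delta>" .
  have ea: "enorm d ?a \<le> \<pi>0 \<theta> * \<delta>"
  proof -
    have "enorm d ?a = h \<theta> * enorm d (grad d \<pi>0 \<theta>)" unfolding enorm_scale using h_range by simp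
    also have "\<dots> \<le> 1 * (\<pi>0 \<theta> * \<delta>)" using g h_range by (intro mult_mono) auto
    finally show ?thesis by simp
  qed
  have eb: "enorm d ?b \<le> \<pi>0 \<theta> * (16 / rho * indicator ?F \<theta>)"
    unfolding enorm_scale using enorm_h'[OF True] p by (simp add: mult_left_mono del: times_divide_eq_left)
  have ev: "enorm d ?v \<le> \<pi>0 \<theta> * (8876 * real n * rho * enorm d (z \<theta>))"
  proof -
    have "enorm d ?v = h \<theta> * \<pi>0 \<theta> * enorm d (V \<theta>)" unfolding enorm_scale using h_range p by (simp add: abs_mult)
    also have "\<dots> \<le> 1 * \<pi>0 \<theta> * (8876 * real n * rho * enorm d (z \<theta>))"
    proof (intro mult_mono)
      have "enorm d (V \<theta>) \<le> 4438 * real n * (enorm d (\<lambda>i. \<theta> i - \<theta>s i) + enorm d (\<lambda>i. th i - \<theta>s i)) * enorm d (z \<theta>)"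
        by (rule V_bound[OF dn])
      also have "\<dots> \<le> 4438 * real n * (2 * rho) * enorm d (z \<theta>)"
        using True th(2) r1_rho rho_pos by (intro mult_right_mono mult_left_mono) (auto simp: ecball_def)
      finally show "enorm d (V \<theta>) \<le> 8876 * real n * rho * enorm d (z \<theta>)" by simp
    qed (use h_range p in auto)
    finally show ?thesis by simp
  qed
  have "enorm d (DG \<theta>) = E \<theta> * enorm d (\<lambda>j. (?a j + ?b j) + ?v j)"
    unfolding DGe enorm_scale using E_pos[of \<theta>] by simp
  also have "\<dots> \<le> E \<theta> * (\<pi>0 \<theta> * (8876 * real n * rho * enorm d (z \<theta>) + \<delta> + 16 / rho * indicator ?F \<theta>))"
  proof (rule mult_left_mono)
    have "enorm d (\<lambda>j. (?a j + ?b j) + ?v j) \<le> enorm d (\<lambda>j. ?a j + ?b j) + enorm d ?v" by (rule L2_set_triangle_ineq)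
    also have "enorm d (\<lambda>j. ?a j + ?b j) \<le> enorm d ?a + enorm d ?b" by (rule L2_set_triangle_ineq)
    finally show "enorm d (\<lambda>j. (?a j + ?b j) + ?v j) \<le> \<pi>0 \<theta> * (8876 * real n * rho * enorm d (z \<theta>) + \<delta> + 16 / rho * indicator ?F \<theta>)"
      using ea eb ev unfolding distrib_left by linarith
  qed (use E_pos[of \<theta>] in simp)
  finally have "enorm d (DG \<theta>) * q \<theta> \<le> E \<theta> * (\<pi>0 \<theta> * (8876 * real n * rho * enorm d (z \<theta>) + \<delta> + 16 / rho * indicator ?F \<theta>)) * q \<theta>"
    using q_nonneg by (rule mult_right_mono)
  also have "\<dots> = (E \<theta> * q \<theta> * \<pi>0 \<theta>) * (8876 * real n * rho * enorm d (z \<theta>) + \<delta> + 16 / rho * indicator ?F \<theta>)"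
    by (simp only: mult_ac)
  also have "\<dots> = 1 / Z * (8876 * real n * rho * (indicator (ecball d \<theta>s rho) \<theta> * (enorm d (z \<theta>) * e \<theta>))
    + \<delta> * e \<theta> + 16 / rho * (indicator ?F \<theta> * e \<theta>))"
    unfolding E_q using True by (simp add: algebra_simps add_divide_distrib)
  finally show ?thesis .
qed

lemma nn_integral_DG:
  assumes dn: "real d \<le> sqrt (real n)"
  shows "(\<integral>\<^sup>+\<theta>. ennreal (enorm d (DG \<theta>)) \<partial>gaussian d th (inv_mat A))
    \<le> ennreal (8876 * real n * rho * (21 / kap * sig) + \<delta> + 16 / rho * T)"
proof -
  let ?B = "ecball d \<theta>s rho" and ?F = "{\<theta>. 2 / 5 * rho \<le> enorm d (z \<theta>)}"
  let ?k = "8876 * real n * rho"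
  have k0: "?k \<ge> 0" "16 / rho \<ge> 0" using rho_pos by auto
  have Zi: "1 / Z \<ge> 0" using Z_pos by simp
  have m1 [measurable]: "(\<lambda>\<theta>. indicator ?B \<theta> * ennreal (enorm d (z \<theta>) * e \<theta>)) \<in> borel_measurable (lebesgue_R d)"
    by (intro borel_measurable_times_ennreal borel_measurable_indicator ball_measurable
        measurable_compose[OF _ measurable_ennreal] borel_measurable_times e_meas measurable_enorm
        borel_measurable_diff measurable_coord borel_measurable_const)
  have m2 [measurable]: "(\<lambda>\<theta>. indicator ?F \<theta> * ennreal (e \<theta>)) \<in> borel_measurable (lebesgue_R d)"
    by measurable
  have "(\<integral>\<^sup>+\<theta>. ennreal (enorm d (DG \<theta>)) \<partial>gaussian d th (inv_mat A))
     = (\<integral>\<^sup>+\<theta>. ennreal (q \<theta>) * ennreal (enorm d (DG \<theta>)) \<partial>lebesgue_R d)"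
    unfolding gamma_star_eq[symmetric] gamma_star_density
    by (intro nn_integral_density measurable_compose[OF _ measurable_ennreal] measurable_enorm DG_meas q_meas)
  also have "\<dots> \<le> (\<integral>\<^sup>+\<theta>. ennreal (1 / Z) * ((ennreal ?k * (indicator ?B \<theta> * ennreal (enorm d (z \<theta>) * e \<theta>))
      + ennreal \<delta> * ennreal (e \<theta>)) + ennreal (16 / rho) * (indicator ?F \<theta> * ennreal (e \<theta>))) \<partial>lebesgue_R d)"
  proof (rule nn_integral_mono)
    fix \<theta> assume "\<theta> \<in> space (lebesgue_R d)"
    then have tR: "\<theta> \<in> Rspace d" by simp
    have e0: "e \<theta> \<ge> 0" using e_pos[OF tR] by simp
    have iB: "ennreal (indicator ?B \<theta> * (enorm d (z \<theta>) * e \<theta>)) = indicator ?B \<theta> * ennreal (enorm d (z \<theta>) * e \<theta>)"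
      by (simp add: indicator_def)
    have iF: "ennreal (indicator ?F \<theta> * e \<theta>) = indicator ?F \<theta> * ennreal (e \<theta>)" by (simp add: indicator_def)
    have n1: "0 \<le> indicator ?B \<theta> * (enorm d (z \<theta>) * e \<theta>)" "0 \<le> indicator ?F \<theta> * e \<theta>"
      using e0 by (auto simp: indicator_def)
    have "ennreal (q \<theta>) * ennreal (enorm d (DG \<theta>)) = ennreal (enorm d (DG \<theta>) * q \<theta>)"
      using q_nonneg by (simp add: ennreal_mult mult.commute)
    also have "\<dots> \<le> ennreal (1 / Z * ((?k * (indicator ?B \<theta> * (enorm d (z \<theta>) * e \<theta>))
      + \<delta> * e \<theta>) + 16 / rho * (indicator ?F \<theta> * e \<theta>)))"
      by (intro ennreal_leI DG_bound[OF dn tR])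
    also have "\<dots> = ennreal (1 / Z) * ((ennreal ?k * ennreal (indicator ?B \<theta> * (enorm d (z \<theta>) * e \<theta>))
      + ennreal \<delta> * ennreal (e \<theta>)) + ennreal (16 / rho) * ennreal (indicator ?F \<theta> * e \<theta>))"
      using k0 Zi n1 \<delta>0 e0
      by (simp only: ennreal_mult[symmetric] ennreal_plus[symmetric] mult_nonneg_nonneg add_nonneg_nonneg)
    finally show "ennreal (q \<theta>) * ennreal (enorm d (DG \<theta>)) \<le> ennreal (1 / Z) * ((ennreal ?k * (indicator ?B \<theta> * ennreal (enorm d (z \<theta>) * e \<theta>))
      + ennreal \<delta> * ennreal (e \<theta>)) + ennreal (16 / rho) * (indicator ?F \<theta> * ennreal (e \<theta>)))"
      unfolding iB iF .
  qed
  also have "\<dots> = ennreal (1 / Z) * ((ennreal ?k * (\<integral>\<^sup>+\<theta>. indicator ?B \<theta> * ennreal (enorm d (z \<theta>) * e \<theta>) \<partial>lebesgue_R d)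
      + ennreal \<delta> * ennreal Z) + ennreal (16 / rho) * (\<integral>\<^sup>+\<theta>. indicator ?F \<theta> * ennreal (e \<theta>) \<partial>lebesgue_R d))"
    unfolding nn_e[symmetric]
    by (simp add: nn_integral_cmult nn_integral_add)
  also have "\<dots> \<le> ennreal (1 / Z) * ((ennreal ?k * ennreal (21 / kap * sig * Z)
      + ennreal \<delta> * ennreal Z) + ennreal (16 / rho) * ennreal (T * Z))"
    by (intro mult_left_mono add_mono order_refl first_moment tail_mass) auto
  also have "\<dots> = ennreal (1 / Z * ((?k * (21 / kap * sig * Z) + \<delta> * Z) + 16 / rho * (T * Z)))"
  proof -
    have "0 \<le> 21 / kap * sig * Z" "0 \<le> T * Z" "0 \<le> Z" using kap_pos sig_pos Z_pos T_pos by auto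
    then show ?thesis using k0 Zi \<delta>0
      by (simp only: ennreal_mult[symmetric] ennreal_plus[symmetric] mult_nonneg_nonneg add_nonneg_nonneg)
  qed
  also have "1 / Z * ((?k * (21 / kap * sig * Z) + \<delta> * Z) + 16 / rho * (T * Z)) = ?k * (21 / kap * sig) + \<delta> + 16 / rho * T"
  proof -
    have "(?k * (21 / kap * sig * Z) + \<delta> * Z) + 16 / rho * (T * Z) = (?k * (21 / kap * sig) + \<delta> + 16 / rho * T) * Z"
      by (simp add: algebra_simps)
    then show ?thesis using Z_pos by simp
  qed
  finally show ?thesis .
qed

text \<open>The Poincare inequality is applied with \<open>kap * n\<close>, the lower bound for the
  precision of gamma*; the mass removed by the cutoff is at most \<open>T\<close>.\<close>

lemma tv_bound_raw:
  assumes dn: "real d \<le> sqrt (real n)"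
  shows "tv_dist (posterior d n \<pi>0 X Y) (gamma_star d n \<theta>s X Y)
    \<le> 2 * T + 8 / sqrt (kap * real n) * (8876 * real n * rho * (21 / kap * sig) + \<delta> + 16 / rho * T)"
proof -
  let ?D = "8876 * real n * rho * (21 / kap * sig) + \<delta> + 16 / rho * T"
  have kn: "kap * real n > 0" using kap_pos n by simp
  have D0: "?D \<ge> 0" using rho_pos kap_pos sig_pos \<delta>0 T_pos by simp
  have "(\<integral>\<^sup>+x. \<integral>\<^sup>+y. ennreal \<bar>G x - G y\<bar> \<partial>gaussian d th (inv_mat A) \<partial>gaussian d th (inv_mat A))
    \<le> ennreal (8 / sqrt (kap * real n)) * (\<integral>\<^sup>+x. ennreal (enorm d (DG x)) \<partial>gaussian d th (inv_mat A))"
  proof (rule gaussian_poincare_l1[where g = G and D = DG, OF pos_def_A kn A_lower G_meas DG_meas])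
    fix c :: "real \<Rightarrow> nat \<Rightarrow> real" and c' :: "real \<Rightarrow> nat \<Rightarrow> real" and t :: real
    assume a: "\<And>t. c t \<in> Rspace d" "\<And>i t. i < d \<Longrightarrow> ((\<lambda>t. c t i) has_real_derivative c' t i) (at t)"
    show "((\<lambda>t. G (c t)) has_real_derivative dot d (DG (c t)) (c' t)) (at t)" by (rule G_path[OF a])
  qed
  also have "\<dots> \<le> ennreal (8 / sqrt (kap * real n)) * ennreal ?D"
    by (intro mult_left_mono nn_integral_DG[OF dn]) simp
  also have "\<dots> = ennreal (8 / sqrt (kap * real n) * ?D)"
    using D0 kn by (intro ennreal_mult[symmetric]) auto
  finally have P: "(\<integral>\<^sup>+x. \<integral>\<^sup>+y. ennreal \<bar>G x - G y\<bar> \<partial>gamma_star d n \<theta>s X Y \<partial>gamma_star d n \<theta>s X Y)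
    \<le> ennreal (8 / sqrt (kap * real n) * ?D)" unfolding gamma_star_eq .
  have h1: "1 - h \<theta> \<le> indicator {\<theta>. 2 / 5 * rho \<le> enorm d (z \<theta>)} \<theta>" for \<theta>
  proof (cases "2 / rho\<^sup>2 * (enorm d (\<lambda>i. \<theta> i - \<theta>s i))\<^sup>2 \<le> 1")
    case True
    then show ?thesis by (simp add: h_def cutoff_one)
  next
    case False
    then show ?thesis using far_of_cutoff[OF False] h_range[of \<theta>] by simp
  qed
  have tail: "(\<integral>\<^sup>+\<theta>. ennreal (1 - h \<theta>) \<partial>posterior d n \<pi>0 X Y) \<le> ennreal T"
  proof -
    have "(\<integral>\<^sup>+\<theta>. ennreal (1 - h \<theta>) \<partial>posterior d n \<pi>0 X Y) = (\<integral>\<^sup>+\<theta>. ennreal (e \<theta> / Z) * ennreal (1 - h \<theta>) \<partial>lebesgue_R d)"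
      unfolding posterior_density by (rule nn_integral_density) measurable
    also have "\<dots> \<le> (\<integral>\<^sup>+\<theta>. ennreal (1 / Z) * (indicator {\<theta>. 2 / 5 * rho \<le> enorm d (z \<theta>)} \<theta> * ennreal (e \<theta>)) \<partial>lebesgue_R d)"
    proof (rule nn_integral_mono)
      fix \<theta> assume "\<theta> \<in> space (lebesgue_R d)"
      then have e0: "e \<theta> \<ge> 0" using e_pos[of \<theta>] by simp
      have "e \<theta> / Z * (1 - h \<theta>) \<le> 1 / Z * (indicator {\<theta>. 2 / 5 * rho \<le> enorm d (z \<theta>)} \<theta> * e \<theta>)"
        using mult_left_mono[OF h1[of \<theta>], of "e \<theta> / Z"] e0 Z_pos by (simp add: mult_ac)
      then have "ennreal (e \<theta> / Z * (1 - h \<theta>)) \<le> ennreal (1 / Z * (indicator {\<theta>. 2 / 5 * rho \<le> enorm d (z \<theta>)} \<theta> * e \<theta>))"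
        by (rule ennreal_leI)
      moreover have "ennreal (e \<theta> / Z * (1 - h \<theta>)) = ennreal (e \<theta> / Z) * ennreal (1 - h \<theta>)"
        using e0 Z_pos h_range[of \<theta>] by (intro ennreal_mult) auto
      moreover have "ennreal (1 / Z * (indicator {\<theta>. 2 / 5 * rho \<le> enorm d (z \<theta>)} \<theta> * e \<theta>))
          = ennreal (1 / Z) * (indicator {\<theta>. 2 / 5 * rho \<le> enorm d (z \<theta>)} \<theta> * ennreal (e \<theta>))"
        using e0 Z_pos by (subst ennreal_mult) (auto simp: indicator_def)
      ultimately show "ennreal (e \<theta> / Z) * ennreal (1 - h \<theta>)
        \<le> ennreal (1 / Z) * (indicator {\<theta>. 2 / 5 * rho \<le> enorm d (z \<theta>)} \<theta> * ennreal (e \<theta>))" by simp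
    qed
    also have "\<dots> = ennreal (1 / Z) * (\<integral>\<^sup>+\<theta>. indicator {\<theta>. 2 / 5 * rho \<le> enorm d (z \<theta>)} \<theta> * ennreal (e \<theta>) \<partial>lebesgue_R d)"
      by (rule nn_integral_cmult) measurable
    also have "\<dots> \<le> ennreal (1 / Z) * ennreal (T * Z)" by (intro mult_left_mono tail_mass) simp
    also have "\<dots> = ennreal T" using Z_pos T_pos by (subst ennreal_mult[symmetric]) auto
    finally show ?thesis .
  qed
  have D1: "8 / sqrt (kap * real n) * ?D \<ge> 0" using D0 kn by simp
  have T0: "T \<ge> 0" using T_pos by simp
  have Gq: "G \<theta> * q \<theta> = h \<theta> * (e \<theta> / Z)" for \<theta>
    unfolding G_def E_q[symmetric] by (simp only: mult_ac)
  show ?thesis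
    unfolding posterior_density gamma_star_density
  proof (rule tv_dist_le[where g = G and h = h, OF _ _ _ _ _ _ _ _ _ _ _ _ _ T0 _ D1])
    show "prob_space (density (lebesgue_R d) (\<lambda>x. ennreal (e x / Z)))"
      using prob_posterior unfolding posterior_density .
    show "prob_space (density (lebesgue_R d) (\<lambda>x. ennreal (q x)))"
      using prob_gamma_star unfolding gamma_star_density .
    show "G x * q x = h x * (e x / Z)" for x by (rule Gq)
    show "0 \<le> e x / Z" if "x \<in> space (lebesgue_R d)" for x using that e_pos[of x] Z_pos by simp
    show "0 \<le> G x" if "x \<in> space (lebesgue_R d)" for x
      using that pi_pos[of x] E_pos[of x] h_range[of x] by (simp add: G_def)
    show "(\<integral>\<^sup>+x. ennreal (1 - h x) \<partial>density (lebesgue_R d) (\<lambda>x. ennreal (e x / Z))) \<le> ennreal T"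
      using tail unfolding posterior_density .
    show "(\<integral>\<^sup>+x. \<integral>\<^sup>+y. ennreal \<bar>G x - G y\<bar> \<partial>density (lebesgue_R d) (\<lambda>x. ennreal (q x)) \<partial>density (lebesgue_R d) (\<lambda>x. ennreal (q x)))
      \<le> ennreal (8 / sqrt (kap * real n) * ?D)"
      using P unfolding gamma_star_density .
  qed (use q_nonneg h_range in auto)
qed

text \<open>The power of 1/kap collects one half from the Poincare constant, rounded up to one, one
  from \<open>rho\<close> and one from \<open>first_moment\<close>. The gradient of the cutoff costs
  only a constant because rho sqrt n >= 1.\<close>

lemma tv_bound:
  assumes dn: "real d \<le> sqrt (real n)"
  shows "tv_dist (posterior d n \<pi>0 X Y) (gamma_star d n \<theta>s X Y)
    \<le> 200000000 / kap ^ 3 * (\<delta> / sqrt (real n) + s * real d / sqrt (real n) + T)"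
proof -
  define w where "w = 1 / kap"
  define sn where "sn = sqrt (real n)"
  have sn: "sn > 0" using n by (simp add: sn_def)
  have w1: "w \<ge> 1" using kap_pos kap_le_1 by (simp add: w_def)
  have w3: "w \<le> w ^ 3" using power_increasing[of 1 3 w] w1 by simp
  have sq: "1 / sqrt kap \<le> w"
  proof -
    have "kap * kap \<le> kap * 1" using kap_pos kap_le_1 by (intro mult_left_mono) auto
    then have "sqrt (kap * kap) \<le> sqrt kap" by (intro real_sqrt_le_mono) simp
    then have "kap \<le> sqrt kap" using kap_pos by simp
    then show ?thesis unfolding w_def using kap_pos by (intro divide_left_mono) auto
  qed
  have sqn: "8 / sqrt (kap * real n) = 8 * (1 / sqrt kap) / sn" by (simp add: sn_def real_sqrt_mult)
  have nr: "real n * rho * sig = 120 * w * (s * real d)"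
    unfolding rho_def sig_sq[symmetric] w_def by (simp add: power2_eq_square)
  have ex: "8876 * real n * rho * (21 / kap * sig) = 22367520 * w\<^sup>2 * (s * real d)"
  proof -
    have "8876 * real n * rho * (21 / kap * sig) = 8876 * 21 * w * (real n * rho * sig)" by (simp add: w_def)
    then show ?thesis unfolding nr by (simp add: power2_eq_square)
  qed
  have rs: "16 / rho / sn \<le> 16"
  proof -
    have "sig * sn = sqrt (real d)" using n by (simp add: sig_def sn_def real_sqrt_divide)
    then have "rho * sn = 120 * w * s * sqrt (real d)" unfolding rho_def w_def by (simp add: mult.assoc)
    also have "\<dots> \<ge> 120 * 1 * 12 * 1" using w1 s d by (intro mult_mono) auto
    finally have "rho * sn \<ge> 1" by simp
    then show ?thesis using rho_pos sn by (simp add: field_simps)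
  qed
  have b0: "0 \<le> s * real d" using s by simp
  have "8 / sqrt (kap * real n) * (8876 * real n * rho * (21 / kap * sig) + \<delta> + 16 / rho * T)
    = 8 * (1 / sqrt kap) * ((22367520 * w\<^sup>2 * (s * real d)) / sn + \<delta> / sn + 16 / rho / sn * T)"
    unfolding sqn ex by (simp add: add_divide_distrib algebra_simps)
  also have "\<dots> \<le> 8 * w * ((22367520 * w\<^sup>2 * (s * real d)) / sn + \<delta> / sn + 16 * T)"
    using sq rs T_pos w1 kap_pos b0 sn \<delta>0 rho_pos
    by (intro mult_mono add_mono mult_right_mono order_refl mult_left_mono) auto
  also have "\<dots> = 178940160 * w ^ 3 * (s * real d / sn) + 8 * w * (\<delta> / sn) + 128 * w * T"
    by (simp add: algebra_simps power2_eq_square power3_eq_cube)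
  also have "\<dots> \<le> 178940160 * w ^ 3 * (s * real d / sn) + 8 * w ^ 3 * (\<delta> / sn) + 128 * w ^ 3 * T"
    using w3 \<delta>0 sn T_pos by (intro add_mono order_refl mult_right_mono mult_left_mono) auto
  finally have 1: "8 / sqrt (kap * real n) * (8876 * real n * rho * (21 / kap * sig) + \<delta> + 16 / rho * T)
    \<le> 178940160 * w ^ 3 * (s * real d / sn) + 8 * w ^ 3 * (\<delta> / sn) + 128 * w ^ 3 * T" .
  have w31: "1 \<le> w ^ 3" using w1 by simp
  have 2: "2 * T \<le> 2 * w ^ 3 * T" using w31 T_pos by simp
  have p: "0 \<le> w ^ 3 * (s * real d / sn)" "0 \<le> w ^ 3 * (\<delta> / sn)" "0 \<le> w ^ 3 * T"
    using w1 b0 sn \<delta>0 T_pos by auto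
  have "tv_dist (posterior d n \<pi>0 X Y) (gamma_star d n \<theta>s X Y)
    \<le> 178940160 * (w ^ 3 * (s * real d / sn)) + 8 * (w ^ 3 * (\<delta> / sn)) + 130 * (w ^ 3 * T)"
    using tv_bound_raw[OF dn] 1 2 by argo
  also have "\<dots> \<le> 200000000 * (w ^ 3 * (s * real d / sn)) + 200000000 * (w ^ 3 * (\<delta> / sn)) + 200000000 * (w ^ 3 * T)"
    using p by (intro add_mono mult_right_mono) auto
  also have "\<dots> = 200000000 * w ^ 3 * (\<delta> / sn + s * real d / sn + T)"
    by (simp add: algebra_simps)
  also have "200000000 * w ^ 3 = 200000000 / kap ^ 3" by (simp add: w_def power_divide)
  finally show ?thesis unfolding sn_def .
qed

end

section \<open>Choice of the constants\<close>

lemma ecball_mono: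
  assumes "r \<le> r'"
  shows "ecball d c r \<subseteq> ecball d c r'"
proof
  fix x assume "x \<in> ecball d c r"
  then have "x \<in> Rspace d" "enorm d (\<lambda>i. x i - c i) \<le> r" unfolding ecball_def by simp_all
  then show "x \<in> ecball d c r'" unfolding ecball_def using order_trans[OF _ assms] by simp
qed

lemma ln_le_two_sqrt: "y > 0 \<Longrightarrow> ln (y :: real) \<le> 2 * sqrt y"
  using ln_le_minus_one[of "sqrt y"] ln_sqrt[of y] by simp

text \<open>ln y <= 2 sqrt y reduces d ln (a sqrt d) to 2 sqrt (a d d^(3/2)). One factor d is at
  most n / (144 C1^2) and d^(3/2) is at most C0 n, which gives n/6; here the growth condition on d
  is spent.\<close>

lemma grid_card_small:
  assumes a: "a > 0" and d: "d \<ge> (1::nat)" and n: "n \<ge> (1::nat)" and C0: "C0 > 0" and C1: "sqrt (a * C0) \<le> C1" "C1 > 0"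
    and d32: "real d powr (3/2) \<le> C0 * real n" and dn: "144 * C1\<^sup>2 * real d \<le> real n"
  shows "(a * sqrt (real d)) ^ d \<le> exp (real n / 2)"
proof -
  let ?D = "real d"
  have pos: "a * sqrt ?D > 0" using a d by simp
  have d32': "?D * sqrt ?D = ?D powr (3/2)"
  proof -
    have "?D powr (3/2) = ?D powr (1 + 1/2)" by simp
    also have "\<dots> = ?D * sqrt ?D" using d by (simp only: powr_add powr_half_sqrt) simp
    finally show ?thesis by simp
  qed
  have "?D * sqrt (a * sqrt ?D) = sqrt (?D\<^sup>2 * (a * sqrt ?D))" by (simp add: real_sqrt_mult)
  also have "?D\<^sup>2 * (a * sqrt ?D) = a * (?D * (?D * sqrt ?D))" by (simp add: power2_eq_square mult_ac)
  also have "\<dots> \<le> a * (real n / (144 * C1\<^sup>2) * (C0 * real n))"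
    unfolding d32' using d32 dn C1 a C0 by (intro mult_left_mono mult_mono) (auto simp: field_simps)
  also have "\<dots> = (sqrt (a * C0) * real n / (12 * C1))\<^sup>2"
    using a C0 by (simp add: power_mult_distrib power_divide power2_eq_square)
  finally have "?D * sqrt (a * sqrt ?D) \<le> sqrt ((sqrt (a * C0) * real n / (12 * C1))\<^sup>2)" by (simp add: real_sqrt_le_mono)
  also have "\<dots> = sqrt (a * C0) * real n / (12 * C1)" using a C0 C1 by simp
  also have "\<dots> \<le> C1 * real n / (12 * C1)" using C1 by (intro divide_right_mono mult_right_mono) auto
  also have "\<dots> = real n / 12" using C1 by simp
  finally have "?D * sqrt (a * sqrt ?D) \<le> real n / 12" .
  moreover have "?D * ln (a * sqrt ?D) \<le> ?D * (2 * sqrt (a * sqrt ?D))"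
    using ln_le_two_sqrt[OF pos] by (intro mult_left_mono) auto
  ultimately have "?D * ln (a * sqrt ?D) \<le> real n / 2" by linarith
  then have "exp (?D * ln (a * sqrt ?D)) \<le> exp (real n / 2)" by simp
  then show ?thesis using pos by (simp add: exp_of_nat_mult)
qed

text \<open>With truncation at x^(1/3) both failure exponents are of order x^(2/3), which beats the
  entropy, of order sqrt x ln x, of a lattice in dimension at most sqrt x.\<close>

lemma cube_event_eventually:
  "\<forall>\<^sub>F x in at_top. exp (sqrt x * ln (20 * x powr (1/4))) *
     (exp (- (x / x powr (1/3))) + x * (2 * exp (- ((x powr (1/3))\<^sup>2 / 16)))) \<le> exp (- sqrt (x :: real))"
proof -
  have 1: "\<forall>\<^sub>F x::real in at_top. sqrt x * ln (20 * x powr (1/4)) - x / x powr (1/3) + ln 2 \<le> - sqrt x"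
    by real_asymp
  have 2: "\<forall>\<^sub>F x::real in at_top. sqrt x * ln (20 * x powr (1/4)) + ln (2 * x) - (x powr (1/3))\<^sup>2 / 16 + ln 2 \<le> - sqrt x"
    by real_asymp
  show ?thesis
    using 1 2 eventually_gt_at_top[of 0]
  proof eventually_elim
    case (elim x)
    let ?A = "sqrt x * ln (20 * x powr (1/4))" and ?P = "x / x powr (1/3)" and ?Q = "(x powr (1/3))\<^sup>2 / 16"
    have h: "exp (- sqrt x - ln 2) = exp (- sqrt x) / 2" by (simp add: exp_diff)
    have "exp ?A * exp (- ?P) = exp (?A - ?P)" unfolding exp_add[symmetric] by simp
    also have "\<dots> \<le> exp (- sqrt x - ln 2)" unfolding exp_le_cancel_iff using elim(1) by linarith
    finally have a: "exp ?A * exp (- ?P) \<le> exp (- sqrt x) / 2" unfolding h .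
    have "exp ?A * (x * (2 * exp (- ?Q))) = exp (?A + ln (2 * x) - ?Q)"
      using elim(3) unfolding diff_conv_add_uminus exp_add by simp
    also have "\<dots> \<le> exp (- sqrt x - ln 2)" unfolding exp_le_cancel_iff using elim(2) by linarith
    finally have "exp ?A * (x * (2 * exp (- ?Q))) \<le> exp (- sqrt x) / 2" unfolding h .
    then show ?case using a unfolding distrib_left by linarith
  qed
qed

text \<open>The lattice count increases with d, so d = sqrt n is the worst case.\<close>

lemma cube_event_small:
  assumes ev: "exp (sqrt (real n) * ln (20 * real n powr (1/4))) *
     (exp (- (real n / real n powr (1/3))) + real n * (2 * exp (- ((real n powr (1/3))\<^sup>2 / 16)))) \<le> exp (- sqrt (real n))"
    and d: "d \<ge> (1::nat)" and dn: "real d \<le> sqrt (real n)"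
  shows "(20 * sqrt (real d)) ^ d * (exp (- (real n / real n powr (1/3))) + real n * (2 * exp (- ((real n powr (1/3))\<^sup>2 / 16))))
     \<le> exp (- sqrt (real n))"
proof -
  have "real n powr (1/4) = sqrt (sqrt (real n))"
    by (simp add: powr_half_sqrt[symmetric] powr_powr)
  then have q: "sqrt (real d) \<le> real n powr (1/4)" using dn by simp
  have s1: "1 \<le> sqrt (real d)" using d by simp
  have "ln (20 * sqrt (real d)) \<le> ln (20 * real n powr (1/4))" using q s1 by (intro ln_mono) auto
  moreover have "0 \<le> ln (20 * sqrt (real d))" using s1 by (intro ln_ge_zero) linarith
  ultimately have "real d * ln (20 * sqrt (real d)) \<le> sqrt (real n) * ln (20 * real n powr (1/4))"
    using dn by (intro mult_mono) auto
  then have "exp (real d * ln (20 * sqrt (real d))) \<le> exp (sqrt (real n) * ln (20 * real n powr (1/4)))" by simp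
  moreover have "exp (real d * ln (20 * sqrt (real d))) = (20 * sqrt (real d)) ^ d"
    using s1 by (simp add: exp_of_nat_mult)
  ultimately have "(20 * sqrt (real d)) ^ d \<le> exp (sqrt (real n) * ln (20 * real n powr (1/4)))" by simp
  then have "(20 * sqrt (real d)) ^ d * (exp (- (real n / real n powr (1/3))) + real n * (2 * exp (- ((real n powr (1/3))\<^sup>2 / 16))))
    \<le> exp (sqrt (real n) * ln (20 * real n powr (1/4))) * (exp (- (real n / real n powr (1/3))) + real n * (2 * exp (- ((real n powr (1/3))\<^sup>2 / 16))))"
    by (rule mult_right_mono) simp
  also note ev
  finally show ?thesis .
qed

text \<open>The value is infinite by definition unless the prior is C1 on the ball, and nonnegative
  because the ball contains its centre.\<close>

lemma delta01_star_finite: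
  assumes D: "delta01_star d n \<theta>s \<pi>0 t \<noteq> \<infinity>" and \<theta>s: "\<theta>s \<in> Rspace d" and t: "t \<ge> 0"
  obtains \<delta> where "delta01_star d n \<theta>s \<pi>0 t = ereal \<delta>" "\<delta> \<ge> 0"
    "C1_on d \<pi>0 (ecball d \<theta>s (t * sqrt (real d / real n)))"
    "\<And>z. z \<in> ecball d \<theta>s (t * sqrt (real d / real n)) \<Longrightarrow> enorm d (grad d (\<lambda>y. ln (\<pi>0 y)) z) \<le> \<delta>"
proof -
  let ?B = "ecball d \<theta>s (t * sqrt (real d / real n))"
  have C: "C1_on d \<pi>0 ?B" and e: "delta01_star d n \<theta>s \<pi>0 t = (SUP \<theta>\<in>?B. ereal (enorm d (grad d (\<lambda>\<theta>'. ln (\<pi>0 \<theta>')) \<theta>)))"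
    using D by (auto simp: delta01_star_def Let_def split: if_splits)
  have up: "ereal (enorm d (grad d (\<lambda>y. ln (\<pi>0 y)) z)) \<le> delta01_star d n \<theta>s \<pi>0 t" if "z \<in> ?B" for z
    unfolding e using that by (rule SUP_upper)
  have "\<theta>s \<in> ?B" using \<theta>s t by (simp add: ecball_def L2_set_def)
  from up[OF this] have "0 \<le> delta01_star d n \<theta>s \<pi>0 t"
    by (rule order_trans[rotated]) simp
  then obtain \<delta> where \<delta>: "delta01_star d n \<theta>s \<pi>0 t = ereal \<delta>" "\<delta> \<ge> 0"
    using D by (cases "delta01_star d n \<theta>s \<pi>0 t") auto
  show thesis by (rule that[OF \<delta> C]) (use up \<delta> in auto)
qed

text \<open>For an unbounded prior the right-hand side of the theorem is infinite; otherwise the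
  factor d cancels the 1/d in \<open>M0_star\<close>.\<close>

lemma M0_star_cases:
  assumes d: "d \<ge> 1" and pos: "\<forall>z\<in>Rspace d. \<pi>0 z > 0" and \<theta>s: "\<theta>s \<in> Rspace d"
  shows "exp_ereal (ereal (real d) * (M0_star d \<theta>s \<pi>0 - ereal c)) = \<infinity> \<or>
    (\<exists>M. (\<forall>z\<in>Rspace d. \<pi>0 z \<le> M) \<and>
      exp_ereal (ereal (real d) * (M0_star d \<theta>s \<pi>0 - ereal c)) = ereal (M / \<pi>0 \<theta>s * exp (- (real d * c))))"
proof -
  define S where "S = (SUP \<theta>\<in>Rspace d. ereal (\<pi>0 \<theta>))"
  have p: "\<pi>0 \<theta>s > 0" using pos \<theta>s by blast
  have up: "ereal (\<pi>0 z) \<le> S" if "z \<in> Rspace d" for z unfolding S_def using that by (rule SUP_upper)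
  have d0: "real d > 0" using d by simp
  show ?thesis
  proof (cases S)
    case (real M)
    have le: "\<pi>0 z \<le> M" if "z \<in> Rspace d" for z using up[OF that] real by simp
    have Mp: "M > 0" using le[OF \<theta>s] p by simp
    have "M / \<pi>0 \<theta>s > 0" using Mp p by simp
    then have "M0_star d \<theta>s \<pi>0 = ereal (ln (M / \<pi>0 \<theta>s) / real d)"
      using Mp p unfolding M0_star_def S_def[symmetric] real by (simp add: ln_ereal_def not_le)
    then have "exp_ereal (ereal (real d) * (M0_star d \<theta>s \<pi>0 - ereal c)) = ereal (exp (ln (M / \<pi>0 \<theta>s) - real d * c))"
      using d0 by (simp add: exp_ereal_def right_diff_distrib)
    also have "\<dots> = ereal (M / \<pi>0 \<theta>s * exp (- (real d * c)))"
      using Mp p by (simp add: exp_diff exp_minus divide_inverse)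
    finally show ?thesis using le by blast
  next
    case PInf
    have "M0_star d \<theta>s \<pi>0 = \<infinity>"
      using p d0 unfolding M0_star_def S_def[symmetric] PInf by (simp add: ln_ereal_def)
    then show ?thesis using d0 by (simp add: exp_ereal_def)
  next
    case MInf
    then show ?thesis using up[OF \<theta>s] by simp
  qed
qed

theorem corollary4p13:
  shows "\<exists>C2::real. C2 > 0 \<and> (\<forall>C0::real. C0 > 0 \<longrightarrow> (\<exists>C1 C3::real. C1 > 0 \<and> C3 > 0 \<and>
    (\<forall>(d::nat) (n::nat) (\<theta>s::nat \<Rightarrow> real) (\<pi>0::(nat \<Rightarrow> real) \<Rightarrow> real) (s::real).
       1 \<le> d \<longrightarrow> 1 \<le> n \<longrightarrow> \<theta>s \<in> Rspace d \<longrightarrow> positive_prior d \<pi>0 \<longrightarrow>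
       enorm d \<theta>s \<le> C0 \<longrightarrow> real d powr (3/2) \<le> C0 * real n \<longrightarrow>
       s \<ge> 12 \<longrightarrow>
       C1 * s * sqrt (real d / real n) \<le> 1 \<longrightarrow>
       ereal C1 * delta01_star d n \<theta>s \<pi>0 (C1 * s) \<le> ereal (sqrt (real n * real d)) \<longrightarrow>
       (\<exists>E \<in> sets (logistic_law d n \<theta>s).
          measure (logistic_law d n \<theta>s) E
            \<ge> 1 - 8 * exp (- C2 * sqrt (real n)) - exp (- real d * s\<^sup>2 / 10) \<and>
          (\<forall>(X, Y) \<in> E.
             mle_exists_unique d n X Y \<and>
             pos_def_mat d (fisher d n X \<theta>s) \<and>
             ereal (tv_dist (posterior d n \<pi>0 X Y) (gamma_star d n \<theta>s X Y))
               \<le> ereal C3 *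
                   (delta01_star d n \<theta>s \<pi>0 (C1 * s) / ereal (sqrt (real n))
                    + ereal (s * real d / sqrt (real n))
                    + exp_ereal (ereal (real d) * (M0_star d \<theta>s \<pi>0 - ereal ((s / 12)\<^sup>2)))))))))"
proof -
  \<comment> \<open>An absolute threshold, independent of C0: from it on the cube event is rare
    enough in every dimension up to sqrt n.\<close>
  obtain N0 where N0: "\<And>x. x \<ge> N0 \<Longrightarrow> exp (sqrt x * ln (20 * x powr (1/4))) *
     (exp (- (x / x powr (1/3))) + x * (2 * exp (- ((x powr (1/3))\<^sup>2 / 16)))) \<le> exp (- sqrt (x :: real))"
    using cube_event_eventually unfolding eventually_at_top_linorder by blast
  show ?thesis
  proof (rule exI[of _ "1::real"], intro conjI allI impI)
    fix C0 :: real assume C0: "C0 > 0"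
    \<comment> \<open>The value of \<open>kap\<close> for C = C0, written out before any sample is
      fixed.\<close>
    define k where "k = exp (- (9 * C0 + 1)) / 8 * small_thr\<^sup>2"
    define a where "a = 5 * real grid_fine"
    \<comment> \<open>The smallness hypothesis forces n >= C1, so |N0| and 4 make n large. 7200/k,
      with 7200 = 120 * 60, puts the radius \<open>rho\<close> below 1/60 and dominates 120/k; sqrt
      (a C0) is for the cardinality of the fine lattice.\<close>
    define C1 where "C1 = \<bar>N0\<bar> + 7200 / k + sqrt (a * C0) + 4"
    define C3 where "C3 = 200000000 / k ^ 3"
    have k0: "k > 0" using small_thr_pos by (simp add: k_def)
    have a0: "a > 0" using grid_fine_ge by (simp add: a_def)
    have sq0: "sqrt (a * C0) \<ge> 0" using a0 C0 by simp
    have k7: "7200 / k > 0" using k0 by simp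
    have C1b: "C1 \<ge> N0" "C1 \<ge> 7200 / k" "C1 \<ge> sqrt (a * C0)" "C1 \<ge> 4"
      using sq0 k7 unfolding C1_def by linarith+
    have C3: "C3 > 0" using k0 by (simp add: C3_def)
    show "\<exists>C1 C3::real. C1 > 0 \<and> C3 > 0 \<and>
    (\<forall>(d::nat) (n::nat) (\<theta>s::nat \<Rightarrow> real) (\<pi>0::(nat \<Rightarrow> real) \<Rightarrow> real) (s::real).
       1 \<le> d \<longrightarrow> 1 \<le> n \<longrightarrow> \<theta>s \<in> Rspace d \<longrightarrow> positive_prior d \<pi>0 \<longrightarrow>
       enorm d \<theta>s \<le> C0 \<longrightarrow> real d powr (3/2) \<le> C0 * real n \<longrightarrow>
       s \<ge> 12 \<longrightarrow>
       C1 * s * sqrt (real d / real n) \<le> 1 \<longrightarrow>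
       ereal C1 * delta01_star d n \<theta>s \<pi>0 (C1 * s) \<le> ereal (sqrt (real n * real d)) \<longrightarrow>
       (\<exists>E \<in> sets (logistic_law d n \<theta>s).
          measure (logistic_law d n \<theta>s) E
            \<ge> 1 - 8 * exp (- 1 * sqrt (real n)) - exp (- real d * s\<^sup>2 / 10) \<and>
          (\<forall>(X, Y) \<in> E.
             mle_exists_unique d n X Y \<and>
             pos_def_mat d (fisher d n X \<theta>s) \<and>
             ereal (tv_dist (posterior d n \<pi>0 X Y) (gamma_star d n \<theta>s X Y))
               \<le> ereal C3 *
                   (delta01_star d n \<theta>s \<pi>0 (C1 * s) / ereal (sqrt (real n))
                    + ereal (s * real d / sqrt (real n))
                    + exp_ereal (ereal (real d) * (M0_star d \<theta>s \<pi>0 - ereal ((s / 12)\<^sup>2)))))))"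
    proof (rule exI[of _ C1], rule exI[of _ C3], intro conjI allI impI)
      show "C1 > 0" using C1b by linarith
      show "C3 > 0" by (rule C3)
      fix d n :: nat and \<theta>s :: "nat \<Rightarrow> real" and \<pi>0 :: "(nat \<Rightarrow> real) \<Rightarrow> real" and s :: real
      assume d: "1 \<le> d" and n: "1 \<le> n" and \<theta>s: "\<theta>s \<in> Rspace d" and prior: "positive_prior d \<pi>0"
        and nt: "enorm d \<theta>s \<le> C0" and d32: "real d powr (3/2) \<le> C0 * real n" and s: "s \<ge> 12"
        and small: "C1 * s * sqrt (real d / real n) \<le> 1"
        and del: "ereal C1 * delta01_star d n \<theta>s \<pi>0 (C1 * s) \<le> ereal (sqrt (real n * real d))"
      let ?\<sigma> = "sqrt (real d / real n)"
      have C1p: "C1 > 0" using C1b by linarith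
      have sg: "?\<sigma> > 0" using d n by simp
      have pos: "\<forall>z\<in>Rspace d. \<pi>0 z > 0" using prior by (simp add: positive_prior_def)
      \<comment> \<open>144 is the square of 12, the least admissible s, in the smallness
        hypothesis.\<close>
      have dn144: "144 * C1\<^sup>2 * real d \<le> real n"
      proof -
        have "C1 * 12 * ?\<sigma> \<le> C1 * s * ?\<sigma>" using s C1p sg by (intro mult_right_mono mult_left_mono) auto
        then have "C1 * 12 * ?\<sigma> \<le> 1" using small by linarith
        then have "(C1 * 12 * ?\<sigma>)\<^sup>2 \<le> 1" using C1p sg by (intro power_le_one) auto
        then show ?thesis using n by (simp add: power_mult_distrib field_simps)
      qed
      have nC1: "real n \<ge> C1"
      proof -
        have "C1 * 1 \<le> C1 * C1" using C1b by (intro mult_left_mono) auto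
        moreover have "C1\<^sup>2 * 1 \<le> 144 * C1\<^sup>2 * real d"
          by (rule mult_mono) (use d in auto)
        ultimately show ?thesis using dn144 by (simp add: power2_eq_square)
      qed
      have n4: "n \<ge> 4" using nC1 C1b by linarith
      have "\<exists>E \<in> sets (logistic_law d n \<theta>s).
         measure (logistic_law d n \<theta>s) E \<ge> 1 - 8 * exp (- sqrt (real n)) - exp (- real d * s\<^sup>2 / 10) \<and>
         (\<forall>(X, Y) \<in> E. good_data d n \<theta>s C0 s X Y \<and> X \<in> space (feat d n))"
      proof (rule good_data_prob[where T = "real n powr (1/3)", OF d n4 C0 nt s])
        show "(5 * real grid_fine * sqrt (real d)) ^ d \<le> exp (real n / 2)"
          using grid_card_small[OF a0 d n C0 C1b(3) C1p d32 dn144] by (simp add: a_def)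
        assume "real d \<le> sqrt (real n)"
        then show "real n powr (1/3) > 0 \<and> (20 * sqrt (real d)) ^ d * (exp (- (real n / real n powr (1/3)))
           + real n * (2 * exp (- ((real n powr (1/3))\<^sup>2 / 16)))) \<le> exp (- sqrt (real n))"
          using n nC1 C1b(1) by (intro conjI cube_event_small N0 d) auto
      qed
      then obtain E where E: "E \<in> sets (logistic_law d n \<theta>s)"
        "measure (logistic_law d n \<theta>s) E \<ge> 1 - 8 * exp (- sqrt (real n)) - exp (- real d * s\<^sup>2 / 10)"
        "\<And>X Y. (X, Y) \<in> E \<Longrightarrow> good_data d n \<theta>s C0 s X Y" by blast
      \<comment> \<open>A finite upper bound on C1 times this value excludes a prior that is not C1
        on the ball.\<close>
      have "delta01_star d n \<theta>s \<pi>0 (C1 * s) \<noteq> \<infinity>"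
        using del C1p by auto
      then obtain \<delta> where \<delta>: "delta01_star d n \<theta>s \<pi>0 (C1 * s) = ereal \<delta>" "\<delta> \<ge> 0"
        "C1_on d \<pi>0 (ecball d \<theta>s (C1 * s * ?\<sigma>))"
        "\<And>z. z \<in> ecball d \<theta>s (C1 * s * ?\<sigma>) \<Longrightarrow> enorm d (grad d (\<lambda>y. ln (\<pi>0 y)) z) \<le> \<delta>"
        using s C1p by (elim delta01_star_finite[OF _ \<theta>s]) auto
      have del': "C1 * \<delta> \<le> sqrt (real n * real d)" using del unfolding \<delta>(1) by simp
      show "\<exists>E \<in> sets (logistic_law d n \<theta>s).
          measure (logistic_law d n \<theta>s) E
            \<ge> 1 - 8 * exp (- 1 * sqrt (real n)) - exp (- real d * s\<^sup>2 / 10) \<and>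
          (\<forall>(X, Y) \<in> E.
             mle_exists_unique d n X Y \<and>
             pos_def_mat d (fisher d n X \<theta>s) \<and>
             ereal (tv_dist (posterior d n \<pi>0 X Y) (gamma_star d n \<theta>s X Y))
               \<le> ereal C3 *
                   (delta01_star d n \<theta>s \<pi>0 (C1 * s) / ereal (sqrt (real n))
                    + ereal (s * real d / sqrt (real n))
                    + exp_ereal (ereal (real d) * (M0_star d \<theta>s \<pi>0 - ereal ((s / 12)\<^sup>2)))))"
      proof (intro bexI[OF _ E(1)] conjI ballI)
        show "1 - 8 * exp (- 1 * sqrt (real n)) - exp (- real d * s\<^sup>2 / 10) \<le> measure (logistic_law d n \<theta>s) E"
          using E(2) by simp
        fix xy assume "xy \<in> E"
        moreover obtain X Y where xy: "xy = (X, Y)" by (cases xy)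
        ultimately have good: "good_data d n \<theta>s C0 s X Y" using E(3) by blast
        interpret logistic_sample d n \<theta>s C0 s X Y
          by unfold_locales (use n d C0 \<theta>s s good in auto)
        have kk: "kap = k" by (simp add: kap_def k_def)
        have sigs: "sig = ?\<sigma>" by (simp add: sig_def)
        have ss: "0 \<le> s * sig" using s sig_pos by simp
        have rs: "120 / kap * s * sig \<le> 1 / 60"
        proof -
          have "7200 / k * (s * sig) \<le> C1 * (s * sig)" using C1b(2) ss by (rule mult_right_mono)
          also have "\<dots> \<le> 1" using small by (simp add: sigs mult.assoc)
          finally show ?thesis unfolding kk by simp
        qed
        interpret logistic_mle d n \<theta>s C0 s X Y
        proof unfold_locales
          have "29 / kap * s * sig = 29 / 120 * (120 / kap * s * sig)" by simp
          then show "29 / kap * s * sig \<le> 1 / 120" using rs by linarith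
        qed
        have tv: "ereal (tv_dist (posterior d n \<pi>0 X Y) (gamma_star d n \<theta>s X Y))
               \<le> ereal C3 * (ereal \<delta> / ereal (sqrt (real n)) + ereal (s * real d / sqrt (real n))
                    + exp_ereal (ereal (real d) * (M0_star d \<theta>s \<pi>0 - ereal ((s / 12)\<^sup>2))))"
        proof -
          have sn: "sqrt (real n) > 0" using n by simp
          from M0_star_cases[of d \<pi>0 \<theta>s "(s / 12)\<^sup>2", OF d pos \<theta>s] show ?thesis
          proof (elim disjE exE conjE)
            assume "exp_ereal (ereal (real d) * (M0_star d \<theta>s \<pi>0 - ereal ((s / 12)\<^sup>2))) = \<infinity>"
            then show ?thesis using C3 sn by simp
          next
            fix M assume M: "\<forall>z\<in>Rspace d. \<pi>0 z \<le> M"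
              and ee: "exp_ereal (ereal (real d) * (M0_star d \<theta>s \<pi>0 - ereal ((s / 12)\<^sup>2))) = ereal (M / \<pi>0 \<theta>s * exp (- (real d * (s / 12)\<^sup>2)))"
            have k120: "120 / kap \<le> C1" using C1b(2) k0 unfolding kk by (simp add: field_simps)
            interpret logistic_tv d n \<theta>s C0 s X Y \<pi>0 \<delta> M "ecball d \<theta>s (C1 * s * ?\<sigma>)"
            proof unfold_locales
              have "120 / kap * s * sig \<le> C1 * s * ?\<sigma>"
                unfolding sigs using k120 s sg by (intro mult_right_mono) auto
              then show "ecball d \<theta>s (120 / kap * s * sig) \<subseteq> ecball d \<theta>s (C1 * s * ?\<sigma>)"
                by (rule ecball_mono)
              have "120 / kap * \<delta> \<le> C1 * \<delta>" using k120 \<delta>(2) by (rule mult_right_mono)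
              then show "120 / kap * \<delta> \<le> sqrt (real n * real d)" using del' by linarith
            qed (use prior rs \<delta> M in auto)
            have "tv_dist (posterior d n \<pi>0 X Y) (gamma_star d n \<theta>s X Y)
               \<le> C3 * (\<delta> / sqrt (real n) + s * real d / sqrt (real n) + T)"
            proof (cases "real d \<le> sqrt (real n)")
              case True
              show ?thesis using tv_bound[OF True] unfolding C3_def kk .
            next
              case False \<comment> \<open>the bound exceeds 1\<close>
              have "k \<le> 1" using kap_le_1 kk by simp
              then have "k ^ 3 \<le> 1" using k0 by (simp add: power_le_one)
              then have "1 \<le> C3" unfolding C3_def using k0 by (simp add: field_simps)
              have "1 * 1 \<le> s * (real d / sqrt (real n))"
                using False s sn by (intro mult_mono) (auto simp: field_simps)
              moreover have "0 \<le> \<delta> / sqrt (real n)" "0 \<le> T" using \<delta>(2) T_pos by auto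
              ultimately have "1 \<le> \<delta> / sqrt (real n) + s * real d / sqrt (real n) + T" by simp
              then have "1 * 1 \<le> C3 * (\<delta> / sqrt (real n) + s * real d / sqrt (real n) + T)"
                using \<open>1 \<le> C3\<close> by (intro mult_mono) auto
              then show ?thesis using tv_dist_le_1[OF prob_posterior prob_gamma_star] by linarith
            qed
            then show ?thesis using sn unfolding ee T_def by simp
          qed
        qed
        show "case xy of (X, Y) \<Rightarrow>
             mle_exists_unique d n X Y \<and>
             pos_def_mat d (fisher d n X \<theta>s) \<and>
             ereal (tv_dist (posterior d n \<pi>0 X Y) (gamma_star d n \<theta>s X Y))
               \<le> ereal C3 *
                   (delta01_star d n \<theta>s \<pi>0 (C1 * s) / ereal (sqrt (real n))
                    + ereal (s * real d / sqrt (real n))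
                    + exp_ereal (ereal (real d) * (M0_star d \<theta>s \<pi>0 - ereal ((s / 12)\<^sup>2))))"
          unfolding xy \<delta>(1) using mle_unique pos_def_fisher tv by simp
      qed
    qed
  qed simp
qed

end
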